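(* Let $Q$ be a meromorphic modular form of weight $4$ on $\mathrm{SL}(2,\mathbb Z)$ such that the differential equation $y''(z)=Q(z)y(z)$ on $\mathbb H$ is Fuchsian (also at $\infty$) and satisfies the following conditions. (1) The equation is apparent at every pole $p\in\mathbb H$ of $Q$, with local exponents $\tfrac12\pm\kappa_p$ where $\kappa_p\in\tfrac12\mathbb N$; $\kappa_p>\tfrac12$ for every pole $p$ not $\mathrm{SL}(2,\mathbb Z)$-equivalent to $i$ or $\rho$; and $Q(\infty)\le 0$. (2) The numbers $\theta_i=\kappa_i$ and $\theta_\rho=2\kappa_\rho/3$ are not integers, where $\tfrac12\pm\kappa_i$ and $\tfrac12\pm\kappa_\rho$ are the local exponents at $i$ and $\rho$ (so $\kappa_i=\tfrac12$, resp. $\kappa_\rho=\tfrac12$, if $Q$ is holomorphic at $i$, resp. $\rho$). Let $\pm\kappa_\infty$ be the local exponents at $\infty$, assume $\kappa_\infty\notin\tfrac12\mathbb Z$, and let $r_\infty\in(0,1/2)$ be the number such that $\kappa_\infty\equiv r_\infty \pmod 1$ or $\kappa_\infty\equiv -r_\infty\pmod 1$. If $1/12<r_\infty<5/12$, then there is an invariant metric of curvature $1/2$ realizing $Q$, and this metric is unique. Conversely, if $Q$ is realized by an invariant metric of curvature $1/2$, then $1/12\le r_\infty\le 5/12$. Furthermore, assume that $r_\infty=1/12$ or $r_\infty=5/12$. Let $\chi$ be the character of $\mathrm{SL}(2,\mathbb Z)$ determined by $\chi(T)=e^{2\pi i/6}$ and $\chi(S)=-1$, where $T=\begin{pmatrix}1&1\\0&1\end{pmatrix}$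 and $S=\begin{pmatrix}0&-1\\1&0\end{pmatrix}$. Then there is an invariant metric of curvature $1/2$ realizing $Q$ if and only if there are two solutions $y_1(z)$ and $y_2(z)$ of $y''=Qy$ such that $y_1(z)^2$ and $y_2(z)^2$ are meromorphic modular forms of weight $-2$ on $\mathrm{SL}(2,\mathbb Z)$ with character $\chi$ and $\overline\chi$, respectively.
   Context: $\mathbb H$ is the upper half-plane, $\mathbb N=\{1,2,3,\dots\}$, $i=\sqrt{-1}$, $\rho=(1+\sqrt{-3})/2$, $q=e^{2\pi i z}$, $'=d/dz$. A meromorphic modular form of weight $k$ on $\mathrm{SL}(2,\mathbb Z)$ is a meromorphic function $f$ on $\mathbb H$, meromorphic at $\infty$, with $f(\gamma z)=(cz+d)^kf(z)$ for all $\gamma=\begin{pmatrix}a&b\\c&d\end{pmatrix}\in\mathrm{SL}(2,\mathbb Z)$; with character $\chi$ the condition is $f(\gamma z)=\chi(\gamma)(cz+d)^kf(z)$. The equation $y''=Qy$ is Fuchsian on $\mathbb H$ if all poles of $Q$ on $\mathbb H$ have order at most $2$, and Fuchsian at $\infty$ if $Q$ is holomorphic at $\infty$; $Q(\infty)$ is the value there. The local exponents at $\infty$ are $\pm\kappa_\infty$ with $\kappa_\infty=\sqrt{-Q(\infty)}/(2\pi)\ge0$, i.e. exponents in $q$ of $(q\,d/dq)^2y=-\frac{Q}{4\pi^2}y$. The local exponents at a point $p\in\mathbb H$ are written $\tfrac12\pm\kappa_p$, $\kappa_p\ge0$. The equation is apparent at a pole $p$ of $Q$ if $\kappa_p\in\frac12\mathbb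 Z_{\ge0}$ and no solution has a logarithmic singularity at $p$. An invariant metric of curvature $1/2$ realizing $Q$ is a metric $ds^2=e^u|dz|^2$, where $u$ is a real-valued function, smooth on $\mathbb H$ away from the poles of $Q$, such that: (a) $4u_{z\bar z}+e^u=4\pi\sum_p n_p\delta_p$ on $\mathbb H$, where $p$ runs over all poles of $Q$ on $\mathbb H$, $n_p=2\kappa_p-1$, and $\delta_p$ is the Dirac measure at $p$; (b) $u(\gamma z)=u(z)+4\log|cz+d|$ for all $\gamma=\begin{pmatrix}a&b\\c&d\end{pmatrix}\in\mathrm{SL}(2,\mathbb Z)$; (c) there are $\alpha_\infty>0$ and $C>0$ such that $e^{u(z)}=|q|^{4\alpha_\infty}(C+o(1))$ as $q\to0$; (d) $Q=-\frac12\left(u_{zz}-\frac12u_z^2\right)$. *)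

theory Defs
  imports "HOL-Complex_Analysis.Complex_Analysis"
begin

section \<open>Modular forms on \<open>SL(2,\<int>)\<close>\<close>

definition upper_half_plane :: "complex set" (\<open>\<H>\<close>) where
  "\<H> = {z. Im z > 0}"

definition SL2Z :: "(int ^ 2 ^ 2) set" where
  "SL2Z = {A. det A = 1}"

definition matT :: "int ^ 2 ^ 2" where
  "matT = vector [vector [1, 1], vector [0, 1]]"

definition matS :: "int ^ 2 ^ 2" where
  "matS = vector [vector [0, -1], vector [1, 0]]"

definition act :: "int ^ 2 ^ 2 \<Rightarrow> complex \<Rightarrow> complex" where
  "act A = moebius (of_int (A $ 1 $ 1)) (of_int (A $ 1 $ 2)) (of_int (A $ 2 $ 1)) (of_int (A $ 2 $ 2))"

definition autfac :: "int ^ 2 ^ 2 \<Rightarrow> complex \<Rightarrow> complex" where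
  "autfac A z = of_int (A $ 2 $ 1) * z + of_int (A $ 2 $ 2)"

definition SL2Z_equivalent :: "complex \<Rightarrow> complex \<Rightarrow> bool" where
  "SL2Z_equivalent z w \<longleftrightarrow> (\<exists>A\<in>SL2Z. w = act A z)"

definition rho :: complex where
  "rho = (1 + \<i> * of_real (sqrt 3)) / 2"

definition SL2Z_character :: "(int ^ 2 ^ 2 \<Rightarrow> complex) \<Rightarrow> bool" where
  "SL2Z_character ch \<longleftrightarrow>
     (\<forall>A\<in>SL2Z. ch A \<noteq> 0) \<and> (\<forall>A\<in>SL2Z. \<forall>B\<in>SL2Z. ch (A ** B) = ch A * ch B)"

definition qpar :: "complex \<Rightarrow> complex" where
  "qpar z = exp (2 * of_real pi * \<i> * z)"

text \<open>The limit \<open>q \<rightarrow> 0\<close>, i.e. \<open>Im z \<rightarrow> \<infinity>\<close>.\<close>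

definition at_cusp :: "complex filter" where
  "at_cusp = filtercomap Im at_top"

text \<open>
  The width \<open>h\<close> accommodates forms with a nontrivial character: such an \<open>f\<close> is only invariant
  under \<open>z \<mapsto> z + h\<close> for some \<open>h\<close>, and has an expansion in powers of \<open>q\<^bsup>1/h\<^esup>\<close>.  If \<open>f (z + 1) = f z\<close>,
  one may equivalently take \<open>h = 1\<close>.
\<close>

definition meromorphic_at_cusp :: "(complex \<Rightarrow> complex) \<Rightarrow> bool" where
  "meromorphic_at_cusp f \<longleftrightarrow>
     (\<exists>h::nat. h > 0 \<and> (\<exists>F. F meromorphic_on {0} \<and>
        (\<forall>\<^sub>F z in at_cusp. f z = F (qpar (z / of_nat h)))))"

definition holomorphic_at_cusp :: "(complex \<Rightarrow> complex) \<Rightarrow> bool" where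
  "holomorphic_at_cusp f \<longleftrightarrow>
     (\<exists>F. F analytic_on {0} \<and> (\<forall>\<^sub>F z in at_cusp. f z = F (qpar z)))"

definition cusp_value :: "(complex \<Rightarrow> complex) \<Rightarrow> complex" where
  "cusp_value f = Lim at_cusp f"

text \<open>
  The predicate \<open>nicely_meromorphic_on\<close> rules out spurious values at removable singularities
  and fixes the value \<open>0\<close> at the poles, so that the transformation law can be required at all points.
\<close>

definition meromorphic_modular_form ::
    "int \<Rightarrow> (int ^ 2 ^ 2 \<Rightarrow> complex) \<Rightarrow> (complex \<Rightarrow> complex) \<Rightarrow> bool" where
  "meromorphic_modular_form k ch f \<longleftrightarrow>
     f nicely_meromorphic_on \<H> \<and> meromorphic_at_cusp f \<and>
     (\<forall>A\<in>SL2Z. \<forall>z\<in>\<H>. f (act A z) = ch A * autfac A z powi k * f z)"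

section \<open>The differential equation \<open>y'' = Q y\<close>\<close>

definition poles :: "(complex \<Rightarrow> complex) \<Rightarrow> complex set" where
  "poles Q = {p\<in>\<H>. is_pole Q p}"

definition ode_solution :: "(complex \<Rightarrow> complex) \<Rightarrow> complex set \<Rightarrow> (complex \<Rightarrow> complex) \<Rightarrow> bool" where
  "ode_solution Q U y \<longleftrightarrow> y holomorphic_on U \<and> (\<forall>z\<in>U. deriv (deriv y) z = Q z * y z)"

definition fuchsian_on_H :: "(complex \<Rightarrow> complex) \<Rightarrow> bool" where
  "fuchsian_on_H Q \<longleftrightarrow> (\<forall>p\<in>poles Q. zorder Q p \<ge> -2)"

definition fuchsian_at_cusp :: "(complex \<Rightarrow> complex) \<Rightarrow> bool" where
  "fuchsian_at_cusp Q \<longleftrightarrow> holomorphic_at_cusp Q"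

definition indicial_coeff :: "(complex \<Rightarrow> complex) \<Rightarrow> complex \<Rightarrow> complex" where
  "indicial_coeff Q p = Lim (at p) (\<lambda>z. (z - p)\<^sup>2 * Q z)"

definition local_exponents :: "(complex \<Rightarrow> complex) \<Rightarrow> complex \<Rightarrow> complex set" where
  "local_exponents Q p = {\<alpha>. \<alpha> * (\<alpha> - 1) = indicial_coeff Q p}"

text \<open>
  The local exponents are \<open>1/2 \<plusminus> csqrt (1/4 + indicial_coeff Q p)\<close>.  The real number below is the
  \<open>\<kappa>\<^sub>p\<close> of the exponents \<open>1/2 \<plusminus> \<kappa>\<^sub>p\<close> whenever these are real; that they are is part of
  \<open>apparent_at\<close> below, and automatic at points where \<open>Q\<close> is holomorphic (there \<open>\<kappa>\<^sub>p = 1/2\<close>).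
\<close>

definition kappa :: "(complex \<Rightarrow> complex) \<Rightarrow> complex \<Rightarrow> real" where
  "kappa Q p = Re (csqrt (1/4 + indicial_coeff Q p))"

definition kappa_cusp :: "(complex \<Rightarrow> complex) \<Rightarrow> real" where
  "kappa_cusp Q = sqrt (- Re (cusp_value Q)) / (2 * pi)"

text \<open>Solutions near \<open>p\<close> are multivalued, hence they are considered on a slit disc.\<close>

definition slit_disc :: "complex \<Rightarrow> real \<Rightarrow> complex set" where
  "slit_disc p r = {z\<in>ball p r. z - p \<notin> \<real>\<^sub>\<le>\<^sub>0}"

definition log_singularity :: "complex \<Rightarrow> real \<Rightarrow> (complex \<Rightarrow> complex) \<Rightarrow> bool" where
  "log_singularity p r y \<longleftrightarrow>
     (\<exists>\<alpha> h1 h2. h1 holomorphic_on ball p r \<and> h2 holomorphic_on ball p r \<and>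
        (\<exists>z\<in>ball p r. h2 z \<noteq> 0) \<and>
        (\<forall>z\<in>slit_disc p r. y z = (z - p) powr \<alpha> * (h1 z + h2 z * Ln (z - p))))"

definition apparent_at :: "(complex \<Rightarrow> complex) \<Rightarrow> complex \<Rightarrow> bool" where
  "apparent_at Q p \<longleftrightarrow>
     local_exponents Q p = {1/2 + of_real (kappa Q p), 1/2 - of_real (kappa Q p)} \<and>
     2 * kappa Q p \<in> \<nat> \<and>
     (\<forall>r>0. ball p r \<subseteq> \<H> \<longrightarrow> Q holomorphic_on (ball p r - {p}) \<longrightarrow>
        \<not> (\<exists>y. ode_solution Q (slit_disc p r) y \<and> log_singularity p r y))"

text \<open>
  A solution of \<open>y'' = Q y\<close> on \<open>\<H>\<close> is in general a multivalued analytic function on the complement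
  of the poles.  If its square is single-valued, its branches agree up to sign; the
  function \<open>y\<close> below selects at each point the value of one of the two branches \<open>\<plusminus>g\<close> (with no
  continuity of the choice required), so that only \<open>y\<^sup>2\<close> has an invariant meaning.
\<close>

definition solution_up_to_sign :: "(complex \<Rightarrow> complex) \<Rightarrow> (complex \<Rightarrow> complex) \<Rightarrow> bool" where
  "solution_up_to_sign Q y \<longleftrightarrow>
     (\<forall>z0\<in>\<H> - poles Q. \<exists>r>0. \<exists>g. ball z0 r \<subseteq> \<H> - poles Q \<and> ode_solution Q (ball z0 r) g \<and>
        (\<forall>z\<in>ball z0 r. y z = g z \<or> y z = - g z))"

text \<open>
  There is a solution \<open>y \<noteq> 0\<close> on \<open>\<H>\<close> whose square is (off the poles of \<open>Q\<close>, and hence as a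
  meromorphic function) a modular form.  The zero solution has to be excluded explicitly,
  since \<open>0\<close> satisfies every transformation law.
\<close>

definition has_solution_with_modular_square ::
    "(complex \<Rightarrow> complex) \<Rightarrow> int \<Rightarrow> (int ^ 2 ^ 2 \<Rightarrow> complex) \<Rightarrow> (complex \<Rightarrow> complex) \<Rightarrow> bool" where
  "has_solution_with_modular_square Q k ch y \<longleftrightarrow>
     solution_up_to_sign Q y \<and> (\<exists>z\<in>\<H> - poles Q. y z \<noteq> 0) \<and>
     (\<exists>f. meromorphic_modular_form k ch f \<and> (\<forall>z\<in>\<H> - poles Q. f z = (y z)\<^sup>2))"

section \<open>Invariant metrics of curvature \<open>1/2\<close>\<close>

definition d_x :: "(complex \<Rightarrow> complex) \<Rightarrow> complex \<Rightarrow> complex" where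
  "d_x f z = frechet_derivative f (at z) 1"

definition d_y :: "(complex \<Rightarrow> complex) \<Rightarrow> complex \<Rightarrow> complex" where
  "d_y f z = frechet_derivative f (at z) \<i>"

definition d_z :: "(complex \<Rightarrow> complex) \<Rightarrow> complex \<Rightarrow> complex" where
  "d_z f z = (d_x f z - \<i> * d_y f z) / 2"

definition d_zbar :: "(complex \<Rightarrow> complex) \<Rightarrow> complex \<Rightarrow> complex" where
  "d_zbar f z = (d_x f z + \<i> * d_y f z) / 2"

text \<open>\<open>C\<^sup>n\<close> in the real sense on an open set.\<close>

primrec Ck_on :: "nat \<Rightarrow> (complex \<Rightarrow> complex) \<Rightarrow> complex set \<Rightarrow> bool" where
  "Ck_on 0 f U \<longleftrightarrow> continuous_on U f"
| "Ck_on (Suc n) f U \<longleftrightarrow>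
     (\<forall>z\<in>U. f differentiable (at z)) \<and> Ck_on n (d_x f) U \<and> Ck_on n (d_y f) U"

definition smooth_on :: "(complex \<Rightarrow> complex) \<Rightarrow> complex set \<Rightarrow> bool" where
  "smooth_on f U \<longleftrightarrow> (\<forall>n. Ck_on n f U)"

definition test_function :: "(complex \<Rightarrow> complex) \<Rightarrow> bool" where
  "test_function \<phi> \<longleftrightarrow>
     smooth_on \<phi> UNIV \<and> compact (closure {z. \<phi> z \<noteq> 0}) \<and> closure {z. \<phi> z \<noteq> 0} \<subseteq> \<H>"

definition locally_integrable :: "(complex \<Rightarrow> real) \<Rightarrow> bool" where
  "locally_integrable u \<longleftrightarrow> (\<forall>K. compact K \<longrightarrow> K \<subseteq> \<H> \<longrightarrow> set_integrable lborel K u)"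

text \<open>
  The equation \<open>4 u\<^bsub>z zbar\<^esub> + e\<^sup>u = 4 \<pi> (\<Sum>p. n\<^sub>p \<delta>\<^sub>p)\<close>, \<open>n\<^sub>p = 2 \<kappa>\<^sub>p - 1\<close>, in the sense of distributions
  on \<open>\<H>\<close>.  The sum is finite, because the poles of \<open>Q\<close> do not accumulate in \<open>\<H>\<close>.
\<close>

definition curvature_equation :: "(complex \<Rightarrow> complex) \<Rightarrow> (complex \<Rightarrow> real) \<Rightarrow> bool" where
  "curvature_equation Q u \<longleftrightarrow>
     locally_integrable u \<and> locally_integrable (\<lambda>z. exp (u z)) \<and>
     (\<forall>\<phi>. test_function \<phi> \<longrightarrow>
        (LINT z:\<H>|lborel. of_real (u z) * (4 * d_zbar (d_z \<phi>) z) + of_real (exp (u z)) * \<phi> z)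
        = 4 * of_real pi * (\<Sum>p\<in>{p\<in>poles Q. \<phi> p \<noteq> 0}. of_real (2 * kappa Q p - 1) * \<phi> p))"

text \<open>
  The metric is \<open>e\<^sup>u |dz|\<^sup>2\<close>.  Only the values of \<open>u\<close> on \<open>\<H> - poles Q\<close> are meaningful.
\<close>

definition invariant_metric :: "(complex \<Rightarrow> complex) \<Rightarrow> (complex \<Rightarrow> real) \<Rightarrow> bool" where
  "invariant_metric Q u \<longleftrightarrow>
     smooth_on (\<lambda>z. of_real (u z)) (\<H> - poles Q) \<and>
     curvature_equation Q u \<and>
     (\<forall>A\<in>SL2Z. \<forall>z\<in>\<H> - poles Q. u (act A z) = u z + 4 * ln (cmod (autfac A z))) \<and>
     (\<exists>\<alpha>>0. \<exists>C>0. ((\<lambda>z. exp (u z) / cmod (qpar z) powr (4 * \<alpha>)) \<longlongrightarrow> C) at_cusp) \<and>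
     (\<forall>z\<in>\<H> - poles Q.
        let U = (\<lambda>z. complex_of_real (u z))
        in Q z = - (1/2) * (d_z (d_z U) z - (1/2) * (d_z U z)\<^sup>2))"

end

theory Submission
  imports Defs "HOL-Real_Asymp.Real_Asymp"
begin

text \<open>
  The products of a fundamental pair of solutions, \<open>(y1\<^sup>2, y1 y2, y2\<^sup>2)\<close>, are single valued on the
  complement of the poles because the equation is apparent, so \<open>SL(2,\<int>)\<close> acts on them through symmetric
  squares of unimodular matrices.  The local exponents at \<open>\<i>\<close>, \<open>\<rho>\<close> and \<open>\<infinity>\<close> determine the traces of the
  matrices of \<open>S\<close>, \<open>T S\<close> and \<open>T\<close> up to sign.  In a basis with \<open>S = diag (\<i>, - \<i>)\<close> the matrix of \<open>T\<close> has
  diagonal entries \<open>(\<tau> \<plusminus> \<i>) / 2\<close> and off-diagonal entries \<open>q, s\<close>, where \<open>\<tau>\<^sup>2 = 4 cos\<^sup>2 (2 \<pi> r)\<close> and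
  \<open>q s = (\<tau>\<^sup>2 - 3) / 4\<close>.

  If \<open>e\<^sup>u |dz|\<^sup>2\<close> realizes \<open>Q\<close>, then \<open>e\<^bsup>-u/2\<^esup>\<close> solves the equation in \<open>z\<close> and its conjugate in the conjugate
  variable; hence it is a Hermitian form in \<open>y1, y2\<close>, definite and of determinant \<open>1/8\<close> by the curvature
  equation, and preserved by the monodromy.  Conversely a preserved definite form of this kind gives a
  metric.  For the normal form above, an invariant definite form exists iff \<open>q s < 0\<close> or \<open>q = s = 0\<close>, and it is
  unique in the first case.  In the boundary case \<open>q s = 0\<close>, \<open>q = s = 0\<close> means that the
  monodromy is diagonal, i.e. that \<open>y1\<^sup>2\<close> and \<open>y2\<^sup>2\<close> are modular with characters.
\<close>

section \<open>Singular points of \<open>y'' = Q y\<close>\<close>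

text \<open>Solutions cannot serve as global objects: at a pole with \<open>n = 2 \<kappa>_p\<close>
  even, the exponents \<open>(1 \<plusminus> n) / 2\<close> are half-integers and continuation
  around the pole changes all signs. Products of two solutions do not see this sign, and without
  logarithms nothing else happens at a pole; so continuation takes place on the whole upper
  half-plane, which is convex. The price is that matrices are known only up to sign, which is why
  squares of traces occur. The two conditions on \<theta> say that \<open>n\<close> is odd at
  \<open>\<i>\<close> and prime to 3 at \<open>rho\<close>; this forces trace 0 for \<open>S\<close>
  and squared trace 1 for \<open>T S\<close>. The numbers 1/12 and 5/12 come from a determinant:
  diagonal entries \<open>(\<tau> \<plusminus> i) / 2\<close> leave
  \<open>q s = (\<tau>^2 + 1) / 4 - 1\<close>, and \<open>4 cos^2 (2 pi r)\<close> equals 3 exactly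
  at these \<open>r\<close>. The constant 8 comes from the curvature: if \<Phi> is a Hermitian form
  of determinant 1 in a basis with Wronskian 1, then \<open>u = - 2 log \<Phi>\<close> has
  \<open>4 u_{z zbar} = - 8 / \<Phi>^2\<close>, so that \<open>e^u\<close> has to be
  \<open>8 / \<Phi>^2\<close>.\<close>

fun frobenius_coeff :: "(nat \<Rightarrow> complex) \<Rightarrow> complex \<Rightarrow> nat \<Rightarrow> complex" where
  "frobenius_coeff p a 0 = 1"
| "frobenius_coeff p a (Suc m) =
     (\<Sum>j\<le>m. p (m - j) * frobenius_coeff p a j) / (of_nat (Suc m) * (a + of_nat m))"

lemma bounded_away_from_negative_integers:
  fixes a :: complex
  assumes "\<And>m::nat. a + of_nat m \<noteq> 0"
  obtains d where "d > 0" "\<And>m::nat. norm (a + of_nat m) \<ge> d"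
proof -
  define N where "N = nat \<lceil>norm a + 1\<rceil>"
  define d where "d = min 1 (Min ((\<lambda>m::nat. norm (a + of_nat m)) ` {..N}))"
  have "Min ((\<lambda>m::nat. norm (a + of_nat m)) ` {..N}) > 0"
    using assms by (subst Min_gr_iff) auto
  hence "d > 0" by (simp add: d_def)
  moreover have "norm (a + of_nat m) \<ge> d" for m :: nat
  proof (cases "m \<le> N")
    case True
    hence "Min ((\<lambda>m::nat. norm (a + of_nat m)) ` {..N}) \<le> norm (a + of_nat m)"
      by (intro Min_le) auto
    thus ?thesis by (simp add: d_def)
  next
    case False
    hence "real m \<ge> norm a + 1" by (simp add: N_def) linarith
    moreover have "norm (a + of_nat m) \<ge> real m - norm a"
      using norm_triangle_ineq2[of "of_nat m :: complex" "- a"] by (simp add: add.commute)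
    ultimately have "norm (a + of_nat m) \<ge> 1" by linarith
    thus ?thesis by (simp add: d_def)
  qed
  ultimately show ?thesis using that by blast
qed

text \<open>A geometric majorant survives the recursion: the \<open>m + 1\<close> summands are at
  most \<open>M * K ^ m\<close> each, their number cancels against the factor \<open>m + 1\<close>
  of the denominator, and \<open>d\<close> bounds the other factor.\<close>

lemma frobenius_coeff_bound:
  assumes p: "\<And>j. norm (p j) \<le> M * K ^ j" and d: "d > 0" "\<And>m::nat. norm (a + of_nat m) \<ge> d"
    and K: "K > 0" "M / d \<le> K" "M \<ge> 0"
  shows "norm (frobenius_coeff p a n) \<le> K ^ n"
proof (induction n rule: less_induct)
  case (less n)
  show ?case
  proof (cases n)
    case (Suc m)
    have "norm (\<Sum>j\<le>m. p (m - j) * frobenius_coeff p a j) \<le> (\<Sum>j\<le>m. M * K ^ m)"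
    proof (rule sum_norm_le)
      fix j assume j: "j \<in> {..m}"
      have "norm (p (m - j) * frobenius_coeff p a j) \<le> (M * K ^ (m - j)) * K ^ j"
        unfolding norm_mult using p[of "m - j"] less.IH[of j] j Suc K
        by (intro mult_mono) auto
      also have "\<dots> = M * K ^ m" using j by (simp add: power_add[symmetric])
      finally show "norm (p (m - j) * frobenius_coeff p a j) \<le> M * K ^ m" .
    qed
    also have "\<dots> = real (Suc m) * (M * K ^ m)" by simp
    finally have *: "norm (\<Sum>j\<le>m. p (m - j) * frobenius_coeff p a j) \<le> real (Suc m) * (M * K ^ m)" .
    have "norm (frobenius_coeff p a n) =
        norm (\<Sum>j\<le>m. p (m - j) * frobenius_coeff p a j) / (real (Suc m) * norm (a + of_nat m))"
      by (simp add: Suc norm_divide norm_mult del: of_nat_Suc)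
    also have "\<dots> \<le> (real (Suc m) * (M * K ^ m)) / (real (Suc m) * d)"
      using * d K by (intro frac_le mult_left_mono mult_pos_pos) auto
    also have "\<dots> = (M / d) * K ^ m" by (simp add: field_simps del: of_nat_Suc)
    also have "\<dots> \<le> K * K ^ m" using K by (intro mult_right_mono) auto
    finally show ?thesis by (simp add: Suc)
  qed simp
qed

text \<open>Comparing coefficients of \<open>w ^ m\<close> in \<open>w g'' + a g' = P g\<close>
  gives \<open>(m + 1) (a + m) c_{m+1}\<close> on the left, which is the recursion. Here
  \<open>a\<close> will be twice the exponent at a point of the upper half-plane, and one more than
  twice the exponent at the cusp.\<close>

lemma frobenius_solution:
  fixes P :: "complex \<Rightarrow> complex"
  assumes P: "P analytic_on {0}" and a: "\<And>m::nat. a + of_nat m \<noteq> 0"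
  obtains g r where "r > 0" "g holomorphic_on ball 0 r" "g 0 = 1" "P holomorphic_on ball 0 r"
    "\<And>w. w \<in> ball 0 r \<Longrightarrow> g w \<noteq> 0"
    "\<And>w. w \<in> ball 0 r \<Longrightarrow> w * deriv (deriv g) w + a * deriv g w = P w * g w"
proof -
  obtain F where F: "P has_fps_expansion F"
    using P by (meson analytic_at_imp_has_fps_expansion_0)
  define p where "p = fps_nth F"
  obtain d where d: "d > 0" "\<And>m::nat. norm (a + of_nat m) \<ge> d"
    using bounded_away_from_negative_integers[of a] a by blast
  have "fps_conv_radius F > 0" using F by (simp add: has_fps_expansion_def)
  then obtain R where R: "R > 0" "ereal R < fps_conv_radius F"
    by (metis ereal_dense2 ereal_less(2))
  have "summable (\<lambda>n. p n * of_real R ^ n)"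
    unfolding p_def using R by (intro summable_fps) auto
  hence "Bseq (\<lambda>n. p n * of_real R ^ n)" by (rule summable_imp_Bseq)
  then obtain M where M: "M > 0" "\<And>n. norm (p n * of_real R ^ n) \<le> M"
    by (auto simp: Bseq_def)
  have pM: "norm (p n) \<le> M * (1 / R) ^ n" for n
    using M(2)[of n] R by (simp add: norm_mult norm_power field_simps)
  \<comment> \<open>\<open>1 / R\<close> dominates the coefficients of \<open>P\<close>, and
    \<open>M / d\<close> is what the induction step of the majorant costs.\<close>
  define K where "K = max (1 / R) (M / d)"
  have K: "K > 0" "M / d \<le> K" "M \<ge> 0" using R M by (auto simp: K_def less_max_iff_disj)
  have pK: "norm (p n) \<le> M * K ^ n" for n
  proof -
    have "(1 / R) ^ n \<le> K ^ n" using R by (intro power_mono) (auto simp: K_def)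
    thus ?thesis using pM[of n] M by (meson mult_left_mono order_trans less_imp_le)
  qed
  define G where "G = Abs_fps (frobenius_coeff p a)"
  have G0: "eval_fps G 0 = 1" by (simp add: eval_fps_at_0 G_def)
  have "fps_conv_radius G \<ge> 1 / K"
    unfolding fps_conv_radius_def
  proof (rule conv_radius_geI_ex')
    fix r :: real assume r: "0 < r" "ereal r < ereal (1 / K)"
    have "K * r < 1" using r K by (simp add: field_simps)
    show "summable (\<lambda>n. fps_nth G n * of_real r ^ n)"
    proof (rule summable_comparison_test')
      show "summable (\<lambda>n. (K * r) ^ n)" using r K \<open>K * r < 1\<close> by (intro summable_geometric) auto
      fix n :: nat
      show "norm (fps_nth G n * of_real r ^ n) \<le> (K * r) ^ n"
        using frobenius_coeff_bound[OF pK d K, of n] r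
        by (simp add: G_def norm_mult norm_power power_mult_distrib mult_right_mono)
    qed
  qed
  hence radG: "fps_conv_radius G > 0"
    using K by (meson ereal_less(2) less_le_trans zero_less_divide_1_iff)
  have fps_eq: "fps_X * fps_deriv (fps_deriv G) + fps_const a * fps_deriv G = F * G"
  proof (rule fps_ext)
    fix n
    have nz: "of_nat (Suc n) * (a + of_nat n) \<noteq> (0::complex)" using a[of n] by (simp del: of_nat_Suc)
    have "fps_nth (fps_X * fps_deriv (fps_deriv G) + fps_const a * fps_deriv G) n
        = of_nat (Suc n) * (a + of_nat n) * frobenius_coeff p a (Suc n)"
      by (cases n) (simp_all add: G_def algebra_simps del: frobenius_coeff.simps)
    also have "\<dots> = (\<Sum>j\<le>n. p (n - j) * frobenius_coeff p a j)" using nz by simp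
    also have "\<dots> = fps_nth (G * F) n"
      unfolding fps_mult_nth p_def G_def by (intro sum.cong) auto
    finally show "fps_nth (fps_X * fps_deriv (fps_deriv G) + fps_const a * fps_deriv G) n
        = fps_nth (F * G) n" by (simp add: mult.commute)
  qed
  have Gexp: "eval_fps G has_fps_expansion G" by (rule eval_fps_has_fps_expansion[OF radG])
  have "(\<lambda>w. w * deriv (deriv (eval_fps G)) w + a * deriv (eval_fps G) w) has_fps_expansion
      (fps_X * fps_deriv (fps_deriv G) + fps_const a * fps_deriv G)"
    by (intro fps_expansion_intros Gexp)
  moreover have "(\<lambda>w. P w * eval_fps G w) has_fps_expansion (F * G)"
    by (intro fps_expansion_intros Gexp F)
  ultimately have ev: "\<forall>\<^sub>F w in nhds 0. w * deriv (deriv (eval_fps G)) w + a * deriv (eval_fps G) w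
      = P w * eval_fps G w"
    unfolding fps_eq has_fps_expansion_def by (auto elim: eventually_elim2)
  \<comment> \<open>The disc is shrunk until \<open>g\<close> has no zeros, so that
    \<open>1 / g^2\<close> can be integrated later.\<close>
  have ev2: "\<forall>\<^sub>F w in nhds 0. eval_fps G w \<noteq> 0"
  proof -
    have "isCont (eval_fps G) 0" using radG by (intro continuous_eval_fps) (auto simp: zero_ereal_def)
    hence "(eval_fps G \<longlongrightarrow> eval_fps G 0) (nhds 0)"
      using continuous_at tendsto_nhds_iff by (simp add: isCont_def tendsto_at_iff_tendsto_nhds)
    thus ?thesis using G0 tendsto_imp_eventually_ne by fastforce
  qed
  obtain U where U: "open U" "0 \<in> U" "P holomorphic_on U" using P by (auto simp: analytic_at)
  have ev3: "\<forall>\<^sub>F w in nhds 0. w \<in> U"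
    using U by (intro eventually_nhds_in_open) auto
  have ev4: "\<forall>\<^sub>F w in nhds 0. w \<in> eball 0 (fps_conv_radius G)"
    using radG by (intro eventually_nhds_in_open) (auto simp: zero_ereal_def)
  obtain r where r: "r > 0" "\<And>w. w \<in> ball 0 r \<Longrightarrow>
       w * deriv (deriv (eval_fps G)) w + a * deriv (eval_fps G) w = P w * eval_fps G w
       \<and> eval_fps G w \<noteq> 0 \<and> w \<in> U \<and> w \<in> eball 0 (fps_conv_radius G)"
    using eventually_conj[OF ev eventually_conj[OF ev2 eventually_conj[OF ev3 ev4]]]
    unfolding eventually_nhds_metric by (auto simp: dist_commute)
  show ?thesis
  proof (rule that[of r "eval_fps G"])
    show "eval_fps G holomorphic_on ball 0 r"
      using r by (intro holomorphic_on_eval_fps) blast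
    show "P holomorphic_on ball 0 r"
      using r by (intro holomorphic_on_subset[OF U(3)]) blast
  qed (use r G0 in auto)
qed

lemma holomorphic_quotient_at_0:
  assumes "E holomorphic_on ball 0 r" "r > 0"
  obtains E1 where "E1 holomorphic_on ball 0 r" "\<And>w. w \<in> ball 0 r \<Longrightarrow> E w = E 0 + w * E1 w"
proof -
  define E1 where "E1 = (\<lambda>w. if w = 0 then deriv E 0 else (E w - E 0) / (w - 0))"
  have "E1 holomorphic_on ball 0 r"
    unfolding E1_def by (rule pole_lemma_open[OF assms(1)]) simp
  thus ?thesis by (rule that) (auto simp: E1_def)
qed

text \<open>
  The equation \<open>w k' - n k = E\<close> is solved by comparing power series coefficients, except that
  the \<open>n\<close>-th coefficient of \<open>E\<close> has to be removed.
\<close>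

lemma primitive_of_power_quotient:
  assumes "E holomorphic_on ball 0 r" "r > 0"
  obtains k c where "k holomorphic_on ball 0 r"
    "\<And>w. w \<in> ball 0 r \<Longrightarrow> w * deriv k w - of_nat n * k w = E w - c * w ^ n"
proof -
  have "\<exists>k c. k holomorphic_on ball 0 r \<and>
      (\<forall>w\<in>ball 0 r. w * deriv k w - of_nat n * k w = E w - c * w ^ n)"
    using assms(1)
  proof (induction n arbitrary: E)
    case 0
    obtain E1 where E1: "E1 holomorphic_on ball 0 r" "\<And>w. w \<in> ball 0 r \<Longrightarrow> E w = E 0 + w * E1 w"
      using holomorphic_quotient_at_0[OF 0 assms(2)] by blast
    obtain k where k: "\<And>w. w \<in> ball 0 r \<Longrightarrow> (k has_field_derivative E1 w) (at w)"
      using holomorphic_convex_primitive'[OF convex_ball open_ball E1(1)]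
      by (metis at_within_open open_ball)
    have "k holomorphic_on ball 0 r" using k holomorphic_on_open[OF open_ball] by blast
    moreover have "w * deriv k w - of_nat 0 * k w = E w - E 0 * w ^ 0" if "w \<in> ball 0 r" for w
      using E1(2)[OF that] DERIV_imp_deriv[OF k[OF that]] by simp
    ultimately show ?case by blast
  next
    case (Suc n)
    obtain E1 where E1: "E1 holomorphic_on ball 0 r" "\<And>w. w \<in> ball 0 r \<Longrightarrow> E w = E 0 + w * E1 w"
      using holomorphic_quotient_at_0[OF Suc.prems assms(2)] by blast
    obtain k1 c where k1: "k1 holomorphic_on ball 0 r"
       "\<And>w. w \<in> ball 0 r \<Longrightarrow> w * deriv k1 w - of_nat n * k1 w = E1 w - c * w ^ n"
      using Suc.IH[OF E1(1)] by blast
    define k where "k = (\<lambda>w. w * k1 w - E 0 / of_nat (Suc n))"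
    have "k holomorphic_on ball 0 r" unfolding k_def by (intro holomorphic_intros k1(1))
    moreover have "w * deriv k w - of_nat (Suc n) * k w = E w - c * w ^ Suc n" if "w \<in> ball 0 r" for w
    proof -
      have "(k1 has_field_derivative deriv k1 w) (at w)"
        using holomorphic_derivI[OF k1(1) _ that] by simp
      hence "(k has_field_derivative (k1 w + w * deriv k1 w)) (at w)"
        unfolding k_def by (auto intro!: derivative_eq_intros)
      hence "deriv k w = k1 w + w * deriv k1 w" by (rule DERIV_imp_deriv)
      hence "w * deriv k w - of_nat (Suc n) * k w = E 0 + w * (w * deriv k1 w - of_nat n * k1 w)"
        by (simp add: k_def algebra_simps del: of_nat_Suc) (simp add: algebra_simps)
      also have "\<dots> = E w - c * w ^ Suc n"
        unfolding k1(2)[OF that] using E1(2)[OF that] by (simp add: algebra_simps)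
      finally show ?thesis .
    qed
    ultimately show ?case by blast
  qed
  thus ?thesis using that by blast
qed

section \<open>Reduction of order and Frobenius pairs\<close>

definition fundamental_pair ::
    "(complex \<Rightarrow> complex) \<Rightarrow> complex set \<Rightarrow> (complex \<Rightarrow> complex) \<Rightarrow> (complex \<Rightarrow> complex) \<Rightarrow> bool" where
  "fundamental_pair Q U y1 y2 \<longleftrightarrow> ode_solution Q U y1 \<and> ode_solution Q U y2 \<and>
     (\<forall>z\<in>U. y1 z * deriv y2 z - deriv y1 z * y2 z = 1)"

lemma ode_solutionI:
  assumes "open U" "\<And>z. z \<in> U \<Longrightarrow> (y has_field_derivative d z) (at z)"
    "\<And>z. z \<in> U \<Longrightarrow> (d has_field_derivative Q z * y z) (at z)"
  shows "ode_solution Q U y"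
  unfolding ode_solution_def
proof (intro conjI ballI)
  show "y holomorphic_on U" using assms by (auto simp: holomorphic_on_open)
  fix z assume z: "z \<in> U"
  have "deriv (deriv y) z = deriv d z"
    using assms(1) z assms(2) by (intro deriv_cong_ev eventually_nhds_in_open[THEN eventually_mono])
      (auto intro: DERIV_imp_deriv)
  thus "deriv (deriv y) z = Q z * y z" using assms(3)[OF z] by (simp add: DERIV_imp_deriv)
qed

lemma ode_solution_derivs:
  assumes "ode_solution Q U y" "open U" "z \<in> U"
  shows "(y has_field_derivative deriv y z) (at z)"
    "(deriv y has_field_derivative Q z * y z) (at z)"
proof -
  have "y holomorphic_on U" using assms(1) by (simp add: ode_solution_def)
  thus "(y has_field_derivative deriv y z) (at z)" using assms by (intro holomorphic_derivI)
  have "deriv y holomorphic_on U" using \<open>y holomorphic_on U\<close> assms by (intro holomorphic_deriv)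
  hence "(deriv y has_field_derivative deriv (deriv y) z) (at z)" using assms by (intro holomorphic_derivI)
  thus "(deriv y has_field_derivative Q z * y z) (at z)"
    using assms by (simp add: ode_solution_def)
qed

lemma ode_solution_subset:
  assumes "ode_solution Q U y" "V \<subseteq> U"
  shows "ode_solution Q V y"
  using assms by (auto simp: ode_solution_def intro: holomorphic_on_subset)

lemma fundamental_pair_subset:
  assumes "fundamental_pair Q U y1 y2" "V \<subseteq> U"
  shows "fundamental_pair Q V y1 y2"
  using assms ode_solution_subset by (auto simp: fundamental_pair_def)

text \<open>Reduction of order: the Wronskian of \<open>y\<close> and \<open>y h\<close> is
  \<open>y^2 h'\<close>, so the choice \<open>h' = 1 / y^2\<close> normalizes it to 1. With this
  normalization all changes of basis have determinant 1.\<close>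

lemma fundamental_pair_by_quadrature:
  assumes U: "open U" and y: "ode_solution Q U y" "\<And>z. z \<in> U \<Longrightarrow> y z \<noteq> 0"
    and h: "\<And>z. z \<in> U \<Longrightarrow> (h has_field_derivative 1 / (y z)\<^sup>2) (at z)"
  shows "fundamental_pair Q U y (\<lambda>z. y z * h z)"
proof -
  note [derivative_intros] = ode_solution_derivs[OF y(1) U]
  have d1: "((\<lambda>z. y z * h z) has_field_derivative deriv y z * h z + 1 / y z) (at z)" if "z \<in> U" for z
    using that h[OF that] y(2)[OF that]
    by (auto intro!: derivative_eq_intros simp: power2_eq_square)
  have d2: "((\<lambda>z. deriv y z * h z + 1 / y z) has_field_derivative Q z * (y z * h z)) (at z)" if "z \<in> U" for z
    using that h[OF that] y(2)[OF that]
    by (auto intro!: derivative_eq_intros simp: power2_eq_square)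
  have "ode_solution Q U (\<lambda>z. y z * h z)" by (rule ode_solutionI[OF U d1 d2])
  moreover have "y z * deriv (\<lambda>z. y z * h z) z - deriv y z * (y z * h z) = 1" if "z \<in> U" for z
    unfolding DERIV_imp_deriv[OF d1[OF that]] using y(2)[OF that] by (simp add: algebra_simps)
  ultimately show ?thesis using y(1) by (simp add: fundamental_pair_def)
qed

text \<open>\<open>L\<close> is an arbitrary branch of the logarithm; thus discs that meet the cut
  of \<open>Ln\<close> are treated like all others.\<close>

lemma deriv_local_log:
  assumes "L holomorphic_on U" "open U" "z \<in> U" "\<And>w. w \<in> U \<Longrightarrow> exp (L w) = w - p"
  shows "(L has_field_derivative 1 / (z - p)) (at z)"
proof -
  have L: "(L has_field_derivative deriv L z) (at z)" using assms by (intro holomorphic_derivI)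
  have "((\<lambda>z. exp (L z)) has_field_derivative exp (L z) * deriv L z) (at z)"
    by (rule DERIV_chain2[OF DERIV_exp L])
  moreover have "((\<lambda>z. exp (L z)) has_field_derivative 1) (at z)"
  proof (rule has_field_derivative_transform_within_open[OF _ assms(2,3), of "\<lambda>z. z - p"])
    show "((\<lambda>z. z - p) has_field_derivative 1) (at z)" by (auto intro!: derivative_eq_intros)
  qed (simp add: assms(4))
  ultimately have *: "exp (L z) * deriv L z = 1" by (rule DERIV_unique)
  hence "exp (L z) \<noteq> 0" "deriv L z = 1 / exp (L z)" by (auto simp: field_simps)
  thus ?thesis using L assms(4)[OF assms(3)] by simp
qed

text \<open>For \<open>y = w^s g\<close> with \<open>w = z - p\<close>, dividing
  \<open>y'' - Q y\<close> by \<open>w^{s-1}\<close> cancels the terms with \<open>s (s - 1)\<close>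
  and leaves \<open>w g'' + 2 s g' - P g\<close>. The factor \<open>exp (s * L z)\<close> is the
  branch of \<open>w^s\<close>.\<close>

lemma frobenius_ode_solution:
  assumes U: "open U" "U \<subseteq> ball p r - {p}"
    and Q: "\<And>z. z \<in> U \<Longrightarrow> Q z = (s * (s - 1) + (z - p) * P (z - p)) / (z - p)\<^sup>2"
    and g: "g holomorphic_on ball 0 r"
      "\<And>w. w \<in> ball 0 r \<Longrightarrow> w * deriv (deriv g) w + 2 * s * deriv g w = P w * g w"
    and L: "L holomorphic_on U" "\<And>z. z \<in> U \<Longrightarrow> exp (L z) = z - p"
  shows "ode_solution Q U (\<lambda>z. exp (s * L z) * g (z - p))"
proof (rule ode_solutionI[OF U(1)])
  have g': "(g has_field_derivative deriv g w) (at w)" "(deriv g has_field_derivative deriv (deriv g) w) (at w)"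
    if "w \<in> ball 0 r" for w
    using g(1) that by (auto intro!: holomorphic_derivI[of _ "ball 0 r"] holomorphic_deriv)
  fix z assume z: "z \<in> U"
  hence w: "z - p \<in> ball 0 r" "z \<noteq> p" using U by (auto simp: dist_norm norm_minus_commute)
  have L': "(L has_field_derivative 1 / (z - p)) (at z)" using deriv_local_log[OF L(1) U(1) z L(2)] .
  have g1: "((\<lambda>z. g (z - p)) has_field_derivative deriv g (z - p)) (at z)"
    using g'(1)[OF w(1)] DERIV_shift[of g _ z "- p"] by simp
  have g2: "((\<lambda>z. deriv g (z - p)) has_field_derivative deriv (deriv g) (z - p)) (at z)"
    using g'(2)[OF w(1)] DERIV_shift[of "deriv g" _ z "- p"] by simp
  show "((\<lambda>z. exp (s * L z) * g (z - p)) has_field_derivative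
      exp (s * L z) * (s / (z - p) * g (z - p) + deriv g (z - p))) (at z)"
    by (auto intro!: derivative_eq_intros L' g1 simp: algebra_simps)
  have ode: "deriv (deriv g) (z - p) = (P (z - p) * g (z - p) - 2 * s * deriv g (z - p)) / (z - p)"
    using g(2)[OF w(1)] w(2) by (simp add: field_simps)
  have wp: "z - p \<noteq> 0" using w by simp
  have "((\<lambda>z. exp (s * L z) * (s / (z - p) * g (z - p) + deriv g (z - p))) has_field_derivative
      exp (s * L z) * (s / (z - p)) * (s / (z - p) * g (z - p) + deriv g (z - p)) +
      exp (s * L z) * (- s / (z - p)\<^sup>2 * g (z - p) + s / (z - p) * deriv g (z - p) + deriv (deriv g) (z - p))) (at z)"
  proof -
    have "((\<lambda>z. exp (s * L z)) has_field_derivative exp (s * L z) * (s / (z - p))) (at z)"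
      using DERIV_chain2[OF DERIV_exp DERIV_cmult[OF L', of s]] by simp
    moreover have "((\<lambda>z. s / (z - p)) has_field_derivative - s / (z - p)\<^sup>2) (at z)"
      using wp by (auto intro!: derivative_eq_intros simp: power2_eq_square)
    ultimately show ?thesis
      by (rule DERIV_cong[OF DERIV_mult[OF _ DERIV_add[OF DERIV_mult[OF _ g1] g2]]]) (simp add: mult_ac)
  qed
  also have "exp (s * L z) * (s / (z - p)) * (s / (z - p) * g (z - p) + deriv g (z - p)) +
      exp (s * L z) * (- s / (z - p)\<^sup>2 * g (z - p) + s / (z - p) * deriv g (z - p) + deriv (deriv g) (z - p))
     = exp (s * L z) * (s / (z - p) * (s / (z - p) * G0 + G1)
        + (- s / (z - p)\<^sup>2 * G0 + s / (z - p) * G1 + (P (z - p) * G0 - 2 * s * G1) / (z - p)))"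
     if "G0 = g (z - p)" "G1 = deriv g (z - p)" for G0 G1
    unfolding that ode by (simp add: algebra_simps)
  also have "(s / (z - p) * (s / (z - p) * G0 + G1)
        + (- s / (z - p)\<^sup>2 * G0 + s / (z - p) * G1 + (P (z - p) * G0 - 2 * s * G1) / (z - p)))
      = (s * (s - 1) + (z - p) * P (z - p)) / (z - p)\<^sup>2 * G0" for G0 G1
    using wp by (simp add: divide_simps power2_eq_square) (simp add: algebra_simps)
  finally show "((\<lambda>z. exp (s * L z) * (s / (z - p) * g (z - p) + deriv g (z - p))) has_field_derivative
      Q z * (exp (s * L z) * g (z - p))) (at z)"
    using Q[OF z] by (simp add: mult_ac)
qed

text \<open>The derivative of \<open>k / w^n\<close> is \<open>(w k' - n k) / w^{n+1}\<close>. By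
  \<open>eq\<close> this misses \<open>e / w^{n+1}\<close> by \<open>c / w\<close>, which is the
  derivative of \<open>c L\<close>.\<close>

lemma power_quotient_primitive_deriv:
  assumes k: "k holomorphic_on ball 0 r" "z - p \<in> ball 0 r" "z \<noteq> p"
    and eq: "(z - p) * deriv k (z - p) - of_nat n * k (z - p) = e - c * (z - p) ^ n"
    and L: "(L has_field_derivative 1 / (z - p)) (at z)"
  shows "((\<lambda>z. k (z - p) / (z - p) ^ n + c * L z) has_field_derivative e / (z - p) ^ Suc n) (at z)"
proof -
  have "(k has_field_derivative deriv k (z - p)) (at (z - p))"
    using k by (intro holomorphic_derivI[of _ "ball 0 r"]) auto
  hence [derivative_intros]: "((\<lambda>z. k (z - p)) has_field_derivative deriv k (z - p)) (at z)"
    using DERIV_shift[of k _ z "- p"] by simp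
  have wp: "z - p \<noteq> 0" using k by simp
  have "((\<lambda>z. k (z - p) / (z - p) ^ n + c * L z) has_field_derivative
     ((z - p) * deriv k (z - p) - of_nat n * k (z - p)) / (z - p) ^ Suc n + c * (1 / (z - p))) (at z)"
  proof -
    have "((\<lambda>z. (z - p) ^ n) has_field_derivative of_nat n * (z - p) ^ (n - 1)) (at z)"
      by (auto intro!: derivative_eq_intros)
    moreover have "((\<lambda>z. k (z - p)) has_field_derivative deriv k (z - p)) (at z)"
      by (intro derivative_intros)
    ultimately have "((\<lambda>z. k (z - p) / (z - p) ^ n) has_field_derivative
        (deriv k (z - p) * (z - p) ^ n - k (z - p) * (of_nat n * (z - p) ^ (n - 1))) / ((z - p) ^ n * (z - p) ^ n)) (at z)"
      using wp by (intro DERIV_divide) auto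
    also have "(deriv k (z - p) * (z - p) ^ n - k (z - p) * (of_nat n * (z - p) ^ (n - 1))) / ((z - p) ^ n * (z - p) ^ n)
       = ((z - p) * deriv k (z - p) - of_nat n * k (z - p)) / (z - p) ^ Suc n"
    proof (cases n)
      case (Suc m)
      have "(deriv k (z - p) * W ^ n - k (z - p) * (of_nat n * W ^ (n - 1))) / (W ^ n * W ^ n)
       = (W * deriv k (z - p) - of_nat n * k (z - p)) / W ^ Suc n" if "W \<noteq> 0" for W
        using that by (simp add: Suc divide_simps del: of_nat_Suc) (simp add: algebra_simps del: of_nat_Suc)
      from this[OF wp] show ?thesis .
    qed (use wp in simp)
    finally show ?thesis by (intro DERIV_add DERIV_cmult L)
  qed
  also have "((z - p) * deriv k (z - p) - of_nat n * k (z - p)) / (z - p) ^ Suc n + c * (1 / (z - p))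
      = e / (z - p) ^ Suc n"
    unfolding eq using wp by (simp add: divide_simps)
  finally show ?thesis .
qed

lemma local_log:
  assumes "p \<notin> ball z r"
  obtains L where "L holomorphic_on ball z r" "\<And>w. w \<in> ball z r \<Longrightarrow> exp (L w) = w - p"
proof -
  have "(\<lambda>w. w - p) holomorphic_on ball z r" by (intro holomorphic_intros)
  moreover have "contractible (ball z r)" by (simp add: convex_imp_contractible)
  moreover have "\<And>w. w \<in> ball z r \<Longrightarrow> w - p \<noteq> 0" using assms by auto
  ultimately show ?thesis
    using that contractible_imp_holomorphic_log[of "\<lambda>w. w - p" "ball z r"] by metis
qed

text \<open>
  The data of a Frobenius expansion at \<open>p\<close> with exponents \<open>1/2 \<plusminus> n/2\<close>, in the coordinate \<open>z - p\<close>: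
  the solutions are \<open>(z - p)\<^bsup>(n + 1)/2\<^esup> g\<close> and its product with
  \<open>k / (z - p)\<^bsup>n\<^esup> + c log (z - p)\<close>.
\<close>

definition frobenius_data ::
    "(complex \<Rightarrow> complex) \<Rightarrow> complex \<Rightarrow> real \<Rightarrow> nat \<Rightarrow> (complex \<Rightarrow> complex) \<Rightarrow> (complex \<Rightarrow> complex) \<Rightarrow> complex \<Rightarrow> bool"
  where
  "frobenius_data Q p r n g k c \<longleftrightarrow> r > 0 \<and> n \<ge> 1 \<and> g holomorphic_on ball 0 r \<and> k holomorphic_on ball 0 r \<and>
     g 0 = 1 \<and> (\<forall>w\<in>ball 0 r. g w \<noteq> 0) \<and>
     (\<forall>w\<in>ball 0 r. w * deriv k w - of_nat n * k w = 1 / (g w)\<^sup>2 - c * w ^ n) \<and>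
     (\<forall>U L. open U \<longrightarrow> U \<subseteq> ball p r - {p} \<longrightarrow> L holomorphic_on U \<longrightarrow> (\<forall>z\<in>U. exp (L z) = z - p) \<longrightarrow>
        fundamental_pair Q U (\<lambda>z. exp (of_nat (n + 1) / 2 * L z) * g (z - p))
          (\<lambda>z. exp (of_nat (n + 1) / 2 * L z) * g (z - p) * (k (z - p) / (z - p) ^ n + c * L z)))"

text \<open>For even \<open>n\<close> the exponent is a half-integer and the sign of the exponential
  depends on the branch; its square does not.\<close>

lemma exp_half_log_square:
  assumes "exp L = (w::complex)"
  shows "(exp (of_nat (n + 1) / 2 * L))\<^sup>2 = w ^ Suc n"
proof -
  have "of_nat (n + 1) / 2 * L + of_nat (n + 1) / 2 * L = of_nat (Suc n) * L"
    by (simp add: field_simps)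
  hence "(exp (of_nat (n + 1) / 2 * L))\<^sup>2 = exp (of_nat (Suc n) * L)"
    by (simp only: power2_eq_square exp_add[symmetric])
  also have "\<dots> = w ^ Suc n" by (simp only: exp_of_nat_mult assms)
  finally show ?thesis .
qed

text \<open>The value \<open>P 0\<close> is \<open>s (s - 1)\<close> for the larger exponent
  \<open>s = (n + 1) / 2\<close>, for which the recursion has \<open>a = n + 1\<close> and no
  vanishing denominators. The smaller exponent differs by an integer, so its solution is found by
  quadrature and may carry a logarithm. The last two conclusions identify the coefficient of the
  logarithm for \<open>n = 1\<close>, the case of regular points.\<close>

lemma frobenius_data_exists:
  assumes n: "n \<ge> 1" and P: "P analytic_on {0}" and r0: "r0 > 0"
    and Q: "\<And>z. z \<in> ball p r0 - {p} \<Longrightarrow> Q z = P (z - p) / (z - p)\<^sup>2"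
    and P0: "P 0 = ((of_nat n)\<^sup>2 - 1) / 4"
  obtains r g k c where "r \<le> r0" "frobenius_data Q p r n g k c"
    "(deriv g 0) * (of_nat n + 1) = deriv P 0" "n = 1 \<Longrightarrow> c = - 2 * deriv g 0"
proof -
  obtain R where R: "R > 0" "P holomorphic_on ball 0 R" using P by (auto simp: analytic_on_def)
  obtain P1 where P1: "P1 holomorphic_on ball 0 R" "\<And>w. w \<in> ball 0 R \<Longrightarrow> P w = P 0 + w * P1 w"
    using holomorphic_quotient_at_0[OF R(2,1)] by blast
  have "P1 analytic_on {0}" using P1(1) R by (auto simp: analytic_on_def)
  moreover have "of_nat n + 1 + of_nat m \<noteq> (0::complex)" for m
  proof -
    have "of_nat n + 1 + of_nat m = (of_nat (n + 1 + m) :: complex)" by simp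
    thus ?thesis by (metis of_nat_eq_0_iff add_is_0 one_neq_zero)
  qed
  ultimately obtain g r1 where g: "r1 > 0" "g holomorphic_on ball 0 r1" "g 0 = 1" "P1 holomorphic_on ball 0 r1"
    "\<And>w. w \<in> ball 0 r1 \<Longrightarrow> g w \<noteq> 0"
    "\<And>w. w \<in> ball 0 r1 \<Longrightarrow> w * deriv (deriv g) w + (of_nat n + 1) * deriv g w = P1 w * g w"
    using frobenius_solution[of P1 "of_nat n + 1"] by metis
  define r where "r = min r0 (min r1 R)"
  have r: "r > 0" "r \<le> r0" "r \<le> r1" "r \<le> R" using g r0 R by (auto simp: r_def)
  have sub: "ball 0 r \<subseteq> ball 0 r1" "ball 0 r \<subseteq> ball (0::complex) R" using r by auto
  have gr: "g holomorphic_on ball 0 r" using g(2) sub holomorphic_on_subset by blast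
  have gnz: "g w \<noteq> 0" if "w \<in> ball 0 r" for w using g(5) that sub by blast
  have "(\<lambda>w. 1 / (g w)\<^sup>2) holomorphic_on ball 0 r"
    using gnz by (intro holomorphic_intros gr) auto
  then obtain k c where k: "k holomorphic_on ball 0 r"
    "\<And>w. w \<in> ball 0 r \<Longrightarrow> w * deriv k w - of_nat n * k w = 1 / (g w)\<^sup>2 - c * w ^ n"
    using primitive_of_power_quotient[of "\<lambda>w. 1 / (g w)\<^sup>2" r n] r(1) by blast
  have fp: "fundamental_pair Q U (\<lambda>z. exp (of_nat (n + 1) / 2 * L z) * g (z - p))
          (\<lambda>z. exp (of_nat (n + 1) / 2 * L z) * g (z - p) * (k (z - p) / (z - p) ^ n + c * L z))"
    if U: "open U" "U \<subseteq> ball p r - {p}" "L holomorphic_on U" "\<forall>z\<in>U. exp (L z) = z - p" for U L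
  proof (rule fundamental_pair_by_quadrature[OF U(1)])
    have zr: "z - p \<in> ball 0 r" "z \<noteq> p" if "z \<in> U" for z
      using that U(2) by (auto simp: dist_norm norm_minus_commute)
    show "ode_solution Q U (\<lambda>z. exp (of_nat (n + 1) / 2 * L z) * g (z - p))"
    proof (rule frobenius_ode_solution[OF U(1,2) _ gr _ U(3)])
      fix z assume z: "z \<in> U"
      have "z \<in> ball p r0 - {p}" using z U(2) r by auto
      moreover have "z - p \<in> ball 0 R" using zr[OF z] sub by blast
      ultimately show "Q z = (of_nat (n + 1) / 2 * (of_nat (n + 1) / 2 - 1) + (z - p) * P1 (z - p)) / (z - p)\<^sup>2"
        using Q[of z] P1(2)[of "z - p"] P0 by (simp add: field_simps power2_eq_square)
    next
      fix w :: complex assume "w \<in> ball 0 r"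
      hence "w \<in> ball 0 r1" using sub by blast
      moreover have "2 * (of_nat (n + 1) / 2) = (of_nat n + 1 :: complex)" by simp
      ultimately show "w * deriv (deriv g) w + 2 * (of_nat (n + 1) / 2) * deriv g w = P1 w * g w"
        using g(6)[of w] by (simp only:)
    qed (use U in auto)
    show "exp (of_nat (n + 1) / 2 * L z) * g (z - p) \<noteq> 0" if "z \<in> U" for z
      using gnz[OF zr(1)[OF that]] by simp
    show "((\<lambda>z. k (z - p) / (z - p) ^ n + c * L z) has_field_derivative
         1 / (exp (of_nat (n + 1) / 2 * L z) * g (z - p))\<^sup>2) (at z)" if z: "z \<in> U" for z
    proof -
      have "(L has_field_derivative 1 / (z - p)) (at z)"
        using deriv_local_log[OF U(3,1) z] U(4) by blast
      from power_quotient_primitive_deriv[OF k(1) zr[OF z] k(2)[OF zr(1)[OF z]] this]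
      show ?thesis using exp_half_log_square[of "L z" "z - p" n] U(4) z
        by (simp add: power_mult_distrib mult.commute)
    qed
  qed
  have fd: "frobenius_data Q p r n g k c"
    unfolding frobenius_data_def using r n gr k g(3) gnz fp by blast
  have z0: "(0::complex) \<in> ball 0 r" "(0::complex) \<in> ball 0 R" "(0::complex) \<in> ball 0 r1" using r R g by auto
  have P1d: "deriv P 0 = P1 0"
  proof -
    have "((\<lambda>w. P 0 + w * P1 w) has_field_derivative P1 0) (at 0)"
      using holomorphic_derivI[OF P1(1) open_ball z0(2)] by (auto intro!: derivative_eq_intros)
    hence "(P has_field_derivative P1 0) (at 0)"
      by (rule has_field_derivative_transform_within_open[OF _ open_ball z0(2)]) (use P1(2) in auto)
    thus ?thesis by (rule DERIV_imp_deriv)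
  qed
  have g1: "deriv g 0 * (of_nat n + 1) = deriv P 0"
    using g(6)[OF z0(3)] g(3) P1d by (simp add: mult.commute)
  \<comment> \<open>Both sides of \<open>w k' - k = 1 / g^2 - c w\<close> are differentiated at 0,
    where the left side contributes \<open>k' - k' = 0\<close>.\<close>
  have c1: "c = - 2 * deriv g 0" if "n = 1"
  proof -
    have dk: "deriv k holomorphic_on ball 0 r" using k(1) by (intro holomorphic_deriv) auto
    have "((\<lambda>w. w * deriv k w - k w) has_field_derivative 0) (at 0)"
      using holomorphic_derivI[OF k(1) open_ball z0(1)] holomorphic_derivI[OF dk open_ball z0(1)]
      by (auto intro!: derivative_eq_intros)
    moreover have "((\<lambda>w. 1 / (g w)\<^sup>2 - c * w) has_field_derivative - 2 * deriv g 0 - c) (at 0)"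
      using holomorphic_derivI[OF gr open_ball z0(1)] g(3)
      by (auto intro!: derivative_eq_intros simp: power2_eq_square)
    hence "((\<lambda>w. w * deriv k w - k w) has_field_derivative - 2 * deriv g 0 - c) (at 0)"
      using k(2) that by (elim has_field_derivative_transform_within_open[OF _ open_ball z0(1)]) auto
    ultimately have "0 = - 2 * deriv g 0 - c" by (rule DERIV_unique)
    thus ?thesis by algebra
  qed
  show ?thesis using that r(2) fd g1 c1 by blast
qed

text \<open>Taking \<open>(z - p) powr (s - n)\<close> out of the second Frobenius solution leaves a
  holomorphic function plus \<open>c (z - p)^n g\<close> times the logarithm, the shape forbidden at
  an apparent singularity.\<close>

lemma no_log_of_apparent:
  assumes fd: "frobenius_data Q p r n g k c" and ap: "apparent_at Q p"
    and H: "ball p r \<subseteq> \<H>" "Q holomorphic_on ball p r - {p}"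
  shows "c = 0"
proof (rule ccontr)
  assume c: "c \<noteq> 0"
  note fd' = fd[unfolded frobenius_data_def]
  define U where "U = slit_disc p r"
  have Usub: "U \<subseteq> ball p r - {p}" by (auto simp: U_def slit_disc_def)
  have Uopen: "open U"
  proof -
    have "U = ball p r \<inter> (\<lambda>z. z - p) -` (- \<real>\<^sub>\<le>\<^sub>0)" by (auto simp: U_def slit_disc_def)
    moreover have "open ((\<lambda>z. z - p) -` (- \<real>\<^sub>\<le>\<^sub>0 :: complex set))"
      by (intro open_vimage) (auto intro!: continuous_intros)
    ultimately show ?thesis by (simp add: open_Int)
  qed
  define s where "s = (of_nat (n + 1) / 2 :: complex)"
  define y where "y = (\<lambda>z. exp (s * Ln (z - p)) * g (z - p) * (k (z - p) / (z - p) ^ n + c * Ln (z - p)))"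
  have "(\<lambda>z. Ln (z - p)) holomorphic_on U"
    by (intro holomorphic_intros) (auto simp: U_def slit_disc_def)
  moreover have "\<forall>z\<in>U. exp (Ln (z - p)) = z - p"
    using Usub by (intro ballI exp_Ln) auto
  ultimately have "ode_solution Q U y"
    using fd' Uopen Usub unfolding y_def s_def fundamental_pair_def by blast
  moreover have "log_singularity p r y"
    unfolding log_singularity_def
  proof (intro exI conjI)
    have sh: "(\<lambda>z. f (z - p)) holomorphic_on ball p r" if "f holomorphic_on ball 0 r" for f
      using that by (intro holomorphic_on_compose_gen[of "\<lambda>z. z - p" "ball p r" f "ball 0 r", unfolded o_def])
        (auto intro!: holomorphic_intros simp: dist_norm norm_minus_commute)
    show "(\<lambda>z. g (z - p) * k (z - p)) holomorphic_on ball p r"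
      using fd' by (intro holomorphic_intros sh) auto
    show "(\<lambda>z. c * (z - p) ^ n * g (z - p)) holomorphic_on ball p r"
      using fd' by (intro holomorphic_intros sh) auto
    \<comment> \<open>The coefficient of the logarithm vanishes at \<open>p\<close> because
      \<open>n \<ge> 1\<close>, so a point off the centre witnesses that it is not zero.\<close>
    have "p + of_real (r / 2) \<in> ball p r" "of_real (r / 2) \<in> ball (0::complex) r"
      using fd' by (auto simp: dist_norm)
    thus "\<exists>z\<in>ball p r. c * (z - p) ^ n * g (z - p) \<noteq> 0"
      using fd' c by (intro bexI[of _ "p + of_real (r / 2)"]) auto
    show "\<forall>z\<in>slit_disc p r. y z = (z - p) powr (s - of_nat n) *
        (g (z - p) * k (z - p) + c * (z - p) ^ n * g (z - p) * Ln (z - p))"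
    proof
      fix z assume "z \<in> slit_disc p r"
      hence nz: "z \<noteq> p" using Usub U_def by auto
      hence "(z - p) powr (s - of_nat n) = exp (s * Ln (z - p)) / (z - p) ^ n"
        by (simp add: powr_def left_diff_distrib exp_diff exp_of_nat_mult)
      thus "y z = (z - p) powr (s - of_nat n) *
        (g (z - p) * k (z - p) + c * (z - p) ^ n * g (z - p) * Ln (z - p))"
        using nz by (simp add: y_def field_simps)
    qed
  qed
  ultimately show False
    using ap fd' H unfolding apparent_at_def U_def by blast
qed

section \<open>Analytic continuation on a convex domain\<close>

text \<open>A neighbourhood of fixed radius of the segment is the Minkowski sum of the segment and a
  ball, hence convex; compactness makes it fit into \<open>U\<close>.\<close>

lemma convex_neighbourhood_of_segment:
  fixes a b :: "'a :: euclidean_space"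
  assumes "open U" "closed_segment a b \<subseteq> U"
  obtains W where "open W" "convex W" "closed_segment a b \<subseteq> W" "W \<subseteq> U"
proof -
  obtain e where e: "e > 0" "(\<Union>x\<in>closed_segment a b. ball x e) \<subseteq> U"
    using compact_subset_open_imp_ball_epsilon_subset[OF compact_segment assms] by metis
  let ?W = "\<Union>x\<in>closed_segment a b. ball x e"
  have "?W = (\<Union>x\<in>closed_segment a b. \<Union>y\<in>ball (0::'a) e. {x + y})"
  proof safe
    fix x w assume "x \<in> closed_segment a b" "w \<in> ball x e"
    moreover from this have "w = x + (w - x)" "w - x \<in> ball 0 e"
      by (auto simp: dist_norm norm_minus_commute)
    ultimately show "w \<in> (\<Union>x\<in>closed_segment a b. \<Union>y\<in>ball (0::'a) e. {x + y})" by blast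
  next
    fix x y :: 'a assume x: "x \<in> closed_segment a b" and y: "y \<in> ball 0 e"
    have "x + y \<in> ball x e" using y by (simp add: dist_norm)
    thus "x + y \<in> ?W" using x by blast
  qed
  moreover have "convex (\<Union>x\<in>closed_segment a b. \<Union>y\<in>ball (0::'a) e. {x + y})"
    by (intro convex_sums convex_closed_segment convex_ball)
  ultimately have "convex ?W" by simp
  moreover have "closed_segment a b \<subseteq> ?W" using e(1) by auto
  moreover have "open ?W" by auto
  ultimately show ?thesis using that[of ?W] e(2) by simp
qed

text \<open>All points lie on one ray from \<open>a\<close>. Those not beyond \<open>x\<close>
  belong to the segment from \<open>a\<close> to \<open>x\<close>, hence to \<open>U\<close>; the
  others lie between \<open>x\<close> and \<open>y\<close>, hence in \<open>B\<close>.\<close>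

lemma segment_subset_two_convex:
  fixes a :: "'a :: real_vector"
  assumes x: "x \<in> closed_segment a z" and y: "y \<in> closed_segment a z"
    and U: "convex U" "a \<in> U" "x \<in> U" and B: "convex B" "x \<in> B" "y \<in> B"
  shows "closed_segment a y \<subseteq> U \<union> B"
proof
  fix w assume w: "w \<in> closed_segment a y"
  obtain s where s: "0 \<le> s" "s \<le> 1" "x = a + s *\<^sub>R (z - a)"
    using x by (auto simp: closed_segment_def algebra_simps)
  obtain t where t: "0 \<le> t" "t \<le> 1" "y = a + t *\<^sub>R (z - a)"
    using y by (auto simp: closed_segment_def algebra_simps)
  obtain v where v: "0 \<le> v" "v \<le> 1" "w = a + v *\<^sub>R (y - a)"
    using w by (auto simp: closed_segment_def algebra_simps)
  have w': "w = a + (v * t) *\<^sub>R (z - a)" using v t by simp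
  have vt: "0 \<le> v * t" "v * t \<le> t" using v t by (auto simp: mult_left_le_one_le)
  show "w \<in> U \<union> B"
  proof (cases "v * t \<le> s")
    case True
    have "w \<in> closed_segment a x"
    proof (cases "s = 0")
      case False
      have "w = a + (v * t / s) *\<^sub>R (x - a)" using s w' False by simp
      moreover have "0 \<le> v * t / s" "v * t / s \<le> 1" using True vt s False by (auto simp: divide_simps)
      ultimately show ?thesis
        unfolding closed_segment_def by (auto intro!: exI[of _ "v * t / s"] simp: algebra_simps)
    qed (use True vt w' s in auto)
    thus ?thesis using U closed_segment_subset by blast
  next
    case False
    hence lt: "s < t" using vt by linarith
    have "w \<in> closed_segment x y"
    proof -
      define l where "l = (v * t - s) / (t - s)"
      have "0 \<le> l" "l \<le> 1" using False vt lt by (auto simp: l_def divide_simps)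
      moreover have "l * (t - s) = v * t - s" using lt by (simp add: l_def)
      hence vt': "v * t = (1 - l) * s + l * t" by algebra
      have "w = (1 - l) *\<^sub>R x + l *\<^sub>R y"
        unfolding w' s(3) t(3) vt' by (simp add: algebra_simps)
      ultimately show ?thesis unfolding closed_segment_def by blast
    qed
    thus ?thesis using B closed_segment_subset by blast
  qed
qed

text \<open>
  \<open>ok f z\<close> is a property of the germ of \<open>f\<close> at \<open>z\<close>.  Germs are continued along the segments
  issuing from \<open>z0\<close>; two continuations to convex neighbourhoods of such segments agree on the
  intersection, which is again convex and contains \<open>z0\<close>.
\<close>

lemma continuation_on_convex_domain:
  fixes D :: "'a :: euclidean_space set" and ok :: "('a \<Rightarrow> 'b) \<Rightarrow> 'a \<Rightarrow> bool"
  assumes D: "open D" "convex D"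
    and germ: "\<And>f g z V. z \<in> D \<Longrightarrow> ok f z \<Longrightarrow> open V \<Longrightarrow> z \<in> V \<Longrightarrow> (\<And>w. w \<in> V \<Longrightarrow> f w = g w) \<Longrightarrow> ok g z"
    and uniq: "\<And>U V f g z. open U \<Longrightarrow> connected U \<Longrightarrow> U \<subseteq> D \<Longrightarrow> (\<And>z. z \<in> U \<Longrightarrow> ok f z) \<Longrightarrow>
       (\<And>z. z \<in> U \<Longrightarrow> ok g z) \<Longrightarrow> open V \<Longrightarrow> V \<noteq> {} \<Longrightarrow> V \<subseteq> U \<Longrightarrow> (\<And>z. z \<in> V \<Longrightarrow> f z = g z) \<Longrightarrow>
       z \<in> U \<Longrightarrow> f z = g z"
    and ext: "\<And>p. p \<in> D \<Longrightarrow> \<exists>r>0. ball p r \<subseteq> D \<and> (\<forall>U f. open U \<longrightarrow> convex U \<longrightarrow> U \<subseteq> D \<longrightarrow>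
       U \<inter> ball p r \<noteq> {} \<longrightarrow> (\<forall>z\<in>U. ok f z) \<longrightarrow>
       (\<exists>g. (\<forall>z\<in>ball p r. ok g z) \<and> (\<forall>z\<in>U \<inter> ball p r. g z = f z)))"
    and V0: "open V0" "convex V0" "V0 \<subseteq> D" "z0 \<in> V0" "\<And>z. z \<in> V0 \<Longrightarrow> ok f0 z"
  obtains f where "\<And>z. z \<in> D \<Longrightarrow> ok f z" "\<And>z. z \<in> V0 \<Longrightarrow> f z = f0 z"
proof -
  define cont where "cont = (\<lambda>U f. open U \<and> convex U \<and> U \<subseteq> D \<and> z0 \<in> U \<and> (\<forall>z\<in>U. ok f z) \<and>
     (\<exists>V. open V \<and> z0 \<in> V \<and> (\<forall>w\<in>V. f w = f0 w)))"
  define reach where "reach = (\<lambda>z. \<exists>U f. cont U f \<and> z \<in> U)"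
  have agree: "f z = g z" if c: "cont U f" "cont U' g" "z \<in> U" "z \<in> U'" for U U' f g z
  proof -
    obtain V where V: "open V" "z0 \<in> V" "\<And>w. w \<in> V \<Longrightarrow> f w = f0 w"
      using c(1) unfolding cont_def by blast
    obtain V' where V': "open V'" "z0 \<in> V'" "\<And>w. w \<in> V' \<Longrightarrow> g w = f0 w"
      using c(2) unfolding cont_def by blast
    show ?thesis
    proof (rule uniq[of "U \<inter> U'" f g "V \<inter> V' \<inter> U \<inter> U'"])
      show "open (U \<inter> U')" "connected (U \<inter> U')" "U \<inter> U' \<subseteq> D" "open (V \<inter> V' \<inter> U \<inter> U')"
        "V \<inter> V' \<inter> U \<inter> U' \<noteq> {}"
        using c V V' unfolding cont_def by (auto intro!: convex_connected convex_Int open_Int)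
      show "ok f w" if "w \<in> U \<inter> U'" for w using that c unfolding cont_def by blast
      show "ok g w" if "w \<in> U \<inter> U'" for w using that c unfolding cont_def by blast
      show "f w = g w" if "w \<in> V \<inter> V' \<inter> U \<inter> U'" for w using that V(3) V'(3) by auto
    qed (use c in auto)
  qed
  have c0: "cont V0 f0" using V0 unfolding cont_def by blast
  have reach: "reach z" if z: "z \<in> D" for z
  proof (rule connected_induction_simple[of "closed_segment z0 z" z0 z reach])
    show "reach z0" using c0 V0 unfolding reach_def by blast
    fix a assume a: "a \<in> closed_segment z0 z"
    have "a \<in> D" using a z V0 D(2) closed_segment_subset by blast
    then obtain r where r: "r > 0" "ball a r \<subseteq> D" "\<And>U f. open U \<Longrightarrow> convex U \<Longrightarrow> U \<subseteq> D \<Longrightarrow>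
       U \<inter> ball a r \<noteq> {} \<Longrightarrow> (\<forall>z\<in>U. ok f z) \<Longrightarrow>
       (\<exists>g. (\<forall>z\<in>ball a r. ok g z) \<and> (\<forall>z\<in>U \<inter> ball a r. g z = f z))"
      using ext[of a] by blast
    have "reach y" if xy: "x \<in> closed_segment z0 z \<inter> ball a r" "y \<in> closed_segment z0 z \<inter> ball a r" "reach x" for x y
    proof -
      obtain U f where U: "cont U f" "x \<in> U" using xy(3) by (auto simp: reach_def)
      have U': "open U" "convex U" "U \<subseteq> D" "z0 \<in> U" "\<And>z. z \<in> U \<Longrightarrow> ok f z" using U(1) by (auto simp: cont_def)
      obtain g where g: "\<And>z. z \<in> ball a r \<Longrightarrow> ok g z" "\<And>z. z \<in> U \<inter> ball a r \<Longrightarrow> g z = f z"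
        using r(3)[of U f] U U' xy(1) by blast
      define h where "h = (\<lambda>z. if z \<in> U then f z else g z)"
      have hU: "h w = f w" if "w \<in> U" for w using that by (simp add: h_def)
      have hB: "h w = g w" if "w \<in> ball a r" for w using that g(2) by (simp add: h_def)
      have ok: "ok h w" if "w \<in> U \<union> ball a r" for w
      proof (cases "w \<in> U")
        case True
        thus ?thesis using germ[of w f U h] U' hU by auto
      next
        case False
        thus ?thesis using germ[of w g "ball a r" h] g(1) hB r(2) that by auto
      qed
      \<comment> \<open>\<open>h\<close> lives on the union, which need not be convex; a
        continuation in the sense of \<open>cont\<close> is recovered on a convex neighbourhood of
        the segment to \<open>y\<close>.\<close>
      have "closed_segment z0 y \<subseteq> U \<union> ball a r"
        by (rule segment_subset_two_convex[of x z0 z]) (use xy U U' in auto)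
      then obtain W where W: "open W" "convex W" "closed_segment z0 y \<subseteq> W" "W \<subseteq> U \<union> ball a r"
        using convex_neighbourhood_of_segment[of "U \<union> ball a r" z0 y] U' by (metis open_Un open_ball)
      obtain V where V: "open V" "z0 \<in> V" "\<And>w. w \<in> V \<Longrightarrow> f w = f0 w"
        using U(1) unfolding cont_def by blast
      have "open (V \<inter> U)" "z0 \<in> V \<inter> U" "\<forall>w\<in>V \<inter> U. h w = f0 w" using V U' hU by auto
      hence "cont W h" unfolding cont_def using W ok U' r(2) ends_in_segment(1) by (meson Un_least subset_eq)
      thus "reach y" unfolding reach_def using W(3) by (meson ends_in_segment(2) subsetD)
    qed
    moreover have "openin (top_of_set (closed_segment z0 z)) (closed_segment z0 z \<inter> ball a r)"
      by (rule openin_open_Int) simp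
    moreover have "a \<in> closed_segment z0 z \<inter> ball a r" using a r(1) by simp
    ultimately show "\<exists>T. openin (top_of_set (closed_segment z0 z)) T \<and> a \<in> T \<and> (\<forall>x\<in>T. \<forall>y\<in>T. reach x \<longrightarrow> reach y)"
      by blast
  qed auto
  have "\<forall>z\<in>D. \<exists>p. cont (fst p) (snd p) \<and> z \<in> fst p"
    using reach unfolding reach_def by (metis fst_conv snd_conv)
  then obtain Uf where "\<forall>z\<in>D. cont (fst (Uf z)) (snd (Uf z)) \<and> z \<in> fst (Uf z)" by (rule bchoice[THEN exE])
  hence Uf: "\<And>z. z \<in> D \<Longrightarrow> cont (fst (Uf z)) (snd (Uf z)) \<and> z \<in> fst (Uf z)" by blast
  \<comment> \<open>Each point uses a continuation of its own; by \<open>agree\<close> the choices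
    are compatible, so near any point \<open>f\<close> coincides with a single continuation.\<close>
  define f where "f = (\<lambda>z. snd (Uf z) z)"
  have fU: "f w = snd (Uf z) w" if "z \<in> D" "w \<in> fst (Uf z)" for z w
  proof -
    have "w \<in> D" using Uf[OF that(1)] that(2) unfolding cont_def by blast
    thus ?thesis unfolding f_def using agree Uf that by blast
  qed
  show ?thesis
  proof (rule that[of f])
    fix z assume z: "z \<in> D"
    show "ok f z"
      using germ[of z "snd (Uf z)" "fst (Uf z)" f] Uf[OF z] fU[OF z] z unfolding cont_def by auto
  next
    fix z assume z: "z \<in> V0"
    hence zD: "z \<in> D" using V0 by blast
    show "f z = f0 z" unfolding f_def using agree[of "fst (Uf z)" "snd (Uf z)" V0 f0 z] Uf[OF zD] c0 z by blast
  qed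
qed

section \<open>Quadratic systems\<close>

text \<open>Invariant under a common change of sign of both entries, which is the ambiguity of
  solutions at poles with half-integral exponents.\<close>

definition veronese :: "complex \<Rightarrow> complex \<Rightarrow> complex \<times> complex \<times> complex" where
  "veronese y1 y2 = (y1\<^sup>2, y1 * y2, y2\<^sup>2)"

abbreviation "e11 (M :: 'a :: comm_ring_1 ^ 2 ^ 2) \<equiv> M $ 1 $ 1"
abbreviation "e12 (M :: 'a :: comm_ring_1 ^ 2 ^ 2) \<equiv> M $ 1 $ 2"
abbreviation "e21 (M :: 'a :: comm_ring_1 ^ 2 ^ 2) \<equiv> M $ 2 $ 1"
abbreviation "e22 (M :: 'a :: comm_ring_1 ^ 2 ^ 2) \<equiv> M $ 2 $ 2"

text \<open>The symmetric square of a matrix: its action on \<open>veronese\<close> vectors.\<close>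

definition sym2 :: "complex ^ 2 ^ 2 \<Rightarrow> complex \<times> complex \<times> complex \<Rightarrow> complex \<times> complex \<times> complex" where
  "sym2 M = (\<lambda>(x, y, z).
     ((e11 M)\<^sup>2 * x + 2 * (e11 M * e12 M) * y + (e12 M)\<^sup>2 * z,
      (e11 M * e21 M) * x + (e11 M * e22 M + e12 M * e21 M) * y + (e12 M * e22 M) * z,
      (e21 M)\<^sup>2 * x + 2 * (e21 M * e22 M) * y + (e22 M)\<^sup>2 * z))"

definition mat2 :: "'a :: comm_ring_1 \<Rightarrow> 'a \<Rightarrow> 'a \<Rightarrow> 'a \<Rightarrow> 'a ^ 2 ^ 2" where
  "mat2 a b c d = vector [vector [a, b], vector [c, d]]"

lemma mat2_nth [simp]:
  "e11 (mat2 a b c d) = a" "e12 (mat2 a b c d) = b" "e21 (mat2 a b c d) = c" "e22 (mat2 a b c d) = d"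
  by (simp_all add: mat2_def)

lemma mat2_mult: "mat2 (a :: 'a :: comm_ring_1) b c d ** mat2 a' b' c' d' =
    mat2 (a * a' + b * c') (a * b' + b * d') (c * a' + d * c') (c * b' + d * d')"
  by (simp add: vec_eq_iff forall_2 matrix_matrix_mult_def sum_2)

lemma mat2_eta: "M = mat2 (e11 M) (e12 M) (e21 M) (e22 M)"
  by (simp add: vec_eq_iff forall_2)

lemma mat2_eq_iff: "mat2 a b c d = mat2 a' b' c' d' \<longleftrightarrow> a = a' \<and> b = b' \<and> c = c' \<and> d = d'"
  by (metis mat2_nth)

lemma det_mat2 [simp]: "det (mat2 a b c d) = a * d - b * c"
  by (simp add: det_2)

lemma trace_mat2 [simp]: "trace (mat2 a b c d) = a + d"
  by (simp add: trace_def sum_2)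

definition adj2 :: "complex ^ 2 ^ 2 \<Rightarrow> complex ^ 2 ^ 2" where
  "adj2 M = mat2 (e22 M) (- (e12 M)) (- (e21 M)) (e11 M)"

lemma adj2_mult: "det M = 1 \<Longrightarrow> adj2 M ** M = mat 1" "det M = 1 \<Longrightarrow> M ** adj2 M = mat 1"
  by (simp_all add: vec_eq_iff forall_2 matrix_matrix_mult_def sum_2 adj2_def det_2 mat_def mult.commute)

lemma det_adj2 [simp]: "det (adj2 M) = det M"
  by (simp add: adj2_def det_2)

lemma sym2_veronese: "sym2 M (veronese y1 y2) = veronese (e11 M * y1 + e12 M * y2) (e21 M * y1 + e22 M * y2)"
  by (simp add: sym2_def veronese_def power2_eq_square algebra_simps)

lemma sym2_mult: "sym2 (A ** B) X = sym2 A (sym2 B X)"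
  by (cases X) (simp add: sym2_def matrix_matrix_mult_def sum_2 power2_eq_square algebra_simps)

lemma sym2_one [simp]: "sym2 (mat 1) X = X"
  by (cases X) (simp add: sym2_def mat_def)

lemma sym2_0 [simp]: "sym2 M (0, 0, 0) = (0, 0, 0)"
  by (simp add: sym2_def)

lemma sym2_adj2: "det M = 1 \<Longrightarrow> sym2 (adj2 M) (sym2 M X) = X" "det M = 1 \<Longrightarrow> sym2 M (sym2 (adj2 M) X) = X"
  by (simp_all add: sym2_mult[symmetric] adj2_mult)

section \<open>Bases of solutions and uniqueness of coefficients\<close>

lemma ode_solution_linear:
  assumes "ode_solution Q U y1" "ode_solution Q U y2" "open U"
  shows "ode_solution Q U (\<lambda>z. a * y1 z + b * y2 z)"
proof (rule ode_solutionI[OF assms(3)])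
  fix z assume z: "z \<in> U"
  note d = ode_solution_derivs[OF assms(1,3) z] ode_solution_derivs[OF assms(2,3) z]
  show "((\<lambda>z. a * y1 z + b * y2 z) has_field_derivative a * deriv y1 z + b * deriv y2 z) (at z)"
    by (intro DERIV_add DERIV_cmult d)
  have "((\<lambda>z. a * deriv y1 z + b * deriv y2 z) has_field_derivative a * (Q z * y1 z) + b * (Q z * y2 z)) (at z)"
    by (intro DERIV_add DERIV_cmult d)
  thus "((\<lambda>z. a * deriv y1 z + b * deriv y2 z) has_field_derivative Q z * (a * y1 z + b * y2 z)) (at z)"
    by (simp add: algebra_simps)
qed

lemma deriv_linear_combination:
  assumes "ode_solution Q U y1" "ode_solution Q U y2" "open U" "z \<in> U"
  shows "deriv (\<lambda>z. a * y1 z + b * y2 z) z = a * deriv y1 z + b * deriv y2 z"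
  using ode_solution_derivs(1)[OF assms(1,3,4)] ode_solution_derivs(1)[OF assms(2,3,4)]
  by (intro DERIV_imp_deriv DERIV_add DERIV_cmult)

lemma fundamental_pair_linear:
  assumes "fundamental_pair Q U y1 y2" "open U" "det M = 1"
  shows "fundamental_pair Q U (\<lambda>z. e11 M * y1 z + e12 M * y2 z) (\<lambda>z. e21 M * y1 z + e22 M * y2 z)"
proof -
  have o: "ode_solution Q U y1" "ode_solution Q U y2" using assms by (auto simp: fundamental_pair_def)
  have "(e11 M * y1 z + e12 M * y2 z) * deriv (\<lambda>z. e21 M * y1 z + e22 M * y2 z) z -
        deriv (\<lambda>z. e11 M * y1 z + e12 M * y2 z) z * (e21 M * y1 z + e22 M * y2 z) = 1" if z: "z \<in> U" for z
  proof -
    have W: "y1 z * deriv y2 z - deriv y1 z * y2 z = 1" using assms(1) z by (auto simp: fundamental_pair_def)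
    have "e11 M * e22 M - e12 M * e21 M = 1" using assms(3) by (simp add: det_2)
    thus ?thesis unfolding deriv_linear_combination[OF o assms(2) z] using W by algebra
  qed
  thus ?thesis using ode_solution_linear[OF o assms(2)] by (auto simp: fundamental_pair_def)
qed

lemma wronskian_constant:
  assumes "ode_solution Q U y" "ode_solution Q U v" and U: "open U" "convex U"
  obtains c where "\<And>z. z \<in> U \<Longrightarrow> y z * deriv v z - deriv y z * v z = c"
proof -
  have "\<exists>c. \<forall>z\<in>U. y z * deriv v z - deriv y z * v z = c"
  proof (rule has_field_derivative_zero_constant[OF U(2)])
    fix z assume z: "z \<in> U"
    note d = ode_solution_derivs[OF assms(1) U(1) z] ode_solution_derivs[OF assms(2) U(1) z]
    have "((\<lambda>z. y z * deriv v z - deriv y z * v z) has_field_derivative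
       (deriv y z * deriv v z + (Q z * v z) * y z) - ((Q z * y z) * v z + deriv v z * deriv y z)) (at z)"
      by (intro DERIV_diff DERIV_mult d)
    thus "((\<lambda>z. y z * deriv v z - deriv y z * v z) has_field_derivative 0) (at z within U)"
      by (simp add: algebra_simps has_field_derivative_at_within)
  qed
  thus ?thesis using that by blast
qed

text \<open>Cramer's rule: the coefficients are Wronskians with the basis elements, which are
  constant because the equation has no first-order term.\<close>

lemma ode_solution_combination:
  assumes fp: "fundamental_pair Q U y1 y2" and y: "ode_solution Q U y" and U: "open U" "convex U"
  obtains a b where "\<And>z. z \<in> U \<Longrightarrow> y z = a * y1 z + b * y2 z"
proof -
  have o: "ode_solution Q U y1" "ode_solution Q U y2" using fp by (auto simp: fundamental_pair_def)
  obtain a where a: "\<And>z. z \<in> U \<Longrightarrow> y z * deriv y2 z - deriv y z * y2 z = a" using wronskian_constant[OF y o(2) U] by blast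
  obtain b where b: "\<And>z. z \<in> U \<Longrightarrow> y z * deriv y1 z - deriv y z * y1 z = b" using wronskian_constant[OF y o(1) U] by blast
  show ?thesis
  proof (rule that[of a "- b"])
    fix z assume z: "z \<in> U"
    have "y1 z * deriv y2 z - deriv y1 z * y2 z = 1" using fp z by (auto simp: fundamental_pair_def)
    thus "y z = a * y1 z + - b * y2 z" using a[OF z] b[OF z] by algebra
  qed
qed

lemma fundamental_pair_change:
  assumes fp: "fundamental_pair Q U y1 y2" "fundamental_pair Q U v1 v2"
    and U: "open U" "convex U" "U \<noteq> {}"
  obtains M where "det M = 1" "\<And>z. z \<in> U \<Longrightarrow> v1 z = e11 M * y1 z + e12 M * y2 z"
    "\<And>z. z \<in> U \<Longrightarrow> v2 z = e21 M * y1 z + e22 M * y2 z"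
proof -
  have o: "ode_solution Q U y1" "ode_solution Q U y2" "ode_solution Q U v1" "ode_solution Q U v2"
    using fp by (auto simp: fundamental_pair_def)
  obtain a b where ab: "\<And>z. z \<in> U \<Longrightarrow> v1 z = a * y1 z + b * y2 z"
    using ode_solution_combination[OF fp(1) o(3) U(1,2)] by blast
  obtain c d where cd: "\<And>z. z \<in> U \<Longrightarrow> v2 z = c * y1 z + d * y2 z"
    using ode_solution_combination[OF fp(1) o(4) U(1,2)] by blast
  obtain z where z: "z \<in> U" using U by blast
  have "deriv v1 z = deriv (\<lambda>z. a * y1 z + b * y2 z) z"
    using ab z U(1) by (intro deriv_cong_ev eventually_nhds_in_open[THEN eventually_mono]) auto
  hence d1: "deriv v1 z = a * deriv y1 z + b * deriv y2 z"
    using deriv_linear_combination[OF o(1,2) U(1) z] by simp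
  have "deriv v2 z = deriv (\<lambda>z. c * y1 z + d * y2 z) z"
    using cd z U(1) by (intro deriv_cong_ev eventually_nhds_in_open[THEN eventually_mono]) auto
  hence d2: "deriv v2 z = c * deriv y1 z + d * deriv y2 z"
    using deriv_linear_combination[OF o(1,2) U(1) z] by simp
  have "y1 z * deriv y2 z - deriv y1 z * y2 z = 1" "v1 z * deriv v2 z - deriv v1 z * v2 z = 1"
    using fp z by (auto simp: fundamental_pair_def)
  hence "a * d - b * c = 1" unfolding d1 d2 ab[OF z] cd[OF z] by algebra
  thus ?thesis using that[of "mat2 a b c d"] ab cd by simp
qed

text \<open>
  The identity is differentiated twice; the quadratic form with coefficients \<open>\<alpha>, \<beta>, \<gamma>\<close> then vanishes
  on \<open>(y1, y2)\<close> and \<open>(y1', y2')\<close>, which are independent, together with its polarization.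
\<close>

lemma quadratic_independence:
  assumes fp: "fundamental_pair Q U y1 y2" and U: "open U" "U \<noteq> {}"
    and zero: "\<And>z. z \<in> U \<Longrightarrow> \<alpha> * (y1 z)\<^sup>2 + \<beta> * (y1 z * y2 z) + \<gamma> * (y2 z)\<^sup>2 = 0"
  shows "\<alpha> = 0 \<and> \<beta> = 0 \<and> \<gamma> = 0"
proof -
  have o: "ode_solution Q U y1" "ode_solution Q U y2" using fp by (auto simp: fundamental_pair_def)
  define q1 where "q1 = (\<lambda>z. 2 * \<alpha> * (y1 z * deriv y1 z) + \<beta> * (deriv y1 z * y2 z + y1 z * deriv y2 z) + 2 * \<gamma> * (y2 z * deriv y2 z))"
  have q1: "q1 z = 0" if z: "z \<in> U" for z
  proof -
    note [derivative_intros] = ode_solution_derivs[OF o(1) U(1) z] ode_solution_derivs[OF o(2) U(1) z]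
    have "((\<lambda>z. \<alpha> * (y1 z)\<^sup>2 + \<beta> * (y1 z * y2 z) + \<gamma> * (y2 z)\<^sup>2) has_field_derivative q1 z) (at z)"
      unfolding q1_def by (auto intro!: derivative_eq_intros simp: algebra_simps)
    moreover have "((\<lambda>z. \<alpha> * (y1 z)\<^sup>2 + \<beta> * (y1 z * y2 z) + \<gamma> * (y2 z)\<^sup>2) has_field_derivative 0) (at z)"
      by (rule has_field_derivative_transform_within_open[OF _ U(1) z, of "\<lambda>_. 0"]) (use zero in auto)
    ultimately show ?thesis by (rule DERIV_unique)
  qed
  obtain z where z: "z \<in> U" using U by blast
  note [derivative_intros] = ode_solution_derivs[OF o(1) U(1) z] ode_solution_derivs[OF o(2) U(1) z]
  have "(q1 has_field_derivative (2 * \<alpha> * ((deriv y1 z)\<^sup>2 + Q z * (y1 z)\<^sup>2) +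
      2 * \<beta> * (deriv y1 z * deriv y2 z + Q z * (y1 z * y2 z)) + 2 * \<gamma> * ((deriv y2 z)\<^sup>2 + Q z * (y2 z)\<^sup>2))) (at z)"
    unfolding q1_def by (auto intro!: derivative_eq_intros simp: algebra_simps power2_eq_square)
  moreover have "(q1 has_field_derivative 0) (at z)"
    by (rule has_field_derivative_transform_within_open[OF _ U(1) z, of "\<lambda>_. 0"]) (use q1 in auto)
  ultimately have e2: "2 * \<alpha> * ((deriv y1 z)\<^sup>2 + Q z * (y1 z)\<^sup>2) +
      2 * \<beta> * (deriv y1 z * deriv y2 z + Q z * (y1 z * y2 z)) + 2 * \<gamma> * ((deriv y2 z)\<^sup>2 + Q z * (y2 z)\<^sup>2) = 0"
    by (rule DERIV_unique)
  define a b c d where "a = y1 z" "b = y2 z" "c = deriv y1 z" "d = deriv y2 z"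
  have W: "a * d - c * b = 1" using fp z by (auto simp: fundamental_pair_def a_b_c_d_def)
  have v: "\<alpha> * a\<^sup>2 + \<beta> * (a * b) + \<gamma> * b\<^sup>2 = 0" using zero[OF z] by (simp add: a_b_c_d_def)
  have p: "2 * \<alpha> * (a * c) + \<beta> * (c * b + a * d) + 2 * \<gamma> * (b * d) = 0"
    using q1[OF z] by (simp add: q1_def a_b_c_d_def)
  have "2 * (\<alpha> * c\<^sup>2 + \<beta> * (c * d) + \<gamma> * d\<^sup>2) + 2 * Q z * (\<alpha> * a\<^sup>2 + \<beta> * (a * b) + \<gamma> * b\<^sup>2) = 0"
    using e2 by (simp add: a_b_c_d_def algebra_simps)
  hence v': "\<alpha> * c\<^sup>2 + \<beta> * (c * d) + \<gamma> * d\<^sup>2 = 0" using v by algebra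
  have "\<alpha> * (a * d - c * b)\<^sup>2 = d\<^sup>2 * (\<alpha> * a\<^sup>2 + \<beta> * (a * b) + \<gamma> * b\<^sup>2)
      - b * d * (2 * \<alpha> * (a * c) + \<beta> * (c * b + a * d) + 2 * \<gamma> * (b * d)) + b\<^sup>2 * (\<alpha> * c\<^sup>2 + \<beta> * (c * d) + \<gamma> * d\<^sup>2)"
    by algebra
  hence "\<alpha> = 0" using v p v' W by simp
  have "\<gamma> * (a * d - c * b)\<^sup>2 = c\<^sup>2 * (\<alpha> * a\<^sup>2 + \<beta> * (a * b) + \<gamma> * b\<^sup>2)
      - a * c * (2 * \<alpha> * (a * c) + \<beta> * (c * b + a * d) + 2 * \<gamma> * (b * d)) + a\<^sup>2 * (\<alpha> * c\<^sup>2 + \<beta> * (c * d) + \<gamma> * d\<^sup>2)"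
    by algebra
  hence "\<gamma> = 0" using v p v' W by simp
  have "\<beta> * (a * d + c * b) = 0" "\<beta> * (a * b) = 0" "\<beta> * (c * d) = 0"
    using v p v' by (auto simp: \<open>\<alpha> = 0\<close> \<open>\<gamma> = 0\<close> algebra_simps)
  hence "\<beta> * (a * d - c * b)\<^sup>2 = 0" by algebra
  hence "\<beta> = 0" using W by simp
  show ?thesis using \<open>\<alpha> = 0\<close> \<open>\<beta> = 0\<close> \<open>\<gamma> = 0\<close> by simp
qed

text \<open>\<open>sym2\<close> forgets the sign of a matrix, hence only the square of the trace can
  be compared. Linear independence of the three products turns the identity into equality of the
  entries of \<open>sym2\<close>.\<close>

lemma sym2_eq_imp_trace_eq:
  assumes fp: "fundamental_pair Q U y1 y2" and U: "open U" "U \<noteq> {}" and det: "det M = 1" "det N = 1"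
    and eq: "\<And>z. z \<in> U \<Longrightarrow> sym2 M (veronese (y1 z) (y2 z)) = sym2 N (veronese (y1 z) (y2 z))"
  shows "(trace M)\<^sup>2 = (trace N)\<^sup>2"
proof -
  note q = quadratic_independence[OF fp U]
  have 1: "(e11 M)\<^sup>2 - (e11 N)\<^sup>2 = 0 \<and> 2 * (e11 M * e12 M) - 2 * (e11 N * e12 N) = 0 \<and> (e12 M)\<^sup>2 - (e12 N)\<^sup>2 = 0"
    by (rule q) (use eq in \<open>auto simp: sym2_def veronese_def algebra_simps\<close>)
  have 2: "(e21 M)\<^sup>2 - (e21 N)\<^sup>2 = 0 \<and> 2 * (e21 M * e22 M) - 2 * (e21 N * e22 N) = 0 \<and> (e22 M)\<^sup>2 - (e22 N)\<^sup>2 = 0"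
    by (rule q) (use eq in \<open>auto simp: sym2_def veronese_def algebra_simps\<close>)
  have 3: "e11 M * e21 M - e11 N * e21 N = 0 \<and> (e11 M * e22 M + e12 M * e21 M) - (e11 N * e22 N + e12 N * e21 N) = 0
      \<and> e12 M * e22 M - e12 N * e22 N = 0"
    by (rule q) (use eq in \<open>auto simp: sym2_def veronese_def algebra_simps\<close>)
  have d: "e11 M * e22 M - e12 M * e21 M = 1" "e11 N * e22 N - e12 N * e21 N = 1" using det by (auto simp: det_2)
  \<comment> \<open>The middle entry gives the sum of \<open>e11 M * e22 M\<close> and
    \<open>e12 M * e21 M\<close>, the determinant their difference.\<close>
  have 4: "e11 M * e22 M = e11 N * e22 N" using 3 d by algebra
  show "(trace M)\<^sup>2 = (trace N)\<^sup>2"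
    using 1 2 4 by (simp add: trace_def sum_2 power2_eq_square algebra_simps)
qed

text \<open>At a pole the value is pinned to zero, so that equality of systems, their continuation
  and the group action can be stated on all of \<open>\<H>\<close> without exceptional
  points.\<close>

definition sq_at :: "(complex \<Rightarrow> complex) \<Rightarrow> (complex \<Rightarrow> complex \<times> complex \<times> complex) \<Rightarrow> complex \<Rightarrow> bool" where
  "sq_at Q X z \<longleftrightarrow> (if z \<in> poles Q then X z = (0, 0, 0) else
     (\<exists>r>0. \<exists>y1 y2. ball z r \<subseteq> \<H> - poles Q \<and> fundamental_pair Q (ball z r) y1 y2 \<and>
        (\<forall>w\<in>ball z r. X w = veronese (y1 w) (y2 w))))"

lemma sq_atI:
  assumes "z \<notin> poles Q" "r > 0" "ball z r \<subseteq> \<H> - poles Q" "fundamental_pair Q (ball z r) y1 y2"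
    "\<And>w. w \<in> ball z r \<Longrightarrow> X w = veronese (y1 w) (y2 w)"
  shows "sq_at Q X z"
  unfolding sq_at_def if_not_P[OF assms(1)] using assms(2-5) by blast

lemma open_H: "open \<H>" and convex_H: "convex \<H>"
  unfolding upper_half_plane_def by (simp_all add: open_halfspace_Im_gt convex_halfspace_Im_gt)

lemma continuous_zero_at_puncture:
  fixes f :: "complex \<Rightarrow> complex"
  assumes "f holomorphic_on ball p r" "r > 0" "\<And>z. z \<in> ball p r - {p} \<Longrightarrow> f z = 0"
  shows "f p = 0"
proof -
  have "isCont f p" using assms holomorphic_on_imp_continuous_on[OF assms(1)]
    by (auto simp: continuous_on_eq_continuous_at)
  hence "(f \<longlongrightarrow> f p) (at p)" by (simp add: isCont_def)
  moreover have "(f \<longlongrightarrow> 0) (at p)"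
    using assms eventually_at_in_open[of "ball p r" p]
    by (intro tendsto_eventually) (auto elim!: eventually_mono)
  ultimately show ?thesis using tendsto_unique trivial_limit_at by blast
qed

lemma fundamental_pair_local:
  assumes U: "open U" and loc: "\<And>z. z \<in> U \<Longrightarrow> \<exists>V v1 v2. open V \<and> z \<in> V \<and> fundamental_pair Q V v1 v2 \<and>
    (\<forall>w\<in>V. v1 w = y1 w \<and> v2 w = y2 w)"
  shows "fundamental_pair Q U y1 y2"
proof -
  have main: "y1 field_differentiable at z \<and> y2 field_differentiable at z \<and> deriv (deriv y1) z = Q z * y1 z
    \<and> deriv (deriv y2) z = Q z * y2 z \<and> y1 z * deriv y2 z - deriv y1 z * y2 z = 1" if "z \<in> U" for z
  proof -
    obtain V v1 v2 where V: "open V" "z \<in> V" "fundamental_pair Q V v1 v2" "\<And>w. w \<in> V \<Longrightarrow> v1 w = y1 w \<and> v2 w = y2 w"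
      using loc[OF \<open>z \<in> U\<close>] by blast
    have o: "ode_solution Q V v1" "ode_solution Q V v2" using V by (auto simp: fundamental_pair_def)
    have aux: "y field_differentiable at z \<and> deriv (deriv y) z = Q z * y z \<and> deriv y z = deriv v z"
      if v: "ode_solution Q V v" "\<And>w. w \<in> V \<Longrightarrow> v w = y w" for v y
    proof -
      have d: "(y has_field_derivative deriv v w) (at w)" if "w \<in> V" for w
        using ode_solution_derivs(1)[OF v(1) V(1) that] v(2)
        by (rule has_field_derivative_transform_within_open[OF _ V(1) that])
      have "\<forall>\<^sub>F w in nhds z. deriv y w = deriv v w"
        using eventually_nhds_in_open[OF V(1,2)] by eventually_elim (rule DERIV_imp_deriv[OF d])
      hence "deriv (deriv y) z = deriv (deriv v) z" by (rule deriv_cong_ev) simp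
      also have "\<dots> = Q z * v z" using ode_solution_derivs(2)[OF v(1) V(1,2)] by (rule DERIV_imp_deriv)
      finally show ?thesis using d[OF V(2)] v(2)[OF V(2)] by (auto simp: field_differentiable_def DERIV_imp_deriv)
    qed
    show ?thesis using aux[OF o(1), of y1] aux[OF o(2), of y2] V by (auto simp: fundamental_pair_def)
  qed
  show ?thesis using main U unfolding fundamental_pair_def ode_solution_def
    by (auto simp: holomorphic_on_def intro: field_differentiable_at_within)
qed

text \<open>Both equations and the Wronskian identity extend to \<open>p\<close> by
  continuity.\<close>

lemma fundamental_pair_fill_puncture:
  assumes hol: "y1 holomorphic_on ball p r" "y2 holomorphic_on ball p r" "Q holomorphic_on ball p r" "r > 0"
    and fp: "fundamental_pair Q (ball p r - {p}) y1 y2"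
  shows "fundamental_pair Q (ball p r) y1 y2"
proof -
  have d: "deriv y1 holomorphic_on ball p r" "deriv y2 holomorphic_on ball p r"
    using hol by (auto intro: holomorphic_deriv)
  have dd: "deriv (deriv y1) holomorphic_on ball p r" "deriv (deriv y2) holomorphic_on ball p r"
    using d by (auto intro: holomorphic_deriv)
  have "deriv (deriv y1) p - Q p * y1 p = 0"
    by (rule continuous_zero_at_puncture[of "\<lambda>z. deriv (deriv y1) z - Q z * y1 z" p r])
       (use fp hol dd in \<open>auto intro!: holomorphic_intros simp: fundamental_pair_def ode_solution_def\<close>)
  moreover have "deriv (deriv y2) p - Q p * y2 p = 0"
    by (rule continuous_zero_at_puncture[of "\<lambda>z. deriv (deriv y2) z - Q z * y2 z" p r])
       (use fp hol dd in \<open>auto intro!: holomorphic_intros simp: fundamental_pair_def ode_solution_def\<close>)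
  moreover have "y1 p * deriv y2 p - deriv y1 p * y2 p - 1 = 0"
    by (rule continuous_zero_at_puncture[of "\<lambda>z. y1 z * deriv y2 z - deriv y1 z * y2 z - 1" p r])
       (use fp hol d in \<open>auto intro!: holomorphic_intros simp: fundamental_pair_def ode_solution_def\<close>)
  ultimately show ?thesis
    using fp hol unfolding fundamental_pair_def ode_solution_def
    by (metis Diff_iff eq_iff_diff_eq_0 singletonD)
qed

lemma kappa_at_regular_point:
  assumes "Q analytic_on {p}"
  shows "kappa Q p = 1/2"
proof -
  have "isCont Q p" using assms analytic_at_imp_isCont by blast
  hence "((\<lambda>z. (z - p)\<^sup>2 * Q z) \<longlongrightarrow> (p - p)\<^sup>2 * Q p) (at p)"
    unfolding isCont_def by (intro tendsto_intros)
  hence "indicial_coeff Q p = 0" unfolding indicial_coeff_def by (intro tendsto_Lim) auto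
  hence "kappa Q p = Re (csqrt (of_real (1/4)))" by (simp add: kappa_def)
  also have "\<dots> = sqrt (1/4)" by (subst csqrt_of_real_nonneg) auto
  also have "\<dots> = 1/2" by (simp add: real_sqrt_divide)
  finally show ?thesis .
qed

section \<open>Systems of an apparent equation: local form and global existence\<close>

locale apparent_ode =
  fixes Q :: "complex \<Rightarrow> complex"
  assumes nice: "Q nicely_meromorphic_on \<H>"
    and fuchsian: "fuchsian_on_H Q"
    and apparent: "\<And>p. p \<in> poles Q \<Longrightarrow> apparent_at Q p"
    and kappa_half_nat: "\<And>p. p \<in> poles Q \<Longrightarrow> \<exists>n::nat. n \<ge> 1 \<and> kappa Q p = real n / 2"
begin

lemma analytic_off_poles: "z \<in> \<H> - poles Q \<Longrightarrow> Q analytic_on {z}"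
  using nicely_meromorphic_on_imp_analytic_at[OF nice, of z] by (auto simp: poles_def)

lemma sparse_poles: "poles Q sparse_in \<H>"
proof -
  have "Q meromorphic_on \<H>" using nice by (simp add: nicely_meromorphic_on_def)
  hence "{w. \<not> Q analytic_on {w}} sparse_in \<H>" by (rule meromorphic_on_imp_sparse_singularities)
  moreover have "poles Q \<subseteq> {w. \<not> Q analytic_on {w}}"
    unfolding poles_def by (auto simp: analytic_at_imp_no_pole)
  ultimately show ?thesis by (rule sparse_in_subset2)
qed

lemma open_regular: "open (\<H> - poles Q)"
  by (rule open_diff_sparse_pts[OF open_H sparse_poles])

lemma poles_subset: "poles Q \<subseteq> \<H>" by (auto simp: poles_def)

lemma open_diff_poles: "open U \<Longrightarrow> U \<subseteq> \<H> \<Longrightarrow> open (U - poles Q)"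
  using open_diff_sparse_pts sparse_in_subset[OF sparse_poles] by blast

lemma connected_diff_poles: "open U \<Longrightarrow> connected U \<Longrightarrow> U \<subseteq> \<H> \<Longrightarrow> connected (U - poles Q)"
  using sparse_imp_connected[of U "poles Q"] sparse_in_subset[OF sparse_poles] by auto

lemma countable_poles: "countable (poles Q)"
  using sparse_imp_countable[OF open_H sparse_poles] poles_subset by (simp add: Int_absorb1)

text \<open>The poles are countable, a ball is not.\<close>

lemma diff_poles_nonempty:
  assumes "open U" "U \<noteq> {}" shows "U - poles Q \<noteq> {}"
proof
  assume "U - poles Q = {}"
  hence "U \<subseteq> poles Q" by blast
  hence "countable U" using countable_poles countable_subset by blast
  moreover obtain x e where "e > 0" "ball x e \<subseteq> U" using assms by (metis openE ex_in_conv)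
  ultimately show False using uncountable_ball[of e x] countable_subset by blast
qed

lemma holomorphic_regular: "Q holomorphic_on \<H> - poles Q"
  using analytic_off_poles by (meson analytic_imp_holomorphic analytic_on_analytic_at)

lemma pole_normal_form:
  assumes p: "p \<in> poles Q"
  obtains r P where "r > 0" "P analytic_on {0}" "P 0 = indicial_coeff Q p"
    "\<And>z. z \<in> ball p r - {p} \<Longrightarrow> Q z = P (z - p) / (z - p)\<^sup>2"
proof -
  define m where "m = nat (- zorder Q p)"
  define S where "S = insert p (\<H> - poles Q)"
  have "open S"
  proof -
    have "S = \<H> - (poles Q - {p})" using p by (auto simp: S_def poles_def)
    thus ?thesis using open_diff_sparse_pts[OF open_H] sparse_in_subset2[OF sparse_poles] by auto
  qed
  moreover have "S - {p} = \<H> - poles Q" using p by (auto simp: S_def)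
  ultimately obtain r where zo: "zorder Q p < 0" and r: "r > 0" "zor_poly Q p holomorphic_on cball p r"
    "\<And>w. w \<in> cball p r - {p} \<Longrightarrow> Q w = zor_poly Q p w / (w - p) ^ m"
    using zorder_exist_pole[of Q S p] holomorphic_regular p by (auto simp: S_def poles_def m_def)
  have m: "m \<le> 2" "m \<ge> 1" using zo fuchsian p by (force simp: fuchsian_on_H_def m_def)+
  \<comment> \<open>The pole may be simple; the factor \<open>w ^ (2 - m)\<close> brings it to the
    common denominator \<open>(z - p)^2\<close>.\<close>
  define P where "P = (\<lambda>w. zor_poly Q p (p + w) * w ^ (2 - m))"
  have "(\<lambda>w. zor_poly Q p (p + w)) holomorphic_on ball 0 r"
    by (rule holomorphic_on_compose_gen[of "\<lambda>w. p + w" _ "zor_poly Q p" "cball p r", unfolded o_def])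
       (auto intro!: holomorphic_intros r simp: dist_norm)
  hence "P holomorphic_on ball 0 r" unfolding P_def by (intro holomorphic_intros)
  hence an: "P analytic_on {0}" using r(1) unfolding analytic_at by (meson centre_in_ball open_ball)
  have Q: "Q z = P (z - p) / (z - p)\<^sup>2" if z: "z \<in> ball p r - {p}" for z
  proof -
    have "(z - p) ^ (2 - m) * (z - p) ^ m = (z - p)\<^sup>2" using m by (simp add: power_add[symmetric])
    moreover have "Q z * (z - p) ^ m = zor_poly Q p z" using r(3)[of z] z by auto
    ultimately have "Q z * (z - p)\<^sup>2 = zor_poly Q p z * (z - p) ^ (2 - m)" by (metis mult.assoc mult.commute)
    thus ?thesis using z by (simp add: P_def divide_simps)
  qed
  have "isCont P 0" using an analytic_at_imp_isCont by blast
  hence "isCont (\<lambda>z. P (z - p)) p"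
    using isCont_o2[where f = "\<lambda>z. z - p" and a = p and g = P] by simp
  hence "((\<lambda>z. P (z - p)) \<longlongrightarrow> P 0) (at p)" by (simp add: isCont_def)
  hence "((\<lambda>z. (z - p)\<^sup>2 * Q z) \<longlongrightarrow> P 0) (at p)"
  proof (rule Lim_transform_eventually)
    show "\<forall>\<^sub>F z in at p. P (z - p) = (z - p)\<^sup>2 * Q z"
      using Q eventually_at_in_open[of "ball p r" p] r(1) by (auto elim!: eventually_mono)
  qed
  hence "P 0 = indicial_coeff Q p" unfolding indicial_coeff_def by (intro tendsto_Lim[symmetric]) auto
  thus ?thesis using that r(1) an Q by blast
qed

lemma isolated_pole:
  assumes "p \<in> \<H>"
  obtains r where "r > 0" "ball p r \<subseteq> \<H>" "ball p r \<inter> poles Q \<subseteq> {p}"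
proof -
  obtain B where B: "open B" "p \<in> B" "\<forall>y\<in>B. y \<noteq> p \<longrightarrow> y \<notin> poles Q"
    using sparse_in_not_in[OF sparse_poles assms] by metis
  have "open (B \<inter> \<H>)" "p \<in> B \<inter> \<H>" using B assms open_H by auto
  then obtain r where "r > 0" "ball p r \<subseteq> B \<inter> \<H>" by (meson openE)
  thus ?thesis using that[of r] B by blast
qed

text \<open>At a pole \<open>n = 2 \<kappa>_p\<close>, and apparentness removes the logarithm. A
  regular point is treated as a singular point with exponents 0 and 1, that is \<open>n = 1\<close>:
  there \<open>P = w^2 Q\<close> has derivative 0 at 0, so \<open>g'\<close> vanishes at 0 and with
  it \<open>c = - 2 g'\<close>.\<close>

lemma frobenius_data_at:
  assumes p: "p \<in> \<H>"
  obtains r n g k where "frobenius_data Q p r n g k 0" "ball p r \<subseteq> \<H>" "ball p r \<inter> poles Q \<subseteq> {p}"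
    "kappa Q p = real n / 2" "p \<notin> poles Q \<Longrightarrow> n = 1"
proof -
  obtain r1 where r1: "r1 > 0" "ball p r1 \<subseteq> \<H>" "ball p r1 \<inter> poles Q \<subseteq> {p}"
    using isolated_pole[OF p] by blast
  have mono: "frobenius_data Q p r n g k c \<Longrightarrow> r \<le> r1 \<Longrightarrow> ball p r \<subseteq> \<H> \<and> ball p r \<inter> poles Q \<subseteq> {p}" for r n g k c
    using r1 subset_ball[of r r1 p] by blast
  have hol: "Q holomorphic_on ball p r - {p}" if "r \<le> r1" for r
    using r1 that by (intro holomorphic_on_subset[OF holomorphic_regular]) (auto dest: subset_ball[of r r1 p, THEN subsetD])
  show ?thesis
  proof (cases "p \<in> poles Q")
    case True
    obtain r2 P where P: "r2 > 0" "P analytic_on {0}" "P 0 = indicial_coeff Q p"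
      "\<And>z. z \<in> ball p r2 - {p} \<Longrightarrow> Q z = P (z - p) / (z - p)\<^sup>2"
      using pole_normal_form[OF True] by blast
    obtain n :: nat where n: "n \<ge> 1" "kappa Q p = real n / 2" using kappa_half_nat[OF True] by blast
    have "1/2 + complex_of_real (kappa Q p) \<in> local_exponents Q p"
      using apparent[OF True] by (auto simp: apparent_at_def)
    hence "(1/2 + complex_of_real (kappa Q p)) * (1/2 + complex_of_real (kappa Q p) - 1) = indicial_coeff Q p"
      by (simp add: local_exponents_def)
    hence P0: "P 0 = ((of_nat n)\<^sup>2 - 1) / 4"
      unfolding P(3) n(2) by (simp add: field_simps power2_eq_square)
    have mp: "min r1 r2 > 0" using P(1) r1(1) by simp
    have Qp: "Q z = P (z - p) / (z - p)\<^sup>2" if "z \<in> ball p (min r1 r2) - {p}" for z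
      using P(4)[of z] that by auto
    obtain r g k c where fd: "r \<le> min r1 r2" "frobenius_data Q p r n g k c"
      by (rule frobenius_data_exists[OF n(1) P(2) mp Qp P0]) (assumption, rule that)
    have "c = 0"
      using no_log_of_apparent[OF fd(2) apparent[OF True]] mono[OF fd(2)] hol[of r] fd(1) by auto
    thus ?thesis using that[of r n g k] fd mono[OF fd(2)] n True by auto
  next
    case False
    hence an: "Q analytic_on {p}" using analytic_off_poles p by blast
    define P where "P = (\<lambda>w. w\<^sup>2 * Q (p + w))"
    obtain R where R: "R > 0" "Q holomorphic_on ball p R" using an by (auto simp: analytic_on_def)
    have "(\<lambda>w. Q (p + w)) holomorphic_on ball 0 R"
      by (rule holomorphic_on_compose_gen[of "\<lambda>w. p + w" _ Q "ball p R", unfolded o_def])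
         (auto intro!: holomorphic_intros R simp: dist_norm)
    hence Ph: "P holomorphic_on ball 0 R" unfolding P_def by (intro holomorphic_intros)
    hence Pan: "P analytic_on {0}" using R(1) unfolding analytic_at by (meson centre_in_ball open_ball)
    have "((\<lambda>w. Q (p + w)) has_field_derivative deriv (\<lambda>w. Q (p + w)) 0) (at 0)"
      using \<open>(\<lambda>w. Q (p + w)) holomorphic_on ball 0 R\<close> R(1) by (intro holomorphic_derivI) auto
    hence "(P has_field_derivative 0) (at 0)"
      unfolding P_def by (auto intro!: derivative_eq_intros)
    hence P': "deriv P 0 = 0" by (rule DERIV_imp_deriv)
    have Q: "Q z = P (z - p) / (z - p)\<^sup>2" if "z \<in> ball p r1 - {p}" for z using that by (simp add: P_def)
    have "(1::nat) \<ge> 1" "P 0 = ((of_nat 1)\<^sup>2 - 1) / 4" by (simp_all add: P_def)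
    then obtain r g k c where fd: "r \<le> r1" "frobenius_data Q p r 1 g k c" "(deriv g 0) * (of_nat 1 + 1) = deriv P 0"
       "c = - 2 * deriv g 0"
      using frobenius_data_exists[of 1 P r1 p Q, OF _ Pan r1(1) Q] by (metis (no_types, lifting))
    hence "c = 0" using P' by simp
    thus ?thesis using that[of r 1 g k] fd mono[OF fd(2)] kappa_at_regular_point[OF an] by auto
  qed
qed

text \<open>The products of the Frobenius pair with all powers of \<open>z - p\<close> multiplied
  out. Their orders \<open>n + 1\<close>, \<open>1\<close> and \<open>1 - n\<close> are integers, so
  no branch of the logarithm is left and the triple is defined on a full punctured disc.\<close>

definition local_system :: "complex \<Rightarrow> nat \<Rightarrow> (complex \<Rightarrow> complex) \<Rightarrow> (complex \<Rightarrow> complex) \<Rightarrow> complex \<Rightarrow> complex \<times> complex \<times> complex" where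
  "local_system p n g k z = (if z \<in> poles Q then (0, 0, 0) else
     ((z - p) ^ Suc n * (g (z - p))\<^sup>2, (z - p) * (g (z - p))\<^sup>2 * k (z - p),
      (g (z - p))\<^sup>2 * (k (z - p))\<^sup>2 / (z - p) ^ (n - 1)))"

lemma sq_at_local_system:
  assumes fd: "frobenius_data Q p r n g k 0" and B: "ball p r \<subseteq> \<H>" "ball p r \<inter> poles Q \<subseteq> {p}"
    and n1: "p \<notin> poles Q \<Longrightarrow> n = 1" and z: "z \<in> ball p r"
  shows "sq_at Q (local_system p n g k) z"
proof -
  note fd' = fd[unfolded frobenius_data_def]
  have loc: "fundamental_pair Q U (\<lambda>z. exp (of_nat (n + 1) / 2 * L z) * g (z - p))
          (\<lambda>z. exp (of_nat (n + 1) / 2 * L z) * g (z - p) * (k (z - p) / (z - p) ^ n))"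
    if "open U" "U \<subseteq> ball p r - {p}" "L holomorphic_on U" "\<And>z. z \<in> U \<Longrightarrow> exp (L z) = z - p" for U L
  proof -
    have "fundamental_pair Q U (\<lambda>z. exp (of_nat (n + 1) / 2 * L z) * g (z - p))
          (\<lambda>z. exp (of_nat (n + 1) / 2 * L z) * g (z - p) * (k (z - p) / (z - p) ^ n + 0 * L z))"
      using fd' that by blast
    thus ?thesis by simp
  qed
  have small: "\<exists>\<rho> L. \<rho> > 0 \<and> ball z \<rho> \<subseteq> ball p r - {p} \<and> L holomorphic_on ball z \<rho> \<and> (\<forall>w\<in>ball z \<rho>. exp (L w) = w - p)"
    if z: "z \<in> ball p r - {p}" for z
  proof -
    have "open (ball p r - {p})" by (simp add: open_delete)
    then obtain \<rho> where \<rho>: "\<rho> > 0" "ball z \<rho> \<subseteq> ball p r - {p}" using z by (meson openE)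
    hence "p \<notin> ball z \<rho>" by blast
    then obtain L where "L holomorphic_on ball z \<rho>" "\<And>w. w \<in> ball z \<rho> \<Longrightarrow> exp (L w) = w - p"
      using local_log by blast
    thus ?thesis using \<rho> by blast
  qed
  show ?thesis
  proof (cases "z = p")
    case False
    then obtain \<rho> L where \<rho>: "\<rho> > 0" "ball z \<rho> \<subseteq> ball p r - {p}" "L holomorphic_on ball z \<rho>"
        "\<And>w. w \<in> ball z \<rho> \<Longrightarrow> exp (L w) = w - p"
      using small[of z] z by blast
    have reg: "ball z \<rho> \<subseteq> \<H> - poles Q" using \<rho>(2) B by blast
    have "local_system p n g k w = veronese (exp (of_nat (n + 1) / 2 * L w) * g (w - p))
        (exp (of_nat (n + 1) / 2 * L w) * g (w - p) * (k (w - p) / (w - p) ^ n))" if w: "w \<in> ball z \<rho>" for w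
    proof -
      have nz: "w - p \<noteq> 0" using w \<rho>(2) by auto
      obtain m where m: "n = Suc m" using fd' by (cases n) auto
      define e where "e = exp (of_nat (n + 1) / 2 * L w)"
      have e: "e * e = (w - p) ^ Suc n"
        using exp_half_log_square[OF \<rho>(4)[OF w], of n] by (simp add: e_def power2_eq_square)
      have 1: "(e * g (w - p))\<^sup>2 = (w - p) ^ Suc n * (g (w - p))\<^sup>2"
        by (simp only: power_mult_distrib power2_eq_square[of e] e)
      have 2: "e * g (w - p) * (e * g (w - p) * (k (w - p) / (w - p) ^ n)) = (w - p) * (g (w - p))\<^sup>2 * k (w - p)"
      proof -
        have "e * g (w - p) * (e * g (w - p) * (k (w - p) / (w - p) ^ n)) = (e * e) * (g (w - p))\<^sup>2 * k (w - p) / (w - p) ^ n"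
          by (simp add: power2_eq_square)
        thus ?thesis unfolding e using nz by simp
      qed
      have 3: "(e * g (w - p) * (k (w - p) / (w - p) ^ n))\<^sup>2 = (g (w - p))\<^sup>2 * (k (w - p))\<^sup>2 / (w - p) ^ (n - 1)"
      proof -
        have "(e * g (w - p) * (k (w - p) / (w - p) ^ n))\<^sup>2 = (e * e) * (g (w - p))\<^sup>2 * (k (w - p))\<^sup>2 / ((w - p) ^ n * (w - p) ^ n)"
          by (simp add: power2_eq_square)
        also have "\<dots> = (g (w - p))\<^sup>2 * (k (w - p))\<^sup>2 / (w - p) ^ (n - 1)"
          unfolding e using nz by (simp add: m divide_simps)
        finally show ?thesis .
      qed
      show ?thesis using w reg unfolding local_system_def veronese_def e_def[symmetric] 1 2 3 by auto
    qed
    moreover have "z \<notin> poles Q" using B z False by blast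
    ultimately show ?thesis
      using sq_atI[OF _ \<rho>(1) reg loc[OF open_ball \<rho>(2,3,4)]] by blast
  next
    case True
    show ?thesis
    proof (cases "p \<in> poles Q")
      case True
      thus ?thesis using \<open>z = p\<close> by (simp add: sq_at_def local_system_def)
    next
      case False
      hence n: "n = 1" by (rule n1)
      have reg: "ball p r \<subseteq> \<H> - poles Q" using B False by blast
      have sh: "(\<lambda>z. f (z - p)) holomorphic_on ball p r" if "f holomorphic_on ball 0 r" for f
        using that by (intro holomorphic_on_compose_gen[of "\<lambda>z. z - p" "ball p r" f "ball 0 r", unfolded o_def])
          (auto intro!: holomorphic_intros simp: dist_norm norm_minus_commute)
      \<comment> \<open>For \<open>n = 1\<close> the fractional power is \<open>z - p\<close> itself
        and the denominator of the second solution cancels, so both solutions extend over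
        \<open>p\<close>.\<close>
      have "fundamental_pair Q (ball p r) (\<lambda>z. (z - p) * g (z - p)) (\<lambda>z. g (z - p) * k (z - p))"
      proof (rule fundamental_pair_fill_puncture)
        show "(\<lambda>z. (z - p) * g (z - p)) holomorphic_on ball p r" "(\<lambda>z. g (z - p) * k (z - p)) holomorphic_on ball p r"
          using fd' by (auto intro!: holomorphic_intros sh)
        show "Q holomorphic_on ball p r" using reg holomorphic_on_subset[OF holomorphic_regular] by blast
        show "r > 0" using fd' by blast
        show "fundamental_pair Q (ball p r - {p}) (\<lambda>z. (z - p) * g (z - p)) (\<lambda>z. g (z - p) * k (z - p))"
        proof (rule fundamental_pair_local)
          show "open (ball p r - {p})" by (simp add: open_delete)
          fix z assume "z \<in> ball p r - {p}"
          then obtain \<rho> L where \<rho>: "\<rho> > 0" "ball z \<rho> \<subseteq> ball p r - {p}" "L holomorphic_on ball z \<rho>"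
            "\<And>w. w \<in> ball z \<rho> \<Longrightarrow> exp (L w) = w - p" using small by blast
          have "exp (of_nat (n + 1) / 2 * L w) * g (w - p) = (w - p) * g (w - p) \<and>
             exp (of_nat (n + 1) / 2 * L w) * g (w - p) * (k (w - p) / (w - p) ^ n) = g (w - p) * k (w - p)"
            if "w \<in> ball z \<rho>" for w
            using \<rho>(4)[OF that] that \<rho>(2) by (auto simp: n)
          thus "\<exists>V v1 v2. open V \<and> z \<in> V \<and> fundamental_pair Q V v1 v2 \<and>
             (\<forall>w\<in>V. v1 w = (w - p) * g (w - p) \<and> v2 w = g (w - p) * k (w - p))"
            using loc[OF open_ball \<rho>(2,3,4)] \<rho>(1) by (meson centre_in_ball open_ball)
        qed
      qed
      moreover have "local_system p n g k w = veronese ((w - p) * g (w - p)) (g (w - p) * k (w - p))" if "w \<in> ball p r" for w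
        using that reg by (auto simp: local_system_def veronese_def n power2_eq_square)
      moreover have "r > 0" using fd' by blast
      ultimately show ?thesis unfolding \<open>z = p\<close> using sq_atI[OF False _ reg] by blast
    qed
  qed
qed

lemma sq_at_germ:
  assumes "sq_at Q X z" "open V" "z \<in> V" "\<And>w. w \<in> V \<Longrightarrow> X w = Y w"
  shows "sq_at Q Y z"
proof (cases "z \<in> poles Q")
  case False
  then obtain r y1 y2 where r: "r > 0" "ball z r \<subseteq> \<H> - poles Q" "fundamental_pair Q (ball z r) y1 y2"
      "\<And>w. w \<in> ball z r \<Longrightarrow> X w = veronese (y1 w) (y2 w)"
    using assms(1) by (auto simp: sq_at_def)
  have "open (V \<inter> ball z r)" "z \<in> V \<inter> ball z r" using assms r by auto
  then obtain e where e: "e > 0" "ball z e \<subseteq> V \<inter> ball z r" by (meson openE)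
  have "\<forall>w\<in>ball z e. Y w = veronese (y1 w) (y2 w)" using e(2) assms(4) r(4) by (metis IntD1 IntD2 subsetD)
  moreover have "fundamental_pair Q (ball z e) y1 y2" using fundamental_pair_subset[OF r(3)] e(2) by blast
  moreover have "ball z e \<subseteq> \<H> - poles Q" using e(2) r(2) by blast
  ultimately show ?thesis using sq_atI[OF False e(1)] by blast
qed (use assms in \<open>auto simp: sq_at_def\<close>)

lemma sq_at_sym2:
  assumes "sq_at Q X z" "det M = 1"
  shows "sq_at Q (\<lambda>z. sym2 M (X z)) z"
proof (cases "z \<in> poles Q")
  case False
  then obtain r y1 y2 where r: "r > 0" "ball z r \<subseteq> \<H> - poles Q" "fundamental_pair Q (ball z r) y1 y2"
      "\<And>w. w \<in> ball z r \<Longrightarrow> X w = veronese (y1 w) (y2 w)"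
    using assms(1) by (auto simp: sq_at_def)
  show ?thesis
    by (rule sq_atI[OF False r(1,2) fundamental_pair_linear[OF r(3) open_ball assms(2)]])
       (simp add: r(4) sym2_veronese)
qed (use assms in \<open>auto simp: sq_at_def\<close>)

lemma sq_holomorphic:
  assumes "open U" "U \<subseteq> \<H>" "\<And>z. z \<in> U \<Longrightarrow> sq_at Q X z"
  shows "(\<lambda>z. fst (X z)) holomorphic_on U - poles Q" "(\<lambda>z. fst (snd (X z))) holomorphic_on U - poles Q"
    "(\<lambda>z. snd (snd (X z))) holomorphic_on U - poles Q"
proof -
  have "(\<lambda>z. fst (X z)) field_differentiable at z \<and> (\<lambda>z. fst (snd (X z))) field_differentiable at z
     \<and> (\<lambda>z. snd (snd (X z))) field_differentiable at z" if z: "z \<in> U - poles Q" for z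
  proof -
    obtain r y1 y2 where r: "r > 0" "fundamental_pair Q (ball z r) y1 y2"
      "\<And>w. w \<in> ball z r \<Longrightarrow> X w = veronese (y1 w) (y2 w)"
      using assms(3)[of z] z by (auto simp: sq_at_def)
    have h: "y1 holomorphic_on ball z r" "y2 holomorphic_on ball z r"
      using r(2) by (auto simp: fundamental_pair_def ode_solution_def)
    have "(\<lambda>z. fst (X z)) holomorphic_on ball z r" "(\<lambda>z. fst (snd (X z))) holomorphic_on ball z r"
      "(\<lambda>z. snd (snd (X z))) holomorphic_on ball z r"
      by (rule holomorphic_transform[of "\<lambda>z. (y1 z)\<^sup>2"] holomorphic_transform[of "\<lambda>z. y1 z * y2 z"]
           holomorphic_transform[of "\<lambda>z. (y2 z)\<^sup>2"], auto intro!: holomorphic_intros h simp: r(3) veronese_def)+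
    thus ?thesis using r(1) by (auto simp: holomorphic_on_open field_differentiable_def)
  qed
  thus "(\<lambda>z. fst (X z)) holomorphic_on U - poles Q" "(\<lambda>z. fst (snd (X z))) holomorphic_on U - poles Q"
    "(\<lambda>z. snd (snd (X z))) holomorphic_on U - poles Q"
    by (auto simp: holomorphic_on_def intro: field_differentiable_at_within)
qed

text \<open>The identity theorem applies because removing the sparse set of poles leaves a connected
  set; at the poles both sides are the pinned value.\<close>

lemma sq_unique:
  assumes U: "open U" "connected U" "U \<subseteq> \<H>" and X: "\<And>z. z \<in> U \<Longrightarrow> sq_at Q X z" and Y: "\<And>z. z \<in> U \<Longrightarrow> sq_at Q Y z"
    and V: "open V" "V \<noteq> {}" "V \<subseteq> U" "\<And>z. z \<in> V \<Longrightarrow> X z = Y z" and z: "z \<in> U"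
  shows "X z = Y z"
proof (cases "z \<in> poles Q")
  case True
  thus ?thesis using X[OF z] Y[OF z] by (simp add: sq_at_def)
next
  case False
  note eq = analytic_continuation_open[of "V - poles Q" "U - poles Q"]
  have *: "open (V - poles Q)" "open (U - poles Q)" "V - poles Q \<noteq> {}" "connected (U - poles Q)" "V - poles Q \<subseteq> U - poles Q"
    using open_diff_poles connected_diff_poles diff_poles_nonempty U V by auto
  have "fst (X z) = fst (Y z)"
    by (rule eq[OF * sq_holomorphic(1)[OF U(1,3) X] sq_holomorphic(1)[OF U(1,3) Y]]) (use V z False in auto)
  moreover have "fst (snd (X z)) = fst (snd (Y z))"
    by (rule eq[OF * sq_holomorphic(2)[OF U(1,3) X] sq_holomorphic(2)[OF U(1,3) Y]]) (use V z False in auto)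
  moreover have "snd (snd (X z)) = snd (snd (Y z))"
    by (rule eq[OF * sq_holomorphic(3)[OF U(1,3) X] sq_holomorphic(3)[OF U(1,3) Y]]) (use V z False in auto)
  ultimately show ?thesis by (simp add: prod_eq_iff)
qed

text \<open>Near one regular point both systems come from bases, which differ by a unimodular
  matrix; the identity theorem carries the relation to all of \<open>U\<close>. All monodromy
  matrices arise in this way.\<close>

lemma sq_change:
  assumes U: "open U" "connected U" "U \<subseteq> \<H>" "U \<noteq> {}"
    and X: "\<And>z. z \<in> U \<Longrightarrow> sq_at Q X z" and Y: "\<And>z. z \<in> U \<Longrightarrow> sq_at Q Y z"
  obtains M where "det M = 1" "\<And>z. z \<in> U \<Longrightarrow> Y z = sym2 M (X z)"
proof -
  obtain z where z: "z \<in> U - poles Q" using diff_poles_nonempty[OF U(1,4)] by blast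
  obtain r y1 y2 where r: "r > 0" "fundamental_pair Q (ball z r) y1 y2" "\<And>w. w \<in> ball z r \<Longrightarrow> X w = veronese (y1 w) (y2 w)"
    using X[of z] z by (auto simp: sq_at_def)
  obtain r' v1 v2 where r': "r' > 0" "fundamental_pair Q (ball z r') v1 v2" "\<And>w. w \<in> ball z r' \<Longrightarrow> Y w = veronese (v1 w) (v2 w)"
    using Y[of z] z by (auto simp: sq_at_def)
  obtain e where e: "e > 0" "ball z e \<subseteq> ball z r \<inter> ball z r' \<inter> U"
    using openE[of "ball z r \<inter> ball z r' \<inter> U" z] r(1) r'(1) z U(1) by (metis Diff_iff IntI centre_in_ball open_Int open_ball)
  have fp: "fundamental_pair Q (ball z e) y1 y2" "fundamental_pair Q (ball z e) v1 v2"
    using r(2) r'(2) e(2) by (auto intro: fundamental_pair_subset)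
  obtain M where M: "det M = 1" "\<And>w. w \<in> ball z e \<Longrightarrow> v1 w = e11 M * y1 w + e12 M * y2 w"
      "\<And>w. w \<in> ball z e \<Longrightarrow> v2 w = e21 M * y1 w + e22 M * y2 w"
    using fundamental_pair_change[OF fp open_ball convex_ball] e(1) by (metis ball_eq_empty not_less)
  have eq: "Y w = sym2 M (X w)" if w: "w \<in> ball z e" for w
  proof -
    have "w \<in> ball z r" "w \<in> ball z r'" using w e(2) by auto
    thus ?thesis using r(3) r'(3) M(2,3)[OF w] by (simp add: sym2_veronese)
  qed
  have "Y w = sym2 M (X w)" if "w \<in> U" for w
    by (rule sq_unique[OF U(1,2,3) Y sq_at_sym2[OF X M(1)] open_ball _ _ eq that]) (use e in auto)
  thus ?thesis using that M(1) by blast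
qed

text \<open>Local systems exist at poles too, so the continuation runs over the convex set
  \<open>\<H>\<close> and meets no topological obstruction. A continuation on a convex set
  \<open>U\<close> is extended to a small disc by the local system there, corrected by the constant
  matrix that matches it on the connected intersection.\<close>

theorem global_system:
  assumes fd: "frobenius_data Q p r n g k 0" and B: "ball p r \<subseteq> \<H>" "ball p r \<inter> poles Q \<subseteq> {p}"
    and n1: "p \<notin> poles Q \<Longrightarrow> n = 1"
  obtains X where "\<And>z. z \<in> \<H> \<Longrightarrow> sq_at Q X z" "\<And>z. z \<in> ball p r \<Longrightarrow> X z = local_system p n g k z"
proof (rule continuation_on_convex_domain[of \<H> "sq_at Q" "ball p r" p "local_system p n g k"])
  show "sq_at Q h z" if "sq_at Q f z" "open V" "z \<in> V" "\<And>w. w \<in> V \<Longrightarrow> f w = h w" for f h z V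
    using sq_at_germ that by blast
  show "f z = h z" if "open U" "connected U" "U \<subseteq> \<H>" "\<And>z. z \<in> U \<Longrightarrow> sq_at Q f z" "\<And>z. z \<in> U \<Longrightarrow> sq_at Q h z"
     "open V" "V \<noteq> {}" "V \<subseteq> U" "\<And>z. z \<in> V \<Longrightarrow> f z = h z" "z \<in> U" for U V f h z
    using sq_unique that by blast
  show "sq_at Q (local_system p n g k) z" if "z \<in> ball p r" for z
    using sq_at_local_system[OF fd B n1 that] by blast
  fix a assume "a \<in> \<H>"
  then obtain r' n' g' k' where fd': "frobenius_data Q a r' n' g' k' 0" "ball a r' \<subseteq> \<H>" "ball a r' \<inter> poles Q \<subseteq> {a}"
    "a \<notin> poles Q \<Longrightarrow> n' = 1" using frobenius_data_at by metis
  define Y where "Y = local_system a n' g' k'"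
  have Y: "sq_at Q Y z" if "z \<in> ball a r'" for z unfolding Y_def by (rule sq_at_local_system[OF fd' that])
  have "\<exists>h. (\<forall>z\<in>ball a r'. sq_at Q h z) \<and> (\<forall>z\<in>U \<inter> ball a r'. h z = f z)"
    if U: "open U" "convex U" "U \<subseteq> \<H>" "U \<inter> ball a r' \<noteq> {}" "\<forall>z\<in>U. sq_at Q f z" for U f
  proof -
    have c: "connected (U \<inter> ball a r')" using U(2) by (intro convex_connected convex_Int) auto
    obtain M where M: "det M = 1" "\<And>z. z \<in> U \<inter> ball a r' \<Longrightarrow> f z = sym2 M (Y z)"
      using sq_change[of "U \<inter> ball a r'" Y f] U Y c by (metis IntE Int_subset_iff inf.coboundedI1 open_Int open_ball)
    thus ?thesis using sq_at_sym2[OF Y M(1)] by (intro exI[of _ "\<lambda>z. sym2 M (Y z)"]) auto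
  qed
  thus "\<exists>r>0. ball a r \<subseteq> \<H> \<and> (\<forall>U f. open U \<longrightarrow> convex U \<longrightarrow> U \<subseteq> \<H> \<longrightarrow> U \<inter> ball a r \<noteq> {} \<longrightarrow>
     (\<forall>z\<in>U. sq_at Q f z) \<longrightarrow> (\<exists>h. (\<forall>z\<in>ball a r. sq_at Q h z) \<and> (\<forall>z\<in>U \<inter> ball a r. h z = f z)))"
    using fd' unfolding frobenius_data_def by blast
qed (use open_H convex_H B fd that in \<open>auto simp: frobenius_data_def\<close>)

end

section \<open>The modular group\<close>

lemma SL2Z_mat2: "mat2 a b c d \<in> SL2Z \<longleftrightarrow> a * d - b * c = 1"
  by (simp add: SL2Z_def)

lemma matT_mat2: "matT = mat2 1 1 0 1" and matS_mat2: "matS = mat2 0 (-1) 1 0"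
  by (simp_all add: matT_def matS_def mat2_def)

lemma matT_SL2Z [simp]: "matT \<in> SL2Z" and matS_SL2Z [simp]: "matS \<in> SL2Z"
  by (simp_all add: matT_mat2 matS_mat2 SL2Z_mat2)

lemma SL2Z_mult: "A \<in> SL2Z \<Longrightarrow> B \<in> SL2Z \<Longrightarrow> A ** B \<in> SL2Z"
  by (simp add: SL2Z_def det_mul)

text \<open>Only products are available to the induction, so inverses are written as words:
  \<open>S^2 = -1\<close> makes \<open>- S\<close> the inverse of \<open>S\<close>, and
  \<open>(S T)^3 = -1\<close> makes \<open>- (S T)^2 S\<close> the inverse of
  \<open>T\<close>.\<close>

lemma SL2Z_induct [consumes 1, case_names S T mult]:
  assumes A: "A \<in> SL2Z" and PS: "P matS" and PT: "P matT"
    and mult: "\<And>A B. A \<in> SL2Z \<Longrightarrow> B \<in> SL2Z \<Longrightarrow> P A \<Longrightarrow> P B \<Longrightarrow> P (A ** B)"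
  shows "P A"
proof -
  define G where "G = (\<lambda>A. A \<in> SL2Z \<and> P A)"
  have GS: "G (mat2 0 (-1) 1 0)" using PS matS_SL2Z by (simp add: G_def matS_mat2[symmetric])
  have GT: "G (mat2 1 1 0 1)" using PT matT_SL2Z by (simp add: G_def matT_mat2[symmetric])
  have Gm: "G (mat2 a b c d) \<Longrightarrow> G (mat2 a' b' c' d') \<Longrightarrow>
      G (mat2 (a * a' + b * c') (a * b' + b * d') (c * a' + d * c') (c * b' + d * d'))" for a b c d a' b' c' d'
    unfolding G_def mat2_mult[symmetric] using mult SL2Z_mult by blast
  have Gneg: "G (mat2 (-1) 0 0 (-1))" using Gm[OF GS GS] by simp
  have GS': "G (mat2 0 1 (-1) 0)" using Gm[OF Gneg GS] by simp
  have GST: "G (mat2 0 (-1) 1 1)" using Gm[OF GS GT] by simp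
  have GT': "G (mat2 1 (-1) 0 1)"
    using Gm[OF Gneg Gm[OF Gm[OF GST GST] GS]] by simp
  have Tpow: "G (mat2 1 q 0 1)" for q
  proof (induction q rule: int_induct[where k = 0])
    case base
    show ?case using Gm[OF Gneg Gneg] by simp
  next
    case (step1 i)
    show ?case using Gm[OF GT step1(2)] by (simp add: add.commute)
  next
    case (step2 i)
    show ?case using Gm[OF GT' step2(2)] by (simp add: add.commute)
  qed
  \<comment> \<open>Euclid's algorithm on the first column: the matrix is \<open>T^q S^{-1}\<close>
    times one whose lower left entry is \<open>a mod c\<close>.\<close>
  have "G (mat2 a b c d)" if "a * d - b * c = 1" for a b c d
    using that
  proof (induction "nat \<bar>c\<bar>" arbitrary: a b c d rule: less_induct)
    case less
    show ?case
    proof (cases "c = 0")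
      case True
      hence "a * d = 1" using less.prems by simp
      hence "(a = 1 \<and> d = 1) \<or> (a = -1 \<and> d = -1)" using zmult_eq_1_iff by blast
      thus ?thesis using Tpow[of b] Gm[OF Gneg Tpow[of "- b"]] True by auto
    next
      case False
      define q where "q = a div c"
      have r: "a - q * c = a mod c" by (simp add: q_def minus_div_mult_eq_mod)
      have "G (mat2 (- c) (- d) (a - q * c) (b - q * d))"
      proof (rule less.hyps)
        show "nat \<bar>a - q * c\<bar> < nat \<bar>c\<bar>" unfolding r using False by (simp add: abs_mod_less)
        show "- c * (b - q * d) - - d * (a - q * c) = 1" using less.prems by (simp add: algebra_simps)
      qed
      from Gm[OF Tpow[of q] Gm[OF GS' this]] show ?thesis by (simp add: algebra_simps)
    qed
  qed
  moreover obtain a b c d where "A = mat2 a b c d" using mat2_eta by metis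
  ultimately show ?thesis using A by (auto simp: SL2Z_mat2 G_def)
qed

abbreviation (input) "c_of A \<equiv> complex_of_int (e21 A)"
abbreviation (input) "d_of A \<equiv> complex_of_int (e22 A)"

lemma autfac_eq: "autfac A z = c_of A * z + d_of A"
  by (simp add: autfac_def)

lemma act_eq: "act A z = (of_int (e11 A) * z + of_int (e12 A)) / autfac A z"
  by (simp add: act_def moebius_def autfac_def)

lemma SL2Z_det: "A \<in> SL2Z \<Longrightarrow> of_int (e11 A) * d_of A - of_int (e12 A) * c_of A = 1"
  unfolding SL2Z_def det_2 by (simp flip: of_int_mult of_int_diff)

lemma autfac_nonzero:
  assumes "A \<in> SL2Z" "z \<in> \<H>" shows "autfac A z \<noteq> 0"
proof
  assume 0: "autfac A z = 0"
  have "Im (autfac A z) = of_int (e21 A) * Im z" by (simp add: autfac_eq)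
  hence "e21 A = 0" using 0 assms by (simp add: upper_half_plane_def)
  hence "e22 A = 0" using 0 by (simp add: autfac_eq)
  thus False using SL2Z_det[OF assms(1)] \<open>e21 A = 0\<close> by simp
qed

lemma Im_act:
  assumes "A \<in> SL2Z" "z \<in> \<H>" shows "Im (act A z) = Im z / (cmod (autfac A z))\<^sup>2"
proof -
  have "Im (act A z) = Im ((of_int (e11 A) * z + of_int (e12 A)) * cnj (autfac A z)) / (cmod (autfac A z))\<^sup>2"
    unfolding act_eq by (simp add: Im_complex_div_eq_0 complex_div_cnj[of _ "autfac A z"])
  also have "Im ((of_int (e11 A) * z + of_int (e12 A)) * cnj (autfac A z))
     = (of_int (e11 A) * of_int (e22 A) - of_int (e12 A) * of_int (e21 A)) * Im z"
    by (simp add: autfac_eq algebra_simps)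
  also have "of_int (e11 A) * of_int (e22 A) - of_int (e12 A) * of_int (e21 A) = (1 :: real)"
    using assms(1) unfolding SL2Z_def det_2 by (simp flip: of_int_mult of_int_diff)
  finally show ?thesis by simp
qed

lemma act_in_H: "A \<in> SL2Z \<Longrightarrow> z \<in> \<H> \<Longrightarrow> act A z \<in> \<H>"
  using Im_act autfac_nonzero by (simp add: upper_half_plane_def)

lemma autfac_mult:
  assumes "B \<in> SL2Z" "z \<in> \<H>"
  shows "autfac (A ** B) z = autfac A (act B z) * autfac B z"
  using autfac_nonzero[OF assms]
  by (simp add: act_eq autfac_eq matrix_matrix_mult_def sum_2 field_simps)

lemma act_mult:
  assumes "A \<in> SL2Z" "B \<in> SL2Z" "z \<in> \<H>"
  shows "act (A ** B) z = act A (act B z)"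
proof -
  have 1: "of_int (e11 (A ** B)) * z + of_int (e12 (A ** B)) = (of_int (e11 A) * act B z + of_int (e12 A)) * autfac B z"
    using autfac_nonzero[OF assms(2,3)]
    by (simp add: act_eq[of B] autfac_eq matrix_matrix_mult_def sum_2 field_simps)
  show ?thesis unfolding act_eq[of "A ** B"] act_eq[of A] 1 autfac_mult[OF assms(2,3)]
    using autfac_nonzero[OF assms(2,3)] by simp
qed

text \<open>The difference version of \<open>act' = 1 / (c z + d)^2\<close>. It gives injectivity,
  and with \<open>w\<close> a fixed point the exact factor by which \<open>z - w\<close> is
  multiplied.\<close>

lemma act_diff:
  assumes "A \<in> SL2Z" "z \<in> \<H>" "w \<in> \<H>"
  shows "act A z - act A w = (z - w) / (autfac A z * autfac A w)"
proof -
  have "(of_int (e11 A) * z + of_int (e12 A)) * autfac A w - (of_int (e11 A) * w + of_int (e12 A)) * autfac A z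
     = (of_int (e11 A) * d_of A - of_int (e12 A) * c_of A) * (z - w)"
    by (simp add: autfac_eq algebra_simps)
  thus ?thesis unfolding act_eq SL2Z_det[OF assms(1)]
    using autfac_nonzero[OF assms(1,2)] autfac_nonzero[OF assms(1,3)] by (simp add: field_simps)
qed

lemma autfac_deriv: "(autfac A has_field_derivative c_of A) (at z)"
  unfolding autfac_eq[abs_def] by (auto intro!: derivative_eq_intros)

lemma act_deriv:
  assumes "A \<in> SL2Z" "z \<in> \<H>"
  shows "(act A has_field_derivative 1 / (autfac A z)\<^sup>2) (at z)"
proof -
  have "(act A has_field_derivative (of_int (e11 A) * autfac A z - (of_int (e11 A) * z + of_int (e12 A)) * c_of A) / (autfac A z * autfac A z)) (at z)"
    unfolding act_eq[abs_def] using autfac_nonzero[OF assms]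
    by (intro DERIV_divide autfac_deriv) (auto intro!: derivative_eq_intros)
  also have "of_int (e11 A) * autfac A z - (of_int (e11 A) * z + of_int (e12 A)) * c_of A =
      of_int (e11 A) * d_of A - of_int (e12 A) * c_of A"
    by (simp add: autfac_eq algebra_simps)
  finally show ?thesis by (simp add: SL2Z_det[OF assms(1)] power2_eq_square)
qed

lemma act_holomorphic: "A \<in> SL2Z \<Longrightarrow> act A holomorphic_on \<H>"
  using act_deriv by (auto simp: holomorphic_on_def field_differentiable_def intro: has_field_derivative_at_within)

lemma filterlim_act:
  assumes A: "A \<in> SL2Z" and z: "z \<in> \<H>"
  shows "filterlim (act A) (at (act A z)) (at z)"
proof (rule filterlim_atI)
  show "(act A \<longlongrightarrow> act A z) (at z)"
    using DERIV_isCont[OF act_deriv[OF A z]] by (simp add: isCont_def)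
  have "\<forall>\<^sub>F w in at z. w \<in> \<H> - {z}"
    using eventually_at_in_open[OF open_H z] by simp
  thus "\<forall>\<^sub>F w in at z. act A w \<noteq> act A z"
  proof eventually_elim
    case (elim w)
    have "act A w - act A z \<noteq> 0"
      using act_diff[OF A _ z, of w] autfac_nonzero[OF A] z elim by auto
    thus ?case by simp
  qed
qed

lemma act_S: "act matS z = - 1 / z" and act_T: "act matT z = z + 1"
  and autfac_S: "autfac matS z = z" and autfac_T: "autfac matT z = 1"
  by (simp_all add: matS_mat2 matT_mat2 act_eq autfac_eq)

section \<open>The slash operation and monodromy\<close>

definition tscale :: "complex \<Rightarrow> complex \<times> complex \<times> complex \<Rightarrow> complex \<times> complex \<times> complex" where
  "tscale c = (\<lambda>(x, y, z). (c * x, c * y, c * z))"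

lemma tscale_sym2: "tscale c (sym2 M X) = sym2 M (tscale c X)"
  by (cases X) (simp add: tscale_def sym2_def algebra_simps)

lemma tscale_tscale: "tscale c (tscale d X) = tscale (c * d) X"
  by (cases X) (simp add: tscale_def)

lemma tscale_veronese: "tscale (c\<^sup>2) (veronese y1 y2) = veronese (c * y1) (c * y2)"
  by (simp add: tscale_def veronese_def power2_eq_square)

text \<open>Solutions have weight -1, so their products carry the square of the automorphy
  factor.\<close>

definition slash :: "int ^ 2 ^ 2 \<Rightarrow> (complex \<Rightarrow> complex \<times> complex \<times> complex) \<Rightarrow> complex \<Rightarrow> complex \<times> complex \<times> complex" where
  "slash A X z = tscale ((autfac A z)\<^sup>2) (X (act A z))"

lemma slash_mult:
  assumes "A \<in> SL2Z" "B \<in> SL2Z" "z \<in> \<H>"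
  shows "slash (A ** B) X z = slash B (slash A X) z"
  unfolding slash_def act_mult[OF assms] autfac_mult[OF assms(2,3)] tscale_tscale
  by (simp add: power_mult_distrib mult.commute)

locale modular_ode = apparent_ode +
  assumes modular: "meromorphic_modular_form 4 (\<lambda>_. 1) Q"
begin

lemma Q_act: "A \<in> SL2Z \<Longrightarrow> z \<in> \<H> \<Longrightarrow> Q (act A z) = (autfac A z) ^ 4 * Q z"
  using modular by (simp add: meromorphic_modular_form_def)

text \<open>If the image were a pole, \<open>Q (act A w)\<close> would tend to infinity as
  \<open>w\<close> tends to \<open>z\<close>, while the weight 4 law gives it the finite limit of
  \<open>(c w + d)^4 Q w\<close>.\<close>

lemma act_regular:
  assumes A: "A \<in> SL2Z" and z: "z \<in> \<H> - poles Q"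
  shows "act A z \<in> \<H> - poles Q"
proof (rule ccontr)
  have zH: "z \<in> \<H>" using z by simp
  assume "act A z \<notin> \<H> - poles Q"
  hence "is_pole Q (act A z)" using act_in_H[OF A zH] by (auto simp: poles_def)
  hence "filterlim Q at_infinity (at (act A z))" by (simp add: is_pole_def)
  moreover have "filterlim (act A) (at (act A z)) (at z)" by (rule filterlim_act[OF A zH])
  ultimately have "filterlim (\<lambda>w. Q (act A w)) at_infinity (at z)" by (rule filterlim_compose)
  moreover have "((\<lambda>w. Q (act A w)) \<longlongrightarrow> (autfac A z) ^ 4 * Q z) (at z)"
  proof (rule Lim_transform_eventually)
    have "isCont Q z" using analytic_off_poles[OF z] analytic_at_imp_isCont by blast
    moreover have "isCont (autfac A) z" using autfac_deriv DERIV_isCont by blast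
    ultimately show "((\<lambda>w. (autfac A w) ^ 4 * Q w) \<longlongrightarrow> (autfac A z) ^ 4 * Q z) (at z)"
      unfolding isCont_def by (intro tendsto_intros)
    show "\<forall>\<^sub>F w in at z. (autfac A w) ^ 4 * Q w = Q (act A w)"
      using eventually_at_in_open'[OF open_H zH] by eventually_elim (simp add: Q_act[OF A])
  qed
  ultimately show False
    using not_tendsto_and_filterlim_at_infinity[of "at z"] by auto
qed

text \<open>Bol's identity: when \<open>c y + y' / (c z + d)\<close> is differentiated, the terms
  with \<open>c y'\<close> cancel and \<open>y'' / (c z + d)^3\<close> remains, which the weight 4
  of \<open>Q\<close> turns into \<open>Q\<close> times the new function.\<close>

lemma slash_solution:
  assumes A: "A \<in> SL2Z" and y: "ode_solution Q V y" and VU: "open V" "open U" "U \<subseteq> \<H>" "\<And>z. z \<in> U \<Longrightarrow> act A z \<in> V"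
  shows "ode_solution Q U (\<lambda>z. autfac A z * y (act A z))" (is "ode_solution Q U ?v")
    and "\<And>z. z \<in> U \<Longrightarrow> deriv (\<lambda>z. autfac A z * y (act A z)) z
        = c_of A * y (act A z) + deriv y (act A z) / autfac A z"
proof -
  have d: "(?v has_field_derivative c_of A * y (act A z) + deriv y (act A z) / autfac A z) (at z)"
    "((\<lambda>z. c_of A * y (act A z) + deriv y (act A z) / autfac A z) has_field_derivative Q z * ?v z) (at z)"
    if z: "z \<in> U" for z
  proof -
    have zH: "z \<in> \<H>" using z VU by blast
    note nz = autfac_nonzero[OF A zH] and ad = act_deriv[OF A zH]
    have y1: "((\<lambda>z. y (act A z)) has_field_derivative deriv y (act A z) * (1 / (autfac A z)\<^sup>2)) (at z)"
      by (rule DERIV_chain2[OF ode_solution_derivs(1)[OF y VU(1) VU(4)[OF z]] ad])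
    have y2: "((\<lambda>z. deriv y (act A z)) has_field_derivative (Q (act A z) * y (act A z)) * (1 / (autfac A z)\<^sup>2)) (at z)"
      by (rule DERIV_chain2[OF ode_solution_derivs(2)[OF y VU(1) VU(4)[OF z]] ad])
    show "(?v has_field_derivative c_of A * y (act A z) + deriv y (act A z) / autfac A z) (at z)"
      by (rule DERIV_cong[OF DERIV_mult[OF autfac_deriv y1]]) (use nz in \<open>simp add: field_simps power2_eq_square\<close>)
    show "((\<lambda>z. c_of A * y (act A z) + deriv y (act A z) / autfac A z) has_field_derivative Q z * ?v z) (at z)"
      by (rule DERIV_cong[OF DERIV_add[OF DERIV_cmult[OF y1] DERIV_divide[OF y2 autfac_deriv nz]]])
         (use nz in \<open>simp add: Q_act[OF A zH] field_simps power2_eq_square power4_eq_xxxx\<close>)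
  qed
  show "ode_solution Q U ?v" by (rule ode_solutionI[OF VU(2) d])
  show "deriv ?v z = c_of A * y (act A z) + deriv y (act A z) / autfac A z" if "z \<in> U" for z
    using d(1)[OF that] by (rule DERIV_imp_deriv)
qed

lemma slash_fundamental_pair:
  assumes A: "A \<in> SL2Z" and fp: "fundamental_pair Q V y1 y2"
    and VU: "open V" "open U" "U \<subseteq> \<H>" "\<And>z. z \<in> U \<Longrightarrow> act A z \<in> V"
  shows "fundamental_pair Q U (\<lambda>z. autfac A z * y1 (act A z)) (\<lambda>z. autfac A z * y2 (act A z))"
proof -
  have o: "ode_solution Q V y1" "ode_solution Q V y2" using fp by (auto simp: fundamental_pair_def)
  have "(autfac A z * y1 (act A z)) * (c_of A * y2 (act A z) + deriv y2 (act A z) / autfac A z) -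
        (c_of A * y1 (act A z) + deriv y1 (act A z) / autfac A z) * (autfac A z * y2 (act A z)) = 1" if z: "z \<in> U" for z
  proof -
    have W: "y1 (act A z) * deriv y2 (act A z) - deriv y1 (act A z) * y2 (act A z) = 1"
      using fp VU(4)[OF z] by (auto simp: fundamental_pair_def)
    have "autfac A z \<noteq> 0" using autfac_nonzero[OF A] z VU by blast
    hence "(autfac A z * y1 (act A z)) * (c_of A * y2 (act A z) + deriv y2 (act A z) / autfac A z) -
        (c_of A * y1 (act A z) + deriv y1 (act A z) / autfac A z) * (autfac A z * y2 (act A z))
        = y1 (act A z) * deriv y2 (act A z) - deriv y1 (act A z) * y2 (act A z)"
      by (simp add: field_simps)
    thus ?thesis using W by simp
  qed
  thus ?thesis
    using slash_solution[OF A o(1) VU] slash_solution[OF A o(2) VU] by (simp add: fundamental_pair_def)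
qed

lemma act_preimage_open:
  assumes A: "A \<in> SL2Z" and V: "open V"
  shows "open {z \<in> \<H>. act A z \<in> V}"
proof -
  have "continuous_on \<H> (act A)" using act_holomorphic[OF A] by (rule holomorphic_on_imp_continuous_on)
  hence "open (act A -` V \<inter> \<H>)" using V open_H by (simp add: continuous_on_open_vimage)
  moreover have "{z \<in> \<H>. act A z \<in> V} = act A -` V \<inter> \<H>" by blast
  ultimately show ?thesis by simp
qed

lemma sq_at_slash:
  assumes A: "A \<in> SL2Z" and X: "\<And>z. z \<in> \<H> \<Longrightarrow> sq_at Q X z" and z: "z \<in> \<H>"
  shows "sq_at Q (slash A X) z"
proof (cases "z \<in> poles Q")
  case True
  have "act A z \<in> poles Q"
  proof (rule ccontr)
    assume n: "act A z \<notin> poles Q"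
    obtain a b c d where abcd: "A = mat2 a b c d" using mat2_eta by metis
    \<comment> \<open>The inverse of \<open>A\<close>; if the image of the pole were regular,
      \<open>B\<close> would map it back to a regular point.\<close>
    define B where "B = mat2 d (- b) (- c) a"
    have det: "a * d - b * c = 1" using A abcd by (simp add: SL2Z_mat2)
    have B: "B \<in> SL2Z" using det by (simp add: B_def SL2Z_mat2 mult.commute)
    have BA: "B ** A = mat2 1 0 0 1" using det by (simp add: B_def abcd mat2_mult mult.commute)
    have "act B (act A z) = z"
      using act_mult[OF B A z] by (simp add: BA act_eq autfac_eq)
    moreover have "act A z \<in> \<H> - poles Q" using n act_in_H[OF A z] by simp
    ultimately have "z \<in> \<H> - poles Q" using act_regular[OF B, of "act A z"] by simp
    thus False using True by simp
  qed
  hence "X (act A z) = (0, 0, 0)" using X[OF act_in_H[OF A z]] by (simp add: sq_at_def)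
  thus ?thesis using True by (simp add: sq_at_def slash_def tscale_def)
next
  case False
  hence "act A z \<in> \<H> - poles Q" using act_regular[OF A] z by blast
  then obtain r y1 y2 where r: "r > 0" "ball (act A z) r \<subseteq> \<H> - poles Q" "fundamental_pair Q (ball (act A z) r) y1 y2"
      "\<And>w. w \<in> ball (act A z) r \<Longrightarrow> X w = veronese (y1 w) (y2 w)"
    using X[of "act A z"] by (auto simp: sq_at_def)
  have "open ({w \<in> \<H>. act A w \<in> ball (act A z) r} - poles Q)"
    by (rule open_diff_poles[OF act_preimage_open[OF A open_ball]]) auto
  moreover have "z \<in> {w \<in> \<H>. act A w \<in> ball (act A z) r} - poles Q" using z r False by simp
  ultimately obtain e where e: "e > 0" "ball z e \<subseteq> {w \<in> \<H>. act A w \<in> ball (act A z) r} - poles Q" by (meson openE)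
  have reg: "ball z e \<subseteq> \<H> - poles Q" and im: "\<And>w. w \<in> ball z e \<Longrightarrow> act A w \<in> ball (act A z) r" using e(2) by blast+
  have "ball z e \<subseteq> \<H>" using reg by blast
  from sq_atI[OF False e(1) reg slash_fundamental_pair[OF A r(3) open_ball open_ball this im]] show ?thesis
    using r(4)[OF im] by (simp add: slash_def tscale_veronese)
qed

text \<open>A relation and not a function, because \<open>sym2\<close> does not distinguish
  \<open>M\<close> from \<open>- M\<close>.\<close>

definition monodromy :: "(complex \<Rightarrow> complex \<times> complex \<times> complex) \<Rightarrow> int ^ 2 ^ 2 \<Rightarrow> complex ^ 2 ^ 2 \<Rightarrow> bool" where
  "monodromy X A M \<longleftrightarrow> det M = 1 \<and> (\<forall>z\<in>\<H>. slash A X z = sym2 M (X z))"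

lemma monodromy_exists:
  assumes "A \<in> SL2Z" "\<And>z. z \<in> \<H> \<Longrightarrow> sq_at Q X z"
  obtains M where "monodromy X A M"
proof -
  have "connected \<H>" "\<H> \<noteq> {}" using convex_connected[OF convex_H] by (auto simp: upper_half_plane_def intro: exI[of _ \<i>])
  thus ?thesis
    using sq_change[OF open_H _ _ _ assms(2) sq_at_slash[OF assms]] that unfolding monodromy_def by (metis order_refl)
qed

text \<open>The constant matrix passes through the slash operation, so the right action on systems
  becomes multiplication of matrices in the same order.\<close>

lemma monodromy_mult:
  assumes "A \<in> SL2Z" "B \<in> SL2Z" "monodromy X A M" "monodromy X B N"
  shows "monodromy X (A ** B) (M ** N)"
  unfolding monodromy_def
proof (intro conjI ballI)
  show "det (M ** N) = 1" using assms by (simp add: det_mul monodromy_def)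
  fix z assume z: "z \<in> \<H>"
  have "slash (A ** B) X z = tscale ((autfac B z)\<^sup>2) (slash A X (act B z))"
    using slash_mult[OF assms(1,2) z] by (simp add: slash_def)
  also have "\<dots> = sym2 M (slash B X z)"
    using assms(3) act_in_H[OF assms(2) z] by (simp add: monodromy_def tscale_sym2 slash_def[of B])
  finally show "slash (A ** B) X z = sym2 (M ** N) (X z)"
    using assms(4) z by (simp add: monodromy_def sym2_mult)
qed

lemma monodromy_sym2:
  assumes "monodromy X A M" "det N = 1" "A \<in> SL2Z"
  shows "monodromy (\<lambda>z. sym2 N (X z)) A (N ** M ** adj2 N)"
proof -
  have "slash A (\<lambda>z. sym2 N (X z)) z = sym2 (N ** M ** adj2 N) (sym2 N (X z))" if z: "z \<in> \<H>" for z
  proof -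
    have "slash A (\<lambda>z. sym2 N (X z)) z = sym2 N (slash A X z)" by (simp add: slash_def tscale_sym2)
    also have "\<dots> = sym2 N (sym2 M (sym2 (adj2 N) (sym2 N (X z))))"
      using assms z by (simp add: monodromy_def sym2_adj2)
    finally show ?thesis by (simp add: sym2_mult)
  qed
  thus ?thesis using assms by (simp add: monodromy_def det_mul)
qed

lemma sym2_uminus: "sym2 (- M) X = sym2 M X"
  by (cases X) (simp add: sym2_def)

lemma monodromy_uminus: "monodromy X A M \<Longrightarrow> monodromy X A (- M)"
  by (simp add: monodromy_def sym2_uminus det_2)

text \<open>
  The leading terms at \<open>p\<close> of \<open>(X|A)\<^sub>1 = a\<^sup>2 X\<^sub>1 + 2 a b X\<^sub>2 + b\<^sup>2 X\<^sub>3\<close>, whose terms on the right have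
  orders \<open>n + 1\<close>, \<open>1\<close> and \<open>1 - n\<close>, give first \<open>b = 0\<close> and then \<open>a\<^sup>2\<close>.
\<close>

lemma elliptic_monodromy:
  assumes A: "A \<in> SL2Z" and p: "p \<in> \<H>" "act A p = p" and m: "monodromy X A M"
    and fd: "frobenius_data Q p r n g k 0" and B: "ball p r \<subseteq> \<H>" "ball p r \<inter> poles Q \<subseteq> {p}"
    and X: "\<And>z. z \<in> ball p r \<Longrightarrow> X z = local_system p n g k z"
  shows "e12 M = 0" "(e11 M)\<^sup>2 * (autfac A p) ^ (2 * n) = 1"
proof -
  note fd' = fd[unfolded frobenius_data_def]
  define a b where "a = e11 M" and "b = e12 M"
  define j where "j = autfac A p"
  have jnz: "j \<noteq> 0" unfolding j_def by (rule autfac_nonzero[OF A p(1)])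
  have r0: "r > 0" using fd' by blast
  have near: "\<forall>\<^sub>F z in at p. z \<in> ball p r - {p} \<and> act A z \<in> ball p r - {p}"
  proof -
    have "open ({z \<in> \<H>. act A z \<in> ball p r} \<inter> ball p r)"
      using act_preimage_open[OF A open_ball] by blast
    moreover have "p \<in> {z \<in> \<H>. act A z \<in> ball p r} \<inter> ball p r" using p r0 by simp
    ultimately have "\<forall>\<^sub>F z in at p. z \<in> {z \<in> \<H>. act A z \<in> ball p r} \<inter> ball p r - {p}"
      by (rule eventually_at_in_open)
    thus ?thesis
    proof eventually_elim
      case (elim z)
      hence "act A z - act A p \<noteq> 0"
        using act_diff[OF A _ p(1), of z] autfac_nonzero[OF A] p by auto
      thus ?case using elim p by auto
    qed
  qed
  have reg: "z \<notin> poles Q" if "z \<in> ball p r - {p}" for z using that B by blast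
  have eq: "\<forall>\<^sub>F z in at p. (autfac A z)\<^sup>2 * ((act A z - p) ^ Suc n * (g (act A z - p))\<^sup>2) =
     a\<^sup>2 * ((z - p) ^ Suc n * (g (z - p))\<^sup>2) + 2 * (a * b) * ((z - p) * (g (z - p))\<^sup>2 * k (z - p))
      + b\<^sup>2 * ((g (z - p))\<^sup>2 * (k (z - p))\<^sup>2 / (z - p) ^ (n - 1)) \<and> z \<noteq> p \<and> z \<in> \<H>"
    using near
  proof eventually_elim
    case (elim z)
    hence "z \<in> \<H>" using B by blast
    hence "fst (slash A X z) = fst (sym2 M (X z))" using m by (simp add: monodromy_def)
    thus ?case using elim \<open>z \<in> \<H>\<close> reg[of z] reg[of "act A z"] X[of z] X[of "act A z"]
      by (simp add: slash_def tscale_def sym2_def local_system_def a_def b_def)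
  qed
  have cg: "isCont g 0" "isCont k 0"
    using fd' holomorphic_on_imp_continuous_on[of _ "ball 0 r"] by (auto simp: continuous_on_eq_continuous_at)
  have cs: "isCont (\<lambda>z. f (z - p)) p" if "isCont f 0" for f :: "complex \<Rightarrow> complex"
    using isCont_o2[where f = "\<lambda>z. z - p" and a = p and g = f] that by simp
  have ca: "isCont (act A) p" by (rule DERIV_isCont[OF act_deriv[OF A p(1)]])
  have cga: "isCont (\<lambda>z. g (act A z - p)) p"
    using isCont_o2[where f = "\<lambda>z. act A z - p" and a = p and g = g] ca cg p(2) by simp
  have cj: "isCont (autfac A) p" by (rule DERIV_isCont[OF autfac_deriv])
  have k0: "k 0 \<noteq> 0"
  proof
    assume "k 0 = 0"
    moreover have "0 * deriv k 0 - of_nat n * k 0 = 1 / (g 0)\<^sup>2 - 0 * 0 ^ n" using fd' r0 by (metis centre_in_ball)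
    ultimately show False using fd' by simp
  qed
  have n: "n \<ge> 1" using fd' by blast
  have limeq: "f p = h p" if "isCont f p" "isCont h p" "\<forall>\<^sub>F z in at p. f z = h z" for f h :: "complex \<Rightarrow> complex"
  proof -
    have "(f \<longlongrightarrow> f p) (at p)" "(h \<longlongrightarrow> h p) (at p)" using that by (auto simp: isCont_def)
    moreover have "(h \<longlongrightarrow> f p) (at p)" using Lim_transform_eventually[OF \<open>(f \<longlongrightarrow> f p) (at p)\<close> that(3)] .
    ultimately show ?thesis using tendsto_unique[OF _ \<open>(h \<longlongrightarrow> f p) (at p)\<close> \<open>(h \<longlongrightarrow> h p) (at p)\<close>] by auto
  qed
  \<comment> \<open>Multiplication by \<open>(z - p) ^ (n - 1)\<close> clears the pole of the third
    product; at \<open>p\<close> only \<open>b^2 k^2\<close> survives.\<close>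
  define f1 where "f1 = (\<lambda>z. (z - p) ^ (n - 1) * ((autfac A z)\<^sup>2 * ((act A z - p) ^ Suc n * (g (act A z - p))\<^sup>2)))"
  define h1 where "h1 = (\<lambda>z. a\<^sup>2 * ((z - p) ^ (n - 1) * (z - p) ^ Suc n * (g (z - p))\<^sup>2) +
        2 * (a * b) * ((z - p) ^ (n - 1) * (z - p) * (g (z - p))\<^sup>2 * k (z - p)) + b\<^sup>2 * ((g (z - p))\<^sup>2 * (k (z - p))\<^sup>2))"
  have "f1 p = h1 p"
  proof (rule limeq)
    show "isCont f1 p" unfolding f1_def by (intro continuous_intros cs cg ca cga cj)
    show "isCont h1 p" unfolding h1_def by (intro continuous_intros cs cg ca cga cj)
    show "\<forall>\<^sub>F z in at p. f1 z = h1 z"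
      unfolding f1_def h1_def using eq
    proof eventually_elim
      case (elim z)
      have nz: "(z - p) ^ (n - 1) \<noteq> 0" using elim by simp
      have e: "W * (a\<^sup>2 * (P * G) + 2 * (a * b) * (x * G * K) + b\<^sup>2 * (G * K2 / W))
         = a\<^sup>2 * (W * P * G) + 2 * (a * b) * (W * x * G * K) + b\<^sup>2 * (G * K2)" if "W \<noteq> 0" for W P G x K K2 :: complex
        using that by (simp add: distrib_left mult_ac)
      show ?case unfolding conjunct1[OF elim] by (rule e[OF nz])
    qed
  qed
  hence "b\<^sup>2 * (k 0)\<^sup>2 = 0" using p(2) n fd' by (simp add: f1_def h1_def)
  hence b0: "b = 0" using k0 by simp
  thus "e12 M = 0" by (simp add: b_def)
  \<comment> \<open>With \<open>b = 0\<close> the power \<open>(z - p) ^ (n + 1)\<close> divides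
    both sides, since \<open>act A z - p\<close> is \<open>z - p\<close> divided by
    \<open>autfac A z * j\<close>. The value at \<open>p\<close> is
    \<open>j^2 = a^2 j^(2 n + 2)\<close>.\<close>
  define f2 where "f2 = (\<lambda>z. (autfac A z)\<^sup>2 * (g (act A z - p))\<^sup>2)"
  define h2 where "h2 = (\<lambda>z. a\<^sup>2 * (autfac A z * j) ^ Suc n * (g (z - p))\<^sup>2)"
  have "f2 p = h2 p"
  proof (rule limeq)
    show "isCont f2 p" unfolding f2_def by (intro continuous_intros cs cg ca cga cj)
    show "isCont h2 p" unfolding h2_def by (intro continuous_intros cs cg ca cga cj)
    show "\<forall>\<^sub>F z in at p. f2 z = h2 z"
      unfolding f2_def h2_def using eq
    proof eventually_elim
      case (elim z)
      have "act A z - p = (z - p) / (autfac A z * j)"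
        using act_diff[OF A _ p(1), of z] elim p(2) by (simp add: j_def)
      hence "(act A z - p) ^ Suc n = (z - p) ^ Suc n / (autfac A z * j) ^ Suc n" by (simp only: power_divide)
      moreover have "(autfac A z * j) ^ Suc n \<noteq> 0" "(z - p) ^ Suc n \<noteq> 0" using autfac_nonzero[OF A] elim jnz by auto
      moreover have "J * (W / V * x) = a\<^sup>2 * (W * y) \<Longrightarrow> V \<noteq> 0 \<Longrightarrow> W \<noteq> 0 \<Longrightarrow> J * x = a\<^sup>2 * V * y"
        for J W V x y :: complex by (simp add: field_simps)
      ultimately show ?case using elim b0 by (metis add.right_neutral mult_zero_left mult_zero_right zero_power2)
    qed
  qed
  hence "j\<^sup>2 = a\<^sup>2 * (j * j) ^ Suc n" using p(2) fd' by (simp add: j_def f2_def h2_def)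
  also have "(j * j) ^ Suc n = j\<^sup>2 * j ^ (2 * n)" by (simp add: power_mult power2_eq_square)
  finally have "j\<^sup>2 * 1 = j\<^sup>2 * (a\<^sup>2 * j ^ (2 * n))" by (simp add: mult_ac)
  thus "(e11 M)\<^sup>2 * (autfac A p) ^ (2 * n) = 1" using jnz unfolding a_def j_def by (metis mult_left_cancel power_not_zero)
qed

end

section \<open>The cusp\<close>

lemma eventually_at_cusp: "eventually P at_cusp \<longleftrightarrow> (\<exists>Y. \<forall>z. Im z > Y \<longrightarrow> P z)"
proof -
  have "eventually P at_cusp \<longleftrightarrow> (\<exists>Y. \<forall>z. Im z \<ge> Y \<longrightarrow> P z)"
    unfolding at_cusp_def eventually_filtercomap eventually_at_top_linorder by blast
  also have "\<dots> \<longleftrightarrow> (\<exists>Y. \<forall>z. Im z > Y \<longrightarrow> P z)"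
    by (meson less_eq_real_def less_le_trans gt_ex order_le_less_trans)
  finally show ?thesis .
qed

lemma at_cusp_neq_bot: "at_cusp \<noteq> bot"
proof
  assume "at_cusp = bot"
  hence "eventually (\<lambda>_. False) at_cusp" by simp
  then obtain Y where "\<forall>z. \<not> Im z > Y" unfolding eventually_at_cusp by blast
  hence "\<not> Im (Complex 0 (Y + 1)) > Y" by blast
  thus False by simp
qed

lemma norm_qpar: "cmod (qpar z) = exp (- (2 * pi * Im z))"
  by (simp add: qpar_def norm_exp_eq_Re)

lemma qpar_nonzero [simp]: "qpar z \<noteq> 0"
  by (simp add: qpar_def)

lemma qpar_tendsto_0: "(qpar \<longlongrightarrow> 0) at_cusp"
proof (rule tendsto_norm_zero_cancel)
  have "((\<lambda>y::real. exp (- (2 * pi * y))) \<longlongrightarrow> 0) at_top"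
    by (rule filterlim_compose[OF exp_at_bot])
       (auto intro!: filterlim_tendsto_pos_mult_at_top[OF tendsto_const] filterlim_ident
             simp: filterlim_uminus_at_bot)
  hence "((\<lambda>z. exp (- (2 * pi * Im z))) \<longlongrightarrow> 0) at_cusp"
    unfolding at_cusp_def by (rule filterlim_compose) (rule filterlim_filtercomap)
  thus "((\<lambda>z. cmod (qpar z)) \<longlongrightarrow> 0) at_cusp" by (simp add: norm_qpar)
qed

lemma qpar_deriv: "(qpar has_field_derivative 2 * of_real pi * \<i> * qpar z) (at z)"
  unfolding qpar_def by (auto intro!: derivative_eq_intros)

lemma qpar_plus_1: "qpar (z + 1) = qpar z"
  by (simp add: qpar_def algebra_simps exp_add)

lemma qpar_in_ball:
  assumes "R > 0" shows "\<exists>Y>0. \<forall>z. Im z > Y \<longrightarrow> qpar z \<in> ball 0 R"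
proof -
  have "\<forall>\<^sub>F z in at_cusp. dist (qpar z) 0 < R" using qpar_tendsto_0 assms by (rule tendstoD)
  then obtain Y where "\<forall>z. Im z > Y \<longrightarrow> dist (qpar z) 0 < R" unfolding eventually_at_cusp by blast
  thus ?thesis by (intro exI[of _ "max 1 Y"]) (auto simp: dist_commute)
qed

lemma isCont_at_cusp:
  assumes "isCont f 0" shows "((\<lambda>z. f (qpar z)) \<longlongrightarrow> f 0) at_cusp"
  using isCont_tendsto_compose[OF assms qpar_tendsto_0] .

text \<open>In the coordinate \<open>q = qpar z\<close> the equation is
  \<open>(q d/dq)^2 y = - Q y / (4 pi^2)\<close>. For \<open>y = q^s g\<close> the left side is
  \<open>q^s (s^2 g + q (q g'' + (2 s + 1) g'))\<close>, so the terms with \<open>s^2\<close>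
  cancel.\<close>

lemma cusp_ode_solution:
  assumes U: "open U" and Q: "\<And>z. z \<in> U \<Longrightarrow> Q z = - 4 * (of_real pi)\<^sup>2 * (s\<^sup>2 + qpar z * P (qpar z))"
    and g: "g holomorphic_on ball 0 R"
      "\<And>w. w \<in> ball 0 R \<Longrightarrow> w * deriv (deriv g) w + (2 * s + 1) * deriv g w = P w * g w"
    and R: "\<And>z. z \<in> U \<Longrightarrow> qpar z \<in> ball 0 R"
  shows "ode_solution Q U (\<lambda>z. exp (2 * of_real pi * \<i> * s * z) * g (qpar z))"
    and "\<And>z. z \<in> U \<Longrightarrow> deriv (\<lambda>z. exp (2 * of_real pi * \<i> * s * z) * g (qpar z)) z =
       2 * of_real pi * \<i> * exp (2 * of_real pi * \<i> * s * z) * (s * g (qpar z) + qpar z * deriv g (qpar z))"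
proof -
  define c where "c = 2 * of_real pi * \<i>"
  have c2: "c * c = - 4 * (of_real pi)\<^sup>2" by (simp add: c_def power2_eq_square algebra_simps)
  have g': "(g has_field_derivative deriv g w) (at w)" "(deriv g has_field_derivative deriv (deriv g) w) (at w)"
    if "w \<in> ball 0 R" for w
    using g(1) that by (auto intro!: holomorphic_derivI[of _ "ball 0 R"] holomorphic_deriv)
  have q': "(qpar has_field_derivative c * qpar z) (at z)" for z using qpar_deriv by (simp add: c_def)
  have e': "((\<lambda>z. exp (c * s * z)) has_field_derivative exp (c * s * z) * (c * s)) (at z)" for z
    by (auto intro!: derivative_eq_intros)
  have d1: "((\<lambda>z. exp (c * s * z) * g (qpar z)) has_field_derivative
      c * exp (c * s * z) * (s * g (qpar z) + qpar z * deriv g (qpar z))) (at z)" if z: "z \<in> U" for z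
    by (rule DERIV_cong[OF DERIV_mult[OF e' DERIV_chain2[OF g'(1)[OF R[OF z]] q']]]) (simp add: algebra_simps)
  have d2: "((\<lambda>z. c * exp (c * s * z) * (s * g (qpar z) + qpar z * deriv g (qpar z))) has_field_derivative
      Q z * (exp (c * s * z) * g (qpar z))) (at z)" if z: "z \<in> U" for z
  proof -
    let ?q = "qpar z"
    have "((\<lambda>z. c * exp (c * s * z) * (s * g (qpar z) + qpar z * deriv g (qpar z))) has_field_derivative
      (c * (exp (c * s * z) * (c * s))) * (s * g ?q + ?q * deriv g ?q) +
      (s * (deriv g ?q * (c * ?q)) + ((c * ?q) * deriv g ?q + (deriv (deriv g) ?q * (c * ?q)) * ?q)) * (c * exp (c * s * z))) (at z)"
      by (intro DERIV_mult DERIV_add DERIV_cmult e' q' DERIV_chain2[OF g'(1)[OF R[OF z]] q'] DERIV_chain2[OF g'(2)[OF R[OF z]] q'])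
    also have "(c * (exp (c * s * z) * (c * s))) * (s * g ?q + ?q * deriv g ?q) +
      (s * (deriv g ?q * (c * ?q)) + ((c * ?q) * deriv g ?q + (deriv (deriv g) ?q * (c * ?q)) * ?q)) * (c * exp (c * s * z))
      = (c * c) * exp (c * s * z) * (s\<^sup>2 * g ?q + ?q * (?q * deriv (deriv g) ?q + (2 * s + 1) * deriv g ?q))"
      by (simp add: power2_eq_square algebra_simps)
    also have "\<dots> = Q z * (exp (c * s * z) * g ?q)"
      unfolding g(2)[OF R[OF z]] Q[OF z] c2 by (simp add: algebra_simps)
    finally show ?thesis .
  qed
  show "ode_solution Q U (\<lambda>z. exp (2 * of_real pi * \<i> * s * z) * g (qpar z))"
    using ode_solutionI[OF U d1 d2] by (simp add: c_def)
  show "deriv (\<lambda>z. exp (2 * of_real pi * \<i> * s * z) * g (qpar z)) z =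
       2 * of_real pi * \<i> * exp (2 * of_real pi * \<i> * s * z) * (s * g (qpar z) + qpar z * deriv g (qpar z))"
    if "z \<in> U" for z
    using DERIV_imp_deriv[OF d1[OF that]] by (simp add: c_def)
qed

section \<open>Solutions at the cusp and traces of the generators\<close>

locale main_setup = modular_ode +
  fixes r :: real
  assumes fuchsian_cusp: "holomorphic_at_cusp Q"
    and cusp_value: "cusp_value Q \<in> \<real>" "Re (cusp_value Q) \<le> 0"
    and theta_i: "kappa Q \<i> \<notin> \<int>"
    and theta_rho: "2 * kappa Q rho / 3 \<notin> \<int>"
    and kappa_cusp: "2 * kappa_cusp Q \<notin> \<int>"
    and r: "0 < r" "r < 1/2" "kappa_cusp Q - r \<in> \<int> \<or> kappa_cusp Q + r \<in> \<int>"
begin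

definition "\<kappa> = kappa_cusp Q"

lemma kappa_pos: "\<kappa> > 0"
proof -
  have "\<kappa> \<ge> 0" using cusp_value(2) unfolding \<kappa>_def kappa_cusp_def
    by (intro divide_nonneg_pos real_sqrt_ge_zero) auto
  moreover have "\<kappa> \<noteq> 0" using kappa_cusp by (auto simp: \<kappa>_def)
  ultimately show ?thesis by simp
qed

definition cusp_data :: "real \<Rightarrow> real \<Rightarrow> (complex \<Rightarrow> complex) \<Rightarrow> (complex \<Rightarrow> complex) \<Rightarrow> bool" where
  "cusp_data Y R g1 g2 \<longleftrightarrow> Y > 0 \<and> R > 0 \<and> g1 holomorphic_on ball 0 R \<and> g2 holomorphic_on ball 0 R \<and>
     g1 0 \<noteq> 0 \<and> g2 0 \<noteq> 0 \<and> {z. Im z > Y} \<subseteq> \<H> - poles Q \<and> (\<forall>z. Im z > Y \<longrightarrow> qpar z \<in> ball 0 R) \<and>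
     fundamental_pair Q {z. Im z > Y} (\<lambda>z. exp (2 * of_real pi * \<i> * (- of_real \<kappa>) * z) * g1 (qpar z))
       (\<lambda>z. exp (2 * of_real pi * \<i> * of_real \<kappa> * z) * g2 (qpar z))"

text \<open>The exponents \<open>\<kappa>\<close> and \<open>- \<kappa>\<close> differ by a
  non-integer, so both power series exist without quadrature or logarithms. The pair is normalized
  by dividing the first solution by the Wronskian.\<close>

lemma cusp_data_exists: obtains Y R g1 g2 where "cusp_data Y R g1 g2"
proof -
  obtain F where F: "F analytic_on {0}" "\<forall>\<^sub>F z in at_cusp. Q z = F (qpar z)"
    using fuchsian_cusp by (auto simp: holomorphic_at_cusp_def)
  have "isCont F 0" using F(1) analytic_at_imp_isCont by blast
  hence "((\<lambda>z. F (qpar z)) \<longlongrightarrow> F 0) at_cusp" by (rule isCont_at_cusp)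
  hence "(Q \<longlongrightarrow> F 0) at_cusp"
    by (rule Lim_transform_eventually) (use F(2) in \<open>simp add: eq_commute\<close>)
  hence F0: "cusp_value Q = F 0" unfolding cusp_value_def by (intro tendsto_Lim at_cusp_neq_bot)
  have F0': "F 0 = - 4 * (of_real pi)\<^sup>2 * (of_real \<kappa>)\<^sup>2"
  proof -
    have "\<kappa>\<^sup>2 = - Re (F 0) / (4 * pi\<^sup>2)"
      using cusp_value(2) unfolding \<kappa>_def kappa_cusp_def F0 by (simp add: power_divide power_mult_distrib)
    hence "Re (F 0) = - 4 * pi\<^sup>2 * \<kappa>\<^sup>2" by (simp add: field_simps)
    moreover have "F 0 = of_real (Re (F 0))" using cusp_value(1) F0 by (simp add: of_real_Re)
    ultimately have "F 0 = of_real (- 4 * pi\<^sup>2 * \<kappa>\<^sup>2)" by simp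
    thus ?thesis by simp
  qed
  obtain R0 where R0: "R0 > 0" "F holomorphic_on ball 0 R0" using F(1) by (auto simp: analytic_on_def)
  obtain F1 where F1: "F1 holomorphic_on ball 0 R0" "\<And>w. w \<in> ball 0 R0 \<Longrightarrow> F w = F 0 + w * F1 w"
    using holomorphic_quotient_at_0[OF R0(2,1)] by blast
  define P where "P = (\<lambda>w. F1 w / (- 4 * (of_real pi)\<^sup>2))"
  have "P holomorphic_on ball 0 R0" unfolding P_def by (intro holomorphic_intros F1) auto
  hence Pan: "P analytic_on {0}" using R0(1) unfolding analytic_at by (meson centre_in_ball open_ball)
  \<comment> \<open>A vanishing denominator would mean \<open>2 \<kappa> = m + 1\<close> or
    \<open>2 \<kappa> = - (m + 1)\<close>, but \<open>2 \<kappa>\<close> is not an integer.\<close>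
  have nonres: "2 * of_real s + 1 + of_nat m \<noteq> (0 :: complex)" if s: "s = \<kappa> \<or> s = - \<kappa>" for s m
  proof
    assume "2 * of_real s + 1 + of_nat m = (0 :: complex)"
    hence "complex_of_real (2 * s + 1 + real m) = 0" by simp
    hence "2 * s + 1 + real m = 0" by (simp only: of_real_eq_0_iff)
    hence "2 * \<kappa> = of_int (- (1 + int m)) \<or> 2 * \<kappa> = of_int (1 + int m)" using s by auto
    thus False using kappa_cusp unfolding \<kappa>_def by (metis Ints_of_int)
  qed
  obtain g1 R1 where g1: "R1 > 0" "g1 holomorphic_on ball 0 R1" "g1 0 = 1"
    "\<And>w. w \<in> ball 0 R1 \<Longrightarrow> w * deriv (deriv g1) w + (2 * of_real (- \<kappa>) + 1) * deriv g1 w = P w * g1 w"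
    using frobenius_solution[OF Pan nonres[of "- \<kappa>"]] by metis
  obtain g2 R2 where g2: "R2 > 0" "g2 holomorphic_on ball 0 R2" "g2 0 = 1"
    "\<And>w. w \<in> ball 0 R2 \<Longrightarrow> w * deriv (deriv g2) w + (2 * of_real \<kappa> + 1) * deriv g2 w = P w * g2 w"
    using frobenius_solution[OF Pan nonres[of "\<kappa>"]] by metis
  define R where "R = min R0 (min R1 R2)"
  have R: "R > 0" "R \<le> R0" "R \<le> R1" "R \<le> R2" using R0 g1 g2 by (auto simp: R_def)
  obtain Y1 where Y1: "\<And>z. Im z > Y1 \<Longrightarrow> Q z = F (qpar z)" using F(2) unfolding eventually_at_cusp by blast
  obtain Y2 where Y2: "Y2 > 0" "\<And>z. Im z > Y2 \<Longrightarrow> qpar z \<in> ball 0 R" using qpar_in_ball[OF R(1)] by blast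
  define Y where "Y = max Y1 Y2"
  define U where "U = {z. Im z > Y}"
  have Uo: "open U" "convex U" unfolding U_def by (simp_all add: open_halfspace_Im_gt convex_halfspace_Im_gt)
  have qb: "qpar z \<in> ball 0 R" if "z \<in> U" for z using Y2 that by (simp add: U_def Y_def)
  have QF: "Q z = F (qpar z)" if "z \<in> U" for z using Y1 that by (simp add: U_def Y_def)
  have Qeq: "Q z = - 4 * (of_real pi)\<^sup>2 * (s\<^sup>2 + qpar z * P (qpar z))" if "z \<in> U" "s\<^sup>2 = (of_real \<kappa>)\<^sup>2" for z s
  proof -
    have "qpar z \<in> ball 0 R0" using qb[OF that(1)] R(2) subset_ball[of R R0 0] by blast
    hence "Q z = - 4 * (of_real pi)\<^sup>2 * (of_real \<kappa>)\<^sup>2 + qpar z * F1 (qpar z)"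
      using F1(2)[of "qpar z"] F0' QF[OF that(1)] by simp
    moreover have "- 4 * p * a + q * f = - 4 * p * (a + q * (f / (- 4 * p)))" if "p \<noteq> 0" for p a q f :: complex
      using that by (simp add: field_simps)
    ultimately show ?thesis by (simp add: P_def that(2))
  qed
  have UH: "U \<subseteq> \<H> - poles Q"
  proof
    fix z assume z: "z \<in> U"
    have "Q holomorphic_on U"
    proof (rule holomorphic_transform)
      show "(\<lambda>z. F (qpar z)) holomorphic_on U"
        by (rule holomorphic_on_compose_gen[of qpar U F "ball 0 R0", unfolded o_def])
           (use qb R R0 subset_ball[of R R0 "0::complex"] in
             \<open>auto simp: holomorphic_on_open[OF Uo(1)] intro: qpar_deriv\<close>)
    qed (simp add: QF)
    hence "Q analytic_on {z}" using z Uo(1) by (auto simp: analytic_at)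
    moreover have "z \<in> \<H>" using z Y2 by (simp add: U_def Y_def upper_half_plane_def)
    ultimately show "z \<in> \<H> - poles Q" by (auto simp: poles_def analytic_at_imp_no_pole)
  qed
  let ?e = "\<lambda>s z. exp (2 * of_real pi * \<i> * s * z)"
  have b1: "w \<in> ball 0 R1" "w \<in> ball 0 R2" if "w \<in> ball 0 R" for w :: complex using that R by auto
  have gR: "g1 holomorphic_on ball 0 R" "g2 holomorphic_on ball 0 R"
    using g1(2) g2(2) b1 by (auto intro: holomorphic_on_subset)
  define y1 where "y1 = (\<lambda>z. ?e (- of_real \<kappa>) z * g1 (qpar z))"
  define y2 where "y2 = (\<lambda>z. ?e (of_real \<kappa>) z * g2 (qpar z))"
  have sol1: "ode_solution Q U y1"
    "\<And>z. z \<in> U \<Longrightarrow> deriv y1 z =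
       2 * of_real pi * \<i> * ?e (- of_real \<kappa>) z * (- of_real \<kappa> * g1 (qpar z) + qpar z * deriv g1 (qpar z))"
    unfolding y1_def using cusp_ode_solution[OF Uo(1) Qeq gR(1) _ qb, of "- of_real \<kappa>"] g1(4)[OF b1(1)] by simp_all
  have sol2: "ode_solution Q U y2"
    "\<And>z. z \<in> U \<Longrightarrow> deriv y2 z =
       2 * of_real pi * \<i> * ?e (of_real \<kappa>) z * (of_real \<kappa> * g2 (qpar z) + qpar z * deriv g2 (qpar z))"
    unfolding y2_def using cusp_ode_solution[OF Uo(1) Qeq gR(2) _ qb, of "of_real \<kappa>"] g2(4)[OF b1(2)] by simp_all
  \<comment> \<open>The two exponential factors cancel in the Wronskian, which becomes a function of
    \<open>q\<close>. Being constant in \<open>z\<close>, it equals its value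
    \<open>4 pi i \<kappa>\<close> at \<open>q = 0\<close>, which is nonzero as
    \<open>\<kappa> > 0\<close>.\<close>
  define W where "W = (\<lambda>q. 2 * of_real pi * \<i> * (2 * of_real \<kappa> * g1 q * g2 q + q * (g1 q * deriv g2 q - deriv g1 q * g2 q)))"
  have Wz: "y1 z * deriv y2 z - deriv y1 z * y2 z = W (qpar z)" if z: "z \<in> U" for z
  proof -
    have e1: "?e (- of_real \<kappa>) z * ?e (of_real \<kappa>) z = 1" by (simp flip: exp_add)
    have "y1 z * deriv y2 z - deriv y1 z * y2 z = (?e (- of_real \<kappa>) z * ?e (of_real \<kappa>) z) * W (qpar z)"
      unfolding sol1(2)[OF z] sol2(2)[OF z] unfolding W_def y1_def y2_def by (simp add: algebra_simps)
    thus ?thesis unfolding e1 by simp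
  qed
  obtain c where "\<And>z. z \<in> U \<Longrightarrow> y1 z * deriv y2 z - deriv y1 z * y2 z = c"
    using wronskian_constant[OF sol1(1) sol2(1) Uo] by blast
  hence c: "W (qpar z) = c" if "z \<in> U" for z using Wz[OF that] that by metis
  have "W holomorphic_on ball 0 R" unfolding W_def
    by (intro holomorphic_intros gR holomorphic_deriv) auto
  hence "isCont W 0" using R(1) holomorphic_on_imp_continuous_on[of W "ball 0 R"] by (auto simp: continuous_on_eq_continuous_at)
  hence "((\<lambda>z. W (qpar z)) \<longlongrightarrow> W 0) at_cusp" by (rule isCont_at_cusp)
  moreover have "((\<lambda>z. W (qpar z)) \<longlongrightarrow> c) at_cusp"
    by (rule tendsto_eventually) (use c in \<open>auto simp: eventually_at_cusp U_def\<close>)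
  ultimately have "c = W 0" using tendsto_unique[OF at_cusp_neq_bot] by blast
  hence c': "c = 4 * of_real pi * \<i> * of_real \<kappa>" by (simp add: W_def g1(3) g2(3))
  hence c0: "c \<noteq> 0" using kappa_pos by simp
  have "fundamental_pair Q U (\<lambda>z. (1/c) * y1 z + 0 * y2 z) y2"
  proof -
    have "((1/c) * y1 z + 0 * y2 z) * deriv y2 z - deriv (\<lambda>z. (1/c) * y1 z + 0 * y2 z) z * y2 z = 1" if z: "z \<in> U" for z
      unfolding deriv_linear_combination[OF sol1(1) sol2(1) Uo(1) z]
      using Wz[OF z] c[OF z] c0 by (simp add: field_simps)
    thus ?thesis unfolding fundamental_pair_def
      using ode_solution_linear[OF sol1(1) sol2(1) Uo(1), of "1/c" 0] sol2(1) by blast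
  qed
  moreover have "(\<lambda>z. (1/c) * y1 z + 0 * y2 z) = (\<lambda>z. ?e (- of_real \<kappa>) z * (g1 (qpar z) / c))"
    by (simp add: y1_def)
  ultimately have fp: "fundamental_pair Q U (\<lambda>z. ?e (- of_real \<kappa>) z * (g1 (qpar z) / c)) (\<lambda>z. ?e (of_real \<kappa>) z * g2 (qpar z))"
    by (simp only: y2_def)
  have "cusp_data Y R (\<lambda>w. g1 w / c) g2"
    unfolding cusp_data_def U_def[symmetric]
    using fp UH qb R gR g1(3) g2(3) c0 Y2(1)
    by (auto intro!: holomorphic_intros simp: U_def Y_def)
  thus ?thesis using that by blast
qed

lemma cusp_system:
  assumes cd: "cusp_data Y R g1 g2" and X: "\<And>z. z \<in> \<H> \<Longrightarrow> sq_at Q X z"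
  obtains N where "det N = 1" "\<And>z. Im z > Y \<Longrightarrow> X z = sym2 N (veronese
     (exp (2 * of_real pi * \<i> * (- of_real \<kappa>) * z) * g1 (qpar z)) (exp (2 * of_real pi * \<i> * of_real \<kappa> * z) * g2 (qpar z)))"
proof -
  define U where "U = {z. Im z > Y}"
  define y1 where "y1 = (\<lambda>z. exp (2 * of_real pi * \<i> * (- of_real \<kappa>) * z) * g1 (qpar z))"
  define y2 where "y2 = (\<lambda>z. exp (2 * of_real pi * \<i> * of_real \<kappa> * z) * g2 (qpar z))"
  note cd' = cd[unfolded cusp_data_def, folded U_def y1_def y2_def]
  have Uo: "open U" "connected U" unfolding U_def by (simp_all add: open_halfspace_Im_gt convex_halfspace_Im_gt convex_connected)
  have "Complex 0 (Y + 1) \<in> U" by (simp add: U_def)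
  hence Une: "U \<noteq> {}" by blast
  have "sq_at Q (\<lambda>z. veronese (y1 z) (y2 z)) z" if z: "z \<in> U" for z
  proof -
    obtain e where e: "e > 0" "ball z e \<subseteq> U" using Uo(1) z by (meson openE)
    show ?thesis
    proof (rule sq_atI[OF _ e(1)])
      show "z \<notin> poles Q" "ball z e \<subseteq> \<H> - poles Q" using cd' z e by blast+
      show "fundamental_pair Q (ball z e) y1 y2" using cd' e(2) by (blast intro: fundamental_pair_subset)
    qed auto
  qed
  moreover have "U \<subseteq> \<H>" using cd' by blast
  ultimately obtain N where "det N = 1" "\<And>z. z \<in> U \<Longrightarrow> X z = sym2 N (veronese (y1 z) (y2 z))"
    using sq_change[OF Uo _ Une, of "\<lambda>z. veronese (y1 z) (y2 z)" X] X by blast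
  thus ?thesis using that by (auto simp: U_def y1_def y2_def)
qed

text \<open>The sum is \<open>2 cos (2 pi \<kappa>)\<close>, which depends on
  \<open>\<kappa>\<close> only up to sign and up to integers, hence only on
  \<open>r\<close>.\<close>

lemma exp_kappa_trace: "(exp (2 * of_real pi * \<i> * (- of_real \<kappa>)) + exp (2 * of_real pi * \<i> * of_real \<kappa>))\<^sup>2 =
   of_real (4 * (cos (2 * pi * r))\<^sup>2)"
proof -
  have "exp (2 * of_real pi * \<i> * (- of_real \<kappa>)) + exp (2 * of_real pi * \<i> * of_real \<kappa>) = complex_of_real (2 * cos (2 * pi * \<kappa>))"
    using cos_exp_eq[of "of_real (2 * pi * \<kappa>)"] cos_of_real[of "2 * pi * \<kappa>", where 'a = complex]
    by (simp add: mult_ac add.commute)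
  moreover have "cos (2 * pi * \<kappa>) = cos (2 * pi * r)"
    using r(3)
  proof
    assume "kappa_cusp Q - r \<in> \<int>"
    then obtain m where "kappa_cusp Q - r = of_int m" by (rule Ints_cases)
    hence "\<kappa> = r + of_int m" by (simp add: \<kappa>_def)
    hence "2 * pi * \<kappa> = 2 * pi * r + of_int m * (2 * pi)" by (simp only: algebra_simps)
    thus ?thesis using cos_add[of "2 * pi * r" "of_int m * (2 * pi)"] cos_int_2pin[of m] sin_int_2pin[of m]
      by (simp add: mult_ac)
  next
    assume "kappa_cusp Q + r \<in> \<int>"
    then obtain m where "kappa_cusp Q + r = of_int m" by (rule Ints_cases)
    hence *: "\<kappa> = of_int m - r" by (simp add: \<kappa>_def)
    have "2 * pi * \<kappa> = of_int m * (2 * pi) - 2 * pi * r" unfolding * by (simp add: algebra_simps)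
    thus ?thesis using cos_diff[of "of_int m * (2 * pi)" "2 * pi * r"] cos_int_2pin[of m] sin_int_2pin[of m]
      by (simp add: mult_ac)
  qed
  ultimately show ?thesis by (simp add: power_mult_distrib)
qed

lemma trace_conj: "det N = 1 \<Longrightarrow> trace (adj2 N ** M ** N) = trace M" "det N = 1 \<Longrightarrow> trace (N ** M ** adj2 N) = trace M"
  by (metis adj2_mult matrix_mul_assoc matrix_mul_lid matrix_mul_rid trace_mul_sym)+

text \<open>The translation multiplies the solutions at the cusp by
  \<open>exp (- 2 pi i \<kappa>)\<close> and \<open>exp (2 pi i \<kappa>)\<close>. In that basis the
  matrix is diagonal up to sign, and the trace is invariant under the change of basis
  \<open>N\<close>.\<close>

lemma parabolic_trace:
  assumes X: "\<And>z. z \<in> \<H> \<Longrightarrow> sq_at Q X z" and m: "monodromy X matT M"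
  shows "(trace M)\<^sup>2 = of_real (4 * (cos (2 * pi * r))\<^sup>2)"
proof -
  obtain Y R g1 g2 where cd: "cusp_data Y R g1 g2" using cusp_data_exists by blast
  obtain N where N: "det N = 1" "\<And>z. Im z > Y \<Longrightarrow> X z = sym2 N (veronese
     (exp (2 * of_real pi * \<i> * (- of_real \<kappa>) * z) * g1 (qpar z)) (exp (2 * of_real pi * \<i> * of_real \<kappa> * z) * g2 (qpar z)))"
    using cusp_system[OF cd X] by blast
  define U where "U = {z. Im z > Y}"
  define y1 where "y1 = (\<lambda>z. exp (2 * of_real pi * \<i> * (- of_real \<kappa>) * z) * g1 (qpar z))"
  define y2 where "y2 = (\<lambda>z. exp (2 * of_real pi * \<i> * of_real \<kappa> * z) * g2 (qpar z))"
  note cd' = cd[unfolded cusp_data_def, folded U_def y1_def y2_def]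
  have N': "X z = sym2 N (veronese (y1 z) (y2 z))" if "Im z > Y" for z
    using N(2)[OF that] by (simp only: y1_def y2_def)
  define \<epsilon> where "\<epsilon> = exp (2 * of_real pi * \<i> * of_real \<kappa>)"
  define \<delta> where "\<delta> = exp (2 * of_real pi * \<i> * (- of_real \<kappa>))"
  have ed: "\<delta> * \<epsilon> = 1" by (simp add: \<epsilon>_def \<delta>_def flip: exp_add)
  have "(trace (adj2 N ** M ** N))\<^sup>2 = (trace (mat2 \<delta> 0 0 \<epsilon>))\<^sup>2"
  proof (rule sym2_eq_imp_trace_eq)
    show "fundamental_pair Q U y1 y2" using cd' by blast
    show "open U" unfolding U_def by (simp add: open_halfspace_Im_gt)
    have "Complex 0 (Y + 1) \<in> U" by (simp add: U_def)
    thus "U \<noteq> {}" by blast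
    show "det (adj2 N ** M ** N) = 1" using N(1) m by (simp add: det_mul monodromy_def)
    show "det (mat2 \<delta> 0 0 \<epsilon>) = 1" using ed by simp
    fix z assume z: "z \<in> U"
    hence zH: "z \<in> \<H>" using cd' by blast
    have "y1 (z + 1) = \<delta> * y1 z" "y2 (z + 1) = \<epsilon> * y2 z"
      unfolding y1_def y2_def \<epsilon>_def \<delta>_def qpar_plus_1 distrib_left[of _ z 1] exp_add by (simp_all add: mult_ac)
    hence v: "veronese (y1 (z + 1)) (y2 (z + 1)) = sym2 (mat2 \<delta> 0 0 \<epsilon>) (veronese (y1 z) (y2 z))"
      by (simp add: sym2_veronese)
    have "sym2 N (sym2 (mat2 \<delta> 0 0 \<epsilon>) (veronese (y1 z) (y2 z))) = X (z + 1)"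
      using N'[of "z + 1"] z v by (simp add: U_def)
    also have "X (z + 1) = slash matT X z" by (cases "X (z + 1)") (simp add: slash_def autfac_T act_T tscale_def)
    also have "\<dots> = sym2 M (sym2 N (veronese (y1 z) (y2 z)))"
      using m zH N'[of z] z by (simp add: monodromy_def U_def)
    finally have "sym2 (adj2 N) (sym2 N (sym2 (mat2 \<delta> 0 0 \<epsilon>) (veronese (y1 z) (y2 z)))) =
        sym2 (adj2 N) (sym2 M (sym2 N (veronese (y1 z) (y2 z))))" by simp
    thus "sym2 (adj2 N ** M ** N) (veronese (y1 z) (y2 z)) = sym2 (mat2 \<delta> 0 0 \<epsilon>) (veronese (y1 z) (y2 z))"
      by (simp add: sym2_adj2[OF N(1)] sym2_mult)
  qed
  also have "\<dots> = of_real (4 * (cos (2 * pi * r))\<^sup>2)"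
    using exp_kappa_trace by (simp add: \<epsilon>_def \<delta>_def)
  finally show ?thesis by (simp add: trace_conj[OF N(1)])
qed

lemma rho_facts: "rho \<in> \<H>" "rho\<^sup>2 = rho - 1" "rho ^ 3 = -1" "act (matT ** matS) rho = rho" "autfac (matT ** matS) rho = rho"
proof -
  have s: "complex_of_real (sqrt 3) * complex_of_real (sqrt 3) = 3" by (simp flip: of_real_mult)
  show 1: "rho \<in> \<H>" by (simp add: rho_def upper_half_plane_def)
  show 2: "rho\<^sup>2 = rho - 1" using s by (simp add: rho_def power2_eq_square field_simps)
  show "rho ^ 3 = -1" using 2 by algebra
  have nz: "rho \<noteq> 0" using 1 by (auto simp: upper_half_plane_def)
  have "act (matT ** matS) rho = - 1 / rho + 1" using 1 by (subst act_mult) (simp_all add: act_S act_T)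
  also have "\<dots> = (rho - 1) / rho" using nz by (simp add: field_simps)
  also have "\<dots> = rho" using nz unfolding 2[symmetric] by (simp add: power2_eq_square)
  finally show "act (matT ** matS) rho = rho" .
  show "autfac (matT ** matS) rho = rho" using 1 by (subst autfac_mult) (simp_all add: autfac_S autfac_T)
qed

text \<open>\<open>T S\<close> is \<open>z \<mapsto> 1 - 1 / z\<close>, with fixed point
  \<open>rho\<close>. In the Frobenius basis its matrix is triangular with
  \<open>a^2 \<zeta> = 1\<close> for \<open>\<zeta> = rho^(2 n)\<close>, so the squared trace is
  \<open>\<zeta> + 1 / \<zeta> + 2\<close>. Since \<open>\<theta>_\<rho> = n / 3\<close> is not an
  integer, \<open>\<zeta>\<close> is a primitive cube root of unity and the value is 1.\<close>

lemma elliptic_trace_rho: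
  assumes X: "\<And>z. z \<in> \<H> \<Longrightarrow> sq_at Q X z" and m: "monodromy X (matT ** matS) M"
  shows "(trace M)\<^sup>2 = 1"
proof -
  obtain e n g k where fd: "frobenius_data Q rho e n g k 0" "ball rho e \<subseteq> \<H>" "ball rho e \<inter> poles Q \<subseteq> {rho}"
    "kappa Q rho = real n / 2" "rho \<notin> poles Q \<Longrightarrow> n = 1" using frobenius_data_at[OF rho_facts(1)] by metis
  obtain X1 where X1: "\<And>z. z \<in> \<H> \<Longrightarrow> sq_at Q X1 z" "\<And>z. z \<in> ball rho e \<Longrightarrow> X1 z = local_system rho n g k z"
    using global_system[OF fd(1,2,3,5)] by blast
  have TS: "matT ** matS \<in> SL2Z" by (intro SL2Z_mult) auto
  have "connected \<H>" "\<H> \<noteq> {}" using convex_connected[OF convex_H] rho_facts(1) by auto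
  then obtain N where N: "det N = 1" "\<And>z. z \<in> \<H> \<Longrightarrow> X1 z = sym2 N (X z)"
    using sq_change[OF open_H _ order_refl, of X X1] X X1(1) by metis
  have m1: "monodromy X1 (matT ** matS) (N ** M ** adj2 N)"
  proof -
    have "monodromy (\<lambda>z. sym2 N (X z)) (matT ** matS) (N ** M ** adj2 N)" by (rule monodromy_sym2[OF m N(1) TS])
    thus ?thesis using N(2) act_in_H[OF TS] by (simp add: monodromy_def slash_def)
  qed
  define M1 where "M1 = N ** M ** adj2 N"
  have el: "e12 M1 = 0" "(e11 M1)\<^sup>2 * rho ^ (2 * n) = 1"
    using elliptic_monodromy[OF TS rho_facts(1,4) m1 fd(1-3) X1(2)] rho_facts(5) by (auto simp: M1_def)
  define \<zeta> where "\<zeta> = rho ^ (2 * n)"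
  have "\<not> 3 dvd n"
  proof
    assume "3 dvd n"
    then obtain m where "n = 3 * m" by blast
    hence "2 * kappa Q rho / 3 = of_int (int m)" using fd(4) by simp
    thus False using theta_rho Ints_of_int by metis
  qed
  have "\<zeta>\<^sup>2 + \<zeta> + 1 = 0"
  proof -
    have "rho ^ 6 = (rho ^ 3)\<^sup>2" by (simp flip: power_mult)
    hence r6: "rho ^ 6 = 1" using rho_facts(3) by simp
    have "n mod 3 = 1 \<or> n mod 3 = 2" using \<open>\<not> 3 dvd n\<close> by presburger
    moreover have "\<zeta> = rho ^ (2 * (n mod 3))"
    proof -
      have "2 * n = 6 * (n div 3) + 2 * (n mod 3)" by presburger
      thus ?thesis unfolding \<zeta>_def by (simp add: power_add power_mult r6)
    qed
    ultimately have "\<zeta> = rho\<^sup>2 \<or> \<zeta> = rho ^ 4" by auto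
    moreover have "rho ^ 4 = - rho" using rho_facts(3) by (simp add: eval_nat_numeral)
    ultimately show ?thesis using rho_facts(2) by auto algebra
  qed
  have "det M1 = 1" using N(1) m by (simp add: M1_def det_mul monodromy_def)
  hence "e11 M1 * e22 M1 = 1" using el(1) by (simp add: det_2)
  moreover have "trace M1 = e11 M1 + e22 M1" by (simp add: trace_def sum_2)
  moreover have "(e11 M1)\<^sup>2 * \<zeta> = 1" using el(2) by (simp add: \<zeta>_def)
  ultimately have "(trace M1)\<^sup>2 = 1" using \<open>\<zeta>\<^sup>2 + \<zeta> + 1 = 0\<close> by algebra
  thus ?thesis by (simp add: M1_def trace_conj[OF N(1)])
qed

text \<open>
  The monodromy of \<open>S\<close> at the elliptic point \<open>\<i>\<close> is diagonalized; the traces of \<open>TS\<close> and \<open>T\<close> then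
  determine the diagonal of the monodromy of \<open>T\<close>.
\<close>

lemma normal_form:
  obtains X q s \<tau> where "\<And>z. z \<in> \<H> \<Longrightarrow> sq_at Q X z" "monodromy X matS (mat2 \<i> 0 0 (- \<i>))"
    "monodromy X matT (mat2 ((of_real \<tau> + \<i>) / 2) q s ((of_real \<tau> - \<i>) / 2))"
    "\<tau>\<^sup>2 = 4 * (cos (2 * pi * r))\<^sup>2" "q * s = of_real ((\<tau>\<^sup>2 - 3) / 4)"
proof -
  have iH: "\<i> \<in> \<H>" by (simp add: upper_half_plane_def)
  obtain e n g k where fd: "frobenius_data Q \<i> e n g k 0" "ball \<i> e \<subseteq> \<H>" "ball \<i> e \<inter> poles Q \<subseteq> {\<i>}"
    "kappa Q \<i> = real n / 2" "\<i> \<notin> poles Q \<Longrightarrow> n = 1" using frobenius_data_at[OF iH] by metis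
  obtain X0 where X0: "\<And>z. z \<in> \<H> \<Longrightarrow> sq_at Q X0 z" "\<And>z. z \<in> ball \<i> e \<Longrightarrow> X0 z = local_system \<i> n g k z"
    using global_system[OF fd(1,2,3,5)] by blast
  \<comment> \<open>\<open>n\<close> is \<open>2 \<theta>_i\<close> and \<open>\<theta>_i\<close> is
    not an integer; this gives \<open>\<i> ^ (2 * n) = -1\<close> below.\<close>
  have "odd n"
  proof
    assume "even n"
    then obtain m where "n = 2 * m" by blast
    hence "kappa Q \<i> = of_int (int m)" using fd(4) by simp
    thus False using theta_i Ints_of_int by metis
  qed
  obtain M0 where M0: "monodromy X0 matS M0" using monodromy_exists[OF matS_SL2Z X0(1)] by blast
  have act_i: "act matS \<i> = \<i>" by (simp add: act_S)
  have el: "e12 M = 0" "(e11 M)\<^sup>2 = -1" if "monodromy X0 matS M" for M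
  proof -
    have "(e11 M)\<^sup>2 * \<i> ^ (2 * n) = 1"
      using elliptic_monodromy(2)[OF matS_SL2Z iH act_i that fd(1-3) X0(2)] by (simp add: autfac_S)
    moreover have "\<i> ^ (2 * n) = -1" using \<open>odd n\<close> by (simp add: power_mult)
    ultimately show "(e11 M)\<^sup>2 = -1" by (simp add: minus_equation_iff[of _ 1])
    show "e12 M = 0" using elliptic_monodromy(1)[OF matS_SL2Z iH act_i that fd(1-3) X0(2)] .
  qed
  have "\<exists>M. monodromy X0 matS M \<and> e11 M = \<i>"
  proof (cases "e11 M0 = \<i>")
    case False
    have "(e11 M0 - \<i>) * (e11 M0 + \<i>) = 0" using el(2)[OF M0] by (simp add: algebra_simps power2_eq_square)
    hence "e11 M0 = - \<i>" using False by (simp add: eq_neg_iff_add_eq_0)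
    thus ?thesis using monodromy_uminus[OF M0] by (intro exI[of _ "- M0"]) simp
  qed (use M0 in blast)
  then obtain M1 where M1: "monodromy X0 matS M1" "e11 M1 = \<i>" by blast
  define c where "c = e21 M1"
  have "e22 M1 = - \<i>"
  proof -
    have "\<i> * e22 M1 = 1" using M1 el(1)[OF M1(1)] by (simp add: monodromy_def det_2)
    hence "- \<i> * (\<i> * e22 M1) = - \<i>" by simp
    thus ?thesis by simp
  qed
  hence M1': "M1 = mat2 \<i> 0 c (- \<i>)" using mat2_eta[of M1] el(1)[OF M1(1)] M1(2) by (simp add: c_def)
  \<comment> \<open>Conjugation by a lower unipotent matrix with entry \<open>x\<close> turns the
    lower left entry \<open>c\<close> into \<open>c + 2 i x\<close>.\<close>
  define N where "N = mat2 1 0 (\<i> * c / 2) 1"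
  define X where "X = (\<lambda>z. sym2 N (X0 z))"
  have dN: "det N = 1" by (simp add: N_def)
  have X: "sq_at Q X z" if "z \<in> \<H>" for z unfolding X_def by (rule sq_at_sym2[OF X0(1)[OF that] dN])
  have "N ** M1 ** adj2 N = mat2 \<i> 0 0 (- \<i>)"
    by (simp add: N_def M1' adj2_def mat2_mult mat2_eq_iff) (simp add: algebra_simps)
  hence mS: "monodromy X matS (mat2 \<i> 0 0 (- \<i>))"
    using monodromy_sym2[OF M1(1) dN matS_SL2Z] by (simp add: X_def)
  obtain MT where MT: "monodromy X matT MT" using monodromy_exists[OF matT_SL2Z X] by blast
  \<comment> \<open>The trace of \<open>M ** mat2 \<i> 0 0 (- \<i>)\<close> is \<open>\<i>\<close>
    times the difference of the diagonal entries of \<open>M\<close>; this is where the elliptic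
    point \<open>rho\<close> enters.\<close>
  have tr: "(e11 M - e22 M)\<^sup>2 = -1" if "monodromy X matT M" for M
  proof -
    have "monodromy X (matT ** matS) (M ** mat2 \<i> 0 0 (- \<i>))" by (rule monodromy_mult[OF _ _ that mS]) auto
    hence "(trace (M ** mat2 \<i> 0 0 (- \<i>)))\<^sup>2 = 1" by (rule elliptic_trace_rho[rotated]) (rule X)
    moreover have "trace (M ** mat2 \<i> 0 0 (- \<i>)) = \<i> * (e11 M - e22 M)"
      by (subst mat2_eta[of M]) (simp add: mat2_mult algebra_simps del: mat2_eta)
    ultimately show ?thesis by (simp add: power_mult_distrib minus_equation_iff[of _ 1])
  qed
  have "\<exists>M. monodromy X matT M \<and> e11 M - e22 M = \<i>"
  proof (cases "e11 MT - e22 MT = \<i>")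
    case False
    define x where "x = e11 MT - e22 MT"
    have "(x - \<i>) * (x + \<i>) = 0" using tr[OF MT] by (simp add: x_def algebra_simps power2_eq_square)
    hence "x = - \<i>" using False by (simp add: eq_neg_iff_add_eq_0 x_def)
    hence "e22 MT - e11 MT = \<i>" unfolding x_def by (simp add: algebra_simps)
    thus ?thesis using monodromy_uminus[OF MT] by (intro exI[of _ "- MT"]) simp
  qed (use MT in blast)
  then obtain M where M: "monodromy X matT M" "e11 M - e22 M = \<i>" by blast
  have trM: "(e11 M + e22 M)\<^sup>2 = of_real (4 * (cos (2 * pi * r))\<^sup>2)"
    using parabolic_trace[OF X M(1)] by (simp add: trace_def sum_2)
  \<comment> \<open>The squared trace is the square of a real number, so the trace is real, with a
    sign that stays undetermined.\<close>
  obtain \<tau> where \<tau>: "e11 M + e22 M = of_real \<tau>" "\<tau>\<^sup>2 = 4 * (cos (2 * pi * r))\<^sup>2"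
  proof -
    define t where "t = 2 * cos (2 * pi * r)"
    have "(e11 M + e22 M)\<^sup>2 = (of_real t)\<^sup>2" using trM by (simp add: t_def power_mult_distrib)
    hence "e11 M + e22 M = of_real t \<or> e11 M + e22 M = of_real (- t)" by (simp add: power2_eq_iff)
    thus ?thesis using that[of t] that[of "- t"] by (auto simp: t_def power_mult_distrib)
  qed
  have 1: "e11 M = (of_real \<tau> + \<i>) / 2" and 2: "e22 M = (of_real \<tau> - \<i>) / 2"
  proof -
    have "2 * e11 M = (e11 M + e22 M) + (e11 M - e22 M)" "2 * e22 M = (e11 M + e22 M) - (e11 M - e22 M)" by simp_all
    thus "e11 M = (of_real \<tau> + \<i>) / 2" "e22 M = (of_real \<tau> - \<i>) / 2" unfolding \<tau>(1) M(2) by (simp_all add: field_simps)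
  qed
  \<comment> \<open>The product of the diagonal entries is \<open>(\<tau>^2 + 1) / 4\<close>, which
    leaves \<open>(\<tau>^2 - 3) / 4\<close> for the other product.\<close>
  have "e11 M * e22 M - e12 M * e21 M = 1" using M(1) by (simp add: monodromy_def det_2)
  hence "e12 M * e21 M = of_real ((\<tau>\<^sup>2 - 3) / 4)" unfolding 1 2 by (simp add: field_simps power2_eq_square)
  moreover have "M = mat2 ((of_real \<tau> + \<i>) / 2) (e12 M) (e21 M) ((of_real \<tau> - \<i>) / 2)"
    using mat2_eta[of M] by (simp only: 1 2)
  ultimately show ?thesis using that[OF X mS _ \<tau>(2)] M(1) by metis
qed

end

section \<open>Wirtinger derivatives and smooth functions\<close>

text \<open>Every real-linear map of the complex plane has the form
  \<open>h \<mapsto> a h + b cnj h\<close>, and \<open>a\<close>, \<open>b\<close> are the two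
  Wirtinger derivatives. In this form the rules of calculus compose; the values of
  \<open>d_z\<close> and \<open>d_zbar\<close> are read off at the end.\<close>

definition has_wd :: "(complex \<Rightarrow> complex) \<Rightarrow> complex \<Rightarrow> complex \<Rightarrow> complex \<Rightarrow> bool" where
  "has_wd f a b z \<longleftrightarrow> (f has_derivative (\<lambda>h. a * h + b * cnj h)) (at z)"

lemma has_wdD:
  assumes "has_wd f a b z"
  shows "d_z f z = a" "d_zbar f z = b" "d_x f z = a + b" "d_y f z = \<i> * (a - b)" "f differentiable (at z)"
proof -
  have d: "(f has_derivative (\<lambda>h. a * h + b * cnj h)) (at z)" using assms by (simp add: has_wd_def)
  hence e: "frechet_derivative f (at z) = (\<lambda>h. a * h + b * cnj h)" by (rule frechet_derivative_at[symmetric])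
  show x: "d_x f z = a + b" by (simp add: d_x_def e)
  show y: "d_y f z = \<i> * (a - b)" by (simp add: d_y_def e algebra_simps)
  show "d_z f z = a" "d_zbar f z = b" by (simp_all add: d_z_def d_zbar_def x y algebra_simps)
  show "f differentiable (at z)" using d by (auto simp: differentiable_def)
qed

lemma differentiable_has_wd:
  assumes "f differentiable (at z)" shows "has_wd f (d_z f z) (d_zbar f z) z"
proof -
  have d: "(f has_derivative frechet_derivative f (at z)) (at z)"
    using assms frechet_derivative_works by blast
  then interpret linear "frechet_derivative f (at z)" by (rule has_derivative_linear)
  have "frechet_derivative f (at z) h = d_z f z * h + d_zbar f z * cnj h" for h
  proof -
    have "h = Re h *\<^sub>R 1 + Im h *\<^sub>R \<i>" by (simp add: complex_eq_iff)
    hence "frechet_derivative f (at z) h = Re h *\<^sub>R d_x f z + Im h *\<^sub>R d_y f z"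
      unfolding d_x_def d_y_def by (metis add scaleR)
    also have "\<dots> = d_z f z * (of_real (Re h) + \<i> * of_real (Im h)) + d_zbar f z * (of_real (Re h) - \<i> * of_real (Im h))"
      by (simp add: d_z_def d_zbar_def scaleR_conv_of_real field_simps)
    also have "\<dots> = d_z f z * h + d_zbar f z * cnj h"
      using complex_eq[of h] complex_cnj_cnj by (simp add: complex_eq_iff algebra_simps)
    finally show ?thesis .
  qed
  thus ?thesis using d unfolding has_wd_def by presburger
qed

lemma has_wd_cong:
  assumes "has_wd f a b z" "open U" "z \<in> U" "\<And>w. w \<in> U \<Longrightarrow> f w = g w"
  shows "has_wd g a b z"
  using assms has_derivative_transform_within_open[of f _ z UNIV U g] by (simp add: has_wd_def)

lemma has_wd_const: "has_wd (\<lambda>_. c) 0 0 z"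
  by (simp add: has_wd_def)

lemma has_wd_field_derivative: "(f has_field_derivative a) (at z) \<Longrightarrow> has_wd f a 0 z"
  by (simp add: has_wd_def has_field_derivative_def)

lemma has_wd_cnj: assumes "has_wd f a b z" shows "has_wd (\<lambda>z. cnj (f z)) (cnj b) (cnj a) z"
  using has_derivative_cnj[OF assms[unfolded has_wd_def]] by (simp add: has_wd_def add.commute)

lemma has_wd_add: "has_wd f a b z \<Longrightarrow> has_wd g c d z \<Longrightarrow> has_wd (\<lambda>z. f z + g z) (a + c) (b + d) z"
  unfolding has_wd_def
  by (rule has_derivative_eq_rhs, rule has_derivative_add, assumption, assumption) (simp add: fun_eq_iff algebra_simps)

lemma has_wd_diff: "has_wd f a b z \<Longrightarrow> has_wd g c d z \<Longrightarrow> has_wd (\<lambda>z. f z - g z) (a - c) (b - d) z"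
  unfolding has_wd_def
  by (rule has_derivative_eq_rhs, rule has_derivative_diff, assumption, assumption) (simp add: fun_eq_iff algebra_simps)

lemma has_wd_mult:
  "has_wd f a b z \<Longrightarrow> has_wd g c d z \<Longrightarrow> has_wd (\<lambda>z. f z * g z) (a * g z + f z * c) (b * g z + f z * d) z"
  unfolding has_wd_def
  by (rule has_derivative_eq_rhs, rule has_derivative_mult, assumption, assumption) (simp add: fun_eq_iff algebra_simps)

lemma has_wd_cmult: "has_wd f a b z \<Longrightarrow> has_wd (\<lambda>z. c * f z) (c * a) (c * b) z"
  using has_wd_mult[OF has_wd_const[of c]] by simp

lemma has_wd_inverse:
  assumes "has_wd f a b z" "f z \<noteq> 0"
  shows "has_wd (\<lambda>z. inverse (f z)) (- a * (inverse (f z) * inverse (f z))) (- b * (inverse (f z) * inverse (f z))) z"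
proof -
  have "((\<lambda>z. inverse (f z)) has_derivative (\<lambda>h. - (inverse (f z) * (a * h + b * cnj h) * inverse (f z)))) (at z)"
    by (rule Deriv.has_derivative_inverse[OF assms(2) assms(1)[unfolded has_wd_def]])
  thus ?thesis unfolding has_wd_def by (rule has_derivative_eq_rhs) (auto simp: algebra_simps)
qed

lemma has_wd_divide:
  assumes "has_wd f a b z" "has_wd g c d z" "g z \<noteq> 0"
  shows "has_wd (\<lambda>z. f z / g z) ((a * g z - f z * c) / (g z)\<^sup>2) ((b * g z - f z * d) / (g z)\<^sup>2) z"
proof -
  have "has_wd (\<lambda>z. f z * inverse (g z)) (a * inverse (g z) + f z * (- c * (inverse (g z) * inverse (g z))))
     (b * inverse (g z) + f z * (- d * (inverse (g z) * inverse (g z)))) z"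
    by (intro has_wd_mult has_wd_inverse assms)
  moreover have "x * inverse (g z) + f z * (- y * (inverse (g z) * inverse (g z))) = (x * g z - f z * y) / (g z)\<^sup>2" for x y
    using assms(3) by (simp add: field_simps power2_eq_square)
  ultimately show ?thesis by (simp add: divide_inverse)
qed

text \<open>The derivative of a real-valued function takes real values; the second conclusion lets
  \<open>Re\<close> be dropped after a real chain rule.\<close>

lemma has_wd_real:
  assumes "has_wd (\<lambda>z. of_real (s z)) a b z"
  shows "(s has_derivative (\<lambda>h. Re (a * h + b * cnj h))) (at z)"
    "complex_of_real (Re (a * h + b * cnj h)) = a * h + b * cnj h"
proof -
  have "((\<lambda>z. Re (of_real (s z))) has_derivative (\<lambda>h. Re (a * h + b * cnj h))) (at z)"
    by (rule has_derivative_Re[OF assms[unfolded has_wd_def]])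
  thus 1: "(s has_derivative (\<lambda>h. Re (a * h + b * cnj h))) (at z)" by simp
  have "((\<lambda>z. complex_of_real (s z)) has_derivative (\<lambda>h. complex_of_real (Re (a * h + b * cnj h)))) (at z)"
    by (rule has_derivative_of_real[OF 1])
  from has_derivative_unique[OF this assms[unfolded has_wd_def]]
  show "complex_of_real (Re (a * h + b * cnj h)) = a * h + b * cnj h" by metis
qed

lemma has_wd_ln:
  assumes "has_wd (\<lambda>z. of_real (s z)) a b z" "s z > 0"
  shows "has_wd (\<lambda>z. of_real (ln (s z))) (a / of_real (s z)) (b / of_real (s z)) z"
proof -
  have "((\<lambda>z. ln (s z)) has_derivative (\<lambda>h. Re (a * h + b * cnj h) * inverse (s z))) (at z)"
    by (rule has_derivative_ln[OF assms(2) has_wd_real(1)[OF assms(1)]])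
  hence "((\<lambda>z. complex_of_real (ln (s z))) has_derivative (\<lambda>h. of_real (Re (a * h + b * cnj h) * inverse (s z)))) (at z)"
    by (rule has_derivative_of_real)
  thus ?thesis unfolding has_wd_def
    by (rule has_derivative_eq_rhs)
       (simp only: of_real_mult has_wd_real(2)[OF assms(1)], simp add: fun_eq_iff divide_inverse algebra_simps)
qed

lemma has_wd_exp:
  assumes "has_wd (\<lambda>z. of_real (s z)) a b z"
  shows "has_wd (\<lambda>z. of_real (exp (s z))) (a * of_real (exp (s z))) (b * of_real (exp (s z))) z"
proof -
  have "((\<lambda>z. exp (s z)) has_derivative (\<lambda>h. Re (a * h + b * cnj h) * exp (s z))) (at z)"
    by (rule has_derivative_exp[OF has_wd_real(1)[OF assms(1)]])
  hence "((\<lambda>z. complex_of_real (exp (s z))) has_derivative (\<lambda>h. of_real (Re (a * h + b * cnj h) * exp (s z)))) (at z)"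
    by (rule has_derivative_of_real)
  thus ?thesis unfolding has_wd_def
    by (rule has_derivative_eq_rhs)
       (simp only: of_real_mult has_wd_real(2)[OF assms(1)], simp add: fun_eq_iff algebra_simps)
qed

lemma has_wd_id: "has_wd (\<lambda>z. z) 1 0 z"
  by (simp add: has_wd_def)

section \<open>Closure properties of \<open>C^n\<close> functions\<close>

lemma Ck_on_cong:
  assumes "open U" "\<And>z. z \<in> U \<Longrightarrow> f z = g z" "Ck_on n f U" shows "Ck_on n g U"
  using assms(2,3)
proof (induction n arbitrary: f g)
  case 0
  thus ?case by (metis Ck_on.simps(1) continuous_on_cong)
next
  case (Suc n)
  have wd: "has_wd g (d_z f z) (d_zbar f z) z" if "z \<in> U" for z
  proof (rule has_wd_cong[OF differentiable_has_wd assms(1) that])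
    show "f differentiable (at z)" using Suc.prems(2) that by simp
  qed (use Suc.prems in simp)
  hence "d_x f z = d_x g z" "d_y f z = d_y g z" "g differentiable (at z)" if "z \<in> U" for z
    using has_wdD[OF wd[OF that]] has_wdD[OF differentiable_has_wd[of f z]] Suc.prems that by auto
  thus ?case using Suc.IH[of "d_x f" "d_x g"] Suc.IH[of "d_y f" "d_y g"] Suc.prems by auto
qed

lemma Ck_on_subset: "Ck_on n f U \<Longrightarrow> V \<subseteq> U \<Longrightarrow> Ck_on n f V"
  by (induction n arbitrary: f) (auto intro: continuous_on_subset)

lemma Ck_on_Suc_imp: "Ck_on (Suc n) f U \<Longrightarrow> Ck_on n f U"
proof (induction n arbitrary: f)
  case 0
  thus ?case by (auto intro!: continuous_at_imp_continuous_on differentiable_imp_continuous_within)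
next
  case (Suc n)
  thus ?case by (simp only: Ck_on.simps(2)[of "Suc n"] Ck_on.simps(2)[of n f]) blast
qed

lemma Ck_on_continuous: "Ck_on n f U \<Longrightarrow> continuous_on U f"
  by (induction n) (auto intro: Ck_on_Suc_imp simp del: Ck_on.simps(2))

lemma Ck_on_has_wd: "Ck_on (Suc n) f U \<Longrightarrow> z \<in> U \<Longrightarrow> has_wd f (d_z f z) (d_zbar f z) z"
  by (auto intro: differentiable_has_wd)

lemma d_x_eq: "d_x f z = d_z f z + d_zbar f z" and d_y_eq: "d_y f z = \<i> * (d_z f z - d_zbar f z)"
  by (simp_all add: d_z_def d_zbar_def algebra_simps flip: add_divide_distrib diff_divide_distrib)

lemma Ck_on_const: "Ck_on n (\<lambda>_. c) U"
proof (induction n arbitrary: c)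
  case (Suc n)
  have "d_x (\<lambda>_. c) = (\<lambda>_. 0)" "d_y (\<lambda>_. c) = (\<lambda>_. 0)"
    using has_wdD(3,4)[OF has_wd_const[of c]] by auto
  thus ?case using Suc by simp
qed auto

context
  fixes U :: "complex set"
  assumes U: "open U"
begin

lemma Ck_on_SucI:
  assumes "\<And>z. z \<in> U \<Longrightarrow> has_wd f (a z) (b z) z" "Ck_on n (\<lambda>z. a z + b z) U" "Ck_on n (\<lambda>z. \<i> * (a z - b z)) U"
  shows "Ck_on (Suc n) f U"
  unfolding Ck_on.simps
proof (intro conjI ballI)
  show "f differentiable (at z)" if "z \<in> U" for z using has_wdD(5)[OF assms(1)[OF that]] .
  show "Ck_on n (d_x f) U" by (rule Ck_on_cong[OF U _ assms(2)]) (simp add: has_wdD(3)[OF assms(1)])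
  show "Ck_on n (d_y f) U" by (rule Ck_on_cong[OF U _ assms(3)]) (simp add: has_wdD(4)[OF assms(1)])
qed

lemma Ck_on_add: "Ck_on n f U \<Longrightarrow> Ck_on n g U \<Longrightarrow> Ck_on n (\<lambda>z. f z + g z) U"
proof (induction n arbitrary: f g)
  case 0
  thus ?case by (auto intro: continuous_intros)
next
  case (Suc n)
  show ?case
  proof (rule Ck_on_SucI)
    show "has_wd (\<lambda>z. f z + g z) (d_z f z + d_z g z) (d_zbar f z + d_zbar g z) z" if "z \<in> U" for z
      by (intro has_wd_add Ck_on_has_wd[OF Suc.prems(1) that] Ck_on_has_wd[OF Suc.prems(2) that])
    show "Ck_on n (\<lambda>z. (d_z f z + d_z g z) + (d_zbar f z + d_zbar g z)) U"
      using Suc.IH[of "d_x f" "d_x g"] Suc.prems by (simp add: d_x_eq[abs_def] algebra_simps)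
    show "Ck_on n (\<lambda>z. \<i> * ((d_z f z + d_z g z) - (d_zbar f z + d_zbar g z))) U"
      using Suc.IH[of "d_y f" "d_y g"] Suc.prems by (simp add: d_y_eq[abs_def] algebra_simps)
  qed
qed

lemma Ck_on_mult: "Ck_on n f U \<Longrightarrow> Ck_on n g U \<Longrightarrow> Ck_on n (\<lambda>z. f z * g z) U"
proof (induction n arbitrary: f g)
  case 0
  thus ?case by (auto intro: continuous_intros)
next
  case (Suc n)
  have fg: "Ck_on n f U" "Ck_on n g U" using Suc.prems Ck_on_Suc_imp by blast+
  have d: "Ck_on n (d_x f) U" "Ck_on n (d_y f) U" "Ck_on n (d_x g) U" "Ck_on n (d_y g) U" using Suc.prems by auto
  show ?case
  proof (rule Ck_on_SucI)
    show "has_wd (\<lambda>z. f z * g z) (d_z f z * g z + f z * d_z g z) (d_zbar f z * g z + f z * d_zbar g z) z" if "z \<in> U" for z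
      by (intro has_wd_mult Ck_on_has_wd[OF Suc.prems(1) that] Ck_on_has_wd[OF Suc.prems(2) that])
    have "Ck_on n (\<lambda>z. d_x f z * g z + f z * d_x g z) U" by (intro Ck_on_add Suc.IH fg d)
    thus "Ck_on n (\<lambda>z. (d_z f z * g z + f z * d_z g z) + (d_zbar f z * g z + f z * d_zbar g z)) U"
      by (simp add: d_x_eq[abs_def] algebra_simps)
    have "Ck_on n (\<lambda>z. d_y f z * g z + f z * d_y g z) U" by (intro Ck_on_add Suc.IH fg d)
    thus "Ck_on n (\<lambda>z. \<i> * ((d_z f z * g z + f z * d_z g z) - (d_zbar f z * g z + f z * d_zbar g z))) U"
      by (simp add: d_y_eq[abs_def] algebra_simps)
  qed
qed

lemma Ck_on_cmult: "Ck_on n f U \<Longrightarrow> Ck_on n (\<lambda>z. c * f z) U"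
  using Ck_on_mult[OF Ck_on_const] by blast

lemma Ck_on_diff: "Ck_on n f U \<Longrightarrow> Ck_on n g U \<Longrightarrow> Ck_on n (\<lambda>z. f z - g z) U"
  using Ck_on_add[of n f "\<lambda>z. (-1) * g z"] Ck_on_cmult[of n g "-1"] by simp

lemma Ck_on_d_z: "Ck_on (Suc n) f U \<Longrightarrow> Ck_on n (d_z f) U" and Ck_on_d_zbar: "Ck_on (Suc n) f U \<Longrightarrow> Ck_on n (d_zbar f) U"
proof -
  assume f: "Ck_on (Suc n) f U"
  have "Ck_on n (d_x f) U" "Ck_on n (d_y f) U" using f by auto
  hence "Ck_on n (\<lambda>z. (1/2) * (d_x f z - \<i> * d_y f z)) U" "Ck_on n (\<lambda>z. (1/2) * (d_x f z + \<i> * d_y f z)) U"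
    by - (intro Ck_on_cmult Ck_on_diff Ck_on_add; assumption)+
  thus "Ck_on n (d_z f) U" "Ck_on n (d_zbar f) U" by (simp_all add: d_z_def[abs_def] d_zbar_def[abs_def])
qed

lemma Ck_on_holomorphic: "f holomorphic_on U \<Longrightarrow> Ck_on n f U"
proof (induction n arbitrary: f)
  case 0
  thus ?case by (auto intro: holomorphic_on_imp_continuous_on)
next
  case (Suc n)
  have d: "Ck_on n (deriv f) U" using Suc U by (intro Suc.IH holomorphic_deriv)
  show ?case
  proof (rule Ck_on_SucI)
    show "has_wd f (deriv f z) 0 z" if "z \<in> U" for z
      using holomorphic_derivI[OF Suc.prems U that] by (rule has_wd_field_derivative)
  qed (use d Ck_on_cmult[OF d] in simp_all)
qed

lemma Ck_on_cnj: "Ck_on n f U \<Longrightarrow> Ck_on n (\<lambda>z. cnj (f z)) U"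
proof (induction n arbitrary: f)
  case 0
  thus ?case by (auto intro: continuous_intros)
next
  case (Suc n)
  show ?case
  proof (rule Ck_on_SucI)
    show "has_wd (\<lambda>z. cnj (f z)) (cnj (d_zbar f z)) (cnj (d_z f z)) z" if "z \<in> U" for z
      by (intro has_wd_cnj Ck_on_has_wd[OF Suc.prems that])
    show "Ck_on n (\<lambda>z. cnj (d_zbar f z) + cnj (d_z f z)) U"
      using Suc.IH[of "d_x f"] Suc.prems by (simp add: d_x_eq[abs_def] algebra_simps)
    show "Ck_on n (\<lambda>z. \<i> * (cnj (d_zbar f z) - cnj (d_z f z))) U"
      using Suc.IH[of "d_y f"] Suc.prems by (simp add: d_y_eq[abs_def] algebra_simps)
  qed
qed

lemma Ck_on_inverse: "Ck_on n f U \<Longrightarrow> (\<And>z. z \<in> U \<Longrightarrow> f z \<noteq> 0) \<Longrightarrow> Ck_on n (\<lambda>z. inverse (f z)) U"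
proof (induction n arbitrary: f)
  case 0
  thus ?case by (auto intro!: continuous_intros)
next
  case (Suc n)
  have i: "Ck_on n (\<lambda>z. inverse (f z)) U" using Suc Ck_on_Suc_imp by blast
  have d: "Ck_on n (d_x f) U" "Ck_on n (d_y f) U" using Suc.prems by auto
  show ?case
  proof (rule Ck_on_SucI)
    show "has_wd (\<lambda>z. inverse (f z)) (- d_z f z * (inverse (f z) * inverse (f z))) (- d_zbar f z * (inverse (f z) * inverse (f z))) z"
      if "z \<in> U" for z
      by (intro has_wd_inverse Ck_on_has_wd[OF Suc.prems(1) that] Suc.prems(2)[OF that])
    have "Ck_on n (\<lambda>z. (-1) * (d_x f z * (inverse (f z) * inverse (f z)))) U" by (intro Ck_on_cmult Ck_on_mult i d)
    thus "Ck_on n (\<lambda>z. - d_z f z * (inverse (f z) * inverse (f z)) + - d_zbar f z * (inverse (f z) * inverse (f z))) U"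
      by (simp add: d_x_eq[abs_def] algebra_simps)
    have "Ck_on n (\<lambda>z. (-1) * (d_y f z * (inverse (f z) * inverse (f z)))) U" by (intro Ck_on_cmult Ck_on_mult i d)
    thus "Ck_on n (\<lambda>z. \<i> * (- d_z f z * (inverse (f z) * inverse (f z)) - - d_zbar f z * (inverse (f z) * inverse (f z)))) U"
      by (simp add: d_y_eq[abs_def] algebra_simps)
  qed
qed

lemma Ck_on_ln:
  assumes "Ck_on n (\<lambda>z. of_real (s z)) U" "\<And>z. z \<in> U \<Longrightarrow> s z > 0"
  shows "Ck_on n (\<lambda>z. of_real (ln (s z))) U"
proof (cases n)
  case 0
  have "continuous_on U (\<lambda>z. Re (of_real (s z)))" using assms(1) 0 by (intro continuous_intros) auto
  hence "continuous_on U s" by simp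
  hence "continuous_on U (\<lambda>z. ln (s z))" using assms(2) by (intro continuous_intros) (auto simp: less_imp_neq[symmetric])
  thus ?thesis using 0 by (auto intro: continuous_intros)
next
  case (Suc m)
  define f where "f = (\<lambda>z. complex_of_real (s z))"
  have f: "Ck_on (Suc m) f U" using assms(1) Suc by (simp only: f_def)
  have nz: "f z \<noteq> 0" if "z \<in> U" for z using assms(2)[OF that] by (simp add: f_def)
  have i: "Ck_on m (\<lambda>z. inverse (f z)) U" using Ck_on_inverse[OF Ck_on_Suc_imp[OF f]] nz by blast
  have d: "Ck_on m (d_x f) U" "Ck_on m (d_y f) U" using f by auto
  show ?thesis unfolding Suc
  proof (rule Ck_on_SucI)
    show "has_wd (\<lambda>z. of_real (ln (s z))) (d_z f z / of_real (s z)) (d_zbar f z / of_real (s z)) z" if "z \<in> U" for z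
      using has_wd_ln[of s, folded f_def, OF Ck_on_has_wd[OF f that] assms(2)[OF that]] .
    have "Ck_on m (\<lambda>z. d_x f z * inverse (f z)) U" by (intro Ck_on_mult i d)
    thus "Ck_on m (\<lambda>z. d_z f z / of_real (s z) + d_zbar f z / of_real (s z)) U"
      by (simp add: d_x_eq[abs_def] f_def divide_inverse algebra_simps)
    have "Ck_on m (\<lambda>z. d_y f z * inverse (f z)) U" by (intro Ck_on_mult i d)
    thus "Ck_on m (\<lambda>z. \<i> * (d_z f z / of_real (s z) - d_zbar f z / of_real (s z))) U"
      by (simp add: d_y_eq[abs_def] f_def divide_inverse algebra_simps)
  qed
qed

lemma Ck_on_norm_square:
  assumes "f holomorphic_on U" shows "Ck_on n (\<lambda>z. of_real ((cmod (f z))\<^sup>2)) U"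
proof -
  have "Ck_on n (\<lambda>z. f z * cnj (f z)) U" using assms by (intro Ck_on_mult Ck_on_cnj Ck_on_holomorphic)
  thus ?thesis by (simp add: complex_norm_square flip: of_real_power)
qed

end

text \<open>
  In the converse direction \<open>\<Phi> = e\<^bsup>-u/2\<^esup>\<close>; here the Wirtinger derivatives of \<open>-2 log \<Phi>\<close> for a
  Hermitian form \<open>\<Phi>\<close> in a fundamental pair.
\<close>

definition herm :: "real \<Rightarrow> complex \<Rightarrow> real \<Rightarrow> complex \<Rightarrow> complex \<Rightarrow> real" where
  "herm C B A y1 y2 = C * (cmod y1)\<^sup>2 + 2 * Re (B * y2 * cnj y1) + A * (cmod y2)\<^sup>2"

lemma herm_complex: "complex_of_real (herm C B A y1 y2) =
   of_real C * (y1 * cnj y1) + B * (y2 * cnj y1) + cnj B * (y1 * cnj y2) + of_real A * (y2 * cnj y2)"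
proof -
  have "complex_of_real (2 * Re (B * y2 * cnj y1)) = B * (y2 * cnj y1) + cnj B * (y1 * cnj y2)"
    using complex_add_cnj[of "B * y2 * cnj y1"] by (simp add: mult_ac)
  thus ?thesis by (simp add: herm_def complex_norm_square flip: of_real_power)
qed

text \<open>The polarized form: holomorphic arguments first, then those that are conjugated.
  \<open>d_z\<close> differentiates only the former and \<open>d_zbar\<close> only the
  latter.\<close>

definition herm_z :: "real \<Rightarrow> complex \<Rightarrow> real \<Rightarrow> complex \<Rightarrow> complex \<Rightarrow> complex \<Rightarrow> complex \<Rightarrow> complex" where
  "herm_z C B A v1 v2 y1 y2 = of_real C * (v1 * cnj y1) + B * (v2 * cnj y1) + cnj B * (v1 * cnj y2) + of_real A * (v2 * cnj y2)"

lemma herm_eq_herm_z: "complex_of_real (herm C B A y1 y2) = herm_z C B A y1 y2 y1 y2"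
  by (simp add: herm_complex herm_z_def)

lemma has_wd_herm_z:
  assumes "(v1 has_field_derivative v1') (at z)" "(v2 has_field_derivative v2') (at z)"
    "(y1 has_field_derivative y1') (at z)" "(y2 has_field_derivative y2') (at z)"
  shows "has_wd (\<lambda>z. herm_z C B A (v1 z) (v2 z) (y1 z) (y2 z))
     (herm_z C B A v1' v2' (y1 z) (y2 z)) (herm_z C B A (v1 z) (v2 z) y1' y2') z"
proof -
  note w = has_wd_field_derivative[OF assms(1)] has_wd_field_derivative[OF assms(2)]
    has_wd_cnj[OF has_wd_field_derivative[OF assms(3)]] has_wd_cnj[OF has_wd_field_derivative[OF assms(4)]]
  have "has_wd (\<lambda>z. herm_z C B A (v1 z) (v2 z) (y1 z) (y2 z))
    (of_real C * (v1' * cnj (y1 z) + v1 z * cnj 0) + B * (v2' * cnj (y1 z) + v2 z * cnj 0)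
      + cnj B * (v1' * cnj (y2 z) + v1 z * cnj 0) + of_real A * (v2' * cnj (y2 z) + v2 z * cnj 0))
    (of_real C * (0 * cnj (y1 z) + v1 z * cnj y1') + B * (0 * cnj (y1 z) + v2 z * cnj y1')
      + cnj B * (0 * cnj (y2 z) + v1 z * cnj y2') + of_real A * (0 * cnj (y2 z) + v2 z * cnj y2')) z"
    unfolding herm_z_def by (intro has_wd_add has_wd_cmult has_wd_mult w)
  thus ?thesis by (simp add: herm_z_def)
qed

text \<open>With \<open>u = c - 2 ln \<Phi>\<close> the first expression is
  \<open>- 2 \<Phi>_zz / \<Phi>\<close>, and \<open>\<Phi>_zz = Q \<Phi>\<close>. The second is
  \<open>- 2 (\<Phi> \<Phi>_{z zbar} - \<Phi>_z \<Phi>_zbar) / \<Phi>^2\<close>, whose bracket is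
  the determinant of the Hermitian matrix times the squared modulus of the Wronskian.\<close>

lemma herm_metric_derivs:
  assumes fp: "fundamental_pair Q V y1 y2" and V: "open V" and pos: "\<And>z. z \<in> V \<Longrightarrow> herm C B A (y1 z) (y2 z) > 0"
    and u: "\<And>z. z \<in> V \<Longrightarrow> u z = c - 2 * ln (herm C B A (y1 z) (y2 z))" and z: "z \<in> V"
  defines "U \<equiv> \<lambda>z. complex_of_real (u z)"
  shows "d_z (d_z U) z - (1/2) * (d_z U z)\<^sup>2 = - 2 * Q z"
    "d_z (d_zbar U) z = - 2 * (of_real C * of_real A - B * cnj B) / (of_real (herm C B A (y1 z) (y2 z)))\<^sup>2"
proof -
  have o: "ode_solution Q V y1" "ode_solution Q V y2" using fp by (auto simp: fundamental_pair_def)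
  define \<Phi> where "\<Phi> = (\<lambda>z. herm_z C B A (y1 z) (y2 z) (y1 z) (y2 z))"
  define \<Phi>1 where "\<Phi>1 = (\<lambda>z. herm_z C B A (deriv y1 z) (deriv y2 z) (y1 z) (y2 z))"
  define \<Phi>2 where "\<Phi>2 = (\<lambda>z. herm_z C B A (y1 z) (y2 z) (deriv y1 z) (deriv y2 z))"
  define \<Phi>12 where "\<Phi>12 = (\<lambda>z. herm_z C B A (deriv y1 z) (deriv y2 z) (deriv y1 z) (deriv y2 z))"
  note d = ode_solution_derivs[OF o(1) V] ode_solution_derivs[OF o(2) V]
  have w0: "has_wd \<Phi> (\<Phi>1 w) (\<Phi>2 w) w" if "w \<in> V" for w
    unfolding \<Phi>_def \<Phi>1_def \<Phi>2_def by (intro has_wd_herm_z d that)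
  have w1: "has_wd \<Phi>1 (Q w * \<Phi> w) (\<Phi>12 w) w" if "w \<in> V" for w
  proof -
    have "has_wd \<Phi>1 (herm_z C B A (Q w * y1 w) (Q w * y2 w) (y1 w) (y2 w)) (\<Phi>12 w) w"
      unfolding \<Phi>1_def \<Phi>12_def by (intro has_wd_herm_z d that)
    thus ?thesis by (simp add: \<Phi>_def herm_z_def algebra_simps)
  qed
  have w2: "has_wd \<Phi>2 (\<Phi>12 w) (cnj (Q w) * \<Phi> w) w" if "w \<in> V" for w
  proof -
    have "has_wd \<Phi>2 (\<Phi>12 w) (herm_z C B A (y1 w) (y2 w) (Q w * y1 w) (Q w * y2 w)) w"
      unfolding \<Phi>2_def \<Phi>12_def by (intro has_wd_herm_z d that)
    thus ?thesis by (simp add: \<Phi>_def herm_z_def algebra_simps)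
  qed
  have \<Phi>r: "\<Phi> w = of_real (herm C B A (y1 w) (y2 w))" for w by (simp add: \<Phi>_def herm_eq_herm_z)
  have nz: "\<Phi> w \<noteq> 0" if "w \<in> V" for w using pos[OF that] by (simp add: \<Phi>r)
  have wU: "has_wd U (- 2 * (\<Phi>1 w / \<Phi> w)) (- 2 * (\<Phi>2 w / \<Phi> w)) w" if w: "w \<in> V" for w
  proof -
    have "has_wd (\<lambda>z. of_real (herm C B A (y1 z) (y2 z))) (\<Phi>1 w) (\<Phi>2 w) w"
      using w0[OF w] \<Phi>r by (simp add: \<Phi>r[abs_def])
    hence "has_wd (\<lambda>z. of_real c - 2 * of_real (ln (herm C B A (y1 z) (y2 z)))) (0 - 2 * (\<Phi>1 w / \<Phi> w)) (0 - 2 * (\<Phi>2 w / \<Phi> w)) w"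
      unfolding \<Phi>r[of w] by (intro has_wd_diff has_wd_const has_wd_cmult has_wd_ln pos w)
    hence "has_wd U (0 - 2 * (\<Phi>1 w / \<Phi> w)) (0 - 2 * (\<Phi>2 w / \<Phi> w)) w"
      by (rule has_wd_cong[OF _ V w]) (simp add: U_def u)
    thus ?thesis by simp
  qed
  have "has_wd (\<lambda>w. - 2 * (\<Phi>1 w / \<Phi> w)) (- 2 * (((Q z * \<Phi> z) * \<Phi> z - \<Phi>1 z * \<Phi>1 z) / (\<Phi> z)\<^sup>2))
     (- 2 * ((\<Phi>12 z * \<Phi> z - \<Phi>1 z * \<Phi>2 z) / (\<Phi> z)\<^sup>2)) z"
    by (intro has_wd_cmult has_wd_divide w0 w1 nz z)
  hence "has_wd (d_z U) (- 2 * (((Q z * \<Phi> z) * \<Phi> z - \<Phi>1 z * \<Phi>1 z) / (\<Phi> z)\<^sup>2)) (- 2 * ((\<Phi>12 z * \<Phi> z - \<Phi>1 z * \<Phi>2 z) / (\<Phi> z)\<^sup>2)) z"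
    by (rule has_wd_cong[OF _ V z]) (simp add: has_wdD(1)[OF wU])
  from has_wdD(1)[OF this] show "d_z (d_z U) z - (1/2) * (d_z U z)\<^sup>2 = - 2 * Q z"
    using nz[OF z] by (simp add: has_wdD(1)[OF wU[OF z]] field_simps power2_eq_square)
  have "has_wd (\<lambda>w. - 2 * (\<Phi>2 w / \<Phi> w)) (- 2 * ((\<Phi>12 z * \<Phi> z - \<Phi>2 z * \<Phi>1 z) / (\<Phi> z)\<^sup>2))
     (- 2 * (((cnj (Q z) * \<Phi> z) * \<Phi> z - \<Phi>2 z * \<Phi>2 z) / (\<Phi> z)\<^sup>2)) z"
    by (intro has_wd_cmult has_wd_divide w0 w2 nz z)
  hence "has_wd (d_zbar U) (- 2 * ((\<Phi>12 z * \<Phi> z - \<Phi>2 z * \<Phi>1 z) / (\<Phi> z)\<^sup>2)) (- 2 * (((cnj (Q z) * \<Phi> z) * \<Phi> z - \<Phi>2 z * \<Phi>2 z) / (\<Phi> z)\<^sup>2)) z"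
    by (rule has_wd_cong[OF _ V z]) (simp add: has_wdD(2)[OF wU])
  from has_wdD(1)[OF this] have e: "d_z (d_zbar U) z = - 2 * ((\<Phi>12 z * \<Phi> z - \<Phi>2 z * \<Phi>1 z) / (\<Phi> z)\<^sup>2)" .
  have W: "y1 z * deriv y2 z - deriv y1 z * y2 z = 1" using fp z by (auto simp: fundamental_pair_def)
  have "cnj (y1 z * deriv y2 z - deriv y1 z * y2 z) = 1" unfolding W by simp
  hence W': "cnj (y1 z) * cnj (deriv y2 z) - cnj (deriv y1 z) * cnj (y2 z) = 1" by simp
  have "\<Phi>12 z * \<Phi> z - \<Phi>2 z * \<Phi>1 z = (of_real C * of_real A - B * cnj B) *
     (y1 z * deriv y2 z - deriv y1 z * y2 z) * (cnj (y1 z) * cnj (deriv y2 z) - cnj (deriv y1 z) * cnj (y2 z))"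
    unfolding \<Phi>_def \<Phi>1_def \<Phi>2_def \<Phi>12_def herm_z_def by algebra
  thus "d_z (d_zbar U) z = - 2 * (of_real C * of_real A - B * cnj B) / (of_real (herm C B A (y1 z) (y2 z)))\<^sup>2"
    unfolding e W W' \<Phi>r[symmetric] by simp
qed

section \<open>Integration by parts in the plane\<close>

lemma integrable_continuous_compact_support:
  fixes f :: "complex \<Rightarrow> complex"
  assumes "continuous_on UNIV f" "compact K" "\<And>z. z \<notin> K \<Longrightarrow> f z = 0"
  shows "integrable lborel f"
proof -
  have "integrable lborel (\<lambda>z. indicator K z *\<^sub>R f z)"
    using assms by (intro borel_integrable_compact) (auto intro: continuous_on_subset)
  moreover have "(\<lambda>z. indicator K z *\<^sub>R f z) = f" using assms(3) by (auto simp: indicator_def fun_eq_iff)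
  ultimately show ?thesis by simp
qed

lemma lborel_integral_shift:
  fixes f :: "complex \<Rightarrow> complex"
  assumes "f \<in> borel_measurable borel"
  shows "(LINT z|lborel. f (z + c)) = (LINT z|lborel. f z)"
proof -
  have "(LINT z|lborel. f z) = (LINT z|distr lborel borel ((+) c). f z)" by (simp add: lborel_distr_plus)
  also have "\<dots> = (LINT z|lborel. f (c + z))" using assms by (subst integral_distr) auto
  finally show ?thesis by (simp add: add.commute)
qed

lemma integrable_shift:
  fixes f :: "complex \<Rightarrow> complex"
  assumes "integrable lborel f" shows "integrable lborel (\<lambda>z. f (z + c))"
proof -
  have "integrable (distr lborel borel ((+) c)) f" using assms by (simp add: lborel_distr_plus)
  moreover have "f \<in> borel_measurable borel" using borel_measurable_integrable[OF assms] by simp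
  ultimately have "integrable lborel (\<lambda>z. f (c + z))" by (subst (asm) integrable_distr_eq) auto
  thus ?thesis by (simp add: add.commute)
qed

lemma bounded_compact_support:
  fixes f :: "complex \<Rightarrow> complex"
  assumes "continuous_on UNIV f" "compact K" "\<And>z. z \<notin> K \<Longrightarrow> f z = 0"
  obtains B where "B \<ge> 0" "\<And>z. norm (f z) \<le> B"
proof -
  have "compact (f ` K)" using assms by (intro compact_continuous_image) (auto intro: continuous_on_subset)
  hence "bounded (f ` K)" by (rule compact_imp_bounded)
  then obtain B where B: "\<And>z. z \<in> K \<Longrightarrow> norm (f z) \<le> B" by (auto simp: bounded_iff)
  have "norm (f z) \<le> max 0 B" for z using B[of z] assms(3)[of z] by (cases "z \<in> K") auto
  thus ?thesis using that[of "max 0 B"] by auto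
qed

text \<open>
  The integral of a difference quotient vanishes by translation invariance; pass to the limit.
\<close>

lemma integral_directional_derivative:
  assumes wd: "\<And>z. has_wd w (a z) (b z) z" and cont: "continuous_on UNIV a" "continuous_on UNIV b"
    and K: "compact K" "\<And>z. z \<notin> K \<Longrightarrow> w z = 0" "\<And>z. z \<notin> K \<Longrightarrow> a z = 0" "\<And>z. z \<notin> K \<Longrightarrow> b z = 0"
    and e: "norm e = 1"
  shows "(LINT z|lborel. a z * e + b z * cnj e) = 0"
proof -
  have wc: "continuous_on UNIV w"
    using wd by (auto intro!: continuous_at_imp_continuous_on simp: has_wd_def dest!: has_derivative_continuous)
  have wi: "integrable lborel w" by (rule integrable_continuous_compact_support[OF wc K(1,2)])
  obtain Ba where Ba: "Ba \<ge> 0" "\<And>z. norm (a z) \<le> Ba" using bounded_compact_support[OF cont(1) K(1,3)] by blast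
  obtain Bb where Bb: "Bb \<ge> 0" "\<And>z. norm (b z) \<le> Bb" using bounded_compact_support[OF cont(2) K(1,4)] by blast
  define B where "B = Ba + Bb"
  have lip: "norm (w x - w y) \<le> B * norm (x - y)" for x y
  proof (rule differentiable_bound[OF convex_UNIV, where f' = "\<lambda>z h. a z * h + b z * cnj h"])
    fix z :: complex
    show "(w has_derivative (\<lambda>h. a z * h + b z * cnj h)) (at z within UNIV)" using wd by (simp add: has_wd_def)
    show "onorm (\<lambda>h. a z * h + b z * cnj h) \<le> B"
    proof (rule onorm_bound)
      show "0 \<le> B" using Ba Bb by (simp add: B_def)
      fix h :: complex
      have "norm (a z * h + b z * cnj h) \<le> norm (a z) * norm h + norm (b z) * norm h"
        using norm_triangle_ineq[of "a z * h" "b z * cnj h"] by (simp add: norm_mult)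
      also have "\<dots> \<le> B * norm h" using Ba(2)[of z] Bb(2)[of z]
        by (simp add: B_def flip: distrib_right) (intro mult_right_mono add_mono, auto)
      finally show "norm (a z * h + b z * cnj h) \<le> B * norm h" .
    qed
  qed auto
  define t where "t = (\<lambda>n. 1 / real (Suc n))"
  define q where "q = (\<lambda>n z. of_nat (Suc n) * (w (z + of_real (t n) * e) - w z))"
  have t0: "t \<longlonglongrightarrow> 0" unfolding t_def by (rule LIMSEQ_Suc[OF lim_1_over_n])
  have tpos: "t n > 0" "t n \<le> 1" for n by (simp_all add: t_def)
  have nt: "norm (of_real (t n) * e) = t n" for n using tpos[of n] e by (simp add: norm_mult)
  have tn: "real (Suc n) * t n = 1" for n by (simp add: t_def)
  \<comment> \<open>The steps \<open>t n\<close> are at most 1, so every difference quotient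
    vanishes outside \<open>K'\<close>; with the Lipschitz bound this provides the dominating
    function.\<close>
  define K' where "K' = {x + y |x y. x \<in> K \<and> y \<in> cball (0::complex) 1}"
  have K': "compact K'" unfolding K'_def by (rule compact_sums[OF K(1)]) simp
  have "integral\<^sup>L lborel (\<lambda>z. a z * e + b z * cnj e) = 0"
  proof -
    have lim: "(\<lambda>n. LINT z|lborel. q n z) \<longlonglongrightarrow> (LINT z|lborel. a z * e + b z * cnj e)"
    proof (rule integral_dominated_convergence[where w = "\<lambda>z. B * indicator K' z"])
      show "(\<lambda>z. a z * e + b z * cnj e) \<in> borel_measurable lborel"
        using cont by (auto intro!: borel_measurable_continuous_onI continuous_intros)
      have "(\<lambda>z. w (z + of_real (t n) * e)) \<in> borel_measurable borel" for n
        by (intro borel_measurable_continuous_onI continuous_on_compose2[OF wc]) (auto intro!: continuous_intros)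
      moreover have "w \<in> borel_measurable borel" using wc by (rule borel_measurable_continuous_onI)
      ultimately show "q n \<in> borel_measurable lborel" for n unfolding q_def by simp
      have "integrable lborel (\<lambda>z. indicator K' z :: real)"
        using borel_integrable_compact[OF K', of "\<lambda>_. 1 :: real"] by simp
      thus "integrable lborel (\<lambda>z. B * indicator K' z)" by simp
      show "AE z in lborel. norm (q n z) \<le> B * indicator K' z" for n
      proof (rule AE_I2)
        fix z
        show "norm (q n z) \<le> B * indicator K' z"
        proof (cases "z \<in> K'")
          case True
          have "norm (q n z) = real (Suc n) * norm (w (z + of_real (t n) * e) - w z)"
            unfolding q_def norm_mult norm_of_nat ..
          also have "\<dots> \<le> real (Suc n) * (B * norm (of_real (t n) * e))"
            using lip[of "z + of_real (t n) * e" z] by (intro mult_left_mono) auto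
          also have "\<dots> = B * (real (Suc n) * t n)" unfolding nt by (simp only: mult_ac)
          also have "\<dots> = B" unfolding tn by simp
          finally show ?thesis using True by simp
        next
          case False
          have "z \<notin> K"
          proof
            assume "z \<in> K"
            hence "z + 0 \<in> K'" unfolding K'_def by (intro CollectI exI[of _ z] exI[of _ 0]) auto
            thus False using False by simp
          qed
          moreover have "z + of_real (t n) * e \<notin> K"
          proof
            assume "z + of_real (t n) * e \<in> K"
            moreover have "- (of_real (t n) * e) \<in> cball 0 1" using tpos[of n] e by (simp add: norm_mult)
            ultimately have "(z + of_real (t n) * e) + - (of_real (t n) * e) \<in> K'" unfolding K'_def by blast
            thus False using False by simp
          qed
          ultimately show ?thesis using K(2) False by (simp add: q_def)
        qed
      qed
      show "AE z in lborel. (\<lambda>n. q n z) \<longlonglongrightarrow> a z * e + b z * cnj e"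
      proof (rule AE_I2)
        fix z
        define D where "D = a z * e + b z * cnj e"
        have "(\<lambda>h. norm (w (z + h) - w z - (a z * h + b z * cnj h)) / norm h) \<midarrow>0\<rightarrow> 0"
          using wd[of z] unfolding has_wd_def has_derivative_at by blast
        moreover have "filterlim (\<lambda>n. of_real (t n) * e) (at 0) sequentially"
        proof (rule filterlim_atI)
          show "(\<lambda>n. complex_of_real (t n) * e) \<longlonglongrightarrow> 0"
            using tendsto_mult_right[OF tendsto_of_real[OF t0], of e] by (simp add: mult.commute)
          show "\<forall>\<^sub>F n in sequentially. complex_of_real (t n) * e \<noteq> 0"
            using tpos e by (intro always_eventually allI) (auto simp: less_imp_neq[symmetric])
        qed
        ultimately have "(\<lambda>n. norm (w (z + of_real (t n) * e) - w z - (a z * (of_real (t n) * e) + b z * cnj (of_real (t n) * e)))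
            / norm (of_real (t n) * e)) \<longlonglongrightarrow> 0" by (rule filterlim_compose)
        moreover have "norm (w (z + of_real (t n) * e) - w z - (a z * (of_real (t n) * e) + b z * cnj (of_real (t n) * e)))
            / norm (of_real (t n) * e) = norm (q n z - D)" for n
        proof -
          have "q n z - D = of_nat (Suc n) * (w (z + of_real (t n) * e) - w z - (a z * (of_real (t n) * e) + b z * cnj (of_real (t n) * e)))"
            unfolding q_def D_def t_def by (simp add: field_simps del: of_nat_Suc)
          hence "norm (q n z - D) = real (Suc n) * norm (w (z + of_real (t n) * e) - w z - (a z * (of_real (t n) * e) + b z * cnj (of_real (t n) * e)))"
            by (simp only: norm_mult norm_of_nat)
          thus ?thesis unfolding nt by (simp add: t_def)
        qed
        ultimately have "(\<lambda>n. norm (q n z - D)) \<longlonglongrightarrow> 0" by simp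
        hence "(\<lambda>n. q n z - D) \<longlonglongrightarrow> 0" by (rule tendsto_norm_zero_cancel)
        thus "(\<lambda>n. q n z) \<longlonglongrightarrow> a z * e + b z * cnj e" unfolding D_def[symmetric] by (rule LIM_zero_cancel)
      qed
    qed
    have "(LINT z|lborel. q n z) = 0" for n
    proof -
      have "w \<in> borel_measurable borel" using wc by (rule borel_measurable_continuous_onI)
      hence "(LINT z|lborel. w (z + of_real (t n) * e) - w z) = 0"
        using lborel_integral_shift[of w "of_real (t n) * e"] integrable_shift[OF wi] wi
        by (subst Bochner_Integration.integral_diff) auto
      thus ?thesis unfolding q_def by simp
    qed
    hence "(\<lambda>n. 0) \<longlonglongrightarrow> (LINT z|lborel. a z * e + b z * cnj e)" using lim by simp
    thus ?thesis using LIMSEQ_unique[OF _ tendsto_const] by metis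
  qed
  thus ?thesis .
qed

text \<open>The directions 1 and \<open>\<i>\<close> show that the sum and the difference of the two
  integrals vanish.\<close>

lemma integral_d_z_0:
  assumes w: "Ck_on 1 w UNIV" and K: "compact K" "\<And>z. z \<notin> K \<Longrightarrow> w z = 0"
  shows "(LINT z|lborel. d_z w z) = 0" "(LINT z|lborel. d_zbar w z) = 0"
    "integrable lborel (d_z w)" "integrable lborel (d_zbar w)"
proof -
  have wd: "has_wd w (d_z w z) (d_zbar w z) z" for z using Ck_on_has_wd[of 0 w UNIV z] w by simp
  have c: "continuous_on UNIV (d_z w)" "continuous_on UNIV (d_zbar w)"
    using Ck_on_d_z[of UNIV 0 w] Ck_on_d_zbar[of UNIV 0 w] w by simp_all
  have z0: "d_z w z = 0" "d_zbar w z = 0" if "z \<notin> K" for z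
  proof -
    have "has_wd w 0 0 z"
      by (rule has_wd_cong[OF has_wd_const[of 0], of "- K"]) (use that K compact_imp_closed in auto)
    thus "d_z w z = 0" "d_zbar w z = 0" by (auto dest: has_wdD)
  qed
  show i: "integrable lborel (d_z w)" "integrable lborel (d_zbar w)"
    using integrable_continuous_compact_support c z0 K(1) by blast+
  have "(LINT z|lborel. d_z w z * 1 + d_zbar w z * cnj 1) = 0"
    by (rule integral_directional_derivative[OF wd c K z0]) auto
  hence 1: "(LINT z|lborel. d_z w z) + (LINT z|lborel. d_zbar w z) = 0" using i by simp
  have "(LINT z|lborel. d_z w z * \<i> + d_zbar w z * cnj \<i>) = 0"
    by (rule integral_directional_derivative[OF wd c K z0]) auto
  hence "(LINT z|lborel. d_z w z) * \<i> + (LINT z|lborel. d_zbar w z) * (- \<i>) = 0" using i by simp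
  hence 2: "(LINT z|lborel. d_z w z) - (LINT z|lborel. d_zbar w z) = 0"
    by (simp add: mult.commute[of _ \<i>] flip: right_diff_distrib)
  show "(LINT z|lborel. d_z w z) = 0" "(LINT z|lborel. d_zbar w z) = 0" using 1 2 by auto
qed

lemma Ck_on_Un:
  assumes "open U" "open V" "Ck_on n f U" "Ck_on n f V" shows "Ck_on n f (U \<union> V)"
  using assms(3,4)
proof (induction n arbitrary: f)
  case 0
  thus ?case using assms(1,2) by (simp add: continuous_on_open_Un)
next
  case (Suc n)
  show ?case using Suc.prems Suc.IH[of "d_x f"] Suc.IH[of "d_y f"] by auto
qed

text \<open>The plane is covered by the open sets \<open>U\<close> and the complement of
  \<open>K\<close>, and on the second of these the extended product is zero.\<close>

lemma Ck_on_extend_product: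
  assumes U: "open U" and f: "Ck_on n f U" and \<psi>: "Ck_on n \<psi> UNIV"
    and K: "compact K" "K \<subseteq> U" "\<And>z. z \<notin> K \<Longrightarrow> \<psi> z = 0"
  shows "Ck_on n (\<lambda>z. if z \<in> U then f z * \<psi> z else 0) UNIV"
proof -
  have "Ck_on n (\<lambda>z. if z \<in> U then f z * \<psi> z else 0) U"
    by (rule Ck_on_cong[OF U _ Ck_on_mult[OF U f Ck_on_subset[OF \<psi>]]]) auto
  moreover have op: "open (- K)" using K compact_imp_closed by auto
  have "Ck_on n (\<lambda>z. if z \<in> U then f z * \<psi> z else 0) (- K)"
    by (rule Ck_on_cong[OF op _ Ck_on_const[of n 0]]) (use K in auto)
  ultimately have "Ck_on n (\<lambda>z. if z \<in> U then f z * \<psi> z else 0) (U \<union> - K)" using U op Ck_on_Un by blast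
  moreover have "U \<union> - K = UNIV" using K by blast
  ultimately show ?thesis by simp
qed

lemma test_functionD:
  assumes "test_function \<phi>"
  shows "Ck_on n \<phi> UNIV" "compact (closure {z. \<phi> z \<noteq> 0})" "closure {z. \<phi> z \<noteq> 0} \<subseteq> \<H>"
    "z \<notin> closure {z. \<phi> z \<noteq> 0} \<Longrightarrow> \<phi> z = 0"
  using assms closure_subset[of "{z. \<phi> z \<noteq> 0}"] unfolding test_function_def smooth_on_def by blast+

lemma derivs_off_support:
  assumes "closed K" "\<And>z. z \<notin> K \<Longrightarrow> \<phi> z = 0" "z \<notin> K"
  shows "d_z \<phi> z = 0" "d_zbar \<phi> z = 0"
proof -
  have "has_wd \<phi> 0 0 z"
    by (rule has_wd_cong[OF has_wd_const[of 0], of "- K"]) (use assms in auto)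
  thus "d_z \<phi> z = 0" "d_zbar \<phi> z = 0" by (auto dest: has_wdD)
qed

text \<open>The difference of the integrands is
  \<open>d_zbar (v d_z \<phi>) - d_z (\<phi> d_zbar v)\<close>, and each term has integral zero. In
  this order the products of first derivatives cancel without interchanging \<open>d_z\<close> and
  \<open>d_zbar\<close>.\<close>

lemma integration_by_parts:
  assumes U: "open U" and v: "Ck_on 2 v U" and \<phi>: "Ck_on 2 \<phi> UNIV"
    and K: "compact K" "K \<subseteq> U" "\<And>z. z \<notin> K \<Longrightarrow> \<phi> z = 0"
  shows "integrable lborel (\<lambda>z. v z * d_zbar (d_z \<phi>) z)"
    "integrable lborel (\<lambda>z. d_z (d_zbar v) z * \<phi> z)"
    "(LINT z|lborel. v z * d_zbar (d_z \<phi>) z) = (LINT z|lborel. d_z (d_zbar v) z * \<phi> z)"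
proof -
  have cK: "closed K" using K by (simp add: compact_imp_closed)
  have v2: "Ck_on (Suc (Suc 0)) v U" and \<phi>2: "Ck_on (Suc (Suc 0)) \<phi> UNIV" using v \<phi> by (simp_all add: numeral_2_eq_2)
  have v1: "Ck_on 1 v U" "Ck_on 1 (d_zbar v) U" "Ck_on 0 (d_z (d_zbar v)) U"
    using Ck_on_Suc_imp[OF v2] Ck_on_d_zbar[OF U v2] Ck_on_d_z[OF U, of 0 "d_zbar v"] by simp_all
  have \<phi>1: "Ck_on 1 \<phi> UNIV" "Ck_on 1 (d_z \<phi>) UNIV" "Ck_on 0 (d_zbar (d_z \<phi>)) UNIV"
    using Ck_on_Suc_imp[OF \<phi>2] Ck_on_d_z[OF open_UNIV \<phi>2] Ck_on_d_zbar[OF open_UNIV, of 0 "d_z \<phi>"] by simp_all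
  have z1: "d_z \<phi> z = 0" if "z \<notin> K" for z using derivs_off_support(1)[OF cK K(3) that] by simp
  have z2: "d_zbar (d_z \<phi>) z = 0" if "z \<notin> K" for z using derivs_off_support(2)[OF cK z1 that] by simp
  define w1 where "w1 = (\<lambda>z. if z \<in> U then v z * d_z \<phi> z else 0)"
  define w2 where "w2 = (\<lambda>z. if z \<in> U then d_zbar v z * \<phi> z else 0)"
  have w1: "Ck_on 1 w1 UNIV" unfolding w1_def by (rule Ck_on_extend_product[OF U v1(1) \<phi>1(2) K(1,2) z1])
  have w2: "Ck_on 1 w2 UNIV" unfolding w2_def by (rule Ck_on_extend_product[OF U v1(2) \<phi>1(1) K])
  have d1: "d_zbar w1 z = d_zbar v z * d_z \<phi> z + v z * d_zbar (d_z \<phi>) z" for z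
  proof (cases "z \<in> U")
    case True
    have "has_wd v (d_z v z) (d_zbar v z) z" "has_wd (d_z \<phi>) (d_z (d_z \<phi>) z) (d_zbar (d_z \<phi>) z) z"
      using Ck_on_has_wd[of 0 v U z] Ck_on_has_wd[of 0 "d_z \<phi>" UNIV z] v1 \<phi>1 True by simp_all
    from has_wd_cong[OF has_wd_mult[OF this] U True, of w1] show ?thesis
      by (auto simp: w1_def dest: has_wdD)
  next
    case False
    hence "z \<notin> K" using K by blast
    moreover from this have "d_zbar w1 z = 0"
      by (intro derivs_off_support[OF cK]) (auto simp: w1_def z1)
    ultimately show ?thesis using z1 z2 by simp
  qed
  have d2: "d_z w2 z = d_z (d_zbar v) z * \<phi> z + d_zbar v z * d_z \<phi> z" for z
  proof (cases "z \<in> U")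
    case True
    have "has_wd (d_zbar v) (d_z (d_zbar v) z) (d_zbar (d_zbar v) z) z" "has_wd \<phi> (d_z \<phi> z) (d_zbar \<phi> z) z"
      using Ck_on_has_wd[of 0 "d_zbar v" U z] Ck_on_has_wd[of 0 \<phi> UNIV z] v1 \<phi>1 True by simp_all
    from has_wd_cong[OF has_wd_mult[OF this] U True, of w2] show ?thesis
      by (auto simp: w2_def dest: has_wdD)
  next
    case False
    hence "z \<notin> K" using K by blast
    moreover from this have "d_z w2 z = 0"
      by (intro derivs_off_support[OF cK]) (auto simp: w2_def K)
    ultimately show ?thesis using z1 K(3) by simp
  qed
  have i1: "(LINT z|lborel. d_zbar w1 z) = 0" "integrable lborel (d_zbar w1)"
    using integral_d_z_0[OF w1 K(1)] K z1 by (auto simp: w1_def)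
  have i2: "(LINT z|lborel. d_z w2 z) = 0" "integrable lborel (d_z w2)"
    using integral_d_z_0[OF w2 K(1)] K by (auto simp: w2_def)
  have "Ck_on 0 (\<lambda>z. if z \<in> U then v z * d_zbar (d_z \<phi>) z else 0) UNIV"
    by (rule Ck_on_extend_product[OF U _ \<phi>1(3) K(1,2) z2]) (use Ck_on_continuous[OF v] in auto)
  moreover have "(\<lambda>z. if z \<in> U then v z * d_zbar (d_z \<phi>) z else 0) = (\<lambda>z. v z * d_zbar (d_z \<phi>) z)"
    using z2 K(2) by (auto simp: fun_eq_iff)
  ultimately show i3: "integrable lborel (\<lambda>z. v z * d_zbar (d_z \<phi>) z)"
    using integrable_continuous_compact_support[OF _ K(1), of "\<lambda>z. v z * d_zbar (d_z \<phi>) z"] z2 by auto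
  have "Ck_on 0 (\<lambda>z. if z \<in> U then d_z (d_zbar v) z * \<phi> z else 0) UNIV"
    by (rule Ck_on_extend_product[OF U v1(3) _ K]) (use Ck_on_continuous[OF \<phi>] in auto)
  moreover have "(\<lambda>z. if z \<in> U then d_z (d_zbar v) z * \<phi> z else 0) = (\<lambda>z. d_z (d_zbar v) z * \<phi> z)"
    using K(2,3) by (auto simp: fun_eq_iff)
  ultimately show i4: "integrable lborel (\<lambda>z. d_z (d_zbar v) z * \<phi> z)"
    using integrable_continuous_compact_support[OF _ K(1), of "\<lambda>z. d_z (d_zbar v) z * \<phi> z"] K(3) by auto
  have "v z * d_zbar (d_z \<phi>) z - d_z (d_zbar v) z * \<phi> z = d_zbar w1 z - d_z w2 z" for z
    by (simp add: d1 d2)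
  hence "(LINT z|lborel. v z * d_zbar (d_z \<phi>) z - d_z (d_zbar v) z * \<phi> z) = 0"
    using i1 i2 by simp
  thus "(LINT z|lborel. v z * d_zbar (d_z \<phi>) z) = (LINT z|lborel. d_z (d_zbar v) z * \<phi> z)"
    using i3 i4 by simp
qed

section \<open>Bump functions\<close>

text \<open>The family is closed under differentiation, \<open>flat k\<close> having derivative
  \<open>flat (k + 2) - k flat (k + 1)\<close>; so smoothness of \<open>exp (- 1 / x)\<close>
  follows by an induction for all \<open>k\<close> at once.\<close>

definition flat :: "nat \<Rightarrow> real \<Rightarrow> real" where
  "flat k x = (if x > 0 then exp (- 1 / x) / x ^ k else 0)"

lemma flat_nonneg: "flat k x \<ge> 0" and flat_pos: "x > 0 \<Longrightarrow> flat k x > 0"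
  by (simp_all add: flat_def)

text \<open>A single term of the series of \<open>exp (1 / x)\<close>, that of degree
  \<open>k + 2\<close>, is enough. A quadratic bound makes the difference quotient at 0 tend to
  0.\<close>

lemma flat_le_square: "flat k x \<le> fact (k + 2) * x\<^sup>2"
proof (cases "x > 0")
  case True
  have "(1 / x) ^ (k + 2) / fact (k + 2) \<le> exp (1 / x)"
  proof -
    have "(\<Sum>n\<in>{k + 2}. inverse (fact n) *\<^sub>R (1 / x) ^ n) \<le> (\<Sum>n. inverse (fact n) *\<^sub>R (1 / x) ^ n)"
      using True summable_exp_generic[of "1/x"] by (intro sum_le_suminf) auto
    thus ?thesis by (simp add: exp_def divide_inverse mult.commute)
  qed
  moreover have "1 / E \<le> F * P" if "(1 / P) / F \<le> E" "E > 0" "F > 0" "P > 0" for E F P :: real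
    using that by (simp add: field_simps)
  ultimately have "1 / exp (1 / x) \<le> fact (k + 2) * x ^ (k + 2)"
    using True by (simp only: power_one_over) (metis exp_gt_zero fact_gt_zero zero_less_power)
  hence "exp (- 1 / x) \<le> fact (k + 2) * x ^ (k + 2)" by (simp add: exp_minus inverse_eq_divide)
  hence "exp (- 1 / x) \<le> fact (k + 2) * x\<^sup>2 * x ^ k" by (simp only: power_add mult_ac)
  thus ?thesis using True by (simp add: flat_def pos_divide_le_eq)
qed (simp add: flat_def)

lemma flat_deriv: "(flat k has_real_derivative (flat (k + 2) x - real k * flat (k + 1) x)) (at x)"
proof -
  consider "x > 0" | "x < 0" | "x = 0" by linarith
  thus ?thesis
  proof cases
    case 1
    have "((\<lambda>x. exp (- 1 / x) / x ^ k) has_real_derivative (flat (k + 2) x - real k * flat (k + 1) x)) (at x)"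
    proof -
      have e: "((\<lambda>x. exp (- 1 / x)) has_real_derivative exp (- 1 / x) * (1 / x\<^sup>2)) (at x)"
        using 1 by (auto intro!: derivative_eq_intros simp: power2_eq_square)
      have p: "((\<lambda>x. x ^ k) has_real_derivative real k * x ^ (k - 1)) (at x)"
        by (auto intro!: derivative_eq_intros)
      have "x ^ k \<noteq> 0" using 1 by simp
      from DERIV_divide[OF e p this] show ?thesis
        by (rule DERIV_cong) (use 1 in \<open>cases k; simp add: flat_def divide_simps; simp add: algebra_simps power2_eq_square\<close>)
    qed
    thus ?thesis
      by (rule has_field_derivative_transform_within_open[of _ _ _ "{0<..}"]) (use 1 in \<open>auto simp: flat_def\<close>)
  next
    case 2
    have "((\<lambda>x. 0) has_real_derivative 0) (at x)" by simp
    hence "(flat k has_real_derivative 0) (at x)"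
      by (rule has_field_derivative_transform_within_open[of _ _ _ "{..<0}"]) (use 2 in \<open>auto simp: flat_def\<close>)
    thus ?thesis using 2 by (simp add: flat_def)
  next
    case 3
    have "((\<lambda>h. (flat k (0 + h) - flat k 0) / h) \<longlongrightarrow> 0) (at 0)"
    proof (rule Lim_null_comparison)
      show "\<forall>\<^sub>F h in at 0. norm ((flat k (0 + h) - flat k 0) / h) \<le> fact (k + 2) * \<bar>h\<bar>"
      proof (rule always_eventually, rule allI)
        fix h :: real
        show "norm ((flat k (0 + h) - flat k 0) / h) \<le> fact (k + 2) * \<bar>h\<bar>"
        proof (cases "h = 0")
          case False
          have "norm ((flat k (0 + h) - flat k 0) / h) = flat k h / \<bar>h\<bar>"
            using flat_nonneg[of k h] by (simp add: flat_def)
          also have "\<dots> \<le> fact (k + 2) * h\<^sup>2 / \<bar>h\<bar>" using flat_le_square by (intro divide_right_mono) auto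
          also have "\<dots> = fact (k + 2) * \<bar>h\<bar>" using False by (simp add: power2_eq_square abs_if)
          finally show ?thesis .
        qed simp
      qed
      have "((\<lambda>h::real. fact (k + 2) * \<bar>h\<bar>) \<longlongrightarrow> fact (k + 2) * \<bar>0\<bar>) (at 0)" by (intro tendsto_intros)
      thus "((\<lambda>h::real. fact (k + 2) * \<bar>h\<bar>) \<longlongrightarrow> 0) (at 0)" by simp
    qed
    thus ?thesis using 3 by (simp add: DERIV_def flat_def)
  qed
qed

lemma Ck_on_flat:
  assumes "\<And>n. Ck_on n (\<lambda>z. of_real (s z)) UNIV"
  shows "Ck_on n (\<lambda>z. of_real (flat k (s z))) UNIV"
proof (induction n arbitrary: k)
  case 0
  have "continuous_on UNIV (\<lambda>z. Re (of_real (s z)))" using assms[of 0] by (intro continuous_intros) auto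
  hence "continuous_on UNIV s" by simp
  moreover have "continuous_on UNIV (flat k)"
    by (intro continuous_at_imp_continuous_on ballI DERIV_isCont[OF flat_deriv])
  ultimately have "continuous_on UNIV (\<lambda>z. flat k (s z))" using continuous_on_compose2 by blast
  thus ?case by (auto intro: continuous_intros)
next
  case (Suc n)
  define f where "f = (\<lambda>z. complex_of_real (s z))"
  have f: "Ck_on (Suc n) f UNIV" using assms by (simp only: f_def)
  define g where "g = (\<lambda>z. complex_of_real (flat (k + 2) (s z)) + (- of_nat k) * complex_of_real (flat (k + 1) (s z)))"
  have g: "Ck_on n g UNIV" unfolding g_def by (intro Ck_on_add Ck_on_cmult Suc.IH open_UNIV)
  show ?case
  proof (rule Ck_on_SucI[OF open_UNIV])
    fix z
    have wd: "has_wd f (d_z f z) (d_zbar f z) z" using Ck_on_has_wd[OF f] by simp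
    define D where "D = (\<lambda>h. Re (d_z f z * h + d_zbar f z * cnj h))"
    have 1: "(s has_derivative D) (at z)" "complex_of_real (D h) = d_z f z * h + d_zbar f z * cnj h" for h
      using has_wd_real[of s, folded f_def, OF wd] by (simp_all only: D_def)
    have "((\<lambda>z. flat k (s z)) has_derivative (\<lambda>h. D h * (flat (k + 2) (s z) - real k * flat (k + 1) (s z)))) (at z)"
      using has_derivative_compose[OF 1(1) flat_deriv[of k "s z", unfolded has_field_derivative_def]] by (simp add: mult.commute)
    hence "((\<lambda>z. complex_of_real (flat k (s z))) has_derivative (\<lambda>h. of_real (D h * (flat (k + 2) (s z) - real k * flat (k + 1) (s z))))) (at z)"
      by (rule has_derivative_of_real)
    thus "has_wd (\<lambda>z. of_real (flat k (s z))) (g z * d_z f z) (g z * d_zbar f z) z"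
      unfolding has_wd_def
      by (rule has_derivative_eq_rhs) (simp only: of_real_mult 1(2), simp add: fun_eq_iff g_def algebra_simps)
  next
    have d: "Ck_on n (d_x f) UNIV" "Ck_on n (d_y f) UNIV" using f by auto
    show "Ck_on n (\<lambda>z. g z * d_z f z + g z * d_zbar f z) UNIV"
      using Ck_on_mult[OF open_UNIV g d(1)] by (simp add: d_x_eq[abs_def] algebra_simps)
    show "Ck_on n (\<lambda>z. \<i> * (g z * d_z f z - g z * d_zbar f z)) UNIV"
      using Ck_on_mult[OF open_UNIV g d(2)] by (simp add: d_y_eq[abs_def] algebra_simps)
  qed
qed

lemma bump_function:
  assumes "r > 0" "cball p r \<subseteq> \<H>"
  obtains b where "test_function (\<lambda>z. complex_of_real (b z))" "\<And>z. b z \<ge> 0" "b p > 0" "\<And>z. z \<notin> cball p r \<Longrightarrow> b z = 0"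
    "continuous_on UNIV b"
proof -
  define s where "s = (\<lambda>z. r\<^sup>2 - (cmod (z - p))\<^sup>2)"
  define b where "b = (\<lambda>z. flat 0 (s z))"
  have s: "Ck_on n (\<lambda>z. complex_of_real (s z)) UNIV" for n
    unfolding s_def of_real_diff by (intro Ck_on_diff Ck_on_const Ck_on_norm_square open_UNIV holomorphic_intros)
  have C: "Ck_on n (\<lambda>z. complex_of_real (b z)) UNIV" for n unfolding b_def by (rule Ck_on_flat[OF s])
  have z: "b z = 0" if "z \<notin> cball p r" for z
  proof -
    have "r \<le> cmod (z - p)" using that by (simp add: dist_norm norm_minus_commute)
    hence "r\<^sup>2 \<le> (cmod (z - p))\<^sup>2" using assms(1) by (intro power_mono) auto
    thus ?thesis by (simp add: b_def s_def flat_def)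
  qed
  have "{z. complex_of_real (b z) \<noteq> 0} \<subseteq> cball p r"
    using z by (metis (mono_tags, lifting) mem_Collect_eq of_real_0 subsetI)
  hence cl: "closure {z. complex_of_real (b z) \<noteq> 0} \<subseteq> cball p r" by (intro closure_minimal) auto
  have "compact (closure {z. complex_of_real (b z) \<noteq> 0})"
    using cl compact_cball closed_closure by (metis compact_Int_closed inf.absorb_iff2)
  hence "test_function (\<lambda>z. complex_of_real (b z))"
    unfolding test_function_def smooth_on_def using C cl assms(2) by blast
  moreover have "continuous_on UNIV (\<lambda>z. Re (complex_of_real (b z)))"
    by (rule continuous_on_Re[OF Ck_on_continuous[OF C[of 0]]])
  hence "continuous_on UNIV b" by simp
  moreover have "b p > 0" using assms(1) by (simp add: b_def s_def flat_pos)
  ultimately show ?thesis using that flat_nonneg z by (metis b_def)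
qed

section \<open>The logarithmic potential\<close>

text \<open>Tonelli: for fixed \<open>t\<close> the points with \<open>norm z \<le> t\<close> form a
  disc of area \<open>pi t^2\<close>. This computes plane integrals of radial functions given as
  integrals of \<open>g\<close> from the radius to infinity.\<close>

lemma nn_integral_layer:
  fixes g :: "real \<Rightarrow> real"
  assumes [measurable]: "g \<in> borel_measurable borel"
  shows "(\<integral>\<^sup>+z. (\<integral>\<^sup>+t. ennreal (g t) * indicator {norm (z::complex)..} t \<partial>lborel) \<partial>lborel) =
     (\<integral>\<^sup>+t. ennreal (g t) * (ennreal (pi * t\<^sup>2) * indicator {0..} t) \<partial>lborel)"
proof -
  have ind: "(indicator {norm (z::complex)..} t :: ennreal) = indicator {x \<in> space (lborel \<Otimes>\<^sub>M lborel). norm (fst x) \<le> snd x} (z, t)" for z :: complex and t :: real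
    by (auto simp: indicator_def space_pair_measure)
  have m: "(\<lambda>(z::complex, t). ennreal (g t) * indicator {norm z..} t) \<in> borel_measurable (lborel \<Otimes>\<^sub>M lborel)"
    unfolding ind by measurable
  have "(\<integral>\<^sup>+z. (\<integral>\<^sup>+t. ennreal (g t) * indicator {norm (z::complex)..} t \<partial>lborel) \<partial>lborel)
     = (\<integral>\<^sup>+t. (\<integral>\<^sup>+z. ennreal (g t) * indicator {norm (z::complex)..} t \<partial>lborel) \<partial>lborel)"
    using lborel_pair.Fubini'[OF m] by simp
  also have "\<dots> = (\<integral>\<^sup>+t. ennreal (g t) * (ennreal (pi * t\<^sup>2) * indicator {0..} t) \<partial>lborel)"
  proof (rule nn_integral_cong)
    fix t :: real
    have "(\<integral>\<^sup>+z. ennreal (g t) * indicator {norm (z::complex)..} t \<partial>lborel) =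
        (\<integral>\<^sup>+z. ennreal (g t) * indicator (cball (0::complex) t) z \<partial>lborel)"
      by (intro nn_integral_cong) (auto simp: indicator_def)
    also have "\<dots> = ennreal (g t) * emeasure lborel (cball (0::complex) t)"
      by (simp add: nn_integral_cmult_indicator)
    also have "emeasure lborel (cball (0::complex) t) = ennreal (pi * t\<^sup>2) * indicator {0..} t"
      using emeasure_cball[of t "0::complex"] by (cases "t \<ge> 0") (auto simp: unit_ball_vol_2)
    finally show "(\<integral>\<^sup>+z. ennreal (g t) * indicator {norm (z::complex)..} t \<partial>lborel) =
        ennreal (g t) * (ennreal (pi * t\<^sup>2) * indicator {0..} t)" .
  qed
  finally show ?thesis .
qed

text \<open>\<open>g\<close> is minus the derivative of the radial profile
  \<open>1 / (1 + t^2)^2\<close>; after the layer formula \<open>pi t^4 / (1 + t^2)^2\<close> is a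
  primitive with limit \<open>pi\<close>. Up to a constant the integrand is the rescaled Laplacian
  of the regularized potential.\<close>

lemma integral_poisson_type:
  "integrable lborel (\<lambda>z::complex. 1 / (1 + (cmod z)\<^sup>2)\<^sup>2)" "(LINT z|lborel. 1 / (1 + (cmod z)\<^sup>2)\<^sup>2) = pi"
proof -
  define g where "g = (\<lambda>t::real. 4 * t / (1 + t\<^sup>2) ^ 3)"
  have [measurable]: "g \<in> borel_measurable borel" unfolding g_def by simp
  have pos: "1 + t\<^sup>2 > (0::real)" for t by (simp add: add_pos_nonneg)
  have inner: "(\<integral>\<^sup>+t. ennreal (g t) * indicator {norm z..} t \<partial>lborel) = ennreal (1 / (1 + (cmod z)\<^sup>2)\<^sup>2)" for z :: complex
  proof -
    have "(\<integral>\<^sup>+t. ennreal (g t) * indicator {norm z..} t \<partial>lborel) = ennreal (0 - (- 1 / (1 + (norm z)\<^sup>2)\<^sup>2))"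
    proof (rule nn_integral_FTC_atLeast)
      fix x :: real
      have nz: "1 + x\<^sup>2 \<noteq> 0" using pos[of x] by simp
      show "((\<lambda>t. - 1 / (1 + t\<^sup>2)\<^sup>2) has_real_derivative g x) (at x)"
      proof -
        have "((\<lambda>y::real. - 1 / y\<^sup>2) has_real_derivative 2 / y ^ 3) (at y)" if "y \<noteq> 0" for y
          using that by (auto intro!: derivative_eq_intros simp: divide_simps power2_eq_square power3_eq_cube)
        from this[OF nz] have "((\<lambda>t::real. - 1 / (1 + t\<^sup>2)\<^sup>2) has_real_derivative 2 / (1 + x\<^sup>2) ^ 3 * (2 * x)) (at x)"
          by (rule DERIV_chain2) (auto intro!: derivative_eq_intros)
        thus ?thesis by (simp add: g_def)
      qed
      show "norm z \<le> x \<Longrightarrow> 0 \<le> g x" using pos[of x] order_trans[OF norm_ge_zero[of z], of x] by (simp add: g_def)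
      show "((\<lambda>t::real. - 1 / (1 + t\<^sup>2)\<^sup>2) \<longlongrightarrow> 0) at_top" by real_asymp
    qed simp
    thus ?thesis by simp
  qed
  have "(\<integral>\<^sup>+z. ennreal (1 / (1 + (cmod z)\<^sup>2)\<^sup>2) \<partial>lborel) = (\<integral>\<^sup>+t. ennreal (g t) * (ennreal (pi * t\<^sup>2) * indicator {0..} t) \<partial>lborel)"
    using nn_integral_layer[of g] by (simp add: inner)
  also have "\<dots> = (\<integral>\<^sup>+t. ennreal (4 * pi * t ^ 3 / (1 + t\<^sup>2) ^ 3) * indicator {0..} t \<partial>lborel)"
  proof (intro nn_integral_cong)
    fix t :: real
    show "ennreal (g t) * (ennreal (pi * t\<^sup>2) * indicator {0..} t) = ennreal (4 * pi * t ^ 3 / (1 + t\<^sup>2) ^ 3) * indicator {0..} t"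
      using pos[of t] by (cases "t \<ge> 0") (auto simp: g_def power2_eq_square power3_eq_cube mult_ac simp flip: ennreal_mult)
  qed
  also have "\<dots> = ennreal (pi - pi * 0 ^ 4 / (1 + 0\<^sup>2)\<^sup>2)"
  proof (rule nn_integral_FTC_atLeast)
    fix x :: real
    have nz: "1 + x\<^sup>2 \<noteq> 0" using pos[of x] by simp
    show "((\<lambda>t. pi * t ^ 4 / (1 + t\<^sup>2)\<^sup>2) has_real_derivative 4 * pi * x ^ 3 / (1 + x\<^sup>2) ^ 3) (at x)"
      using nz by (auto intro!: derivative_eq_intros simp: divide_simps) (simp add: eval_nat_numeral algebra_simps)
    show "0 \<le> x \<Longrightarrow> 0 \<le> 4 * pi * x ^ 3 / (1 + x\<^sup>2) ^ 3" using pos[of x] by simp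
    show "((\<lambda>t::real. pi * t ^ 4 / (1 + t\<^sup>2)\<^sup>2) \<longlongrightarrow> pi) at_top" by real_asymp
  qed simp
  finally have *: "(\<integral>\<^sup>+z. ennreal (1 / (1 + (cmod z)\<^sup>2)\<^sup>2) \<partial>lborel) = ennreal pi" by simp
  show "integrable lborel (\<lambda>z::complex. 1 / (1 + (cmod z)\<^sup>2)\<^sup>2)"
    by (rule integrableI_nn_integral_finite[OF _ _ *]) auto
  show "(LINT z|lborel. 1 / (1 + (cmod z)\<^sup>2)\<^sup>2) = pi"
    by (rule integral_eq_nn_integral[THEN trans]) (auto simp: *)
qed

definition neg_log :: "complex \<Rightarrow> real" where
  "neg_log z = (if z \<noteq> 0 \<and> cmod z \<le> 1 then - ln (cmod z) else 0)"

text \<open>On the unit disc \<open>- ln (norm z)\<close> is the integral of \<open>1 / t\<close>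
  from \<open>norm z\<close> to 1; the layer formula leaves \<open>pi t\<close> on the unit
  interval, which is at most \<open>pi\<close>.\<close>

lemma integrable_neg_log: "integrable lborel neg_log"
proof -
  define g where "g = (\<lambda>t::real. if 0 < t \<and> t \<le> 1 then 1 / t else 0)"
  have [measurable]: "g \<in> borel_measurable borel" unfolding g_def by measurable
  have m: "neg_log \<in> borel_measurable lborel" unfolding neg_log_def[abs_def] by measurable
  have nn: "neg_log z \<ge> 0" for z by (simp add: neg_log_def)
  have le: "ennreal (neg_log z) \<le> (\<integral>\<^sup>+t. ennreal (g t) * indicator {norm z..} t \<partial>lborel)" for z
  proof (cases "z \<noteq> 0 \<and> cmod z \<le> 1")
    case True
    have "ennreal (neg_log z) = ennreal (ln 1 - ln (cmod z))" using True by (simp add: neg_log_def)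
    also have "\<dots> = (\<integral>\<^sup>+t. ennreal (1 / t) * indicator {norm z..1} t \<partial>lborel)"
    proof (rule nn_integral_FTC_Icc[symmetric])
      show "norm z \<le> 1" using True by simp
      show "x \<in> {cmod z..1} \<Longrightarrow> (ln has_real_derivative 1 / x) (at x)" for x :: real
        using True less_le_trans[of 0 "cmod z" x] by (auto intro!: derivative_eq_intros)
      show "x \<in> {cmod z..1} \<Longrightarrow> 0 \<le> 1 / x" for x :: real
        using order_trans[OF norm_ge_zero[of z], of x] by simp
    qed simp
    also have "\<dots> \<le> (\<integral>\<^sup>+t. ennreal (g t) * indicator {norm z..} t \<partial>lborel)"
    proof (rule nn_integral_mono)
      fix t :: real
      have "cmod z \<le> t \<Longrightarrow> 0 < t" using True by (meson less_le_trans zero_less_norm_iff)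
      thus "ennreal (1 / t) * indicator {cmod z..1} t \<le> ennreal (g t) * indicator {cmod z..} t"
        by (auto simp: indicator_def g_def)
    qed
    finally show ?thesis .
  qed (auto simp: neg_log_def)
  have "(\<integral>\<^sup>+z. ennreal (neg_log z) \<partial>lborel) \<le> (\<integral>\<^sup>+t. ennreal (g t) * (ennreal (pi * t\<^sup>2) * indicator {0..} t) \<partial>lborel)"
    unfolding nn_integral_layer[of g, symmetric, simplified] by (intro nn_integral_mono le)
  also have "\<dots> \<le> (\<integral>\<^sup>+t. ennreal pi * indicator {0..1::real} t \<partial>lborel)"
  proof (rule nn_integral_mono)
    fix t :: real
    show "ennreal (g t) * (ennreal (pi * t\<^sup>2) * indicator {0..} t) \<le> ennreal pi * indicator {0..1} t"
    proof (cases "0 < t \<and> t \<le> 1")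
      case True
      have "1 / t * (pi * t\<^sup>2) = pi * t" using True by (simp add: power2_eq_square)
      also have "\<dots> \<le> pi" using True by simp
      finally have "ennreal (1 / t * (pi * t\<^sup>2)) \<le> ennreal pi" by (rule ennreal_leI)
      moreover have "ennreal (1 / t) * ennreal (pi * t\<^sup>2) = ennreal (1 / t * (pi * t\<^sup>2))"
        by (rule ennreal_mult[symmetric]) (use True in auto)
      moreover have "g t = 1 / t" "indicator {0..} t = (1 :: ennreal)" "indicator {0..1} t = (1 :: ennreal)"
        using True by (auto simp: g_def)
      ultimately show ?thesis by (simp only: mult_1_right)
    next
      case False
      hence "g t = 0" by (simp only: g_def if_False)
      thus ?thesis by simp
    qed
  qed
  also have "\<dots> < \<infinity>" by (simp add: nn_integral_cmult_indicator ennreal_mult_less_top)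
  finally have "(\<integral>\<^sup>+z. ennreal (neg_log z) \<partial>lborel) < \<infinity>" .
  thus ?thesis using m nn by (intro integrableI_nonneg) auto
qed

text \<open>Near zero the logarithm is controlled by its integrable singular part, away from zero by
  the square. The right side also dominates the regularized potentials, uniformly in the
  parameter.\<close>

lemma abs_ln_norm_le: "\<bar>ln (cmod w)\<bar> \<le> neg_log w + (cmod w)\<^sup>2"
proof (cases "w = 0 \<or> cmod w \<le> 1")
  case False
  hence "ln (cmod w) \<ge> 0" "ln (cmod w) \<le> cmod w" "cmod w \<le> (cmod w)\<^sup>2"
    using ln_le_minus_one[of "cmod w"] by (auto simp: power2_eq_square)
  thus ?thesis using False by (simp add: neg_log_def)
qed (auto simp: neg_log_def)

lemma integrable_log_times_compact_support:
  fixes \<psi> :: "complex \<Rightarrow> complex"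
  assumes \<psi>: "continuous_on UNIV \<psi>" "compact K" "\<And>z. z \<notin> K \<Longrightarrow> \<psi> z = 0"
  shows "integrable lborel (\<lambda>z. of_real (ln (cmod (z - p))) * \<psi> z)"
    "integrable lborel (\<lambda>z. (neg_log (z - p) + (cmod (z - p))\<^sup>2) * cmod (\<psi> z))"
proof -
  have m [measurable]: "\<psi> \<in> borel_measurable borel" using \<psi>(1) by (rule borel_measurable_continuous_onI)
  obtain B where B: "B \<ge> 0" "\<And>z. norm (\<psi> z) \<le> B" using bounded_compact_support[OF \<psi>] by blast
  have "integrable (distr lborel borel ((+) (- p))) neg_log" using integrable_neg_log by (simp add: lborel_distr_plus)
  hence nl: "integrable lborel (\<lambda>z. neg_log (z - p))"
    by (subst (asm) integrable_distr_eq) (use borel_measurable_integrable[OF integrable_neg_log] in auto)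
  have 1: "integrable lborel (\<lambda>z. neg_log (z - p) * cmod (\<psi> z))"
  proof (rule Bochner_Integration.integrable_bound)
    show "integrable lborel (\<lambda>z. B * neg_log (z - p))" using nl by simp
    show "(\<lambda>z. neg_log (z - p) * cmod (\<psi> z)) \<in> borel_measurable lborel"
      using borel_measurable_integrable[OF nl] by simp
    show "AE z in lborel. norm (neg_log (z - p) * cmod (\<psi> z)) \<le> norm (B * neg_log (z - p))"
    proof (rule AE_I2)
      fix z
      have "neg_log (z - p) \<ge> 0" by (simp add: neg_log_def)
      thus "norm (neg_log (z - p) * cmod (\<psi> z)) \<le> norm (B * neg_log (z - p))"
        using B mult_left_mono[OF B(2)[of z], of "neg_log (z - p)"] by (simp add: abs_mult mult.commute)
    qed
  qed
  have 2: "integrable lborel (\<lambda>z. (cmod (z - p))\<^sup>2 * cmod (\<psi> z))"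
  proof -
    have "integrable lborel (\<lambda>z. of_real ((cmod (z - p))\<^sup>2 * cmod (\<psi> z)) :: complex)"
      by (rule integrable_continuous_compact_support[OF _ \<psi>(2)])
         (use \<psi> in \<open>auto intro!: continuous_intros\<close>)
    thus ?thesis using integrable_Re by fastforce
  qed
  show 3: "integrable lborel (\<lambda>z. (neg_log (z - p) + (cmod (z - p))\<^sup>2) * cmod (\<psi> z))"
    using 1 2 by (simp add: distrib_right)
  show "integrable lborel (\<lambda>z. of_real (ln (cmod (z - p))) * \<psi> z)"
  proof (rule Bochner_Integration.integrable_bound[OF 3])
    show "AE z in lborel. norm (of_real (ln (cmod (z - p))) * \<psi> z) \<le> norm ((neg_log (z - p) + (cmod (z - p))\<^sup>2) * cmod (\<psi> z))"
    proof (rule AE_I2)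
      fix z
      have "\<bar>ln (cmod (z - p))\<bar> * cmod (\<psi> z) \<le> (neg_log (z - p) + (cmod (z - p))\<^sup>2) * cmod (\<psi> z)"
        by (intro mult_right_mono abs_ln_norm_le) auto
      thus "norm (of_real (ln (cmod (z - p))) * \<psi> z) \<le> norm ((neg_log (z - p) + (cmod (z - p))\<^sup>2) * cmod (\<psi> z))"
        by (simp add: norm_mult)
    qed
  qed measurable
qed

lemma integral_scale_shift:
  fixes f :: "complex \<Rightarrow> complex"
  assumes [measurable]: "f \<in> borel_measurable borel" and e: "e > 0"
  shows "(LINT z|lborel. f z) = (LINT z|lborel. of_real (e\<^sup>2) * f (p + of_real e * z))"
proof -
  have "(LINT z|lborel. f z) = (LINT z|density (distr lborel borel (\<lambda>x. p + e *\<^sub>R x)) (\<lambda>_. ennreal (\<bar>e\<bar> ^ DIM(complex))). f z)"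
    using lborel_affine[of e p] e by simp
  also have "\<dots> = (LINT z|distr lborel borel (\<lambda>x. p + e *\<^sub>R x). (\<bar>e\<bar> ^ DIM(complex)) *\<^sub>R f z)"
    by (rule integral_density) auto
  also have "\<dots> = (LINT z|lborel. (\<bar>e\<bar> ^ DIM(complex)) *\<^sub>R f (p + e *\<^sub>R z))"
    by (subst integral_distr) auto
  finally show ?thesis by (simp add: scaleR_conv_of_real power2_eq_square)
qed

text \<open>
  The potential \<open>log |z - p|\<close> is regularized to \<open>log (|z - p|\<^sup>2 + \<epsilon>\<^sup>2) / 2\<close>, whose Laplacian is an
  approximate identity.
\<close>

lemma log_potential:
  fixes \<phi> :: "complex \<Rightarrow> complex"
  assumes \<phi>: "Ck_on 2 \<phi> UNIV" and K: "compact K" "\<And>z. z \<notin> K \<Longrightarrow> \<phi> z = 0"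
  shows "integrable lborel (\<lambda>z. of_real (ln (cmod (z - p))) * d_zbar (d_z \<phi>) z)" (is ?int)
    "(LINT z|lborel. of_real (ln (cmod (z - p))) * d_zbar (d_z \<phi>) z) = of_real (pi / 2) * \<phi> p"
proof -
  define \<psi> where "\<psi> = d_zbar (d_z \<phi>)"
  have cK: "closed K" using K by (simp add: compact_imp_closed)
  have z1: "d_z \<phi> z = 0" if "z \<notin> K" for z using derivs_off_support(1)[OF cK K(2) that] by simp
  have z2: "\<psi> z = 0" if "z \<notin> K" for z unfolding \<psi>_def using derivs_off_support(2)[OF cK z1 that] by simp
  have "Ck_on (Suc (Suc 0)) \<phi> UNIV" using \<phi> by (simp add: numeral_2_eq_2)
  hence "Ck_on (Suc 0) (d_z \<phi>) UNIV" by (rule Ck_on_d_z[OF open_UNIV])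
  hence "Ck_on 0 \<psi> UNIV" unfolding \<psi>_def by (rule Ck_on_d_zbar[OF open_UNIV])
  hence \<psi>c: "continuous_on UNIV \<psi>" by simp
  have \<phi>c: "continuous_on UNIV \<phi>" using \<phi> by (rule Ck_on_continuous)
  have [measurable]: "\<psi> \<in> borel_measurable borel" "\<phi> \<in> borel_measurable borel"
    using \<psi>c \<phi>c by (auto intro: borel_measurable_continuous_onI)
  show ?int using integrable_log_times_compact_support(1)[OF \<psi>c K(1) z2] by (simp add: \<psi>_def)
  define \<epsilon> where "\<epsilon> = (\<lambda>n. 1 / real (Suc n))"
  have e0: "\<epsilon> \<longlonglongrightarrow> 0" unfolding \<epsilon>_def by (rule LIMSEQ_Suc[OF lim_1_over_n])
  have e: "\<epsilon> n > 0" "\<epsilon> n \<le> 1" for n by (simp_all add: \<epsilon>_def)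
  define s where "s = (\<lambda>n z. (cmod (z - p))\<^sup>2 + (\<epsilon> n)\<^sup>2)"
  have spos: "s n z > 0" for n z unfolding s_def using e[of n] by (intro add_nonneg_pos) auto
  define L where "L = (\<lambda>n z. complex_of_real (ln (s n z) / 2))"
  have sC: "Ck_on m (\<lambda>z. of_real (s n z)) UNIV" for n m
    unfolding s_def of_real_add by (intro Ck_on_add Ck_on_const Ck_on_norm_square open_UNIV holomorphic_intros)
  have LC: "Ck_on m (L n) UNIV" for n m
  proof -
    have "Ck_on m (\<lambda>z. (1/2) * of_real (ln (s n z))) UNIV"
      by (intro Ck_on_cmult Ck_on_ln sC spos open_UNIV)
    thus ?thesis by (simp add: L_def)
  qed
  have swd: "has_wd (\<lambda>z. of_real (s n z)) (cnj (z - p)) (z - p) z" for n z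
  proof -
    have w: "has_wd (\<lambda>z. z - p) 1 0 z" using has_wd_diff[OF has_wd_id has_wd_const[of p]] by simp
    have "has_wd (\<lambda>z. (z - p) * cnj (z - p) + of_real ((\<epsilon> n)\<^sup>2)) ((1 * cnj (z - p) + (z - p) * cnj 0) + 0) ((0 * cnj (z - p) + (z - p) * cnj 1) + 0) z"
      by (intro has_wd_add has_wd_mult has_wd_const w has_wd_cnj)
    moreover have "complex_of_real (s n z) = (z - p) * cnj (z - p) + of_real ((\<epsilon> n)\<^sup>2)" for z
      unfolding s_def of_real_add complex_norm_square ..
    ultimately show ?thesis by simp
  qed
  \<comment> \<open>Since \<open>s\<close> exceeds \<open>|z - p|^2\<close> by
    \<open>\<epsilon>^2\<close>, the quotient rule leaves \<open>\<epsilon>^2 / s^2\<close>; the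
    factor 1/2 is that of the regularized logarithm.\<close>
  have dL: "d_z (d_zbar (L n)) z = of_real ((\<epsilon> n)\<^sup>2 / (2 * (s n z)\<^sup>2))" for n z
  proof -
    have 1: "has_wd (L n) ((1/2) * (cnj (z - p) / of_real (s n z))) ((1/2) * ((z - p) / of_real (s n z))) z" for z
      using has_wd_cmult[OF has_wd_ln[OF swd spos], of "1/2"] by (simp add: L_def)
    have "has_wd (\<lambda>z. z - p) 1 0 z" using has_wd_diff[OF has_wd_id has_wd_const[of p]] by simp
    from has_wd_cmult[OF has_wd_divide[OF this swd], of n "1/2"] spos[of n z]
    have "has_wd (\<lambda>z. (1/2) * ((z - p) / of_real (s n z))) ((1/2) * ((1 * of_real (s n z) - (z - p) * cnj (z - p)) / (of_real (s n z))\<^sup>2))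
       ((1/2) * ((0 * of_real (s n z) - (z - p) * (z - p)) / (of_real (s n z))\<^sup>2)) z" by simp
    hence "d_z (\<lambda>z. (1/2) * ((z - p) / of_real (s n z))) z = (1/2) * ((1 * of_real (s n z) - (z - p) * cnj (z - p)) / (of_real (s n z))\<^sup>2)"
      by (rule has_wdD)
    moreover have "d_zbar (L n) = (\<lambda>z. (1/2) * ((z - p) / of_real (s n z)))" using has_wdD(2)[OF 1] by auto
    moreover have "of_real (s n z) - (z - p) * cnj (z - p) = of_real ((\<epsilon> n)\<^sup>2)"
      unfolding s_def of_real_add by (simp only: complex_norm_square[symmetric] of_real_power) simp
    ultimately show ?thesis by simp
  qed
  have ibp: "(LINT z|lborel. L n z * \<psi> z) = (LINT z|lborel. of_real ((\<epsilon> n)\<^sup>2 / (2 * (s n z)\<^sup>2)) * \<phi> z)" for n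
    using integration_by_parts(3)[OF open_UNIV LC[of 2 n] \<phi> K(1) _ K(2)] by (simp add: dL \<psi>_def)
  \<comment> \<open>The substitution \<open>z \<mapsto> p + \<epsilon> z\<close> turns the
    Laplacians into one fixed kernel of mass \<open>pi / 2\<close> and moves
    \<open>\<epsilon>\<close> into the argument of \<open>\<phi>\<close>.\<close>
  have rhs: "(LINT z|lborel. of_real ((\<epsilon> n)\<^sup>2 / (2 * (s n z)\<^sup>2)) * \<phi> z)
     = (LINT z|lborel. of_real (1 / (2 * (1 + (cmod z)\<^sup>2)\<^sup>2)) * \<phi> (p + of_real (\<epsilon> n) * z))" for n
  proof -
    have m: "(\<lambda>z. of_real ((\<epsilon> n)\<^sup>2 / (2 * (s n z)\<^sup>2)) * \<phi> z) \<in> borel_measurable borel"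
      unfolding s_def by measurable
    have "of_real ((\<epsilon> n)\<^sup>2) * (of_real ((\<epsilon> n)\<^sup>2 / (2 * (s n (p + of_real (\<epsilon> n) * z))\<^sup>2)) * \<phi> (p + of_real (\<epsilon> n) * z))
       = of_real (1 / (2 * (1 + (cmod z)\<^sup>2)\<^sup>2)) * \<phi> (p + of_real (\<epsilon> n) * z)" for z
    proof -
      have "s n (p + of_real (\<epsilon> n) * z) = (\<epsilon> n)\<^sup>2 * (1 + (cmod z)\<^sup>2)"
        using e[of n] by (simp add: s_def norm_mult power_mult_distrib algebra_simps)
      moreover have "E * (E / (2 * (E * T)\<^sup>2)) = 1 / (2 * T\<^sup>2)" if "E \<noteq> 0" for E T :: real
        using that by (simp add: power2_eq_square)
      moreover have "(\<epsilon> n)\<^sup>2 \<noteq> 0" using e[of n] by simp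
      ultimately have "(\<epsilon> n)\<^sup>2 * ((\<epsilon> n)\<^sup>2 / (2 * (s n (p + of_real (\<epsilon> n) * z))\<^sup>2)) = 1 / (2 * (1 + (cmod z)\<^sup>2)\<^sup>2)"
        by metis
      thus ?thesis by (metis mult.assoc of_real_mult)
    qed
    thus ?thesis using integral_scale_shift[OF m e(1)[of n], of p] by simp
  qed
  have lim1: "(\<lambda>n. LINT z|lborel. L n z * \<psi> z) \<longlonglongrightarrow> (LINT z|lborel. of_real (ln (cmod (z - p))) * \<psi> z)"
  proof (rule integral_dominated_convergence[OF _ _ integrable_log_times_compact_support(2)[OF \<psi>c K(1) z2, of p]])
    show "(\<lambda>z. of_real (ln (cmod (z - p))) * \<psi> z) \<in> borel_measurable lborel" by measurable
    show "(\<lambda>z. L n z * \<psi> z) \<in> borel_measurable lborel" for n unfolding L_def s_def by measurable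
    have ae: "AE z in lborel. z \<noteq> p" by (rule AE_lborel_singleton)
    show "AE z in lborel. (\<lambda>n. L n z * \<psi> z) \<longlonglongrightarrow> of_real (ln (cmod (z - p))) * \<psi> z"
      using ae
    proof eventually_elim
      case (elim z)
      have "(\<lambda>n. s n z) \<longlonglongrightarrow> (cmod (z - p))\<^sup>2 + 0\<^sup>2" unfolding s_def by (intro tendsto_intros e0)
      hence "(\<lambda>n. s n z) \<longlonglongrightarrow> (cmod (z - p))\<^sup>2" by simp
      hence "(\<lambda>n. L n z * \<psi> z) \<longlonglongrightarrow> of_real (ln ((cmod (z - p))\<^sup>2) / 2) * \<psi> z"
        unfolding L_def by (intro tendsto_intros) (use elim in auto)
      thus ?case using elim by (simp add: ln_realpow)
    qed
    \<comment> \<open>Domination uniform in \<open>n\<close>: from below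
      \<open>s n z \<ge> |z - p|^2\<close>, from above
      \<open>ln s \<le> s - 1 \<le> |z - p|^2\<close> because
      \<open>\<epsilon> n \<le> 1\<close>.\<close>
    show "AE z in lborel. norm (L n z * \<psi> z) \<le> (neg_log (z - p) + (cmod (z - p))\<^sup>2) * cmod (\<psi> z)" for n
      using ae
    proof eventually_elim
      case (elim z)
      have w: "cmod (z - p) > 0" using elim by simp
      have "ln ((cmod (z - p))\<^sup>2) \<le> ln (s n z)" using w by (intro ln_mono) (auto simp: s_def)
      hence lo: "2 * ln (cmod (z - p)) \<le> ln (s n z)" using w by (simp add: ln_realpow)
      have "(\<epsilon> n)\<^sup>2 \<le> 1" using e[of n] by (simp add: power_le_one)
      hence "ln (s n z) \<le> (cmod (z - p))\<^sup>2"
        using ln_le_minus_one[OF spos[of n z]] by (simp add: s_def)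
      hence "\<bar>ln (s n z) / 2\<bar> \<le> neg_log (z - p) + (cmod (z - p))\<^sup>2"
        using lo abs_ln_norm_le[of "z - p"] zero_le_power2[of "cmod (z - p)"] by (auto simp: abs_le_iff neg_log_def)
      hence "\<bar>ln (s n z) / 2\<bar> * cmod (\<psi> z) \<le> (neg_log (z - p) + (cmod (z - p))\<^sup>2) * cmod (\<psi> z)"
        by (intro mult_right_mono) auto
      thus ?case unfolding L_def norm_mult norm_of_real .
    qed
  qed
  obtain B where B: "B \<ge> 0" "\<And>z. norm (\<phi> z) \<le> B" using bounded_compact_support[OF \<phi>c K] by blast
  have lim2: "(\<lambda>n. LINT z|lborel. of_real (1 / (2 * (1 + (cmod z)\<^sup>2)\<^sup>2)) * \<phi> (p + of_real (\<epsilon> n) * z))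
     \<longlonglongrightarrow> (LINT z|lborel. of_real (1 / (2 * (1 + (cmod z)\<^sup>2)\<^sup>2)) * \<phi> p)"
  proof (rule integral_dominated_convergence[where w = "\<lambda>z. B * (1 / (1 + (cmod z)\<^sup>2)\<^sup>2)"])
    show "(\<lambda>z. of_real (1 / (2 * (1 + (cmod z)\<^sup>2)\<^sup>2)) * \<phi> p) \<in> borel_measurable lborel"
      "(\<lambda>z. of_real (1 / (2 * (1 + (cmod z)\<^sup>2)\<^sup>2)) * \<phi> (p + of_real (\<epsilon> n) * z)) \<in> borel_measurable lborel" for n
      by measurable
    show "integrable lborel (\<lambda>z::complex. B * (1 / (1 + (cmod z)\<^sup>2)\<^sup>2))"
      using integral_poisson_type(1) by (intro integrable_mult_right) auto
    show "AE z in lborel. (\<lambda>n. of_real (1 / (2 * (1 + (cmod z)\<^sup>2)\<^sup>2)) * \<phi> (p + of_real (\<epsilon> n) * z)) \<longlonglongrightarrow>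
       of_real (1 / (2 * (1 + (cmod z)\<^sup>2)\<^sup>2)) * \<phi> p"
    proof (rule AE_I2)
      fix z :: complex
      have "(\<lambda>n. p + of_real (\<epsilon> n) * z) \<longlonglongrightarrow> p + of_real 0 * z" by (intro tendsto_intros e0)
      moreover have "isCont \<phi> p" using \<phi>c by (simp add: continuous_on_eq_continuous_at)
      ultimately have "(\<lambda>n. \<phi> (p + of_real (\<epsilon> n) * z)) \<longlonglongrightarrow> \<phi> p" using isCont_tendsto_compose by fastforce
      thus "(\<lambda>n. of_real (1 / (2 * (1 + (cmod z)\<^sup>2)\<^sup>2)) * \<phi> (p + of_real (\<epsilon> n) * z)) \<longlonglongrightarrow>
       of_real (1 / (2 * (1 + (cmod z)\<^sup>2)\<^sup>2)) * \<phi> p" by (intro tendsto_intros)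
    qed
    show "AE z in lborel. norm (of_real (1 / (2 * (1 + (cmod z)\<^sup>2)\<^sup>2)) * \<phi> (p + of_real (\<epsilon> n) * z)) \<le> B * (1 / (1 + (cmod z)\<^sup>2)\<^sup>2)" for n
    proof (rule AE_I2)
      fix z :: complex
      have "1 + (cmod z)\<^sup>2 > 0" by (rule add_pos_nonneg) auto
      hence p1: "(1 + (cmod z)\<^sup>2)\<^sup>2 > 0" by simp
      have "1 / (2 * (1 + (cmod z)\<^sup>2)\<^sup>2) * norm (\<phi> (p + of_real (\<epsilon> n) * z)) \<le> 1 / (1 + (cmod z)\<^sup>2)\<^sup>2 * B"
        using p1 B by (intro mult_mono divide_left_mono) auto
      thus "norm (of_real (1 / (2 * (1 + (cmod z)\<^sup>2)\<^sup>2)) * \<phi> (p + of_real (\<epsilon> n) * z)) \<le> B * (1 / (1 + (cmod z)\<^sup>2)\<^sup>2)"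
        unfolding norm_mult norm_of_real using p1 by (simp add: mult.commute)
    qed
  qed
  have "(LINT z|lborel. complex_of_real (1 / (2 * (1 + (cmod z)\<^sup>2)\<^sup>2)) * \<phi> p) = of_real (pi / 2) * \<phi> p"
  proof -
    have "(LINT z|lborel. complex_of_real (1 / (2 * (1 + (cmod z)\<^sup>2)\<^sup>2)) * \<phi> p)
       = (LINT z|lborel. complex_of_real (1 / (1 + (cmod z)\<^sup>2)\<^sup>2)) * (\<phi> p / 2)"
      by (simp flip: integral_mult_left_zero)
    also have "(LINT z|lborel. complex_of_real (1 / (1 + (cmod z)\<^sup>2)\<^sup>2)) = of_real pi"
      by (subst integral_of_real) (simp_all only: integral_poisson_type)
    finally show ?thesis by simp
  qed
  hence "(\<lambda>n. LINT z|lborel. L n z * \<psi> z) \<longlonglongrightarrow> of_real (pi / 2) * \<phi> p"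
    using lim2 by (simp only: ibp rhs)
  from LIMSEQ_unique[OF lim1 this] show "(LINT z|lborel. of_real (ln (cmod (z - p))) * d_zbar (d_z \<phi>) z) = of_real (pi / 2) * \<phi> p"
    by (simp add: \<psi>_def)
qed

section \<open>The metric of a unitary system\<close>

definition tnorm :: "complex \<times> complex \<times> complex \<Rightarrow> real" where
  "tnorm = (\<lambda>(x, y, z). cmod x + cmod z)"

text \<open>Equal to the square of \<open>tnorm\<close> on Veronese vectors, but a sum of squared
  moduli and therefore smooth also where a component vanishes. The weight 2 of the middle term comes
  from expanding the square.\<close>

definition tsquare :: "complex \<times> complex \<times> complex \<Rightarrow> real" where
  "tsquare = (\<lambda>(x, y, z). (cmod x)\<^sup>2 + 2 * (cmod y)\<^sup>2 + (cmod z)\<^sup>2)"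

lemma tnorm_veronese: "tnorm (veronese y1 y2) = (cmod y1)\<^sup>2 + (cmod y2)\<^sup>2"
  by (simp add: tnorm_def veronese_def norm_power)

lemma tsquare_veronese: "tsquare (veronese y1 y2) = (tnorm (veronese y1 y2))\<^sup>2"
  unfolding tnorm_veronese by (simp add: tsquare_def veronese_def norm_power norm_mult power2_eq_square algebra_simps)

lemma tnorm_tscale: "tnorm (tscale c X) = cmod c * tnorm X"
  by (cases X) (simp add: tnorm_def tscale_def norm_mult algebra_simps)

lemma tsquare_tscale: "tsquare (tscale c X) = (cmod c)\<^sup>2 * tsquare X"
  by (cases X) (simp add: tsquare_def tscale_def norm_mult power_mult_distrib algebra_simps)

lemma tsquare_pos: "X \<noteq> (0, 0, 0) \<Longrightarrow> tsquare X > 0"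
proof -
  assume nz: "X \<noteq> (0, 0, 0)"
  obtain x y z where X: "X = (x, y, z)" by (cases X)
  have "(cmod x)\<^sup>2 > 0 \<or> (cmod y)\<^sup>2 > 0 \<or> (cmod z)\<^sup>2 > 0" using nz X by auto
  moreover have "(cmod x)\<^sup>2 \<ge> 0" "(cmod y)\<^sup>2 \<ge> 0" "(cmod z)\<^sup>2 \<ge> 0" by auto
  ultimately show ?thesis unfolding X tsquare_def by (simp, linarith)
qed

lemma herm_1_0_1: "herm 1 0 1 y1 y2 = (cmod y1)\<^sup>2 + (cmod y2)\<^sup>2"
  by (simp add: herm_def)

lemma fundamental_pair_pos:
  assumes "fundamental_pair Q V y1 y2" "z \<in> V"
  shows "(cmod (y1 z))\<^sup>2 + (cmod (y2 z))\<^sup>2 > 0"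
proof -
  have "y1 z * deriv y2 z - deriv y1 z * y2 z = 1" using assms by (auto simp: fundamental_pair_def)
  hence "y1 z \<noteq> 0 \<or> y2 z \<noteq> 0" by auto
  thus ?thesis by (auto intro: add_pos_nonneg add_nonneg_pos)
qed

text \<open>\<open>ln |f|^2\<close> is harmonic: its \<open>d_zbar\<close> is the conjugate of
  \<open>f' / f\<close>, which \<open>d_z\<close> annihilates.\<close>

lemma log_norm_product_derivs:
  fixes f :: "complex \<Rightarrow> complex"
  assumes f: "f holomorphic_on V" and V: "open V" and nz: "\<And>z. z \<in> V \<Longrightarrow> f z \<noteq> 0" and z: "z \<in> V"
  shows "has_wd (\<lambda>z. of_real (ln ((cmod (f z))\<^sup>2))) (deriv f z / f z) (cnj (deriv f z / f z)) z"
    "has_wd (\<lambda>z. cnj (deriv f z / f z)) 0 (cnj (deriv (\<lambda>z. deriv f z / f z) z)) z"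
proof -
  have d: "(f has_field_derivative deriv f z) (at z)" by (rule holomorphic_derivI[OF f V z])
  have w: "has_wd f (deriv f z) 0 z" by (rule has_wd_field_derivative[OF d])
  have "has_wd (\<lambda>z. f z * cnj (f z)) (deriv f z * cnj (f z) + f z * cnj 0) (0 * cnj (f z) + f z * cnj (deriv f z)) z"
    by (rule has_wd_mult[OF w has_wd_cnj[OF w]])
  hence "has_wd (\<lambda>z. of_real ((cmod (f z))\<^sup>2)) (deriv f z * cnj (f z)) (f z * cnj (deriv f z)) z"
    unfolding complex_norm_square by simp
  hence "has_wd (\<lambda>z. of_real (ln ((cmod (f z))\<^sup>2))) (deriv f z * cnj (f z) / of_real ((cmod (f z))\<^sup>2))
     (f z * cnj (deriv f z) / of_real ((cmod (f z))\<^sup>2)) z"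
    by (rule has_wd_ln) (use nz[OF z] in simp)
  thus "has_wd (\<lambda>z. of_real (ln ((cmod (f z))\<^sup>2))) (deriv f z / f z) (cnj (deriv f z / f z)) z"
    using nz[OF z] unfolding complex_norm_square by simp
  have "(\<lambda>z. deriv f z / f z) holomorphic_on V" using nz by (intro holomorphic_intros f V) auto
  hence "((\<lambda>z. deriv f z / f z) has_field_derivative deriv (\<lambda>z. deriv f z / f z) z) (at z)"
    by (rule holomorphic_derivI[OF _ V z])
  from has_wd_cnj[OF has_wd_field_derivative[OF this]]
  show "has_wd (\<lambda>z. cnj (deriv f z / f z)) 0 (cnj (deriv (\<lambda>z. deriv f z / f z) z)) z" by simp
qed

lemma integrable_log_on_compact:
  assumes "compact K"
  shows "integrable lborel (\<lambda>z. indicator K z * ln (cmod (z - p)))"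
proof -
  have "integrable (distr lborel borel ((+) (- p))) neg_log" using integrable_neg_log by (simp add: lborel_distr_plus)
  hence nl: "integrable lborel (\<lambda>z. neg_log (z - p))"
    by (subst (asm) integrable_distr_eq) (use borel_measurable_integrable[OF integrable_neg_log] in auto)
  have i2: "integrable lborel (\<lambda>z. indicator K z *\<^sub>R (cmod (z - p))\<^sup>2)"
    by (intro borel_integrable_compact assms continuous_intros)
  have [measurable]: "K \<in> sets borel" using assms by (simp add: borel_compact)
  show ?thesis
  proof (rule Bochner_Integration.integrable_bound[OF Bochner_Integration.integrable_add[OF nl i2]])
    show "AE z in lborel. norm (indicator K z * ln (cmod (z - p))) \<le> norm (neg_log (z - p) + indicator K z *\<^sub>R (cmod (z - p))\<^sup>2)"
    proof (rule AE_I2)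
      fix z
      have "neg_log (z - p) \<ge> 0" by (simp add: neg_log_def)
      thus "norm (indicator K z * ln (cmod (z - p))) \<le> norm (neg_log (z - p) + indicator K z *\<^sub>R (cmod (z - p))\<^sup>2)"
        using abs_ln_norm_le[of "z - p"] by (auto simp: indicator_def)
    qed
  qed measurable
qed

lemma remove_sings_eq_near:
  assumes "g analytic_on {p}" "\<forall>\<^sub>F z in at p. f z = g z"
  shows "\<forall>\<^sub>F z in nhds p. remove_sings f z = g z"
proof -
  obtain r1 where r1: "r1 > 0" "g holomorphic_on ball p r1" using assms(1) by (auto simp: analytic_on_def)
  obtain r2 where r2: "r2 > 0" "\<And>z. z \<noteq> p \<Longrightarrow> dist z p < r2 \<Longrightarrow> f z = g z"
    using assms(2) unfolding eventually_at by blast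
  define r where "r = min r1 r2"
  have "remove_sings f z = g z" if z: "z \<in> ball p r" for z
  proof (rule remove_sings_eqI)
    have "isCont g z" using holomorphic_on_imp_continuous_on[OF r1(2)] z
      by (simp add: continuous_on_eq_continuous_at r_def)
    hence "(g \<longlongrightarrow> g z) (at z)" by (simp add: isCont_def)
    moreover have "\<forall>\<^sub>F w in at z. g w = f w"
    proof (cases "z = p")
      case True
      thus ?thesis using assms(2) by (simp add: eq_commute)
    next
      case False
      have "open (ball p r - {p})" by (simp add: open_delete)
      hence "\<forall>\<^sub>F w in at z. w \<in> ball p r - {p}" using z False by (intro eventually_at_in_open') auto
      thus ?thesis by eventually_elim (use r2(2) in \<open>auto simp: r_def dist_commute\<close>)
    qed
    ultimately show "(f \<longlongrightarrow> g z) (at z)" by (rule Lim_transform_eventually)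
  qed
  moreover have "\<forall>\<^sub>F z in nhds p. z \<in> ball p r"
    using r1(1) r2(1) by (intro eventually_nhds_in_open) (auto simp: r_def)
  ultimately show ?thesis by (auto elim: eventually_mono)
qed

section \<open>Poles, curvature, cusp and invariance of the metric\<close>

context main_setup
begin

lemma finite_poles: "compact K \<Longrightarrow> K \<subseteq> \<H> \<Longrightarrow> finite (poles Q \<inter> K)"
  using sparse_in_compact_finite[OF sparse_in_subset[OF sparse_poles]] by (metis inf_commute)

lemma local_pair:
  assumes "sq_at Q X z" "z \<in> \<H> - poles Q"
  obtains e y1 y2 where "e > 0" "ball z e \<subseteq> \<H> - poles Q" "fundamental_pair Q (ball z e) y1 y2"
    "\<And>w. w \<in> ball z e \<Longrightarrow> X w = veronese (y1 w) (y2 w)"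
  using assms by (auto simp: sq_at_def)

text \<open>The mass \<open>n_p = 2 \<kappa>_p - 1\<close> as a natural number; it is at the same
  time the order of the pole of a system at \<open>p\<close>.\<close>

definition pole_exponent :: "complex \<Rightarrow> nat" where
  "pole_exponent p = (THE m. real m = 2 * kappa Q p - 1)"

lemma pole_exponentI: "real m = 2 * kappa Q p - 1 \<Longrightarrow> pole_exponent p = m"
  unfolding pole_exponent_def by (rule the_equality) auto

lemma pole_exponent: "p \<in> poles Q \<Longrightarrow> real (pole_exponent p) = 2 * kappa Q p - 1"
proof -
  assume "p \<in> poles Q"
  then obtain n :: nat where "n \<ge> 1" "kappa Q p = real n / 2" using kappa_half_nat by blast
  hence "real (n - 1) = 2 * kappa Q p - 1" by (simp add: of_nat_diff)
  thus ?thesis using pole_exponentI by metis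
qed

text \<open>The third product of the Frobenius pair has the highest pole order,
  \<open>n - 1\<close>. After multiplication its value at the centre is \<open>k^2\<close>, which is
  nonzero, and the invertible \<open>sym2 N\<close> preserves nonvanishing of the triple.\<close>

lemma pole_removal:
  assumes X: "\<And>z. z \<in> \<H> \<Longrightarrow> sq_at Q X z" and p: "p \<in> poles Q"
  obtains e f where "e > 0" "ball p e \<subseteq> \<H>" "ball p e \<inter> poles Q \<subseteq> {p}"
    "(\<lambda>z. fst (f z)) holomorphic_on ball p e" "(\<lambda>z. fst (snd (f z))) holomorphic_on ball p e"
    "(\<lambda>z. snd (snd (f z))) holomorphic_on ball p e"
    "\<And>z. z \<in> ball p e - {p} \<Longrightarrow> tscale ((z - p) ^ pole_exponent p) (X z) = f z" "f p \<noteq> (0, 0, 0)"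
proof -
  have pH: "p \<in> \<H>" using p by (simp add: poles_def)
  obtain r n g k where fd: "frobenius_data Q p r n g k 0" "ball p r \<subseteq> \<H>" "ball p r \<inter> poles Q \<subseteq> {p}"
    "kappa Q p = real n / 2" "p \<notin> poles Q \<Longrightarrow> n = 1" using frobenius_data_at[OF pH] by metis
  note fd' = fd(1)[unfolded frobenius_data_def]
  have r0: "r > 0" using fd' by blast
  have "real (n - 1) = 2 * kappa Q p - 1" using fd(4) fd' by (simp add: of_nat_diff)
  hence m: "pole_exponent p = n - 1" by (rule pole_exponentI)
  have ls: "sq_at Q (local_system p n g k) z" if "z \<in> ball p r" for z
    using sq_at_local_system[OF fd(1,2,3,5) that] .
  have Xb: "sq_at Q X z" if "z \<in> ball p r" for z using X that fd(2) by blast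
  obtain N where N: "det N = 1" "\<And>z. z \<in> ball p r \<Longrightarrow> X z = sym2 N (local_system p n g k z)"
    using sq_change[OF open_ball connected_ball fd(2) _ ls Xb] r0 by auto
  define f0 where "f0 = (\<lambda>z. ((z - p) ^ (n - 1 + Suc n) * (g (z - p))\<^sup>2, (z - p) ^ n * (g (z - p))\<^sup>2 * k (z - p),
      (g (z - p))\<^sup>2 * (k (z - p))\<^sup>2))"
  define f where "f = (\<lambda>z. sym2 N (f0 z))"
  have sh: "(\<lambda>z. h (z - p)) holomorphic_on ball p r" if "h holomorphic_on ball 0 r" for h
    using that by (intro holomorphic_on_compose_gen[of "\<lambda>z. z - p" "ball p r" h "ball 0 r", unfolded o_def])
      (auto intro!: holomorphic_intros simp: dist_norm norm_minus_commute)
  have gk: "(\<lambda>z. g (z - p)) holomorphic_on ball p r" "(\<lambda>z. k (z - p)) holomorphic_on ball p r"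
    using fd' sh by blast+
  show ?thesis
  proof (rule that[OF r0 fd(2,3)])
    show "(\<lambda>z. fst (f z)) holomorphic_on ball p r" "(\<lambda>z. fst (snd (f z))) holomorphic_on ball p r"
      "(\<lambda>z. snd (snd (f z))) holomorphic_on ball p r"
      unfolding f_def f0_def sym2_def prod.case fst_conv snd_conv by (intro holomorphic_intros gk)+
    show "tscale ((z - p) ^ pole_exponent p) (X z) = f z" if z: "z \<in> ball p r - {p}" for z
    proof -
      have "z \<notin> poles Q" using z fd(3) by blast
      obtain l where n: "n = Suc l" using fd' by (cases n) auto
      have wp: "z - p \<noteq> 0" using z by simp
      have "tscale ((z - p) ^ (n - 1)) (local_system p n g k z) = f0 z"
        using \<open>z \<notin> poles Q\<close> wp by (simp add: n local_system_def tscale_def f0_def power_add mult_ac)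
      thus ?thesis using z by (simp add: m f_def N(2) tscale_sym2)
    qed
    show "f p \<noteq> (0, 0, 0)"
    proof
      assume "f p = (0, 0, 0)"
      hence "sym2 (adj2 N) (sym2 N (f0 p)) = (0, 0, 0)" by (simp add: f_def)
      hence "f0 p = (0, 0, 0)" by (simp add: sym2_adj2[OF N(1)])
      hence "k 0 = 0" using fd' r0 by (simp add: f0_def)
      moreover have "0 * deriv k 0 - of_nat n * k 0 = 1 / (g 0)\<^sup>2 - 0 * 0 ^ n" using fd' r0 by (metis centre_in_ball)
      ultimately show False using fd' by simp
    qed
  qed
qed

text \<open>A form of determinant 1 has \<open>4 u_{z zbar} = - 8 / \<Phi>^2\<close>; the constant
  \<open>ln 8\<close> makes the right side equal to \<open>- e^u\<close>.\<close>

definition metric :: "(complex \<Rightarrow> complex \<times> complex \<times> complex) \<Rightarrow> complex \<Rightarrow> real" where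
  "metric X z = ln 8 - 2 * ln (tnorm (X z))"

lemma tsquare_regular:
  assumes X: "\<And>z. z \<in> \<H> \<Longrightarrow> sq_at Q X z" and z: "z \<in> \<H> - poles Q"
  shows "tnorm (X z) > 0" "tsquare (X z) = (tnorm (X z))\<^sup>2" "metric X z = ln 8 - ln (tsquare (X z))"
proof -
  have "sq_at Q X z" using X z by blast
  then obtain r y1 y2 where r: "r > 0" "ball z r \<subseteq> \<H> - poles Q" "fundamental_pair Q (ball z r) y1 y2"
      "\<And>w. w \<in> ball z r \<Longrightarrow> X w = veronese (y1 w) (y2 w)" using z by (rule local_pair) (rule that)
  show 1: "tnorm (X z) > 0" using fundamental_pair_pos[OF r(3)] r by (simp add: tnorm_veronese)
  show 2: "tsquare (X z) = (tnorm (X z))\<^sup>2" using r by (simp add: tsquare_veronese)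
  show "metric X z = ln 8 - ln (tsquare (X z))" unfolding 2 using 1 by (simp add: metric_def ln_realpow)
qed

lemma Ck_on_tsquare:
  assumes "open U" "(\<lambda>z. fst (f z)) holomorphic_on U" "(\<lambda>z. fst (snd (f z))) holomorphic_on U"
    "(\<lambda>z. snd (snd (f z))) holomorphic_on U"
  shows "Ck_on n (\<lambda>z. of_real (tsquare (f z))) U"
proof -
  have "tsquare (f z) = (cmod (fst (f z)))\<^sup>2 + 2 * (cmod (fst (snd (f z))))\<^sup>2 + (cmod (snd (snd (f z))))\<^sup>2" for z
    by (cases "f z") (simp add: tsquare_def)
  moreover have "Ck_on n (\<lambda>z. of_real ((cmod (fst (f z)))\<^sup>2) + 2 * of_real ((cmod (fst (snd (f z))))\<^sup>2)
      + of_real ((cmod (snd (snd (f z))))\<^sup>2)) U"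
    by (intro Ck_on_add Ck_on_cmult Ck_on_norm_square assms)
  ultimately show ?thesis by simp
qed

lemma metric_derivs:
  assumes X: "\<And>z. z \<in> \<H> \<Longrightarrow> sq_at Q X z" and z: "z \<in> \<H> - poles Q"
  defines "U \<equiv> \<lambda>z. complex_of_real (metric X z)"
  shows "Q z = - (1/2) * (d_z (d_z U) z - (1/2) * (d_z U z)\<^sup>2)"
    "complex_of_real (exp (metric X z)) = - 4 * d_z (d_zbar U) z"
proof -
  have "sq_at Q X z" using X z by blast
  then obtain r y1 y2 where r: "r > 0" "ball z r \<subseteq> \<H> - poles Q" "fundamental_pair Q (ball z r) y1 y2"
      "\<And>w. w \<in> ball z r \<Longrightarrow> X w = veronese (y1 w) (y2 w)" using z by (rule local_pair) (rule that)
  have pos: "herm 1 0 1 (y1 w) (y2 w) > 0" if "w \<in> ball z r" for w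
    using fundamental_pair_pos[OF r(3) that] by (simp add: herm_1_0_1)
  have u: "metric X w = ln 8 - 2 * ln (herm 1 0 1 (y1 w) (y2 w))" if "w \<in> ball z r" for w
    by (simp add: metric_def r(4)[OF that] tnorm_veronese herm_1_0_1)
  have zb: "z \<in> ball z r" using r by simp
  note d = herm_metric_derivs[OF r(3) open_ball pos u zb, folded U_def]
  show "Q z = - (1/2) * (d_z (d_z U) z - (1/2) * (d_z U z)\<^sup>2)" using d(1) by algebra
  have "exp (metric X z) = 8 / (herm 1 0 1 (y1 z) (y2 z))\<^sup>2"
    unfolding u[OF zb] using pos[OF zb] by (simp add: exp_diff exp_double)
  thus "complex_of_real (exp (metric X z)) = - 4 * d_z (d_zbar U) z" using d(2) by simp
qed

text \<open>Splits the metric into a function smooth across the finite set \<open>S\<close> and its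
  logarithmic singularities. These are harmonic away from \<open>S\<close>, so \<open>v\<close>
  carries the whole curvature term.\<close>

definition log_decomposition :: "(complex \<Rightarrow> complex \<times> complex \<times> complex) \<Rightarrow> complex set \<Rightarrow> (complex \<Rightarrow> real) \<Rightarrow> bool" where
  "log_decomposition X S v \<longleftrightarrow> open (\<H> - (poles Q - S)) \<and>
    (\<forall>n. Ck_on n (\<lambda>z. complex_of_real (v z)) (\<H> - (poles Q - S))) \<and>
    (\<forall>z\<in>\<H> - poles Q. metric X z = v z + (\<Sum>p\<in>S. 2 * real (pole_exponent p) * ln (cmod (z - p)))) \<and>
    (\<forall>z\<in>\<H> - poles Q. complex_of_real (exp (metric X z)) = - 4 * d_z (d_zbar (\<lambda>z. complex_of_real (v z))) z)"

text \<open>Multiplying the system by \<open>\<Theta>\<close>, the product of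
  \<open>(z - p) ^ pole_exponent p\<close> over \<open>S\<close>, removes its poles in
  \<open>S\<close> without creating zeros. So \<open>tsquare\<close> of the product is smooth and
  positive, and \<open>ln |\<Theta>|^2\<close> is the sum of logarithms.\<close>

lemma log_decomposition_exists:
  assumes X: "\<And>z. z \<in> \<H> \<Longrightarrow> sq_at Q X z" and S: "finite S" "S \<subseteq> poles Q"
  obtains v where "log_decomposition X S v"
proof -
  define U where "U = \<H> - (poles Q - S)"
  have Uo: "open U" unfolding U_def
    using open_diff_sparse_pts[OF open_H] sparse_in_subset2[OF sparse_poles] by (metis Diff_subset)
  define \<Theta> where "\<Theta> = (\<lambda>z. \<Prod>p\<in>S. (z - p) ^ pole_exponent p)"
  have \<Theta>nz: "\<Theta> z \<noteq> 0" if "z \<notin> S" for z using that S(1) by (auto simp: \<Theta>_def)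
  have \<Theta>h: "\<Theta> holomorphic_on V" for V unfolding \<Theta>_def by (intro holomorphic_intros)
  define Z where "Z = (\<lambda>z. tscale (\<Theta> z) (X z))"
  \<comment> \<open>At the poles \<open>Z\<close> is zero because the system is pinned to zero
    there; \<open>remove_sings\<close> puts in the limits.\<close>
  define Zh where "Zh = (\<lambda>z. (remove_sings (\<lambda>z. fst (Z z)) z, remove_sings (\<lambda>z. fst (snd (Z z))) z, remove_sings (\<lambda>z. snd (snd (Z z))) z))"
  note hol = sq_holomorphic[OF open_H order_refl X]
  have Zc: "fst (Z z) = \<Theta> z * fst (X z)" "fst (snd (Z z)) = \<Theta> z * fst (snd (X z))" "snd (snd (Z z)) = \<Theta> z * snd (snd (X z))" for z
    by (cases "X z", simp add: Z_def tscale_def)+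
  have "(\<lambda>z. fst (Z z)) holomorphic_on \<H> - poles Q" "(\<lambda>z. fst (snd (Z z))) holomorphic_on \<H> - poles Q"
    "(\<lambda>z. snd (snd (Z z))) holomorphic_on \<H> - poles Q"
    unfolding Zc using hol by (auto intro!: holomorphic_intros \<Theta>h)
  hence Zan: "(\<lambda>z. fst (Z z)) analytic_on {z}" "(\<lambda>z. fst (snd (Z z))) analytic_on {z}" "(\<lambda>z. snd (snd (Z z))) analytic_on {z}"
    if "z \<in> \<H> - poles Q" for z
    using that open_regular by (auto simp: analytic_at)
  have Zh_reg: "Zh z = Z z" if "z \<in> \<H> - poles Q" for z
    using Zan[OF that] by (cases "Z z") (simp add: Zh_def)
  have near: "(\<exists>r>0. ball z r \<subseteq> U \<and> (\<lambda>z. fst (Zh z)) holomorphic_on ball z r \<and> (\<lambda>z. fst (snd (Zh z))) holomorphic_on ball z r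
      \<and> (\<lambda>z. snd (snd (Zh z))) holomorphic_on ball z r) \<and> Zh z \<noteq> (0, 0, 0)" if z: "z \<in> U" for z
  proof (cases "z \<in> poles Q")
    case False
    hence zr: "z \<in> \<H> - poles Q" using z by (auto simp: U_def)
    obtain r where r: "r > 0" "ball z r \<subseteq> \<H> - poles Q" using open_regular zr by (meson openE)
    have "(\<lambda>z. fst (Zh z)) holomorphic_on ball z r \<and> (\<lambda>z. fst (snd (Zh z))) holomorphic_on ball z r
      \<and> (\<lambda>z. snd (snd (Zh z))) holomorphic_on ball z r"
    proof (intro conjI)
      have *: "Zh w = Z w" if "w \<in> ball z r" for w using Zh_reg r(2) that by blast
      show "(\<lambda>z. fst (Zh z)) holomorphic_on ball z r"
        by (rule holomorphic_transform[of "\<lambda>z. \<Theta> z * fst (X z)"])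
           (use hol r(2) in \<open>auto simp: * Zc intro!: holomorphic_intros \<Theta>h intro: holomorphic_on_subset\<close>)
      show "(\<lambda>z. fst (snd (Zh z))) holomorphic_on ball z r"
        by (rule holomorphic_transform[of "\<lambda>z. \<Theta> z * fst (snd (X z))"])
           (use hol r(2) in \<open>auto simp: * Zc intro!: holomorphic_intros \<Theta>h intro: holomorphic_on_subset\<close>)
      show "(\<lambda>z. snd (snd (Zh z))) holomorphic_on ball z r"
        by (rule holomorphic_transform[of "\<lambda>z. \<Theta> z * snd (snd (X z))"])
           (use hol r(2) in \<open>auto simp: * Zc intro!: holomorphic_intros \<Theta>h intro: holomorphic_on_subset\<close>)
    qed
    moreover have "Zh z \<noteq> (0, 0, 0)"
    proof
      assume "Zh z = (0, 0, 0)"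
      hence "tsquare (Z z) = 0" using Zh_reg[OF zr] by (simp add: tsquare_def)
      moreover have "z \<notin> S" using False S by blast
      ultimately show False using tsquare_regular[OF X zr] \<Theta>nz[of z] by (simp add: Z_def tsquare_tscale)
    qed
    moreover have "ball z r \<subseteq> U" using r(2) by (auto simp: U_def)
    ultimately show ?thesis using r(1) by blast
  next
    case True
    hence zS: "z \<in> S" using z by (simp add: U_def)
    obtain r f where r: "r > 0" "ball z r \<subseteq> \<H>" "ball z r \<inter> poles Q \<subseteq> {z}"
      "(\<lambda>z. fst (f z)) holomorphic_on ball z r" "(\<lambda>z. fst (snd (f z))) holomorphic_on ball z r"
      "(\<lambda>z. snd (snd (f z))) holomorphic_on ball z r"
      "\<And>w. w \<in> ball z r - {z} \<Longrightarrow> tscale ((w - z) ^ pole_exponent z) (X w) = f w" "f z \<noteq> (0, 0, 0)"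
      using pole_removal[OF X True] by blast
    \<comment> \<open>The factors of the other poles, nonzero at \<open>z\<close>; the remaining
      factor is the one that \<open>pole_removal\<close> absorbs.\<close>
    define \<Theta>' where "\<Theta>' = (\<lambda>w. \<Prod>p\<in>S - {z}. (w - p) ^ pole_exponent p)"
    have \<Theta>'h: "\<Theta>' holomorphic_on ball z r" unfolding \<Theta>'_def by (intro holomorphic_intros)
    have split: "\<Theta> w = \<Theta>' w * (w - z) ^ pole_exponent z" for w
      unfolding \<Theta>_def \<Theta>'_def using S(1) zS by (subst prod.remove[of S z]) (auto simp: mult.commute)
    have Zf: "Z w = tscale (\<Theta>' w) (f w)" if "w \<in> ball z r - {z}" for w
      unfolding Z_def split using r(7)[OF that] by (simp flip: tscale_tscale)
    have fc: "fst (tscale c t) = c * fst t" "fst (snd (tscale c t)) = c * fst (snd t)" "snd (snd (tscale c t)) = c * snd (snd t)" for c t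
      by (cases t, simp add: tscale_def)+
    have ev: "\<forall>\<^sub>F w in at z. w \<in> ball z r - {z}" using r(1) by (intro eventually_at_in_open) auto
    have an: "(\<lambda>w. \<Theta>' w * h w) analytic_on {z}" if "h holomorphic_on ball z r" for h
      using \<Theta>'h that r(1) by (auto simp: analytic_at intro!: exI[of _ "ball z r"] holomorphic_intros)
    have "\<forall>\<^sub>F w in nhds z. remove_sings (\<lambda>z. fst (Z z)) w = \<Theta>' w * fst (f w)"
      by (rule remove_sings_eq_near[OF an[OF r(4)]]) (use ev in \<open>auto simp: Zf fc elim!: eventually_mono\<close>)
    moreover have "\<forall>\<^sub>F w in nhds z. remove_sings (\<lambda>z. fst (snd (Z z))) w = \<Theta>' w * fst (snd (f w))"
      by (rule remove_sings_eq_near[OF an[OF r(5)]]) (use ev in \<open>auto simp: Zf fc elim!: eventually_mono\<close>)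
    moreover have "\<forall>\<^sub>F w in nhds z. remove_sings (\<lambda>z. snd (snd (Z z))) w = \<Theta>' w * snd (snd (f w))"
      by (rule remove_sings_eq_near[OF an[OF r(6)]]) (use ev in \<open>auto simp: Zf fc elim!: eventually_mono\<close>)
    ultimately have "\<forall>\<^sub>F w in nhds z. Zh w = tscale (\<Theta>' w) (f w)"
      by eventually_elim (simp add: Zh_def prod_eq_iff fc)
    moreover have "\<forall>\<^sub>F w in nhds z. w \<in> ball z r \<inter> U" using r(1) z Uo by (intro eventually_nhds_in_open) auto
    ultimately have "\<forall>\<^sub>F w in nhds z. Zh w = tscale (\<Theta>' w) (f w) \<and> w \<in> ball z r \<inter> U" by (rule eventually_conj)
    then obtain e where e: "e > 0" "\<And>w. dist w z < e \<Longrightarrow> Zh w = tscale (\<Theta>' w) (f w) \<and> w \<in> ball z r \<inter> U"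
      unfolding eventually_nhds_metric by blast
    have eq: "Zh w = tscale (\<Theta>' w) (f w)" if "w \<in> ball z e" for w using e(2)[of w] that by (simp add: dist_commute)
    have sub: "ball z e \<subseteq> ball z r" "ball z e \<subseteq> U" using e(2) by (auto simp: dist_commute)
    have "(\<lambda>z. fst (Zh z)) holomorphic_on ball z e"
      by (rule holomorphic_transform[of "\<lambda>w. \<Theta>' w * fst (f w)"])
         (use r sub \<Theta>'h in \<open>auto simp: eq fc intro!: holomorphic_intros intro: holomorphic_on_subset\<close>)
    moreover have "(\<lambda>z. fst (snd (Zh z))) holomorphic_on ball z e"
      by (rule holomorphic_transform[of "\<lambda>w. \<Theta>' w * fst (snd (f w))"])
         (use r sub \<Theta>'h in \<open>auto simp: eq fc intro!: holomorphic_intros intro: holomorphic_on_subset\<close>)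
    moreover have "(\<lambda>z. snd (snd (Zh z))) holomorphic_on ball z e"
      by (rule holomorphic_transform[of "\<lambda>w. \<Theta>' w * snd (snd (f w))"])
         (use r sub \<Theta>'h in \<open>auto simp: eq fc intro!: holomorphic_intros intro: holomorphic_on_subset\<close>)
    moreover have "Zh z \<noteq> (0, 0, 0)"
    proof -
      have "\<Theta>' z \<noteq> 0" using S(1) by (auto simp: \<Theta>'_def)
      moreover have "Zh z = tscale (\<Theta>' z) (f z)" using eq e(1) by simp
      ultimately show ?thesis using r(8) by (cases "f z") (auto simp: tscale_def)
    qed
    ultimately show ?thesis using e(1) sub(2) by blast
  qed
  have Zhol: "(\<lambda>z. fst (Zh z)) holomorphic_on U" "(\<lambda>z. fst (snd (Zh z))) holomorphic_on U" "(\<lambda>z. snd (snd (Zh z))) holomorphic_on U"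
  proof -
    have "(\<lambda>z. fst (Zh z)) analytic_on U" unfolding analytic_on_def
    proof
      fix z assume "z \<in> U" from near[OF this] show "\<exists>e>0. (\<lambda>z. fst (Zh z)) holomorphic_on ball z e" by auto
    qed
    moreover have "(\<lambda>z. fst (snd (Zh z))) analytic_on U" unfolding analytic_on_def
    proof
      fix z assume "z \<in> U" from near[OF this] show "\<exists>e>0. (\<lambda>z. fst (snd (Zh z))) holomorphic_on ball z e" by auto
    qed
    moreover have "(\<lambda>z. snd (snd (Zh z))) analytic_on U" unfolding analytic_on_def
    proof
      fix z assume "z \<in> U" from near[OF this] show "\<exists>e>0. (\<lambda>z. snd (snd (Zh z))) holomorphic_on ball z e" by auto
    qed
    ultimately show "(\<lambda>z. fst (Zh z)) holomorphic_on U" "(\<lambda>z. fst (snd (Zh z))) holomorphic_on U" "(\<lambda>z. snd (snd (Zh z))) holomorphic_on U"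
      by (simp_all add: analytic_imp_holomorphic)
  qed
  have Zpos: "tsquare (Zh z) > 0" if "z \<in> U" for z using near[OF that] tsquare_pos by blast
  define v where "v = (\<lambda>z. ln 8 - ln (tsquare (Zh z)))"
  have vC: "Ck_on n (\<lambda>z. complex_of_real (v z)) U" for n
    unfolding v_def of_real_diff by (intro Ck_on_diff Ck_on_const Ck_on_ln Ck_on_tsquare Uo Zhol Zpos)
  have uv: "metric X z = v z + ln ((cmod (\<Theta> z))\<^sup>2)" if z: "z \<in> \<H> - poles Q" for z
  proof -
    have "z \<notin> S" using z S by blast
    hence "(cmod (\<Theta> z))\<^sup>2 > 0" using \<Theta>nz by simp
    moreover have "tsquare (X z) > 0" using tsquare_regular[OF X z] by simp
    ultimately have "ln (tsquare (Zh z)) = ln ((cmod (\<Theta> z))\<^sup>2) + ln (tsquare (X z))"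
      unfolding Zh_reg[OF z] Z_def tsquare_tscale by (simp add: ln_mult)
    thus ?thesis by (simp add: v_def tsquare_regular(3)[OF X z])
  qed
  have "ln ((cmod (\<Theta> z))\<^sup>2) = (\<Sum>p\<in>S. 2 * real (pole_exponent p) * ln (cmod (z - p)))" if z: "z \<in> \<H> - poles Q" for z
  proof -
    have zS: "z \<notin> S" using z S by blast
    have c: "cmod (\<Theta> z) = (\<Prod>p\<in>S. cmod (z - p) ^ pole_exponent p)" by (simp add: \<Theta>_def norm_power flip: prod_norm)
    have "ln ((cmod (\<Theta> z))\<^sup>2) = 2 * ln (\<Prod>p\<in>S. cmod (z - p) ^ pole_exponent p)"
      using \<Theta>nz[OF zS] by (simp add: ln_realpow flip: c)
    also have "ln (\<Prod>p\<in>S. cmod (z - p) ^ pole_exponent p) = (\<Sum>p\<in>S. ln (cmod (z - p) ^ pole_exponent p))"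
      by (rule ln_prod) (use zS S(1) in auto)
    also have "\<dots> = (\<Sum>p\<in>S. real (pole_exponent p) * ln (cmod (z - p)))"
      by (rule sum.cong) (use zS in \<open>auto simp: ln_realpow\<close>)
    finally show ?thesis by (simp add: sum_distrib_left mult.assoc)
  qed
  hence uv2: "metric X z = v z + (\<Sum>p\<in>S. 2 * real (pole_exponent p) * ln (cmod (z - p)))" if "z \<in> \<H> - poles Q" for z
    using uv[OF that] that by simp
  have "complex_of_real (exp (metric X z)) = - 4 * d_z (d_zbar (\<lambda>z. complex_of_real (v z))) z" if z: "z \<in> \<H> - poles Q" for z
  proof -
    let ?D = "\<H> - poles Q"
    let ?M = "\<lambda>z. complex_of_real (metric X z)" and ?v = "\<lambda>z. complex_of_real (v z)"
    have Dnz: "\<Theta> w \<noteq> 0" if "w \<in> ?D" for w using \<Theta>nz S that by blast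
    have DU: "?D \<subseteq> U" by (auto simp: U_def)
    have lg: "has_wd (\<lambda>z. of_real (ln ((cmod (\<Theta> z))\<^sup>2))) (deriv \<Theta> w / \<Theta> w) (cnj (deriv \<Theta> w / \<Theta> w)) w"
      "has_wd (\<lambda>z. cnj (deriv \<Theta> z / \<Theta> z)) 0 (cnj (deriv (\<lambda>z. deriv \<Theta> z / \<Theta> z) w)) w" if "w \<in> ?D" for w
      using log_norm_product_derivs[OF \<Theta>h open_regular _ that] Dnz by blast+
    have wv: "has_wd ?v (d_z ?v w) (d_zbar ?v w) w" if "w \<in> ?D" for w
      using Ck_on_has_wd[OF vC] that DU by blast
    have M: "has_wd ?M (d_z ?v w + deriv \<Theta> w / \<Theta> w) (d_zbar ?v w + cnj (deriv \<Theta> w / \<Theta> w)) w" if w: "w \<in> ?D" for w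
      by (rule has_wd_cong[OF has_wd_add[OF wv[OF w] lg(1)[OF w]] open_regular w]) (simp add: uv)
    have C1: "Ck_on (Suc 0) (d_zbar ?v) U" by (rule Ck_on_d_zbar[OF Uo vC])
    have dv: "has_wd (d_zbar ?v) (d_z (d_zbar ?v) z) (d_zbar (d_zbar ?v) z) z"
      using Ck_on_has_wd[OF C1] z DU by blast
    have "has_wd (d_zbar ?M) (d_z (d_zbar ?v) z + 0) (d_zbar (d_zbar ?v) z + cnj (deriv (\<lambda>z. deriv \<Theta> z / \<Theta> z) z)) z"
      by (rule has_wd_cong[OF has_wd_add[OF dv lg(2)[OF z]] open_regular z has_wdD(2)[OF M, symmetric]])
    hence "d_z (d_zbar ?M) z = d_z (d_zbar ?v) z" by (auto dest: has_wdD(1))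
    thus ?thesis using metric_derivs(2)[OF X z] by simp
  qed
  thus ?thesis using Uo vC uv2 that[of v] unfolding U_def log_decomposition_def by blast
qed

text \<open>With \<open>S\<close> the poles in the support of \<open>\<phi>\<close>, the smooth part
  is integrated by parts and cancels \<open>e^u\<close>, while each term
  \<open>2 n_p ln |z - p|\<close>, tested against \<open>4 \<phi>_{z zbar}\<close>, contributes
  \<open>8 n_p (pi / 2) \<phi> p = 4 pi n_p \<phi> p\<close>.\<close>

lemma metric_curvature_equation:
  assumes X: "\<And>z. z \<in> \<H> \<Longrightarrow> sq_at Q X z"
  shows "curvature_equation Q (metric X)"
proof -
  \<comment> \<open>The poles form a countable set of measure zero, so integrals do not see the
    values of \<open>metric\<close> there.\<close>
  have nullP: "\<And>x. x \<in> poles Q \<Longrightarrow> emeasure lborel {x} = 0" "\<And>x. x \<in> poles Q \<Longrightarrow> {x} \<in> sets (lborel :: complex measure)"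
    by auto
  have li: "set_integrable lborel K (metric X) \<and> set_integrable lborel K (\<lambda>z. exp (metric X z))"
    if K: "compact K" "K \<subseteq> \<H>" for K
  proof -
    define S where "S = poles Q \<inter> K"
    have S: "finite S" "S \<subseteq> poles Q" using finite_poles[OF K] by (auto simp: S_def)
    obtain v where "log_decomposition X S v" using log_decomposition_exists[OF X S] by blast
    hence v: "\<And>n. Ck_on n (\<lambda>z. complex_of_real (v z)) (\<H> - (poles Q - S))"
      "\<And>z. z \<in> \<H> - poles Q \<Longrightarrow> metric X z = v z + (\<Sum>p\<in>S. 2 * real (pole_exponent p) * ln (cmod (z - p)))"
      unfolding log_decomposition_def by blast+
    have KU: "K \<subseteq> \<H> - (poles Q - S)" using K(2) by (auto simp: S_def)
    have "continuous_on K (\<lambda>z. Re (complex_of_real (v z)))"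
      by (rule continuous_on_Re[OF continuous_on_subset[OF Ck_on_continuous[OF v(1)[of 0]] KU]])
    hence vc: "continuous_on K v" by simp
    have iv: "integrable lborel (\<lambda>z. indicator K z *\<^sub>R v z)" by (rule borel_integrable_compact[OF K(1) vc])
    have isum: "integrable lborel (\<lambda>z. indicator K z *\<^sub>R v z + (\<Sum>p\<in>S. 2 * real (pole_exponent p) * (indicator K z * ln (cmod (z - p)))))"
      by (intro Bochner_Integration.integrable_add iv Bochner_Integration.integrable_sum integrable_mult_right integrable_log_on_compact K(1))
    have "integrable lborel (\<lambda>z. indicator K z *\<^sub>R metric X z)"
      by (rule integrable_discrete_difference[THEN iffD1, OF countable_poles nullP _ isum])
         (use v(2) K(2) in \<open>auto simp: indicator_def\<close>)
    \<comment> \<open>Off the poles \<open>exp (metric X z)\<close> is this product on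
      \<open>K\<close>; all exponents are nonnegative, so it is continuous there.\<close>
    moreover have "integrable lborel (\<lambda>z. indicator K z *\<^sub>R (exp (v z) * (\<Prod>p\<in>S. cmod (z - p) ^ (2 * pole_exponent p))))"
      by (intro borel_integrable_compact K(1) continuous_intros vc)
    moreover have "indicator K z *\<^sub>R (exp (v z) * (\<Prod>p\<in>S. cmod (z - p) ^ (2 * pole_exponent p))) = indicator K z *\<^sub>R exp (metric X z)"
      if z: "z \<notin> poles Q" for z
    proof (cases "z \<in> K")
      case True
      have "exp (2 * real (pole_exponent p) * ln (cmod (z - p))) = cmod (z - p) ^ (2 * pole_exponent p)" if "p \<in> S" for p
      proof -
        have "cmod (z - p) > 0" using that z S by auto
        have "exp (2 * real (pole_exponent p) * ln (cmod (z - p))) = exp (real (2 * pole_exponent p) * ln (cmod (z - p)))" by simp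
        also have "\<dots> = cmod (z - p) ^ (2 * pole_exponent p)"
          unfolding exp_of_nat_mult using \<open>cmod (z - p) > 0\<close> by simp
        finally show ?thesis .
      qed
      thus ?thesis using v(2)[of z] True K(2) z S(1) by (simp add: exp_add exp_sum subset_eq)
    qed simp
    hence "integrable lborel (\<lambda>z. indicator K z *\<^sub>R (exp (v z) * (\<Prod>p\<in>S. cmod (z - p) ^ (2 * pole_exponent p)))) \<longleftrightarrow>
        integrable lborel (\<lambda>z. indicator K z *\<^sub>R exp (metric X z))"
      by (intro integrable_discrete_difference[OF countable_poles nullP]) auto
    ultimately show ?thesis by (simp add: set_integrable_def)
  qed
  have eq: "(LINT z:\<H>|lborel. of_real (metric X z) * (4 * d_zbar (d_z \<phi>) z) + of_real (exp (metric X z)) * \<phi> z)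
        = 4 * of_real pi * (\<Sum>p\<in>{p\<in>poles Q. \<phi> p \<noteq> 0}. of_real (2 * kappa Q p - 1) * \<phi> p)"
    if \<phi>: "test_function \<phi>" for \<phi>
  proof -
    define K where "K = closure {z. \<phi> z \<noteq> 0}"
    have K: "compact K" "K \<subseteq> \<H>" unfolding K_def by (rule test_functionD[OF \<phi>])+
    have \<phi>0: "\<phi> z = 0" if "z \<notin> K" for z using test_functionD(4)[OF \<phi>] that unfolding K_def by blast
    have \<phi>2: "Ck_on 2 \<phi> UNIV" by (rule test_functionD(1)[OF \<phi>])
    have cK: "closed K" using K by (simp add: compact_imp_closed)
    have z1: "d_z \<phi> z = 0" if "z \<notin> K" for z using derivs_off_support(1)[OF cK \<phi>0 that] by simp
    have z2: "d_zbar (d_z \<phi>) z = 0" if "z \<notin> K" for z using derivs_off_support(2)[OF cK z1 that] by simp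
    define S where "S = poles Q \<inter> K"
    have S: "finite S" "S \<subseteq> poles Q" using finite_poles[OF K] by (auto simp: S_def)
    obtain v where "log_decomposition X S v" using log_decomposition_exists[OF X S] by blast
    hence v: "open (\<H> - (poles Q - S))" "\<And>n. Ck_on n (\<lambda>z. complex_of_real (v z)) (\<H> - (poles Q - S))"
      "\<And>z. z \<in> \<H> - poles Q \<Longrightarrow> metric X z = v z + (\<Sum>p\<in>S. 2 * real (pole_exponent p) * ln (cmod (z - p)))"
      "\<And>z. z \<in> \<H> - poles Q \<Longrightarrow> complex_of_real (exp (metric X z)) = - 4 * d_z (d_zbar (\<lambda>z. complex_of_real (v z))) z"
      unfolding log_decomposition_def by blast+
    define V where "V = (\<lambda>z. complex_of_real (v z))"
    have KU: "K \<subseteq> \<H> - (poles Q - S)" using K(2) by (auto simp: S_def)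
    have VC: "Ck_on 2 V (\<H> - (poles Q - S))" unfolding V_def by (rule v(2))
    have ibp: "integrable lborel (\<lambda>z. V z * d_zbar (d_z \<phi>) z)" "integrable lborel (\<lambda>z. d_z (d_zbar V) z * \<phi> z)"
      "(LINT z|lborel. V z * d_zbar (d_z \<phi>) z) = (LINT z|lborel. d_z (d_zbar V) z * \<phi> z)"
      using integration_by_parts[OF v(1) VC \<phi>2 K(1) KU \<phi>0] by blast+
    have lp: "integrable lborel (\<lambda>z. of_real (ln (cmod (z - p))) * d_zbar (d_z \<phi>) z)"
      "(LINT z|lborel. of_real (ln (cmod (z - p))) * d_zbar (d_z \<phi>) z) = of_real (pi / 2) * \<phi> p" for p
      using log_potential[OF \<phi>2 K(1) \<phi>0] by blast+
    let ?J = "\<lambda>z. 4 * (V z * d_zbar (d_z \<phi>) z) + (\<Sum>p\<in>S. of_real (8 * real (pole_exponent p)) * (of_real (ln (cmod (z - p))) * d_zbar (d_z \<phi>) z))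
       - 4 * (d_z (d_zbar V) z * \<phi> z)"
    have "(LINT z:\<H>|lborel. of_real (metric X z) * (4 * d_zbar (d_z \<phi>) z) + of_real (exp (metric X z)) * \<phi> z)
       = (LINT z|lborel. indicator \<H> z *\<^sub>R (of_real (metric X z) * (4 * d_zbar (d_z \<phi>) z) + of_real (exp (metric X z)) * \<phi> z))"
      by (simp add: set_lebesgue_integral_def)
    also have "\<dots> = (LINT z|lborel. ?J z)"
    proof (rule integral_discrete_difference[OF countable_poles nullP])
      fix z assume z: "z \<notin> poles Q"
      show "indicator \<H> z *\<^sub>R (of_real (metric X z) * (4 * d_zbar (d_z \<phi>) z) + of_real (exp (metric X z)) * \<phi> z) = ?J z"
      proof (cases "z \<in> K")
        case True
        hence zD: "z \<in> \<H> - poles Q" using z K(2) by blast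
        have "of_real (metric X z) = V z + (\<Sum>p\<in>S. of_real (2 * real (pole_exponent p) * ln (cmod (z - p))))"
          unfolding v(3)[OF zD] V_def by simp
        moreover have "of_real (exp (metric X z)) = - 4 * d_z (d_zbar V) z" using v(4)[OF zD] by (simp add: V_def)
        ultimately have "of_real (metric X z) * (4 * d_zbar (d_z \<phi>) z) + of_real (exp (metric X z)) * \<phi> z
           = (V z + (\<Sum>p\<in>S. of_real (2 * real (pole_exponent p) * ln (cmod (z - p))))) * (4 * d_zbar (d_z \<phi>) z) + (- 4 * d_z (d_zbar V) z) * \<phi> z"
          by simp
        also have "\<dots> = ?J z"
          by (simp add: ring_distribs sum_distrib_right sum_distrib_left mult_ac)
        finally show ?thesis using zD by simp
      qed (simp add: z2 \<phi>0)
    qed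
    also have "\<dots> = 4 * (LINT z|lborel. V z * d_zbar (d_z \<phi>) z) +
       (\<Sum>p\<in>S. of_real (8 * real (pole_exponent p)) * (LINT z|lborel. of_real (ln (cmod (z - p))) * d_zbar (d_z \<phi>) z))
       - 4 * (LINT z|lborel. d_z (d_zbar V) z * \<phi> z)"
    proof -
      have "integrable lborel (\<lambda>z. \<Sum>p\<in>S. of_real (8 * real (pole_exponent p)) * (of_real (ln (cmod (z - p))) * d_zbar (d_z \<phi>) z))"
        by (intro Bochner_Integration.integrable_sum integrable_mult_right lp(1))
      moreover have "integrable lborel (\<lambda>z. 4 * (V z * d_zbar (d_z \<phi>) z))" "integrable lborel (\<lambda>z. 4 * (d_z (d_zbar V) z * \<phi> z))"
        using ibp by (auto intro: integrable_mult_right)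
      moreover have "(LINT z|lborel. (\<Sum>p\<in>S. of_real (8 * real (pole_exponent p)) * (of_real (ln (cmod (z - p))) * d_zbar (d_z \<phi>) z)))
         = (\<Sum>p\<in>S. of_real (8 * real (pole_exponent p)) * (LINT z|lborel. of_real (ln (cmod (z - p))) * d_zbar (d_z \<phi>) z))"
        by (subst Bochner_Integration.integral_sum) (auto intro: integrable_mult_right lp(1))
      ultimately show ?thesis by (simp add: Bochner_Integration.integral_add Bochner_Integration.integral_diff)
    qed
    also have "\<dots> = (\<Sum>p\<in>S. of_real (8 * real (pole_exponent p)) * (of_real (pi / 2) * \<phi> p))"
      unfolding ibp(3) lp(2) by simp
    also have "\<dots> = 4 * of_real pi * (\<Sum>p\<in>S. of_real (2 * kappa Q p - 1) * \<phi> p)"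
      unfolding sum_distrib_left
    proof (rule sum.cong)
      fix p assume "p \<in> S"
      hence e: "2 * kappa Q p - 1 = real (pole_exponent p)" using pole_exponent[of p] S(2) by auto
      show "of_real (8 * real (pole_exponent p)) * (of_real (pi / 2) * \<phi> p) = 4 * of_real pi * (of_real (2 * kappa Q p - 1) * \<phi> p)"
        unfolding e by simp
    qed simp
    also have "(\<Sum>p\<in>S. of_real (2 * kappa Q p - 1) * \<phi> p) = (\<Sum>p\<in>{p\<in>poles Q. \<phi> p \<noteq> 0}. of_real (2 * kappa Q p - 1) * \<phi> p)"
    proof (rule sum.mono_neutral_right[OF S(1)])
      show "{p \<in> poles Q. \<phi> p \<noteq> 0} \<subseteq> S" using \<phi>0 by (auto simp: S_def)
    qed (auto simp: S_def)
    finally show ?thesis .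
  qed
  show ?thesis unfolding curvature_equation_def locally_integrable_def using li eq by blast
qed

text \<open>With \<open>t = q^\<kappa>\<close> the solution with \<open>q^{-\<kappa>}\<close>
  dominates: \<open>tnorm (X z) |t|^2\<close> tends to \<open>|g1 0|^2\<close> times the squared
  norm of the first column of \<open>N\<close>, nonzero as \<open>det N = 1\<close>. Hence
  \<open>e^u = 8 / tnorm^2\<close> decays like \<open>|q|^(4 \<kappa>)\<close>, and
  \<open>\<alpha>\<close> is \<open>\<kappa>\<close>.\<close>

lemma metric_cusp:
  assumes X: "\<And>z. z \<in> \<H> \<Longrightarrow> sq_at Q X z"
  shows "\<exists>\<alpha>>0. \<exists>C>0. ((\<lambda>z. exp (metric X z) / cmod (qpar z) powr (4 * \<alpha>)) \<longlongrightarrow> C) at_cusp"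
proof -
  obtain Y R g1 g2 where cd: "cusp_data Y R g1 g2" using cusp_data_exists by blast
  note cd' = cd[unfolded cusp_data_def]
  obtain N where N: "det N = 1" "\<And>z. Im z > Y \<Longrightarrow> X z = sym2 N (veronese
     (exp (2 * of_real pi * \<i> * (- of_real \<kappa>) * z) * g1 (qpar z)) (exp (2 * of_real pi * \<i> * of_real \<kappa> * z) * g2 (qpar z)))"
    using cusp_system[OF cd X] by blast
  define t where "t = (\<lambda>z. exp (2 * of_real pi * \<i> * of_real \<kappa> * z))"
  have tinv: "exp (2 * of_real pi * \<i> * (- of_real \<kappa>) * z) = inverse (t z)" for z
    by (simp add: t_def exp_minus)
  have tz: "exp (2 * of_real pi * \<i> * of_real \<kappa> * z) = t z" for z
    by (simp add: t_def)
  have tn: "t z \<noteq> 0" for z by (simp add: t_def)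
  have qt: "cmod (qpar z) powr (2 * \<kappa>) = (cmod (t z))\<^sup>2" for z
  proof -
    have "cmod (qpar z) powr (2 * \<kappa>) = exp (2 * \<kappa> * - (2 * pi * Im z))"
      unfolding norm_qpar powr_def by simp
    also have "\<dots> = exp (- (2 * pi * \<kappa> * Im z)) * exp (- (2 * pi * \<kappa> * Im z))"
      by (simp add: algebra_simps flip: exp_add)
    also have "exp (- (2 * pi * \<kappa> * Im z)) = cmod (t z)" by (simp add: t_def norm_exp_eq_Re)
    finally show ?thesis by (simp add: power2_eq_square)
  qed
  have t0: "((\<lambda>z. (t z)\<^sup>2) \<longlongrightarrow> 0) at_cusp"
  proof (rule tendsto_norm_zero_cancel)
    have "((\<lambda>z. cmod (qpar z) powr (2 * \<kappa>)) \<longlongrightarrow> 0 powr (2 * \<kappa>)) at_cusp"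
      using kappa_pos tendsto_norm_zero[OF qpar_tendsto_0] by (intro tendsto_powr' tendsto_const) auto
    thus "((\<lambda>z. cmod ((t z)\<^sup>2)) \<longlongrightarrow> 0) at_cusp" by (simp add: qt norm_power)
  qed
  have gc: "((\<lambda>z. g1 (qpar z)) \<longlongrightarrow> g1 0) at_cusp" "((\<lambda>z. g2 (qpar z)) \<longlongrightarrow> g2 0) at_cusp"
    using cd' holomorphic_on_imp_continuous_on[of _ "ball 0 R"]
    by (auto intro!: isCont_at_cusp simp: continuous_on_eq_continuous_at)
  define G where "G = (\<lambda>z. (cmod (e11 N * g1 (qpar z) + e12 N * ((t z)\<^sup>2 * g2 (qpar z))))\<^sup>2 +
     (cmod (e21 N * g1 (qpar z) + e22 N * ((t z)\<^sup>2 * g2 (qpar z))))\<^sup>2)"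
  define c where "c = (cmod (e11 N * g1 0))\<^sup>2 + (cmod (e21 N * g1 0))\<^sup>2"
  have "(G \<longlongrightarrow> (cmod (e11 N * g1 0 + e12 N * (0 * g2 0)))\<^sup>2 + (cmod (e21 N * g1 0 + e22 N * (0 * g2 0)))\<^sup>2) at_cusp"
    unfolding G_def by (intro tendsto_intros gc t0)
  hence Gl: "(G \<longlongrightarrow> c) at_cusp" by (simp add: c_def)
  have c: "c > 0"
  proof -
    have "e11 N \<noteq> 0 \<or> e21 N \<noteq> 0" using N(1) by (auto simp: det_2)
    moreover have "g1 0 \<noteq> 0" using cd' by blast
    ultimately show ?thesis unfolding c_def by (auto intro: add_pos_nonneg add_nonneg_pos)
  qed
  have scale_squares: "((cmod x)\<^sup>2 + (cmod y)\<^sup>2) * (cmod T)\<^sup>2 = (cmod (T * x))\<^sup>2 + (cmod (T * y))\<^sup>2" for x y T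
    by (simp add: norm_mult power_mult_distrib algebra_simps)
  have GX: "tnorm (X z) * (cmod (t z))\<^sup>2 = G z" if z: "Im z > Y" for z
  proof -
    have "tnorm (X z) = (cmod (e11 N * (inverse (t z) * g1 (qpar z)) + e12 N * (t z * g2 (qpar z))))\<^sup>2 +
       (cmod (e21 N * (inverse (t z) * g1 (qpar z)) + e22 N * (t z * g2 (qpar z))))\<^sup>2"
      unfolding N(2)[OF z] sym2_veronese tnorm_veronese tinv tz ..
    hence "tnorm (X z) * (cmod (t z))\<^sup>2 = (cmod (t z * (e11 N * (inverse (t z) * g1 (qpar z)) + e12 N * (t z * g2 (qpar z)))))\<^sup>2 +
       (cmod (t z * (e21 N * (inverse (t z) * g1 (qpar z)) + e22 N * (t z * g2 (qpar z)))))\<^sup>2"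
      by (simp only: scale_squares)
    moreover have "t z * (a * (inverse (t z) * g1 (qpar z)) + b * (t z * g2 (qpar z))) = a * g1 (qpar z) + b * ((t z)\<^sup>2 * g2 (qpar z))" for a b
      using tn[of z] by (simp add: field_simps power2_eq_square)
    ultimately show ?thesis by (simp only: G_def)
  qed
  have "((\<lambda>z. 8 / (G z)\<^sup>2) \<longlongrightarrow> 8 / c\<^sup>2) at_cusp" using c by (intro tendsto_intros Gl) auto
  moreover have "\<forall>\<^sub>F z in at_cusp. 8 / (G z)\<^sup>2 = exp (metric X z) / cmod (qpar z) powr (4 * \<kappa>)"
    unfolding eventually_at_cusp
  proof (intro exI allI impI)
    fix z assume z: "Im z > Y"
    hence zD: "z \<in> \<H> - poles Q" using cd' by blast
    have "exp (metric X z) = 8 / (tnorm (X z))\<^sup>2"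
      using tsquare_regular[OF X zD] by (simp add: exp_diff)
    moreover have "cmod (qpar z) powr (4 * \<kappa>) = ((cmod (t z))\<^sup>2)\<^sup>2"
    proof -
      have "cmod (qpar z) powr (4 * \<kappa>) = cmod (qpar z) powr (2 * \<kappa> + 2 * \<kappa>)" by simp
      also have "\<dots> = cmod (qpar z) powr (2 * \<kappa>) * cmod (qpar z) powr (2 * \<kappa>)" by (rule powr_add)
      finally show ?thesis by (simp only: qt power2_eq_square)
    qed
    ultimately show "8 / (G z)\<^sup>2 = exp (metric X z) / cmod (qpar z) powr (4 * \<kappa>)"
      unfolding GX[OF z, symmetric] power_mult_distrib by simp
  qed
  ultimately have "((\<lambda>z. exp (metric X z) / cmod (qpar z) powr (4 * \<kappa>)) \<longlongrightarrow> 8 / c\<^sup>2) at_cusp"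
    by (rule Lim_transform_eventually)
  thus ?thesis using kappa_pos c by (intro exI[of _ \<kappa>] conjI exI[of _ "8 / c\<^sup>2"]) auto
qed

text \<open>The automorphy factor is a cocycle, so the law has to be checked on the generators only.
  There \<open>tnorm\<close> of the slash carries the factor \<open>|c z + d|^2\<close>, and
  \<open>- 2 ln\<close> doubles the exponent.\<close>

lemma metric_invariance:
  assumes X: "\<And>z. z \<in> \<H> \<Longrightarrow> sq_at Q X z"
    and inv: "\<And>z. z \<in> \<H> - poles Q \<Longrightarrow> tnorm (slash matS X z) = tnorm (X z)"
      "\<And>z. z \<in> \<H> - poles Q \<Longrightarrow> tnorm (slash matT X z) = tnorm (X z)"
    and A: "A \<in> SL2Z" and z: "z \<in> \<H> - poles Q"
  shows "metric X (act A z) = metric X z + 4 * ln (cmod (autfac A z))"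
proof -
  have base: "metric X (act A z) = metric X z + 4 * ln (cmod (autfac A z))"
    if A: "A \<in> SL2Z" and z: "z \<in> \<H> - poles Q" and i: "tnorm (slash A X z) = tnorm (X z)" for A z
  proof -
    have "(cmod (autfac A z))\<^sup>2 * tnorm (X (act A z)) = tnorm (X z)"
      using i by (simp add: slash_def tnorm_tscale norm_power)
    moreover have "tnorm (X (act A z)) > 0" using tsquare_regular(1)[OF X act_regular[OF A z]] .
    moreover have "cmod (autfac A z) > 0" using autfac_nonzero[OF A] z by auto
    ultimately have "ln (tnorm (X z)) = 2 * ln (cmod (autfac A z)) + ln (tnorm (X (act A z)))"
      by (metis ln_mult_pos ln_realpow of_nat_numeral zero_less_power)
    thus ?thesis by (simp add: metric_def)
  qed
  have "\<forall>z\<in>\<H> - poles Q. metric X (act A z) = metric X z + 4 * ln (cmod (autfac A z))"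
    using A
  proof (induction A rule: SL2Z_induct)
    case S
    thus ?case using base[OF matS_SL2Z] inv(1) by blast
  next
    case T
    thus ?case using base[OF matT_SL2Z] inv(2) by blast
  next
    case (mult A B)
    show ?case
    proof
      fix z assume z: "z \<in> \<H> - poles Q"
      have Bz: "act B z \<in> \<H> - poles Q" using act_regular[OF mult(2) z] .
      have "cmod (autfac A (act B z)) > 0" "cmod (autfac B z) > 0"
        using autfac_nonzero[OF mult(1)] autfac_nonzero[OF mult(2)] Bz z by auto
      hence "ln (cmod (autfac (A ** B) z)) = ln (cmod (autfac A (act B z))) + ln (cmod (autfac B z))"
        using autfac_mult[OF mult(2), of z A] z by (simp add: norm_mult ln_mult)
      moreover have "act (A ** B) z = act A (act B z)" using act_mult[OF mult(1,2)] z by blast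
      ultimately show "metric X (act (A ** B) z) = metric X z + 4 * ln (cmod (autfac (A ** B) z))"
        using mult(3,4) z Bz by simp
    qed
  qed
  thus ?thesis using z by blast
qed

theorem invariant_metric_of_unitary_system:
  assumes X: "\<And>z. z \<in> \<H> \<Longrightarrow> sq_at Q X z"
    and inv: "\<And>z. z \<in> \<H> - poles Q \<Longrightarrow> tnorm (slash matS X z) = tnorm (X z)"
      "\<And>z. z \<in> \<H> - poles Q \<Longrightarrow> tnorm (slash matT X z) = tnorm (X z)"
  shows "invariant_metric Q (metric X)"
proof -
  have "smooth_on (\<lambda>z. of_real (metric X z)) (\<H> - poles Q)"
    unfolding smooth_on_def
  proof
    fix n
    have "Ck_on n (\<lambda>z. of_real (ln 8) - of_real (ln (tsquare (X z)))) (\<H> - poles Q)"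
    proof (intro Ck_on_diff Ck_on_const Ck_on_ln Ck_on_tsquare open_regular)
      show "tsquare (X z) > 0" if "z \<in> \<H> - poles Q" for z using tsquare_regular[OF X that] by simp
    qed (use sq_holomorphic[OF open_H order_refl X] in auto)
    thus "Ck_on n (\<lambda>z. of_real (metric X z)) (\<H> - poles Q)"
      by (rule Ck_on_cong[OF open_regular, rotated]) (simp add: tsquare_regular(3)[OF X])
  qed
  thus ?thesis
    unfolding invariant_metric_def Let_def
    using metric_curvature_equation[OF X] metric_invariance[OF X inv] metric_cusp[OF X] metric_derivs(1)[OF X] by blast
qed

end

section \<open>The Hermitian form of an invariant metric\<close>

text \<open>Applying \<open>d_z\<close>, \<open>d_zbar\<close> and both to the difference of the
  forms gives, with the difference itself, four linear equations for its coefficients; their matrix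
  is built from the Wronskian matrix and its conjugate and is invertible.\<close>

lemma herm_coefficients_unique:
  assumes fp: "fundamental_pair Q V y1 y2" and V: "open V" "V \<noteq> {}"
    and eq: "\<And>z. z \<in> V \<Longrightarrow> herm C B A (y1 z) (y2 z) = herm C' B' A' (y1 z) (y2 z)"
  shows "C = C' \<and> B = B' \<and> A = A'"
proof -
  have o: "ode_solution Q V y1" "ode_solution Q V y2" using fp by (auto simp: fundamental_pair_def)
  note d = ode_solution_derivs[OF o(1) V(1)] ode_solution_derivs[OF o(2) V(1)]
  define c b a where "c = C - C'" and "b = B - B'" and "a = A - A'"
  have lin: "herm_z c b a v1 v2 w1 w2 = herm_z C B A v1 v2 w1 w2 - herm_z C' B' A' v1 v2 w1 w2" for v1 v2 w1 w2
    by (simp add: herm_z_def c_def b_def a_def algebra_simps)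
  have 0: "herm_z c b a (y1 z) (y2 z) (y1 z) (y2 z) = 0" if "z \<in> V" for z
    using eq[OF that] unfolding lin by (simp flip: herm_eq_herm_z)
  have z1: "herm_z c b a (deriv y1 z) (deriv y2 z) (y1 z) (y2 z) = 0"
    "herm_z c b a (y1 z) (y2 z) (deriv y1 z) (deriv y2 z) = 0" if z: "z \<in> V" for z
  proof -
    have "has_wd (\<lambda>_. 0) (herm_z c b a (deriv y1 z) (deriv y2 z) (y1 z) (y2 z)) (herm_z c b a (y1 z) (y2 z) (deriv y1 z) (deriv y2 z)) z"
      by (rule has_wd_cong[OF has_wd_herm_z[OF d(1)[OF z] d(3)[OF z] d(1)[OF z] d(3)[OF z]] V(1) z 0])
    with has_wdD[OF this] has_wdD[OF has_wd_const[of 0 z]]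
    show "herm_z c b a (deriv y1 z) (deriv y2 z) (y1 z) (y2 z) = 0" "herm_z c b a (y1 z) (y2 z) (deriv y1 z) (deriv y2 z) = 0"
      by auto
  qed
  obtain z where z: "z \<in> V" using V(2) by blast
  have "has_wd (\<lambda>_. 0) (herm_z c b a (Q z * y1 z) (Q z * y2 z) (y1 z) (y2 z)) (herm_z c b a (deriv y1 z) (deriv y2 z) (deriv y1 z) (deriv y2 z)) z"
    by (rule has_wd_cong[OF has_wd_herm_z[OF d(2)[OF z] d(4)[OF z] d(1)[OF z] d(3)[OF z]] V(1) z z1(1)])
  with has_wdD[OF this] has_wdD[OF has_wd_const[of 0 z]]
  have z2: "herm_z c b a (deriv y1 z) (deriv y2 z) (deriv y1 z) (deriv y2 z) = 0" by auto
  have W: "y1 z * deriv y2 z - deriv y1 z * y2 z = 1" using fp z by (auto simp: fundamental_pair_def)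
  have "cnj (y1 z * deriv y2 z - deriv y1 z * y2 z) = 1" unfolding W by simp
  hence W': "cnj (y1 z) * cnj (deriv y2 z) - cnj (deriv y1 z) * cnj (y2 z) = 1" by simp
  define x y x' y' where "x = y1 z" and "y = y2 z" and "x' = deriv y1 z" and "y' = deriv y2 z"
  define X Y X' Y' where "X = cnj (y1 z)" and "Y = cnj (y2 z)" and "X' = cnj (deriv y1 z)" and "Y' = cnj (deriv y2 z)"
  note defs = x_def y_def x'_def y'_def X_def Y_def X'_def Y'_def
  define ac cc where "ac = complex_of_real a" and "cc = complex_of_real c"
  have e: "cc * (x * X) + b * (y * X) + cnj b * (x * Y) + ac * (y * Y) = 0"
    "cc * (x' * X) + b * (y' * X) + cnj b * (x' * Y) + ac * (y' * Y) = 0"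
    "cc * (x * X') + b * (y * X') + cnj b * (x * Y') + ac * (y * Y') = 0"
    "cc * (x' * X') + b * (y' * X') + cnj b * (x' * Y') + ac * (y' * Y') = 0"
    using 0[OF z] z1[OF z] z2 by (simp_all add: herm_z_def defs ac_def cc_def)
  have w: "x * y' - x' * y = 1" "X * Y' - X' * Y = 1" using W W' by (simp_all add: defs)
  have "cc = 0" using e w by algebra
  moreover have "b = 0" using e w by algebra
  moreover have "ac = 0" using e w by algebra
  ultimately show ?thesis by (simp add: ac_def cc_def a_def b_def c_def)
qed

text \<open>The form as a function of the three products: for \<open>y1 \<noteq> 0\<close> the mixed
  product \<open>y2 cnj y1\<close> equals \<open>y1 y2 |y1^2| / y1^2\<close>, which makes sense for
  solutions known up to sign.\<close>

definition therm :: "real \<Rightarrow> complex \<Rightarrow> real \<Rightarrow> complex \<times> complex \<times> complex \<Rightarrow> real" where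
  "therm C B A = (\<lambda>(x, y, z). C * cmod x + 2 * Re (B * y * of_real (cmod x) / x) + A * cmod z)"

text \<open>If \<open>y1 = 0\<close> the mixed term vanishes on both sides, because \<open>x / 0 = 0\<close>.\<close>

lemma therm_veronese: "therm C B A (veronese y1 y2) = herm C B A y1 y2"
proof (cases "y1 = 0")
  case False
  have "B * (y1 * y2) * of_real (cmod (y1\<^sup>2)) / y1\<^sup>2 = B * (y1 * y2) * (y1 * cnj y1) / y1\<^sup>2"
    by (simp only: norm_power complex_norm_square)
  also have "\<dots> = B * y2 * cnj y1" using False by (simp add: power2_eq_square)
  finally show ?thesis by (simp add: therm_def veronese_def herm_def norm_power)
qed (simp add: therm_def veronese_def herm_def norm_power)

lemma therm_tscale: "c \<noteq> 0 \<Longrightarrow> therm C B A (tscale c X) = cmod c * therm C B A X"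
proof -
  assume c: "c \<noteq> 0"
  obtain x y z where X: "X = (x, y, z)" by (cases X)
  have "B * (c * y) * of_real (cmod (c * x)) / (c * x) = of_real (cmod c) * (B * y * of_real (cmod x) / x)"
    using c by (cases "x = 0") (simp_all add: norm_mult)
  moreover have "Re (of_real a * w) = a * Re w" for a w by simp
  ultimately have "Re (B * (c * y) * of_real (cmod (c * x)) / (c * x)) = cmod c * Re (B * y * of_real (cmod x) / x)"
    by metis
  thus ?thesis by (simp add: X therm_def tscale_def norm_mult algebra_simps)
qed

text \<open>\<open>\<Phi> = exp (- u / 2)\<close> satisfies \<open>\<Phi>_zz = Q \<Phi>\<close>, so
  its Wronskians with \<open>y1\<close> and \<open>y2\<close> are annihilated by \<open>d_z\<close>.
  By Cramer's rule and reality \<open>\<Phi> = k1 cnj y1 + k2 cnj y2\<close> with \<open>k1\<close>,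
  \<open>k2\<close> holomorphic, and the equation for \<open>\<Phi>\<close> forces these to be
  solutions themselves.\<close>

lemma real_metric_hermitian:
  assumes fp: "fundamental_pair Q V y1 y2" and V: "open V" "convex V"
    and C2: "Ck_on 2 (\<lambda>z. complex_of_real (u z)) V"
    and eq: "\<And>z. z \<in> V \<Longrightarrow> Q z = - (1/2) * (d_z (d_z (\<lambda>z. complex_of_real (u z))) z - (1/2) * (d_z (\<lambda>z. complex_of_real (u z)) z)\<^sup>2)"
  obtains C B A where "\<And>z. z \<in> V \<Longrightarrow> exp (- (u z / 2)) = herm C B A (y1 z) (y2 z)"
proof -
  have o: "ode_solution Q V y1" "ode_solution Q V y2" using fp by (auto simp: fundamental_pair_def)
  define U where "U = (\<lambda>z. complex_of_real (u z))"
  define \<Phi> where "\<Phi> = (\<lambda>z. complex_of_real (exp (- (u z / 2))))"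
  have U2: "Ck_on (Suc (Suc 0)) U V" using C2 by (simp add: U_def numeral_2_eq_2)
  have wU: "has_wd U (d_z U z) (d_zbar U z) z" if "z \<in> V" for z by (rule Ck_on_has_wd[OF U2 that])
  have wU1: "has_wd (d_z U) (d_z (d_z U) z) (d_zbar (d_z U) z) z" if "z \<in> V" for z
    by (rule Ck_on_has_wd[OF Ck_on_d_z[OF V(1) U2] that])
  have w\<Phi>: "has_wd \<Phi> (- (1/2) * d_z U z * \<Phi> z) (- (1/2) * d_zbar U z * \<Phi> z) z" if "z \<in> V" for z
  proof -
    have "has_wd (\<lambda>z. (- (1/2)) * U z) (- (1/2) * d_z U z) (- (1/2) * d_zbar U z) z"
      by (rule has_wd_cmult[OF wU[OF that]])
    hence "has_wd (\<lambda>z. complex_of_real (- (u z / 2))) (- (1/2) * d_z U z) (- (1/2) * d_zbar U z) z"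
      by (simp add: U_def)
    from has_wd_exp[OF this] show ?thesis by (simp add: \<Phi>_def)
  qed
  define \<Phi>1 where "\<Phi>1 = (\<lambda>z. - (1/2) * d_z U z * \<Phi> z)"
  have w1: "has_wd \<Phi>1 (Q z * \<Phi> z) (- (1/2) * d_zbar (d_z U) z * \<Phi> z + - (1/2) * d_z U z * (- (1/2) * d_zbar U z * \<Phi> z)) z" if z: "z \<in> V" for z
  proof -
    have "has_wd \<Phi>1 (- (1/2) * d_z (d_z U) z * \<Phi> z + - (1/2) * d_z U z * (- (1/2) * d_z U z * \<Phi> z))
       (- (1/2) * d_zbar (d_z U) z * \<Phi> z + - (1/2) * d_z U z * (- (1/2) * d_zbar U z * \<Phi> z)) z"
      unfolding \<Phi>1_def by (rule has_wd_mult[OF has_wd_cmult[OF wU1[OF z]] w\<Phi>[OF z]])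
    moreover have "- (1/2) * d_z (d_z U) z * \<Phi> z + - (1/2) * d_z U z * (- (1/2) * d_z U z * \<Phi> z) = Q z * \<Phi> z"
      unfolding eq[OF z] U_def[symmetric] by (simp add: power2_eq_square algebra_simps)
    ultimately show ?thesis by simp
  qed
  note dy = ode_solution_derivs[OF o(1) V(1)] ode_solution_derivs[OF o(2) V(1)]
  have kh: "(\<lambda>z. cnj (\<Phi> z * deriv y z - \<Phi>1 z * y z)) holomorphic_on V" if y: "ode_solution Q V y" for y
    unfolding holomorphic_on_open[OF V(1)]
  proof
    fix z assume z: "z \<in> V"
    note d = ode_solution_derivs[OF y V(1) z]
    have "\<exists>b. has_wd (\<lambda>z. \<Phi> z * deriv y z - \<Phi>1 z * y z) 0 b z"
    proof -
      obtain b1 where b1: "has_wd \<Phi>1 (Q z * \<Phi> z) b1 z" using w1[OF z] by blast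
      have "has_wd (\<lambda>z. \<Phi> z * deriv y z - \<Phi>1 z * y z)
        ((- (1/2) * d_z U z * \<Phi> z) * deriv y z + \<Phi> z * (Q z * y z) - ((Q z * \<Phi> z) * y z + \<Phi>1 z * deriv y z))
        ((- (1/2) * d_zbar U z * \<Phi> z) * deriv y z + \<Phi> z * 0 - (b1 * y z + \<Phi>1 z * 0)) z"
        by (intro has_wd_diff has_wd_mult w\<Phi> z b1 has_wd_field_derivative d)
      moreover have "(- (1/2) * d_z U z * \<Phi> z) * deriv y z + \<Phi> z * (Q z * y z) - ((Q z * \<Phi> z) * y z + \<Phi>1 z * deriv y z) = 0"
        by (simp add: \<Phi>1_def algebra_simps)
      ultimately show ?thesis by auto
    qed
    then obtain b where "has_wd (\<lambda>z. \<Phi> z * deriv y z - \<Phi>1 z * y z) 0 b z" by blast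
    from has_wd_cnj[OF this] have "has_wd (\<lambda>z. cnj (\<Phi> z * deriv y z - \<Phi>1 z * y z)) (cnj b) 0 z" by simp
    thus "\<exists>f'. ((\<lambda>z. cnj (\<Phi> z * deriv y z - \<Phi>1 z * y z)) has_field_derivative f') (at z)"
      by (auto simp: has_wd_def has_field_derivative_def)
  qed
  define k1 where "k1 = (\<lambda>z. cnj (\<Phi> z * deriv y2 z - \<Phi>1 z * y2 z))"
  define k2 where "k2 = (\<lambda>z. - cnj (\<Phi> z * deriv y1 z - \<Phi>1 z * y1 z))"
  have k: "k1 holomorphic_on V" "k2 holomorphic_on V"
    unfolding k1_def k2_def by (intro holomorphic_intros kh o)+
  have W: "y1 z * deriv y2 z - deriv y1 z * y2 z = 1" if "z \<in> V" for z using fp that by (auto simp: fundamental_pair_def)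
  have \<Phi>cnj: "cnj (\<Phi> z) = \<Phi> z" for z by (simp add: \<Phi>_def)
  have \<Phi>k: "\<Phi> z = k1 z * cnj (y1 z) + k2 z * cnj (y2 z)" if z: "z \<in> V" for z
  proof -
    have "cnj (k1 z) * y1 z + cnj (k2 z) * y2 z = \<Phi> z * (y1 z * deriv y2 z - deriv y1 z * y2 z)"
      by (simp add: k1_def k2_def algebra_simps)
    hence "cnj (k1 z) * y1 z + cnj (k2 z) * y2 z = \<Phi> z" using W[OF z] by simp
    hence "cnj (cnj (k1 z) * y1 z + cnj (k2 z) * y2 z) = cnj (\<Phi> z)" by simp
    thus ?thesis by (simp add: \<Phi>cnj)
  qed
  have kd: "(k1 has_field_derivative deriv k1 z) (at z)" "(k2 has_field_derivative deriv k2 z) (at z)"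
    "(deriv k1 has_field_derivative deriv (deriv k1) z) (at z)" "(deriv k2 has_field_derivative deriv (deriv k2) z) (at z)" if "z \<in> V" for z
    using k V(1) that by (auto intro!: holomorphic_derivI[of _ V] holomorphic_deriv)
  have wk: "has_wd (\<lambda>z. f z * cnj (y1 z) + g z * cnj (y2 z)) (f' * cnj (y1 z) + g' * cnj (y2 z))
      (f z * cnj (deriv y1 z) + g z * cnj (deriv y2 z)) z"
    if z: "z \<in> V" and fg: "(f has_field_derivative f') (at z)" "(g has_field_derivative g') (at z)" for f g f' g' z
  proof -
    have "has_wd (\<lambda>z. f z * cnj (y1 z) + g z * cnj (y2 z)) ((f' * cnj (y1 z) + f z * cnj 0) + (g' * cnj (y2 z) + g z * cnj 0))
      ((0 * cnj (y1 z) + f z * cnj (deriv y1 z)) + (0 * cnj (y2 z) + g z * cnj (deriv y2 z))) z"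
      by (intro has_wd_add has_wd_mult has_wd_cnj has_wd_field_derivative fg dy z)
    thus ?thesis by simp
  qed
  have \<Phi>1k: "\<Phi>1 z = deriv k1 z * cnj (y1 z) + deriv k2 z * cnj (y2 z)" if z: "z \<in> V" for z
  proof -
    have "has_wd \<Phi> (deriv k1 z * cnj (y1 z) + deriv k2 z * cnj (y2 z)) (k1 z * cnj (deriv y1 z) + k2 z * cnj (deriv y2 z)) z"
      by (rule has_wd_cong[OF wk[OF z kd(1,2)[OF z]] V(1) z]) (simp add: \<Phi>k)
    from has_wdD(1)[OF this] has_wdD(1)[OF w\<Phi>[OF z]] show ?thesis by (simp add: \<Phi>1_def)
  qed
  have k0: "(deriv (deriv k1) z - Q z * k1 z) * cnj (y1 z) + (deriv (deriv k2) z - Q z * k2 z) * cnj (y2 z) = 0" if z: "z \<in> V" for z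
  proof -
    have "has_wd \<Phi>1 (deriv (deriv k1) z * cnj (y1 z) + deriv (deriv k2) z * cnj (y2 z))
       (deriv k1 z * cnj (deriv y1 z) + deriv k2 z * cnj (deriv y2 z)) z"
      by (rule has_wd_cong[OF wk[OF z kd(3,4)[OF z]] V(1) z]) (simp add: \<Phi>1k)
    from has_wdD(1)[OF this] has_wdD(1)[OF w1[OF z]]
    have "deriv (deriv k1) z * cnj (y1 z) + deriv (deriv k2) z * cnj (y2 z) = Q z * \<Phi> z" by simp
    thus ?thesis unfolding \<Phi>k[OF z] by (simp add: algebra_simps)
  qed
  \<comment> \<open>The identity \<open>k0\<close> is one equation for the two defects; its
    \<open>d_zbar\<close> is a second one with conjugated derivatives, and the Wronskian makes the
    system invertible.\<close>
  have ode: "deriv (deriv k1) z = Q z * k1 z \<and> deriv (deriv k2) z = Q z * k2 z" if z: "z \<in> V" for z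
  proof -
    define K1 where "K1 = (\<lambda>z. deriv (deriv k1) z - Q z * k1 z)"
    define K2 where "K2 = (\<lambda>z. deriv (deriv k2) z - Q z * k2 z)"
    \<comment> \<open>\<open>Q\<close> is recovered from the basis, since
      \<open>y1'' y2' - y2'' y1'\<close> is \<open>Q\<close> times the Wronskian.\<close>
    have Qh: "Q holomorphic_on V"
    proof (rule holomorphic_transform)
      show "(\<lambda>z. deriv (deriv y1) z * deriv y2 z - deriv (deriv y2) z * deriv y1 z) holomorphic_on V"
        using o V(1) by (auto intro!: holomorphic_intros holomorphic_deriv simp: ode_solution_def)
      show "deriv (deriv y1) w * deriv y2 w - deriv (deriv y2) w * deriv y1 w = Q w" if "w \<in> V" for w
      proof -
        have "deriv (deriv y1) w = Q w * y1 w" "deriv (deriv y2) w = Q w * y2 w"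
          using o that by (auto simp: ode_solution_def)
        thus ?thesis using W[OF that] by algebra
      qed
    qed
    have "K1 holomorphic_on V" "K2 holomorphic_on V"
      unfolding K1_def K2_def using k Qh V(1) by (auto intro!: holomorphic_intros holomorphic_deriv)
    hence Kd: "(K1 has_field_derivative deriv K1 z) (at z)" "(K2 has_field_derivative deriv K2 z) (at z)"
      using V(1) z by (auto intro: holomorphic_derivI)
    have "has_wd (\<lambda>_. 0) (deriv K1 z * cnj (y1 z) + deriv K2 z * cnj (y2 z)) (K1 z * cnj (deriv y1 z) + K2 z * cnj (deriv y2 z)) z"
      by (rule has_wd_cong[OF wk[OF z Kd] V(1) z]) (simp add: k0 K1_def K2_def)
    from has_wdD(2)[OF this] has_wdD(2)[OF has_wd_const[of 0 z]]
    have 1: "K1 z * cnj (deriv y1 z) + K2 z * cnj (deriv y2 z) = 0" by simp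
    have 2: "K1 z * cnj (y1 z) + K2 z * cnj (y2 z) = 0" using k0[OF z] by (simp add: K1_def K2_def)
    have "cnj (y1 z * deriv y2 z - deriv y1 z * y2 z) = 1" unfolding W[OF z] by simp
    hence 3: "cnj (y1 z) * cnj (deriv y2 z) - cnj (deriv y1 z) * cnj (y2 z) = 1" by simp
    have "K1 z = 0" "K2 z = 0" using 1 2 3 by algebra+
    thus ?thesis by (simp add: K1_def K2_def)
  qed
  have "ode_solution Q V k1" "ode_solution Q V k2" using k ode by (auto simp: ode_solution_def)
  then obtain a b c d where k12: "\<And>z. z \<in> V \<Longrightarrow> k1 z = a * y1 z + b * y2 z" "\<And>z. z \<in> V \<Longrightarrow> k2 z = c * y1 z + d * y2 z"
    using ode_solution_combination[OF fp _ V] by metis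
  \<comment> \<open>The coefficient matrix is not known to be Hermitian; as \<open>\<Phi>\<close> is
    real, taking real parts replaces it by its Hermitian part.\<close>
  have "exp (- (u z / 2)) = herm (Re a) ((b + cnj c) / 2) (Re d) (y1 z) (y2 z)" if z: "z \<in> V" for z
  proof -
    have "exp (- (u z / 2)) = Re (\<Phi> z)" by (simp add: \<Phi>_def)
    also have "\<Phi> z = (a * (y1 z * cnj (y1 z)) + d * (y2 z * cnj (y2 z))) + (b * (y2 z * cnj (y1 z)) + c * (y1 z * cnj (y2 z)))"
      unfolding \<Phi>k[OF z] k12[OF z] by (simp add: algebra_simps)
    also have "Re \<dots> = herm (Re a) ((b + cnj c) / 2) (Re d) (y1 z) (y2 z)"
    proof -
      have "Re (x * (y * cnj y)) = Re x * (cmod y)\<^sup>2" for x y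
        unfolding complex_norm_square[symmetric] by simp
      moreover have "Re (b * (y2 z * cnj (y1 z)) + c * (y1 z * cnj (y2 z))) = 2 * Re ((b + cnj c) / 2 * y2 z * cnj (y1 z))"
        by (simp add: algebra_simps)
      ultimately show ?thesis unfolding plus_complex.sel(1)[of "a * (y1 z * cnj (y1 z)) + d * (y2 z * cnj (y2 z))"]
        plus_complex.sel(1)[of "a * (y1 z * cnj (y1 z))"] by (simp only: herm_def ac_simps)
    qed
    finally show ?thesis .
  qed
  thus ?thesis using that by blast
qed

section \<open>From an invariant metric to an invariant form\<close>

context main_setup
begin

lemma regular_nonempty: obtains z where "z \<in> \<H> - poles Q"
  using diff_poles_nonempty[OF open_H] rho_facts(1) by blast

lemma connected_regular: "connected (\<H> - poles Q)"
  by (rule connected_diff_poles[OF open_H convex_connected[OF convex_H] order_refl])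

text \<open>On each small disc there is a form, and its coefficients with respect to the system are
  unique; so they are locally constant, and constant by connectedness.\<close>

lemma metric_hermitian_form:
  assumes X: "\<And>z. z \<in> \<H> \<Longrightarrow> sq_at Q X z" and u: "invariant_metric Q u"
  obtains C B A where "\<And>z. z \<in> \<H> - poles Q \<Longrightarrow> exp (- (u z / 2)) = therm C B A (X z)"
proof -
  let ?D = "\<H> - poles Q"
  have sm: "Ck_on 2 (\<lambda>z. complex_of_real (u z)) ?D"
    using u by (auto simp: invariant_metric_def smooth_on_def)
  have eq: "Q z = - (1/2) * (d_z (d_z (\<lambda>z. complex_of_real (u z))) z - (1/2) * (d_z (\<lambda>z. complex_of_real (u z)) z)\<^sup>2)" if "z \<in> ?D" for z
    using u that by (simp add: invariant_metric_def Let_def)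
  have loc: "\<exists>e>0. \<exists>y1 y2 C B A. ball z e \<subseteq> ?D \<and> fundamental_pair Q (ball z e) y1 y2 \<and>
      (\<forall>w\<in>ball z e. X w = veronese (y1 w) (y2 w) \<and> exp (- (u w / 2)) = therm C B A (X w))" if z: "z \<in> ?D" for z
  proof -
    have "sq_at Q X z" using X z by blast
    then obtain e y1 y2 where e: "e > 0" "ball z e \<subseteq> ?D" "fundamental_pair Q (ball z e) y1 y2"
      "\<And>w. w \<in> ball z e \<Longrightarrow> X w = veronese (y1 w) (y2 w)" using z by (rule local_pair) (rule that)
    obtain C B A where "\<And>w. w \<in> ball z e \<Longrightarrow> exp (- (u w / 2)) = herm C B A (y1 w) (y2 w)"
      using real_metric_hermitian[OF e(3) open_ball convex_ball Ck_on_subset[OF sm e(2)] eq] e(2) by blast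
    thus ?thesis using e by (intro exI[of _ e] conjI exI[of _ y1] exI[of _ y2] exI[of _ C] exI[of _ B] exI[of _ A]) (auto simp: therm_veronese)
  qed
  obtain z0 where z0: "z0 \<in> ?D" by (rule regular_nonempty)
  obtain e0 C B A where e0: "e0 > 0" "\<And>w. w \<in> ball z0 e0 \<Longrightarrow> exp (- (u w / 2)) = therm C B A (X w)"
    using loc[OF z0] by blast
  define P where "P = (\<lambda>z. \<forall>\<^sub>F w in nhds z. exp (- (u w / 2)) = therm C B A (X w))"
  have "P z" if z: "z \<in> ?D" for z
  proof (rule connected_induction_simple[OF connected_regular z0 z])
    show "P z0" unfolding P_def using e0 eventually_nhds_in_open[of "ball z0 e0" z0] by (auto elim!: eventually_mono)
    fix a assume a: "a \<in> ?D"
    obtain e y1 y2 C' B' A' where e: "e > 0" "ball a e \<subseteq> ?D" "fundamental_pair Q (ball a e) y1 y2"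
      "\<And>w. w \<in> ball a e \<Longrightarrow> X w = veronese (y1 w) (y2 w) \<and> exp (- (u w / 2)) = therm C' B' A' (X w)"
      using loc[OF a] by blast
    have "P y" if x: "x \<in> ball a e" and y: "y \<in> ball a e" and P: "P x" for x y
    proof -
      have "\<forall>\<^sub>F w in nhds x. exp (- (u w / 2)) = therm C B A (X w) \<and> w \<in> ball a e"
        using P x unfolding P_def by (intro eventually_conj eventually_nhds_in_open) auto
      then obtain V where V: "open V" "x \<in> V" "\<And>w. w \<in> V \<Longrightarrow> exp (- (u w / 2)) = therm C B A (X w) \<and> w \<in> ball a e"
        unfolding eventually_nhds by blast
      have "C = C' \<and> B = B' \<and> A = A'"
      proof (rule herm_coefficients_unique)
        show "fundamental_pair Q V y1 y2" using fundamental_pair_subset[OF e(3)] V(3) by blast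
        show "open V" "V \<noteq> {}" using V by auto
        show "herm C B A (y1 w) (y2 w) = herm C' B' A' (y1 w) (y2 w)" if "w \<in> V" for w
          using V(3)[OF that] e(4)[of w] by (metis therm_veronese)
      qed
      thus ?thesis unfolding P_def using e(4) eventually_nhds_in_open[of "ball a e" y] y by (auto elim!: eventually_mono)
    qed
    moreover have "openin (top_of_set ?D) (ball a e)" using e(2) by (simp add: open_subset)
    ultimately show "\<exists>T. openin (top_of_set ?D) T \<and> a \<in> T \<and> (\<forall>x\<in>T. \<forall>y\<in>T. P x \<longrightarrow> P y)"
      using e(1) by (meson centre_in_ball)
  qed
  hence "exp (- (u z / 2)) = therm C B A (X z)" if "z \<in> ?D" for z
    using that eventually_nhds_x_imp_x unfolding P_def by fastforce
  thus ?thesis using that by blast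
qed

lemma metric_form_invariance:
  assumes X: "\<And>z. z \<in> \<H> \<Longrightarrow> sq_at Q X z" and u: "invariant_metric Q u"
    and form: "\<And>z. z \<in> \<H> - poles Q \<Longrightarrow> exp (- (u z / 2)) = therm C B A (X z)"
    and T: "T \<in> SL2Z" and z: "z \<in> \<H> - poles Q" and m: "monodromy X T M"
  shows "therm C B A (sym2 M (X z)) = therm C B A (X z)"
proof -
  have j: "autfac T z \<noteq> 0" using autfac_nonzero[OF T] z by blast
  have ui: "u (act T z) = u z + 4 * ln (cmod (autfac T z))"
    using u T z by (simp add: invariant_metric_def)
  have "therm C B A (sym2 M (X z)) = therm C B A (tscale ((autfac T z)\<^sup>2) (X (act T z)))"
    using m z by (simp add: monodromy_def slash_def)
  also have "\<dots> = (cmod (autfac T z))\<^sup>2 * exp (- (u (act T z) / 2))"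
    using j form[OF act_regular[OF T z]] by (simp add: therm_tscale norm_power)
  also have "exp (- (u (act T z) / 2)) = exp (- (u z / 2)) / exp (2 * ln (cmod (autfac T z)))"
    unfolding ui by (simp add: add_divide_distrib exp_diff)
  also have "exp (2 * ln (cmod (autfac T z))) = (cmod (autfac T z))\<^sup>2" using j by (simp add: exp_double)
  finally show ?thesis using j form[OF z] by simp
qed

lemma herm_linear:
  "herm C B A (p * y1 + q * y2) (s * y1 + t * y2) =
   herm (C * (cmod p)\<^sup>2 + 2 * Re (B * s * cnj p) + A * (cmod s)\<^sup>2)
     (of_real C * q * cnj p + B * t * cnj p + cnj B * q * cnj s + of_real A * t * cnj s)
     (C * (cmod q)\<^sup>2 + 2 * Re (B * t * cnj q) + A * (cmod t)\<^sup>2) y1 y2"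
proof -
  have "complex_of_real (C * (cmod p)\<^sup>2 + 2 * Re (B * s * cnj p) + A * (cmod s)\<^sup>2) = complex_of_real (herm C B A p s)"
    "complex_of_real (C * (cmod q)\<^sup>2 + 2 * Re (B * t * cnj q) + A * (cmod t)\<^sup>2) = complex_of_real (herm C B A q t)"
    by (simp_all add: herm_def)
  hence "complex_of_real (herm C B A (p * y1 + q * y2) (s * y1 + t * y2)) =
   complex_of_real (herm (C * (cmod p)\<^sup>2 + 2 * Re (B * s * cnj p) + A * (cmod s)\<^sup>2)
     (of_real C * q * cnj p + B * t * cnj p + cnj B * q * cnj s + of_real A * t * cnj s)
     (C * (cmod q)\<^sup>2 + 2 * Re (B * t * cnj q) + A * (cmod t)\<^sup>2) y1 y2)"
    unfolding herm_complex by (simp add: herm_complex algebra_simps)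
  thus ?thesis by (simp only: of_real_eq_iff)
qed

text \<open>Away from the poles the form gives \<open>4 u_{z zbar} = - 8 \<delta> e^u\<close> with
  \<open>\<delta>\<close> its determinant. Tested against a nonnegative bump supported at regular
  points, the curvature equation says that \<open>1 - 8 \<delta>\<close> times a positive integral
  is 0.\<close>

lemma metric_form_determinant:
  assumes X: "\<And>z. z \<in> \<H> \<Longrightarrow> sq_at Q X z" and u: "invariant_metric Q u"
    and form: "\<And>z. z \<in> \<H> - poles Q \<Longrightarrow> exp (- (u z / 2)) = therm C B A (X z)"
  shows "C * A - (cmod B)\<^sup>2 = 1/8"
proof -
  let ?D = "\<H> - poles Q"
  define U where "U = (\<lambda>z. complex_of_real (u z))"
  have sm: "Ck_on n U ?D" for n using u by (auto simp: invariant_metric_def smooth_on_def U_def)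
  define \<delta> where "\<delta> = C * A - (cmod B)\<^sup>2"
  have lap: "4 * d_z (d_zbar U) z = - (of_real (8 * \<delta>) * of_real (exp (u z)))" if z: "z \<in> ?D" for z
  proof -
    have "sq_at Q X z" using X z by blast
    then obtain e y1 y2 where e: "e > 0" "ball z e \<subseteq> ?D" "fundamental_pair Q (ball z e) y1 y2"
      "\<And>w. w \<in> ball z e \<Longrightarrow> X w = veronese (y1 w) (y2 w)" using z by (rule local_pair) (rule that)
    have h: "exp (- (u w / 2)) = herm C B A (y1 w) (y2 w)" if "w \<in> ball z e" for w
      using form[of w] e(2,4) that by (metis subsetD therm_veronese)
    have pos: "herm C B A (y1 w) (y2 w) > 0" if "w \<in> ball z e" for w
      by (simp flip: h[OF that])
    have uh: "u w = 0 - 2 * ln (herm C B A (y1 w) (y2 w))" if "w \<in> ball z e" for w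
      by (simp flip: h[OF that])
    have "z \<in> ball z e" using e(1) by simp
    from herm_metric_derivs(2)[OF e(3) open_ball pos uh this]
    have "d_z (d_zbar U) z = - 2 * (of_real C * of_real A - B * cnj B) / (of_real (herm C B A (y1 z) (y2 z)))\<^sup>2"
      by (simp add: U_def)
    also have "of_real C * of_real A - B * cnj B = of_real \<delta>"
      by (simp only: \<delta>_def of_real_diff of_real_mult complex_norm_square)
    also have "herm C B A (y1 z) (y2 z) = exp (- (u z / 2))" using h e(1) by simp
    also have "(complex_of_real (exp (- (u z / 2))))\<^sup>2 = of_real (exp (- u z))"
      by (simp only: of_real_power[symmetric] exp_double[symmetric]) simp
    also have "- 2 * of_real \<delta> / complex_of_real (exp (- u z)) = - 2 * of_real \<delta> * of_real (exp (u z))"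
      by (simp add: exp_minus divide_inverse)
    finally show ?thesis by simp
  qed
  obtain p where p: "p \<in> ?D" by (rule regular_nonempty)
  obtain e where e: "e > 0" "cball p e \<subseteq> ?D" using open_regular p by (meson open_contains_cball)
  obtain b where b: "test_function (\<lambda>z. complex_of_real (b z))" "\<And>z. b z \<ge> 0" "b p > 0" "\<And>z. z \<notin> cball p e \<Longrightarrow> b z = 0"
    "continuous_on UNIV b" using bump_function[OF e(1)] e(2) by (metis Diff_subset dual_order.trans)
  define \<phi> where "\<phi> = (\<lambda>z. complex_of_real (b z))"
  have \<phi>0: "\<phi> z = 0" if "z \<notin> cball p e" for z using b(4)[OF that] by (simp add: \<phi>_def)
  have \<phi>2: "Ck_on 2 \<phi> UNIV" using test_functionD(1)[OF b(1)] by (simp add: \<phi>_def)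
  have ibp: "integrable lborel (\<lambda>z. U z * d_zbar (d_z \<phi>) z)" "integrable lborel (\<lambda>z. d_z (d_zbar U) z * \<phi> z)"
      "(LINT z|lborel. U z * d_zbar (d_z \<phi>) z) = (LINT z|lborel. d_z (d_zbar U) z * \<phi> z)"
    using integration_by_parts[OF open_regular sm[of 2] \<phi>2 compact_cball e(2) \<phi>0] by blast+
  \<comment> \<open>\<open>u\<close> is smooth only at regular points; the bump cuts
    \<open>exp (u z)\<close> off to a continuous function on the whole plane.\<close>
  define w where "w = (\<lambda>z. if z \<in> ?D then exp (u z) * b z else 0)"
  have wC: "continuous_on UNIV w"
  proof -
    have "continuous_on ?D (\<lambda>z. Re (U z))" by (rule continuous_on_Re[OF Ck_on_continuous[OF sm[of 0]]])
    hence uc: "continuous_on ?D u" by (simp add: U_def)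
    have "continuous_on (?D \<union> - cball p e) w"
    proof (rule continuous_on_open_Un[OF open_regular])
      show "open (- cball p e)" by (rule open_Compl[OF closed_cball])
      show "continuous_on ?D w"
        by (rule continuous_on_eq[of _ "\<lambda>z. exp (u z) * b z"])
           (auto intro!: continuous_intros uc continuous_on_subset[OF b(5)] simp: w_def)
      show "continuous_on (- cball p e) w"
        by (rule continuous_on_eq[of _ "\<lambda>_. 0"]) (use b(4) in \<open>auto simp: w_def\<close>)
    qed
    moreover have "?D \<union> - cball p e = UNIV" using e(2) by blast
    ultimately show ?thesis by simp
  qed
  have w0: "w z = 0" if "z \<notin> cball p e" for z using b(4)[OF that] by (simp add: w_def)
  have wi: "integrable lborel w"
  proof -
    have "continuous_on UNIV (\<lambda>z. complex_of_real (w z))" using wC by (intro continuous_intros)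
    hence "integrable lborel (\<lambda>z. complex_of_real (w z))"
      by (rule integrable_continuous_compact_support[OF _ compact_cball[of p e]]) (simp add: w0)
    thus ?thesis using integrable_Re by fastforce
  qed
  have "(LINT z:\<H>|lborel. of_real (u z) * (4 * d_zbar (d_z \<phi>) z) + of_real (exp (u z)) * \<phi> z) = 0"
  proof -
    have "{q \<in> poles Q. \<phi> q \<noteq> 0} = {}" using \<phi>0 e(2) by blast
    thus ?thesis using u b(1) unfolding invariant_metric_def curvature_equation_def \<phi>_def[symmetric] by simp
  qed
  also have "(LINT z:\<H>|lborel. of_real (u z) * (4 * d_zbar (d_z \<phi>) z) + of_real (exp (u z)) * \<phi> z)
     = (LINT z|lborel. 4 * (U z * d_zbar (d_z \<phi>) z) + of_real (w z))"
    unfolding set_lebesgue_integral_def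
  proof (rule Bochner_Integration.integral_cong[OF refl])
    fix z
    have "d_zbar (d_z \<phi>) z = 0" if "z \<notin> cball p e"
    proof -
      have "d_z \<phi> w = 0" if "w \<notin> cball p e" for w using derivs_off_support(1)[OF closed_cball \<phi>0 that] by simp
      thus ?thesis using derivs_off_support(2)[OF closed_cball _ that] by blast
    qed
    thus "indicator \<H> z *\<^sub>R (of_real (u z) * (4 * d_zbar (d_z \<phi>) z) + of_real (exp (u z)) * \<phi> z) = 4 * (U z * d_zbar (d_z \<phi>) z) + of_real (w z)"
      using \<phi>0[of z] w0[of z] e(2) by (cases "z \<in> cball p e") (auto simp: U_def w_def \<phi>_def)
  qed
  also have "\<dots> = 4 * (LINT z|lborel. U z * d_zbar (d_z \<phi>) z) + of_real (LINT z|lborel. w z)"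
    using ibp(1) wi by simp
  also have "4 * (LINT z|lborel. U z * d_zbar (d_z \<phi>) z) = (LINT z|lborel. 4 * (d_z (d_zbar U) z * \<phi> z))"
    unfolding ibp(3) by simp
  also have "\<dots> = (LINT z|lborel. - (of_real (8 * \<delta>)) * of_real (w z))"
  proof (rule Bochner_Integration.integral_cong[OF refl])
    fix z
    show "4 * (d_z (d_zbar U) z * \<phi> z) = - (of_real (8 * \<delta>)) * of_real (w z)"
    proof (cases "z \<in> ?D")
      case True
      have "4 * (d_z (d_zbar U) z * \<phi> z) = (4 * d_z (d_zbar U) z) * \<phi> z" by simp
      thus ?thesis unfolding lap[OF True] using True by (simp add: w_def \<phi>_def)
    next
      case False
      hence "z \<notin> cball p e" using e(2) by blast
      thus ?thesis using \<phi>0 w0 by simp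
    qed
  qed
  also have "\<dots> = - (of_real (8 * \<delta>)) * of_real (LINT z|lborel. w z)"
    by (subst integral_mult_right_zero) (simp add: integral_of_real wi)
  finally have "complex_of_real ((1 - 8 * \<delta>) * (LINT z|lborel. w z)) = 0" by (simp add: algebra_simps)
  hence 0: "(1 - 8 * \<delta>) * (LINT z|lborel. w z) = 0" by (simp only: of_real_eq_0_iff)
  have wnn: "w z \<ge> 0" for z using b(2) by (simp add: w_def)
  have "(LINT z|lborel. w z) \<noteq> 0"
  proof
    assume "(LINT z|lborel. w z) = 0"
    hence ae: "AE z in lborel. w z = 0" using integral_nonneg_eq_0_iff_AE[OF wi] wnn by simp
    have wp: "w p > 0" using p b(3) by (simp add: w_def)
    have "open (w -` {0<..})" using wC by (intro open_vimage) auto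
    then obtain d where d: "d > 0" "ball p d \<subseteq> w -` {0<..}" using wp by (meson openE vimageI greaterThan_iff)
    have "AE z in lborel. z \<notin> ball p d" using ae
    proof eventually_elim
      case (elim z)
      show ?case
      proof
        assume "z \<in> ball p d"
        hence "w z > 0" using d(2) by auto
        thus False using elim by simp
      qed
    qed
    hence "emeasure lborel (ball p d) = 0" by (subst (asm) AE_iff_measurable[of "ball p d"]) auto
    thus False using d(1) by (simp add: emeasure_ball unit_ball_vol_2)
  qed
  hence "1 - 8 * \<delta> = 0" using 0 by simp
  thus ?thesis by (simp add: \<delta>_def)
qed

text \<open>
  Invariance of the form under \<open>diag (\<i>, - \<i>)\<close> kills its mixed coefficient, and the mixed coefficient of
  its transform under the monodromy of \<open>T\<close> gives the last relation.
\<close>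

lemma metric_normal_form:
  assumes X: "\<And>z. z \<in> \<H> \<Longrightarrow> sq_at Q X z" and mS: "monodromy X matS (mat2 \<i> 0 0 (- \<i>))"
    and mT: "monodromy X matT (mat2 ((of_real \<tau> + \<i>) / 2) q s ((of_real \<tau> - \<i>) / 2))"
    and u: "invariant_metric Q u"
  obtains C A where "C > 0" "A > 0" "C * A = 1/8" "of_real C * q = - (of_real A * cnj s)"
    "\<And>z. z \<in> \<H> - poles Q \<Longrightarrow> exp (- (u z / 2)) = therm C 0 A (X z)"
proof -
  obtain C B A where form: "\<And>z. z \<in> \<H> - poles Q \<Longrightarrow> exp (- (u z / 2)) = therm C B A (X z)"
    using metric_hermitian_form[OF X u] by blast
  have det: "C * A - (cmod B)\<^sup>2 = 1/8" by (rule metric_form_determinant[OF X u form])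
  obtain z where z: "z \<in> \<H> - poles Q" by (rule regular_nonempty)
  have "sq_at Q X z" using X z by blast
  then obtain e y1 y2 where e: "e > 0" "ball z e \<subseteq> \<H> - poles Q" "fundamental_pair Q (ball z e) y1 y2"
    "\<And>w. w \<in> ball z e \<Longrightarrow> X w = veronese (y1 w) (y2 w)" using z by (rule local_pair) (rule that)
  have ne: "ball z e \<noteq> {}" using e(1) by auto
  have inv: "herm C B A (e11 M * y1 w + e12 M * y2 w) (e21 M * y1 w + e22 M * y2 w) = herm C B A (y1 w) (y2 w)"
    if "T \<in> SL2Z" "monodromy X T M" "w \<in> ball z e" for T M w
  proof -
    have w: "w \<in> \<H> - poles Q" using e(2) that by blast
    have "therm C B A (sym2 M (X w)) = therm C B A (X w)"
      by (rule metric_form_invariance[OF X u form that(1) w that(2)])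
    thus ?thesis unfolding e(4)[OF that(3)] sym2_veronese therm_veronese .
  qed
  have "B = 0"
  proof -
    have "herm C (- B) A (y1 w) (y2 w) = herm C B A (y1 w) (y2 w)" if "w \<in> ball z e" for w
    proof -
      have "B * (- \<i> * y2 w) * cnj (\<i> * y1 w) = - B * y2 w * cnj (y1 w)" by (simp add: algebra_simps)
      hence "herm C B A (\<i> * y1 w) (- \<i> * y2 w) = herm C (- B) A (y1 w) (y2 w)"
        by (simp only: herm_def norm_mult norm_minus_cancel norm_ii mult_1)
      thus ?thesis using inv[OF matS_SL2Z mS that] by simp
    qed
    from herm_coefficients_unique[OF e(3) open_ball ne this] have "- B = B" by blast
    hence "2 * B = 0" by (metis add.right_inverse mult_2)
    thus ?thesis by simp
  qed
  have CA: "C * A = 1/8" using det \<open>B = 0\<close> by simp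
  define p where "p = (of_real \<tau> + \<i>) / 2"
  have pc: "(of_real \<tau> - \<i>) / 2 = cnj p" by (simp add: p_def)
  have mT': "monodromy X matT (mat2 p q s (cnj p))" using mT unfolding pc p_def[symmetric] .
  have "herm (C * (cmod p)\<^sup>2 + A * (cmod s)\<^sup>2) (of_real C * q * cnj p + of_real A * cnj p * cnj s)
       (C * (cmod q)\<^sup>2 + A * (cmod p)\<^sup>2) (y1 w) (y2 w) = herm C 0 A (y1 w) (y2 w)" if "w \<in> ball z e" for w
    using inv[OF matT_SL2Z mT' that] unfolding \<open>B = 0\<close> herm_linear by simp
  from herm_coefficients_unique[OF e(3) open_ball ne this]
  have "of_real C * q * cnj p + of_real A * cnj p * cnj s = 0" by blast
  hence "cnj p * (of_real C * q + of_real A * cnj s) = 0" by (simp add: algebra_simps)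
  \<comment> \<open>\<open>p\<close> has imaginary part 1/2 whatever \<open>\<tau>\<close> is, so
    \<open>cnj p\<close> can be cancelled from the mixed coefficient.\<close>
  moreover have "Im p \<noteq> 0" by (simp add: p_def)
  hence "cnj p \<noteq> 0" by (metis complex_cnj_zero_iff zero_complex.sel(2))
  ultimately have rel: "of_real C * q = - (of_real A * cnj s)" by (simp add: add_eq_0_iff2)
  \<comment> \<open>\<open>C\<close> and \<open>A\<close> have the same sign; if it were negative,
    the form could not equal an exponential.\<close>
  have pos: "C > 0"
  proof (rule ccontr)
    assume "\<not> C > 0"
    hence "C \<le> 0" "A \<le> 0" using CA by (auto simp: not_less) (smt (verit) mult_nonpos_nonneg)
    have "therm C B A (X z) = C * (cmod (y1 z))\<^sup>2 + A * (cmod (y2 z))\<^sup>2"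
      using e(1,4) \<open>B = 0\<close> by (simp add: therm_veronese herm_def)
    also have "\<dots> \<le> 0" using \<open>C \<le> 0\<close> \<open>A \<le> 0\<close> by (intro add_nonpos_nonpos mult_nonpos_nonneg) auto
    finally show False using form[OF z] by (metis exp_gt_zero not_less)
  qed
  have "A > 0" using CA pos by (metis zero_less_divide_1_iff zero_less_mult_pos zero_less_numeral)
  thus ?thesis using that[OF pos _ CA rel] form \<open>B = 0\<close> by blast
qed

end

section \<open>Existence, uniqueness, and the range of \<open>r\<close>\<close>

lemma cos_less_half_iff:
  assumes "0 < x" "x < 2 * pi"
  shows "cos x < 1/2 \<longleftrightarrow> pi/3 < x \<and> x < 5 * pi/3" and "cos x \<le> 1/2 \<longleftrightarrow> pi/3 \<le> x \<and> x \<le> 5 * pi/3"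
proof -
  have 1: "cos (pi/3) = 1/2" by (rule cos_60)
  have "(cos x < 1/2 \<longleftrightarrow> pi/3 < x \<and> x < 5 * pi/3) \<and> (cos x \<le> 1/2 \<longleftrightarrow> pi/3 \<le> x \<and> x \<le> 5 * pi/3)"
  proof (cases "x \<le> pi")
    case True
    thus ?thesis using assms cos_mono_less_eq[of x "pi/3"] cos_mono_le_eq[of x "pi/3"] unfolding 1 by auto
  next
    case False
    have "cos (2 * pi - x) = cos x" by (simp add: cos_diff)
    thus ?thesis using assms False cos_mono_less_eq[of "2 * pi - x" "pi/3"] cos_mono_le_eq[of "2 * pi - x" "pi/3"] unfolding 1
      by (auto simp: field_simps)
  qed
  thus "cos x < 1/2 \<longleftrightarrow> pi/3 < x \<and> x < 5 * pi/3" "cos x \<le> 1/2 \<longleftrightarrow> pi/3 \<le> x \<and> x \<le> 5 * pi/3" by blast+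
qed

text \<open>By the double angle formula the left side is \<open>2 + 2 cos (4 pi r)\<close>, so the
  comparison with 3 is that of \<open>cos x\<close> with 1/2 for \<open>x = 4 pi r\<close> between 0
  and \<open>2 pi\<close>.\<close>

lemma trace_square_range:
  assumes "0 < r" "r < 1/2"
  shows "4 * (cos (2 * pi * r))\<^sup>2 < 3 \<longleftrightarrow> 1/12 < r \<and> r < 5/12" (is ?A)
    and "4 * (cos (2 * pi * r))\<^sup>2 \<le> 3 \<longleftrightarrow> 1/12 \<le> r \<and> r \<le> 5/12" (is ?B)
    and "r = 1/12 \<or> r = 5/12 \<Longrightarrow> 4 * (cos (2 * pi * r))\<^sup>2 = 3" (is "_ \<Longrightarrow> ?C")
proof -
  define x where "x = 4 * pi * r"
  have "x < 4 * pi * (1/2)" unfolding x_def using assms by (intro mult_strict_left_mono) auto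
  hence x: "0 < x" "x < 2 * pi" using assms by (auto simp: x_def)
  have c: "4 * (cos (2 * pi * r))\<^sup>2 = 2 + 2 * cos x"
    using cos_double_cos[of "2 * pi * r"] by (simp add: x_def mult_ac)
  have i: "pi/3 < x \<longleftrightarrow> 1/12 < r" "x < 5 * pi/3 \<longleftrightarrow> r < 5/12" "pi/3 \<le> x \<longleftrightarrow> 1/12 \<le> r" "x \<le> 5 * pi/3 \<longleftrightarrow> r \<le> 5/12"
    by (simp_all add: x_def field_simps)
  show A: ?A unfolding c using cos_less_half_iff(1)[OF x] i by auto
  show B: ?B unfolding c using cos_less_half_iff(2)[OF x] i by auto
  show ?C if "r = 1/12 \<or> r = 5/12" using A B that by fastforce
qed

section \<open>Solving for the invariant form\<close>

context main_setup
begin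

text \<open>The matrix has the shape of an element of \<open>SU(2)\<close>, and its determinant
  condition is \<open>|p|^2 + |s|^2 = 1\<close>; hence it preserves
  \<open>|y1|^2 + |y2|^2\<close>.\<close>

lemma unitary_invariance:
  assumes X: "\<And>z. z \<in> \<H> \<Longrightarrow> sq_at Q X z" and m: "monodromy X A (mat2 p (- cnj s) s (cnj p))" and z: "z \<in> \<H> - poles Q"
  shows "tnorm (slash A X z) = tnorm (X z)"
proof -
  have "sq_at Q X z" using X z by blast
  then obtain e y1 y2 where e: "e > 0" "ball z e \<subseteq> \<H> - poles Q" "fundamental_pair Q (ball z e) y1 y2"
      "\<And>w. w \<in> ball z e \<Longrightarrow> X w = veronese (y1 w) (y2 w)" using z by (rule local_pair) (rule that)
  have Xz: "X z = veronese (y1 z) (y2 z)" using e by simp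
  have "p * cnj p + cnj s * s = 1" using m by (simp add: monodromy_def)
  hence "complex_of_real ((cmod p)\<^sup>2 + (cmod s)\<^sup>2) = 1" by (simp only: of_real_add complex_norm_square mult.commute)
  hence ps: "(cmod p)\<^sup>2 + (cmod s)\<^sup>2 = 1" by (simp only: of_real_eq_1_iff)
  have "slash A X z = sym2 (mat2 p (- cnj s) s (cnj p)) (veronese (y1 z) (y2 z))"
    using m z Xz by (simp add: monodromy_def)
  hence "tnorm (slash A X z) = herm 1 0 1 (p * y1 z + - cnj s * y2 z) (s * y1 z + cnj p * y2 z)"
    by (simp add: sym2_veronese tnorm_veronese herm_1_0_1)
  also have "\<dots> = herm ((cmod p)\<^sup>2 + (cmod s)\<^sup>2) 0 ((cmod s)\<^sup>2 + (cmod p)\<^sup>2) (y1 z) (y2 z)"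
    unfolding herm_linear by (simp add: mult.commute)
  also have "\<dots> = tnorm (X z)" using ps by (simp add: Xz herm_1_0_1 tnorm_veronese add.commute)
  finally show ?thesis .
qed

lemma metric_exists_if_unitary:
  assumes X: "\<And>z. z \<in> \<H> \<Longrightarrow> sq_at Q X z" and mS: "monodromy X matS (mat2 \<i> 0 0 (- \<i>))"
    and mT: "monodromy X matT (mat2 p (- cnj s) s (cnj p))"
  shows "\<exists>u. invariant_metric Q u"
proof -
  have mS': "monodromy X matS (mat2 \<i> (- cnj 0) 0 (cnj \<i>))" using mS by simp
  have "tnorm (slash matS X z) = tnorm (X z)" "tnorm (slash matT X z) = tnorm (X z)" if "z \<in> \<H> - poles Q" for z
    using unitary_invariance[of X] X mS' mT that by blast+
  hence "invariant_metric Q (metric X)" using invariant_metric_of_unitary_system[of X] X by blast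
  thus ?thesis by blast
qed

text \<open>Rescaling the basis by \<open>diag (m, 1 / m)\<close> keeps the diagonal entries and
  replaces \<open>q, s\<close> by \<open>m^2 q, s / m^2\<close>. The sign of \<open>q s\<close>
  gives \<open>q = - k cnj s\<close> with \<open>k = \<delta> / |s|^2\<close>, and
  \<open>m^4 = 1 / k\<close> brings the matrix into unitary form.\<close>

lemma metric_exists_if_negative:
  assumes X: "\<And>z. z \<in> \<H> \<Longrightarrow> sq_at Q X z" and mS: "monodromy X matS (mat2 \<i> 0 0 (- \<i>))"
    and mT: "monodromy X matT (mat2 p q s (cnj p))" and qs: "q * s = - of_real \<delta>" "\<delta> > 0"
  shows "\<exists>u. invariant_metric Q u"
proof -
  have snz: "s \<noteq> 0" using qs by auto
  define k where "k = \<delta> / (cmod s)\<^sup>2"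
  have k: "k > 0" using qs(2) snz by (simp add: k_def)
  have "q * s = - of_real k * (s * cnj s)" unfolding complex_norm_square[symmetric] using snz qs(1) by (simp add: k_def)
  hence "q * s = (- of_real k * cnj s) * s" by simp
  hence q: "q = - of_real k * cnj s" using snz by (metis mult_right_cancel)
  define m where "m = sqrt (sqrt (1 / k))"
  have "m\<^sup>2 = sqrt (1 / k)" using k by (simp only: m_def) (rule real_sqrt_pow2, simp)
  hence "m\<^sup>2 * m\<^sup>2 = 1 / k" using k by simp
  hence m: "m > 0" "m\<^sup>2 * m\<^sup>2 * k = 1" using k by (auto simp: m_def)
  have mk: "m\<^sup>2 * k = 1 / m\<^sup>2" using m by (simp add: field_simps)
  define N where "N = mat2 (complex_of_real m) 0 0 (1 / complex_of_real m)"
  have det: "det N = 1" using m(1) by (simp add: N_def)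
  define Y where "Y = (\<lambda>z. sym2 N (X z))"
  have Y: "sq_at Q Y z" if "z \<in> \<H>" for z unfolding Y_def by (rule sq_at_sym2[OF X[OF that] det])
  have conj: "N ** mat2 a b c d ** adj2 N = mat2 a (of_real (m\<^sup>2) * b) (c / of_real (m\<^sup>2)) d" for a b c d
    using m(1) by (simp add: N_def adj2_def mat2_mult mat2_eq_iff power2_eq_square)
  have "monodromy Y matS (mat2 \<i> 0 0 (- \<i>))"
    using monodromy_sym2[OF mS det matS_SL2Z] by (simp add: conj Y_def)
  moreover have "monodromy Y matT (mat2 p (of_real (m\<^sup>2) * q) (s / of_real (m\<^sup>2)) (cnj p))"
    using monodromy_sym2[OF mT det matT_SL2Z] by (simp add: conj Y_def)
  moreover have "of_real (m\<^sup>2) * q = - cnj (s / of_real (m\<^sup>2))"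
  proof -
    have "of_real (m\<^sup>2) * q = - (of_real (m\<^sup>2 * k) * cnj s)" by (simp add: q)
    thus ?thesis unfolding mk by simp
  qed
  ultimately show ?thesis using metric_exists_if_unitary[OF Y] by metis
qed

text \<open>Multiplying the relation \<open>C q = - A cnj s\<close> by \<open>s\<close> gives
  \<open>C \<delta> = - A |s|^2\<close>.\<close>

lemma metric_implies_nonpositive:
  assumes X: "\<And>z. z \<in> \<H> \<Longrightarrow> sq_at Q X z" and mS: "monodromy X matS (mat2 \<i> 0 0 (- \<i>))"
    and mT: "monodromy X matT (mat2 ((of_real \<tau> + \<i>) / 2) q s ((of_real \<tau> - \<i>) / 2))"
    and qs: "q * s = of_real \<delta>" and u: "invariant_metric Q u"
  shows "\<delta> \<le> 0" "\<delta> = 0 \<Longrightarrow> q = 0 \<and> s = 0"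
proof -
  obtain C A where CA: "C > 0" "A > 0" "of_real C * q = - (of_real A * cnj s)"
    using metric_normal_form[OF X mS mT u] by metis
  have "complex_of_real (C * \<delta>) = (of_real C * q) * s" using qs by (simp add: mult_ac)
  also have "\<dots> = - (of_real A * (s * cnj s))" unfolding CA(3) by (simp add: mult_ac)
  also have "\<dots> = of_real (- (A * (cmod s)\<^sup>2))" unfolding complex_norm_square[symmetric] by simp
  finally have eq: "C * \<delta> = - (A * (cmod s)\<^sup>2)" by (simp only: of_real_eq_iff)
  have "A * (cmod s)\<^sup>2 \<ge> 0" using CA(2) by simp
  hence "C * \<delta> \<le> 0" using eq by simp
  thus "\<delta> \<le> 0" using CA(1) by (simp add: mult_le_0_iff)
  show "q = 0 \<and> s = 0" if "\<delta> = 0"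
  proof -
    have "s = 0" using eq that CA(2) by simp
    thus ?thesis using CA by simp
  qed
qed

text \<open>Absolute values in \<open>C q = - A cnj s\<close> together with \<open>C A = 1/8\<close>
  give \<open>C^2 |q| = |s| / 8\<close>, which determines \<open>C\<close> since \<open>q\<close> is
  not zero. For \<open>q = s = 0\<close> this equation would be empty.\<close>

lemma metric_unique:
  assumes X: "\<And>z. z \<in> \<H> \<Longrightarrow> sq_at Q X z" and mS: "monodromy X matS (mat2 \<i> 0 0 (- \<i>))"
    and mT: "monodromy X matT (mat2 ((of_real \<tau> + \<i>) / 2) q s ((of_real \<tau> - \<i>) / 2))"
    and qs: "q * s \<noteq> 0" and u: "invariant_metric Q u" and v: "invariant_metric Q v" and z: "z \<in> \<H> - poles Q"
  shows "u z = v z"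
proof -
  have main: "C\<^sup>2 * cmod q = cmod s / 8" if "C > 0" "A > 0" "C * A = 1/8" "of_real C * q = - (of_real A * cnj s)" for C A
  proof -
    have "cmod (of_real C * q) = cmod (of_real A * cnj s)" unfolding that(4) by simp
    hence "C * cmod q = A * cmod s" using that(1,2) by (simp add: norm_mult)
    hence "C * (C * cmod q) = (C * A) * cmod s" by simp
    thus ?thesis unfolding that(3) by (simp add: power2_eq_square)
  qed
  obtain C A where CA: "C > 0" "A > 0" "C * A = 1/8" "of_real C * q = - (of_real A * cnj s)"
    "\<And>z. z \<in> \<H> - poles Q \<Longrightarrow> exp (- (u z / 2)) = therm C 0 A (X z)" using metric_normal_form[OF X mS mT u] by metis
  obtain C' A' where CA': "C' > 0" "A' > 0" "C' * A' = 1/8" "of_real C' * q = - (of_real A' * cnj s)"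
    "\<And>z. z \<in> \<H> - poles Q \<Longrightarrow> exp (- (v z / 2)) = therm C' 0 A' (X z)" using metric_normal_form[OF X mS mT v] by metis
  have "C\<^sup>2 * cmod q = C'\<^sup>2 * cmod q" using main[OF CA(1-4)] main[OF CA'(1-4)] by metis
  hence "C\<^sup>2 = C'\<^sup>2" using qs by simp
  hence "C = C'" using CA(1) CA'(1) by (simp add: power2_eq_iff_nonneg)
  moreover have "A = A'" using CA(1,3) CA'(1,3) calculation by (metis less_irrefl mult_left_cancel)
  ultimately have "exp (- (u z / 2)) = exp (- (v z / 2))" using CA(5)[OF z] CA'(5)[OF z] by simp
  thus ?thesis by simp
qed

end

section \<open>Solutions with modular squares\<close>

text \<open>The automorphy factor is continuous and nonzero, so limits and poles of \<open>F\<close>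
  at \<open>z\<close> and at \<open>act A z\<close> correspond; at poles both sides are 0, the
  default value of \<open>remove_sings\<close>.\<close>

lemma remove_sings_act:
  assumes A: "A \<in> SL2Z" and mero: "F meromorphic_on \<H>" and c: "c \<noteq> 0"
    and F: "\<And>z. z \<in> \<H> \<Longrightarrow> F (act A z) = c * autfac A z powi k * F z" and z: "z \<in> \<H>"
  shows "remove_sings F (act A z) = c * autfac A z powi k * remove_sings F z"
proof -
  define j where "j = (\<lambda>z. c * autfac A z powi k)"
  have jnz: "j w \<noteq> 0" if "w \<in> \<H>" for w using c autfac_nonzero[OF A that] by (simp add: j_def)
  have "autfac A field_differentiable at z" using autfac_deriv by (auto simp: field_differentiable_def)
  hence jc: "isCont j z" unfolding j_def using autfac_nonzero[OF A z] DERIV_isCont[OF autfac_deriv]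
    by (intro continuous_intros) auto
  have ev: "\<forall>\<^sub>F w in at z. inverse (j w) * F (act A w) = F w"
    using eventually_at_in_open'[OF open_H z] by eventually_elim (use jnz F in \<open>simp add: j_def field_simps\<close>)
  have ij: "((\<lambda>w. inverse (j w)) \<longlongrightarrow> inverse (j z)) (at z)"
    using jc jnz[OF z] by (auto simp: isCont_def intro: tendsto_inverse)
  have "F meromorphic_on {act A z}" by (rule meromorphic_on_subset[OF mero]) (use act_in_H[OF A z] in simp)
  hence "not_essential F (act A z)" by (rule meromorphic_on_not_essential)
  then consider L where "F \<midarrow>act A z\<rightarrow> L" | "is_pole F (act A z)" by (auto simp: not_essential_def)
  hence "remove_sings F (act A z) = j z * remove_sings F z"
  proof cases
    case 1
    have "((\<lambda>w. F (act A w)) \<longlongrightarrow> L) (at z)" by (rule filterlim_compose[OF 1 filterlim_act[OF A z]])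
    hence "((\<lambda>w. inverse (j w) * F (act A w)) \<longlongrightarrow> inverse (j z) * L) (at z)" by (intro tendsto_mult ij)
    hence "F \<midarrow>z\<rightarrow> inverse (j z) * L" by (rule Lim_transform_eventually[OF _ ev])
    hence "remove_sings F z = inverse (j z) * L" by (rule remove_sings_eqI)
    moreover have "remove_sings F (act A z) = L" using 1 by (rule remove_sings_eqI)
    ultimately show ?thesis using jnz[OF z] by simp
  next
    case 2
    hence "filterlim (\<lambda>w. F (act A w)) at_infinity (at z)"
      unfolding is_pole_def by (rule filterlim_compose[OF _ filterlim_act[OF A z]])
    hence "filterlim (\<lambda>w. inverse (j w) * F (act A w)) at_infinity (at z)"
      by (rule tendsto_mult_filterlim_at_infinity[OF ij, rotated]) (use jnz[OF z] in simp)
    hence "filterlim F at_infinity (at z)" using filterlim_cong[OF refl refl ev] by blast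
    thus ?thesis using 2 by (simp add: is_pole_def[symmetric])
  qed
  thus ?thesis by (simp add: j_def)
qed

context main_setup
begin

lemma fst_meromorphic:
  assumes X: "\<And>z. z \<in> \<H> \<Longrightarrow> sq_at Q X z"
  shows "(\<lambda>z. fst (X z)) meromorphic_on \<H>" "z \<in> \<H> - poles Q \<Longrightarrow> (\<lambda>z. fst (X z)) analytic_on {z}"
proof -
  define F where "F = (\<lambda>z. fst (X z))"
  have "F holomorphic_on \<H> - poles Q" unfolding F_def by (rule sq_holomorphic(1)[OF open_H order_refl X])
  hence an: "F analytic_on {z}" if "z \<in> \<H> - poles Q" for z
    using open_regular that by (auto simp: analytic_at)
  have "F meromorphic_on {p}" if p: "p \<in> \<H>" for p
  proof (cases "p \<in> poles Q")
    case False
    thus ?thesis using an[of p] p by (intro analytic_on_imp_meromorphic_on) auto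
  next
    case True
    obtain e f where e: "e > 0" "(\<lambda>z. fst (f z)) holomorphic_on ball p e"
      "\<And>z. z \<in> ball p e - {p} \<Longrightarrow> tscale ((z - p) ^ pole_exponent p) (X z) = f z"
      using pole_removal[OF X True] by metis
    have "(\<lambda>z. fst (f z)) analytic_on {p}" using e(1,2) by (auto simp: analytic_at intro!: exI[of _ "ball p e"])
    hence "(\<lambda>z. fst (f z)) meromorphic_on {p}" by (rule analytic_on_imp_meromorphic_on)
    hence m: "(\<lambda>z. fst (f z) / (z - p) ^ pole_exponent p) meromorphic_on {p}"
      by (intro meromorphic_intros)
    have "\<forall>\<^sub>F z in at p. z \<in> ball p e - {p}" using e(1) by (intro eventually_at_in_open) auto
    hence "\<forall>\<^sub>F z in at p. F z = fst (f z) / (z - p) ^ pole_exponent p"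
    proof eventually_elim
      case (elim z)
      have "fst (f z) = (z - p) ^ pole_exponent p * F z"
        unfolding e(3)[OF elim, symmetric] by (cases "X z") (simp add: tscale_def F_def)
      thus ?case using elim by simp
    qed
    thus ?thesis using meromorphic_on_cong[of "{p}" F "\<lambda>z. fst (f z) / (z - p) ^ pole_exponent p" "{p}"] m by auto
  qed
  hence "F meromorphic_on \<H>" using meromorphic_on_meromorphic_at by blast
  thus "(\<lambda>z. fst (X z)) meromorphic_on \<H>" "z \<in> \<H> - poles Q \<Longrightarrow> (\<lambda>z. fst (X z)) analytic_on {z}"
    using an by (auto simp: F_def)
qed

text \<open>\<open>\<kappa>\<close> is \<plusminus> 1/12 or \<plusminus> 5/12 modulo 1. Hence
  \<open>q^(2 \<kappa>)\<close> is an integral power of \<open>q^(1/6)\<close>, which allows an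
  expansion of width 6 at the cusp.\<close>

lemma twelve_kappa_nat:
  assumes "r = 1/12 \<or> r = 5/12"
  obtains K :: nat where "12 * \<kappa> = real K"
proof -
  have "12 * \<kappa> \<in> \<int>"
  proof (cases "\<kappa> - r \<in> \<int>")
    case True
    then obtain n where n: "\<kappa> - r = of_int n" by (auto elim: Ints_cases)
    hence "12 * \<kappa> = of_int (12 * n + 1) \<or> 12 * \<kappa> = of_int (12 * n + 5)" using assms by auto
    thus ?thesis by (metis Ints_of_int)
  next
    case False
    hence "\<kappa> + r \<in> \<int>" using r(3) by (simp add: \<kappa>_def)
    then obtain n where n: "\<kappa> + r = of_int n" by (auto elim: Ints_cases)
    hence "12 * \<kappa> = of_int (12 * n - 1) \<or> 12 * \<kappa> = of_int (12 * n - 5)" using assms by auto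
    thus ?thesis by (metis Ints_of_int)
  qed
  then obtain k where k: "12 * \<kappa> = of_int k" by (auto elim: Ints_cases)
  have "k \<ge> 0" using kappa_pos k by linarith
  hence "12 * \<kappa> = real (nat k)" using k by simp
  thus ?thesis by (rule that)
qed

lemma qpar_div_6: "qpar z = (qpar (z / 6)) ^ 6"
proof -
  have "2 * of_real pi * \<i> * z = of_nat 6 * (2 * of_real pi * \<i> * (z / 6))" by simp
  thus ?thesis unfolding qpar_def by (simp only: exp_of_nat_mult)
qed

text \<open>In \<open>x = q^(1/6)\<close> the squares of the two exponentials are
  \<open>x^(-K)\<close> and \<open>x^K\<close> and their product is 1, so the first component is a
  Laurent expression in \<open>x\<close> with the power series evaluated at
  \<open>x^6\<close>.\<close>

lemma fst_meromorphic_at_cusp: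
  assumes X: "\<And>z. z \<in> \<H> \<Longrightarrow> sq_at Q X z" and r12: "r = 1/12 \<or> r = 5/12"
  shows "meromorphic_at_cusp (remove_sings (\<lambda>z. fst (X z)))"
proof -
  obtain K :: nat where K: "12 * \<kappa> = real K" using twelve_kappa_nat[OF r12] .
  obtain Y R g1 g2 where cd: "cusp_data Y R g1 g2" by (rule cusp_data_exists)
  note cd' = cd[unfolded cusp_data_def]
  define E1 where "E1 = (\<lambda>z. exp (2 * of_real pi * \<i> * (- of_real \<kappa>) * z))"
  define E2 where "E2 = (\<lambda>z. exp (2 * of_real pi * \<i> * of_real \<kappa> * z))"
  obtain N where N: "det N = 1" "\<And>z. Im z > Y \<Longrightarrow> X z = sym2 N (veronese (E1 z * g1 (qpar z)) (E2 z * g2 (qpar z)))"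
    using cusp_system[OF cd X] unfolding E1_def E2_def by metis
  have K': "2 * complex_of_real \<kappa> = of_nat K / 6"
  proof -
    have "2 * \<kappa> = real K / 6" using K by simp
    hence "complex_of_real (2 * \<kappa>) = complex_of_real (real K / 6)" by (simp only:)
    thus ?thesis by simp
  qed
  have E: "(E1 z)\<^sup>2 = inverse (qpar (z / 6) ^ K)" "(E2 z)\<^sup>2 = qpar (z / 6) ^ K" "E1 z * E2 z = 1" for z
  proof -
    have "(E2 z)\<^sup>2 = exp (2 * (2 * of_real pi * \<i> * of_real \<kappa> * z))" unfolding E2_def by (rule exp_double[symmetric])
    also have "2 * (2 * of_real pi * \<i> * of_real \<kappa> * z) = (2 * of_real \<kappa>) * (2 * of_real pi * \<i> * z)" by simp
    also have "\<dots> = of_nat K * (2 * of_real pi * \<i> * (z / 6))" unfolding K' by simp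
    also have "exp \<dots> = qpar (z / 6) ^ K" by (simp only: exp_of_nat_mult qpar_def)
    finally show 2: "(E2 z)\<^sup>2 = qpar (z / 6) ^ K" .
    show 3: "E1 z * E2 z = 1" by (simp add: E1_def E2_def flip: exp_add)
    hence "E1 z = inverse (E2 z)" by (simp add: inverse_unique[symmetric] mult.commute)
    thus "(E1 z)\<^sup>2 = inverse (qpar (z / 6) ^ K)" by (simp add: 2[symmetric] power_inverse)
  qed
  define G where "G = (\<lambda>x. (e11 N)\<^sup>2 * (inverse (x ^ K) * (g1 (x ^ 6))\<^sup>2) + 2 * (e11 N * e12 N) * (g1 (x ^ 6) * g2 (x ^ 6))
     + (e12 N)\<^sup>2 * (x ^ K * (g2 (x ^ 6))\<^sup>2))"
  have "(\<lambda>x. g (x ^ 6)) analytic_on {0}" if "g holomorphic_on ball 0 R" for g :: "complex \<Rightarrow> complex"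
  proof -
    have "g analytic_on {0 ^ 6}" using that cd' by (auto simp: analytic_at intro!: exI[of _ "ball 0 R"])
    thus ?thesis using analytic_on_compose[of "\<lambda>x. x ^ 6" "{0}" g] by (simp add: o_def analytic_intros)
  qed
  hence "(\<lambda>x. g1 (x ^ 6)) meromorphic_on {0}" "(\<lambda>x. g2 (x ^ 6)) meromorphic_on {0}"
    using cd' analytic_on_imp_meromorphic_on by blast+
  hence "G meromorphic_on {0}" unfolding G_def by (intro meromorphic_intros)
  moreover have "\<forall>\<^sub>F z in at_cusp. remove_sings (\<lambda>z. fst (X z)) z = G (qpar (z / of_nat 6))"
    unfolding eventually_at_cusp
  proof (intro exI[of _ Y] allI impI)
    fix z assume z: "Im z > Y"
    hence "z \<in> \<H> - poles Q" using cd' by blast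
    hence "remove_sings (\<lambda>z. fst (X z)) z = fst (X z)" using fst_meromorphic(2)[OF X] by simp
    also have "\<dots> = (e11 N)\<^sup>2 * ((E1 z)\<^sup>2 * (g1 (qpar z))\<^sup>2) + 2 * (e11 N * e12 N) * ((E1 z * E2 z) * (g1 (qpar z) * g2 (qpar z)))
        + (e12 N)\<^sup>2 * ((E2 z)\<^sup>2 * (g2 (qpar z))\<^sup>2)"
      unfolding N(2)[OF z] by (simp add: sym2_def veronese_def power_mult_distrib mult_ac)
    also have "\<dots> = G (qpar (z / of_nat 6))" unfolding E qpar_div_6[of z] by (simp add: G_def)
    finally show "remove_sings (\<lambda>z. fst (X z)) z = G (qpar (z / of_nat 6))" .
  qed
  ultimately show ?thesis unfolding meromorphic_at_cusp_def by (intro exI[of _ 6] conjI exI[of _ G]) auto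
qed

text \<open>Diagonal matrices multiply entrywise and squaring removes the sign ambiguity; thus the
  square of the first entry follows the character from the generators to the whole group.\<close>

lemma diagonal_monodromy_character:
  assumes mS: "monodromy X matS (mat2 a 0 0 a')" and mT: "monodromy X matT (mat2 p 0 0 p')"
    and ch: "SL2Z_character ch" "ch matS = a\<^sup>2" "ch matT = p\<^sup>2" and A: "A \<in> SL2Z"
  shows "\<exists>m m'. monodromy X A (mat2 m 0 0 m') \<and> m\<^sup>2 = ch A"
  using A
proof (induction A rule: SL2Z_induct)
  case (mult A B)
  then obtain m m' n n' where mn: "monodromy X A (mat2 m 0 0 m')" "m\<^sup>2 = ch A" "monodromy X B (mat2 n 0 0 n')" "n\<^sup>2 = ch B"
    by blast
  have "monodromy X (A ** B) (mat2 (m * n) 0 0 (m' * n'))"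
    using monodromy_mult[OF mult(1,2) mn(1,3)] by (simp add: mat2_mult)
  moreover have "(m * n)\<^sup>2 = ch (A ** B)"
    using ch(1) mult(1,2) mn by (simp add: SL2Z_character_def power_mult_distrib)
  ultimately show ?case by blast
next
  case S
  show ?case using mS ch(2) by metis
next
  case T
  show ?case using mT ch(3) by metis
qed

text \<open>For diagonal monodromy the first component of the system is modular with a character.
  \<open>csqrt\<close> of it serves as \<open>y\<close>: a discontinuous choice of branch, permitted
  since only the square has a meaning, and not identically zero by
  \<open>quadratic_independence\<close>.\<close>

lemma modular_square_exists:
  assumes X: "\<And>z. z \<in> \<H> \<Longrightarrow> sq_at Q X z"
    and mS: "monodromy X matS (mat2 a 0 0 a')" and mT: "monodromy X matT (mat2 p 0 0 p')"
    and ch: "SL2Z_character ch" "ch matS = a\<^sup>2" "ch matT = p\<^sup>2" and r12: "r = 1/12 \<or> r = 5/12"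
  shows "\<exists>y. has_solution_with_modular_square Q (-2) ch y"
proof -
  define F where "F = (\<lambda>z. fst (X z))"
  define f where "f = remove_sings F"
  have fF: "f z = F z" if "z \<in> \<H> - poles Q" for z
    using fst_meromorphic(2)[OF X that] by (simp add: f_def F_def)
  define y where "y = (\<lambda>z. csqrt (F z))"
  have FA: "F (act A z) = ch A * autfac A z powi (-2) * F z" if A: "A \<in> SL2Z" and z: "z \<in> \<H>" for A z
  proof -
    obtain m m' where m: "monodromy X A (mat2 m 0 0 m')" "m\<^sup>2 = ch A"
      using diagonal_monodromy_character[OF mS mT ch A] by blast
    have "fst (slash A X z) = fst (sym2 (mat2 m 0 0 m') (X z))" using m(1) z by (simp add: monodromy_def)
    hence "(autfac A z)\<^sup>2 * F (act A z) = ch A * F z"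
      by (simp add: slash_def tscale_def sym2_def F_def m(2)[symmetric] split: prod.splits)
    thus ?thesis using autfac_nonzero[OF A z] by (simp add: power_int_minus field_simps)
  qed
  have "meromorphic_modular_form (-2) ch f"
    unfolding meromorphic_modular_form_def
  proof (intro conjI ballI)
    show "f nicely_meromorphic_on \<H>"
      unfolding f_def F_def by (rule remove_sings_nicely_meromorphic[OF fst_meromorphic(1)[OF X]])
    show "meromorphic_at_cusp f" unfolding f_def F_def by (rule fst_meromorphic_at_cusp[OF X r12])
    show "f (act A z) = ch A * autfac A z powi (-2) * f z" if "A \<in> SL2Z" "z \<in> \<H>" for A z
      unfolding f_def
    proof (rule remove_sings_act[OF that(1) _ _ FA[OF that(1)] that(2)])
      show "F meromorphic_on \<H>" unfolding F_def by (rule fst_meromorphic(1)[OF X])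
      show "ch A \<noteq> 0" using ch(1) that by (simp add: SL2Z_character_def)
    qed
  qed
  moreover have "\<forall>z\<in>\<H> - poles Q. f z = (y z)\<^sup>2" by (simp add: fF y_def)
  moreover have "solution_up_to_sign Q y"
    unfolding solution_up_to_sign_def
  proof
    fix z assume z: "z \<in> \<H> - poles Q"
    have "sq_at Q X z" using X z by blast
    then obtain e y1 y2 where e: "e > 0" "ball z e \<subseteq> \<H> - poles Q" "fundamental_pair Q (ball z e) y1 y2"
      "\<And>w. w \<in> ball z e \<Longrightarrow> X w = veronese (y1 w) (y2 w)" using z by (rule local_pair) (rule that)
    have "y w = y1 w \<or> y w = - y1 w" if "w \<in> ball z e" for w
    proof -
      have "(y w)\<^sup>2 = (y1 w)\<^sup>2" using e(4)[OF that] by (simp add: y_def F_def veronese_def)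
      thus ?thesis by (simp add: power2_eq_iff)
    qed
    moreover have "ode_solution Q (ball z e) y1" using e(3) by (simp add: fundamental_pair_def)
    ultimately show "\<exists>r>0. \<exists>g. ball z r \<subseteq> \<H> - poles Q \<and> ode_solution Q (ball z r) g \<and> (\<forall>w\<in>ball z r. y w = g w \<or> y w = - g w)"
      using e(1,2) by blast
  qed
  moreover have "\<exists>z\<in>\<H> - poles Q. y z \<noteq> 0"
  proof -
    obtain z where z: "z \<in> \<H> - poles Q" by (rule regular_nonempty)
    have "sq_at Q X z" using X z by blast
    then obtain e y1 y2 where e: "e > 0" "ball z e \<subseteq> \<H> - poles Q" "fundamental_pair Q (ball z e) y1 y2"
      "\<And>w. w \<in> ball z e \<Longrightarrow> X w = veronese (y1 w) (y2 w)" using z by (rule local_pair) (rule that)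
    have ne: "ball z e \<noteq> {}" using e(1) by auto
    have "\<exists>w\<in>ball z e. (y1 w)\<^sup>2 \<noteq> 0"
    proof (rule ccontr)
      assume "\<not> (\<exists>w\<in>ball z e. (y1 w)\<^sup>2 \<noteq> 0)"
      hence "1 * (y1 w)\<^sup>2 + 0 * (y1 w * y2 w) + 0 * (y2 w)\<^sup>2 = 0" if "w \<in> ball z e" for w using that by simp
      from quadratic_independence[OF e(3) open_ball ne this] show False by simp
    qed
    then obtain w where w: "w \<in> ball z e" "(y1 w)\<^sup>2 \<noteq> 0" by blast
    hence "y w \<noteq> 0" using e(4) by (simp add: y_def F_def veronese_def)
    thus ?thesis using w e(2) by blast
  qed
  ultimately show ?thesis unfolding has_solution_with_modular_square_def by blast
qed

text \<open>Near one point a branch of \<open>y\<close> is \<open>\<alpha> y1 + \<beta> y2\<close>;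
  its square is linear in the three products, and the identity theorem extends this to all regular
  points.\<close>

lemma modular_square_combination:
  assumes X: "\<And>z. z \<in> \<H> \<Longrightarrow> sq_at Q X z" and y: "has_solution_with_modular_square Q k ch y"
  obtains f \<alpha> \<beta> where "meromorphic_modular_form k ch f" "\<alpha> \<noteq> 0 \<or> \<beta> \<noteq> 0"
    "\<And>z. z \<in> \<H> - poles Q \<Longrightarrow> f z = \<alpha>\<^sup>2 * fst (X z) + 2 * (\<alpha> * \<beta>) * fst (snd (X z)) + \<beta>\<^sup>2 * snd (snd (X z))"
proof -
  let ?D = "\<H> - poles Q"
  obtain f where f: "meromorphic_modular_form k ch f" "\<And>z. z \<in> ?D \<Longrightarrow> f z = (y z)\<^sup>2"
    using y by (auto simp: has_solution_with_modular_square_def)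
  have loc: "\<exists>e>0. \<exists>g. ball z e \<subseteq> ?D \<and> ode_solution Q (ball z e) g \<and> (\<forall>w\<in>ball z e. f w = (g w)\<^sup>2)" if z: "z \<in> ?D" for z
  proof -
    obtain e g where e: "e > 0" "ball z e \<subseteq> ?D" "ode_solution Q (ball z e) g" "\<And>w. w \<in> ball z e \<Longrightarrow> y w = g w \<or> y w = - g w"
      using y z unfolding has_solution_with_modular_square_def solution_up_to_sign_def by blast
    have "f w = (g w)\<^sup>2" if "w \<in> ball z e" for w using f(2)[of w] e(2) e(4)[OF that] that by auto
    thus ?thesis using e by blast
  qed
  have fh: "f holomorphic_on ?D"
  proof -
    have "f field_differentiable at z" if "z \<in> ?D" for z
    proof -
      obtain e g where e: "e > 0" "ode_solution Q (ball z e) g" "\<And>w. w \<in> ball z e \<Longrightarrow> f w = (g w)\<^sup>2" using loc[of z] \<open>z \<in> ?D\<close> by blast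
      have "g holomorphic_on ball z e" using e(2) by (simp add: ode_solution_def)
      hence "(\<lambda>w. (g w)\<^sup>2) holomorphic_on ball z e" by (intro holomorphic_intros)
      hence "f holomorphic_on ball z e" by (rule holomorphic_transform) (simp add: e(3))
      thus ?thesis using e(1) by (simp add: holomorphic_on_imp_differentiable_at)
    qed
    thus ?thesis by (auto simp: holomorphic_on_def intro: field_differentiable_at_within)
  qed
  obtain z0 where z0: "z0 \<in> ?D" "y z0 \<noteq> 0" using y by (auto simp: has_solution_with_modular_square_def)
  obtain e g where e: "e > 0" "ball z0 e \<subseteq> ?D" "ode_solution Q (ball z0 e) g" "\<And>w. w \<in> ball z0 e \<Longrightarrow> f w = (g w)\<^sup>2"
    using loc[OF z0(1)] by blast
  have "sq_at Q X z0" using X z0 by blast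
  then obtain d y1 y2 where d: "d > 0" "ball z0 d \<subseteq> ?D" "fundamental_pair Q (ball z0 d) y1 y2"
    "\<And>w. w \<in> ball z0 d \<Longrightarrow> X w = veronese (y1 w) (y2 w)" using z0(1) by (rule local_pair) (rule that)
  define b where "b = min d e"
  have b: "b > 0" "ball z0 b \<subseteq> ball z0 d" "ball z0 b \<subseteq> ball z0 e" using d(1) e(1) by (auto simp: b_def)
  obtain \<alpha> \<beta> where ab: "\<And>w. w \<in> ball z0 b \<Longrightarrow> g w = \<alpha> * y1 w + \<beta> * y2 w"
    using ode_solution_combination[OF fundamental_pair_subset[OF d(3) b(2)] ode_solution_subset[OF e(3) b(3)] open_ball convex_ball]
    by blast
  define h where "h = (\<lambda>z. \<alpha>\<^sup>2 * fst (X z) + 2 * (\<alpha> * \<beta>) * fst (snd (X z)) + \<beta>\<^sup>2 * snd (snd (X z)))"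
  have hh: "h holomorphic_on ?D" unfolding h_def using sq_holomorphic[OF open_H order_refl X] by (intro holomorphic_intros)
  have near: "f w = h w" if "w \<in> ball z0 b" for w
  proof -
    have "w \<in> ball z0 d" "w \<in> ball z0 e" using that b by blast+
    thus ?thesis using e(4) d(4) ab[OF that] by (simp add: h_def veronese_def power2_eq_square algebra_simps)
  qed
  have "f z = h z" if "z \<in> ?D" for z
    by (rule analytic_continuation_open[OF open_ball open_regular _ connected_regular _ fh hh near that])
       (use b e(2) in auto)
  moreover have "\<alpha> \<noteq> 0 \<or> \<beta> \<noteq> 0"
  proof (rule ccontr)
    assume "\<not> (\<alpha> \<noteq> 0 \<or> \<beta> \<noteq> 0)"
    hence "h z0 = 0" by (simp add: h_def)
    thus False using near[of z0] b(1) f(2)[OF z0(1)] z0(2) by simp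
  qed
  ultimately show ?thesis using that f(1) unfolding h_def by blast
qed

text \<open>Under \<open>S\<close> the square \<open>(\<alpha> y1 + \<beta> y2)^2\<close> becomes
  \<open>- (\<alpha> y1 - \<beta> y2)^2\<close>; as the character is -1 on \<open>S\<close>, this
  forces \<open>\<alpha> \<beta> = 0\<close>. So the modular square is a multiple of
  \<open>y1^2\<close> or \<open>y2^2\<close>, and its invariance under \<open>T\<close> up to a
  scalar kills an off-diagonal entry.\<close>

lemma modular_square_monodromy:
  assumes X: "\<And>z. z \<in> \<H> \<Longrightarrow> sq_at Q X z" and mS: "monodromy X matS (mat2 \<i> 0 0 (- \<i>))"
    and mT: "monodromy X matT (mat2 p q s t)"
    and y: "has_solution_with_modular_square Q (-2) ch y" and chS: "ch matS = -1"
  shows "(p\<^sup>2 = ch matT \<and> q = 0) \<or> (t\<^sup>2 = ch matT \<and> s = 0)"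
proof -
  obtain f \<alpha> \<beta> where f: "meromorphic_modular_form (-2) ch f" "\<alpha> \<noteq> 0 \<or> \<beta> \<noteq> 0"
    "\<And>z. z \<in> \<H> - poles Q \<Longrightarrow> f z = \<alpha>\<^sup>2 * fst (X z) + 2 * (\<alpha> * \<beta>) * fst (snd (X z)) + \<beta>\<^sup>2 * snd (snd (X z))"
    using modular_square_combination[OF X y] by blast
  define L where "L = (\<lambda>X. \<alpha>\<^sup>2 * fst X + 2 * (\<alpha> * \<beta>) * fst (snd X) + \<beta>\<^sup>2 * snd (snd X))"
  have fL: "f z = L (X z)" if "z \<in> \<H> - poles Q" for z using f(3)[OF that] by (simp add: L_def)
  have Lc: "L (tscale c T) = c * L T" for c T by (cases T) (simp add: L_def tscale_def algebra_simps)
  have inv: "L (sym2 M (X z)) = ch A * L (X z)" if A: "A \<in> SL2Z" and M: "monodromy X A M" and z: "z \<in> \<H> - poles Q" for A M z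
  proof -
    have zH: "z \<in> \<H>" using z by blast
    have "L (sym2 M (X z)) = (autfac A z)\<^sup>2 * f (act A z)"
      unfolding fL[OF act_regular[OF A z]] using M zH by (simp add: monodromy_def slash_def flip: Lc)
    also have "f (act A z) = ch A * autfac A z powi (-2) * f z" using f(1) A zH by (simp add: meromorphic_modular_form_def)
    finally show ?thesis using fL[OF z] autfac_nonzero[OF A zH] by (simp add: power_int_minus)
  qed
  obtain z where z: "z \<in> \<H> - poles Q" by (rule regular_nonempty)
  have "sq_at Q X z" using X z by blast
  then obtain e y1 y2 where e: "e > 0" "ball z e \<subseteq> \<H> - poles Q" "fundamental_pair Q (ball z e) y1 y2"
    "\<And>w. w \<in> ball z e \<Longrightarrow> X w = veronese (y1 w) (y2 w)" using z by (rule local_pair) (rule that)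
  have ne: "ball z e \<noteq> {}" using e(1) by auto
  note qi = quadratic_independence[OF e(3) open_ball ne]
  have Lv: "L (veronese a b) = (\<alpha> * a + \<beta> * b)\<^sup>2" for a b by (simp add: L_def veronese_def power2_eq_square algebra_simps)
  have invv: "(\<alpha> * (e11 M * y1 w + e12 M * y2 w) + \<beta> * (e21 M * y1 w + e22 M * y2 w))\<^sup>2 = ch A * (\<alpha> * y1 w + \<beta> * y2 w)\<^sup>2"
    if "A \<in> SL2Z" "monodromy X A M" "w \<in> ball z e" for A M w
  proof -
    have "w \<in> \<H> - poles Q" using e(2) that(3) by blast
    from inv[OF that(1,2) this] show ?thesis unfolding e(4)[OF that(3)] sym2_veronese Lv .
  qed
  have "0 * (y1 w)\<^sup>2 + 4 * (\<alpha> * \<beta>) * (y1 w * y2 w) + 0 * (y2 w)\<^sup>2 = 0" if "w \<in> ball z e" for w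
  proof -
    have "(\<alpha> * (\<i> * y1 w) + \<beta> * (- \<i> * y2 w))\<^sup>2 = - ((\<alpha> * y1 w + \<beta> * y2 w)\<^sup>2)"
      using invv[OF matS_SL2Z mS that] chS by simp
    moreover have "(\<alpha> * (\<i> * y1 w) + \<beta> * (- \<i> * y2 w))\<^sup>2 = - ((\<alpha> * y1 w - \<beta> * y2 w)\<^sup>2)"
      by (simp add: power2_eq_square algebra_simps)
    ultimately show ?thesis by (simp add: power2_eq_square algebra_simps)
  qed
  from qi[OF this] have "\<alpha> = 0 \<or> \<beta> = 0" by simp
  thus ?thesis
  proof
    assume b0: "\<beta> = 0"
    have "(p\<^sup>2 - ch matT) * (y1 w)\<^sup>2 + 2 * (p * q) * (y1 w * y2 w) + q\<^sup>2 * (y2 w)\<^sup>2 = 0" if "w \<in> ball z e" for w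
    proof -
      have "\<alpha>\<^sup>2 * (p * y1 w + q * y2 w)\<^sup>2 = \<alpha>\<^sup>2 * (ch matT * (y1 w)\<^sup>2)"
        using invv[OF matT_SL2Z mT that] by (simp add: b0 power_mult_distrib mult_ac)
      hence "(p * y1 w + q * y2 w)\<^sup>2 = ch matT * (y1 w)\<^sup>2" using f(2) b0 by simp
      thus ?thesis by (simp add: power2_eq_square algebra_simps)
    qed
    from qi[OF this] show ?thesis by simp
  next
    assume a0: "\<alpha> = 0"
    have "s\<^sup>2 * (y1 w)\<^sup>2 + 2 * (s * t) * (y1 w * y2 w) + (t\<^sup>2 - ch matT) * (y2 w)\<^sup>2 = 0" if "w \<in> ball z e" for w
    proof -
      have "\<beta>\<^sup>2 * (s * y1 w + t * y2 w)\<^sup>2 = \<beta>\<^sup>2 * (ch matT * (y2 w)\<^sup>2)"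
        using invv[OF matT_SL2Z mT that] by (simp add: a0 power_mult_distrib mult_ac)
      hence "(s * y1 w + t * y2 w)\<^sup>2 = ch matT * (y2 w)\<^sup>2" using f(2) a0 by simp
      thus ?thesis by (simp add: power2_eq_square algebra_simps)
    qed
    from qi[OF this] show ?thesis by simp
  qed
qed

text \<open>Here \<open>q s = 0\<close>, and a metric exists iff \<open>q\<close> and
  \<open>s\<close> both vanish. One modular square yields the vanishing of one of them; the
  conjugate character supplies the other.\<close>

lemma boundary_case:
  assumes r12: "r = 1/12 \<or> r = 5/12" and ch: "SL2Z_character ch" "ch matT = exp (2 * of_real pi * \<i> / 6)" "ch matS = -1"
  shows "(\<exists>u. invariant_metric Q u) \<longleftrightarrow>
     (\<exists>y1 y2. has_solution_with_modular_square Q (-2) ch y1 \<and> has_solution_with_modular_square Q (-2) (\<lambda>A. cnj (ch A)) y2)"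
proof -
  obtain X q s \<tau> where X: "\<And>z. z \<in> \<H> \<Longrightarrow> sq_at Q X z" and mS: "monodromy X matS (mat2 \<i> 0 0 (- \<i>))"
    and mT: "monodromy X matT (mat2 ((of_real \<tau> + \<i>) / 2) q s ((of_real \<tau> - \<i>) / 2))"
    and \<tau>: "\<tau>\<^sup>2 = 4 * (cos (2 * pi * r))\<^sup>2" and qs: "q * s = of_real ((\<tau>\<^sup>2 - 3) / 4)" by (rule normal_form) (rule that)
  define p where "p = (of_real \<tau> + \<i>) / 2"
  have pc: "(of_real \<tau> - \<i>) / 2 = cnj p" by (simp add: p_def)
  have mT': "monodromy X matT (mat2 p q s (cnj p))" using mT unfolding pc p_def[symmetric] .
  have \<tau>3: "\<tau>\<^sup>2 = 3" unfolding \<tau> by (rule trace_square_range(3)[OF r(1,2) r12])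
  have chT: "ch matT = (1 + \<i> * of_real (sqrt 3)) / 2"
  proof -
    have "ch matT = cis (pi / 3)" unfolding ch(2) cis_conv_exp by (rule arg_cong[of _ _ exp]) simp
    thus ?thesis by (simp add: complex_eq_iff cos_60 sin_60)
  qed
  \<comment> \<open>With \<open>\<tau> = \<plusminus> sqrt 3\<close> this is
    \<open>exp (\<plusminus> i pi / 3)\<close>, the value of the character on \<open>T\<close> or
    its conjugate.\<close>
  have p2: "p\<^sup>2 = (1 + \<i> * of_real \<tau>) / 2"
  proof -
    have "(complex_of_real \<tau>)\<^sup>2 = 3" using \<tau>3 by (simp flip: of_real_power)
    thus ?thesis by (simp add: p_def power2_eq_square algebra_simps)
  qed
  have ch': "SL2Z_character (\<lambda>A. cnj (ch A))" using ch(1) by (simp add: SL2Z_character_def)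
  show ?thesis
  proof
    assume "\<exists>u. invariant_metric Q u"
    then obtain u where u: "invariant_metric Q u" by blast
    have "q = 0 \<and> s = 0" using metric_implies_nonpositive(2)[OF X mS mT qs u] \<tau>3 by simp
    hence mT0: "monodromy X matT (mat2 p 0 0 (cnj p))" using mT' by simp
    \<comment> \<open>Interchanges the two solutions up to sign, so that the first component of
      \<open>Y\<close> is \<open>y2^2\<close>; this realizes the conjugate character.\<close>
    define N where "N = mat2 0 1 (- 1) (0 :: complex)"
    have det: "det N = 1" by (simp add: N_def)
    define Y where "Y = (\<lambda>z. sym2 N (X z))"
    have Y: "sq_at Q Y z" if "z \<in> \<H>" for z unfolding Y_def by (rule sq_at_sym2[OF X[OF that] det])
    have conj: "N ** mat2 a 0 0 d ** adj2 N = mat2 d 0 0 a" for a d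
      by (simp add: N_def adj2_def mat2_mult mat2_eq_iff)
    have YS: "monodromy Y matS (mat2 (- \<i>) 0 0 \<i>)" using monodromy_sym2[OF mS det matS_SL2Z] by (simp add: conj Y_def)
    have YT: "monodromy Y matT (mat2 (cnj p) 0 0 p)" using monodromy_sym2[OF mT0 det matT_SL2Z] by (simp add: conj Y_def)
    have "\<bar>\<tau>\<bar> = sqrt 3" using \<tau>3 by (metis real_sqrt_abs)
    hence "\<tau> = sqrt 3 \<or> \<tau> = - sqrt 3" by linarith
    hence "ch matT = p\<^sup>2 \<or> ch matT = cnj (p\<^sup>2)" unfolding chT p2 by auto
    thus "\<exists>y1 y2. has_solution_with_modular_square Q (-2) ch y1 \<and> has_solution_with_modular_square Q (-2) (\<lambda>A. cnj (ch A)) y2"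
    proof
      assume c: "ch matT = p\<^sup>2"
      have "\<exists>y. has_solution_with_modular_square Q (-2) ch y"
        by (rule modular_square_exists[OF X mS mT0 ch(1) _ c r12]) (simp_all add: ch(3))
      moreover have "\<exists>y. has_solution_with_modular_square Q (-2) (\<lambda>A. cnj (ch A)) y"
        by (rule modular_square_exists[OF Y YS YT ch' _ _ r12]) (simp_all add: ch(3) c)
      ultimately show ?thesis by blast
    next
      assume c: "ch matT = cnj (p\<^sup>2)"
      have "\<exists>y. has_solution_with_modular_square Q (-2) ch y"
        by (rule modular_square_exists[OF Y YS YT ch(1) _ _ r12]) (simp_all add: ch(3) c)
      moreover have "\<exists>y. has_solution_with_modular_square Q (-2) (\<lambda>A. cnj (ch A)) y"
        by (rule modular_square_exists[OF X mS mT0 ch' _ _ r12]) (simp_all add: ch(3) c)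
      ultimately show ?thesis by blast
    qed
  next
    assume "\<exists>y1 y2. has_solution_with_modular_square Q (-2) ch y1 \<and> has_solution_with_modular_square Q (-2) (\<lambda>A. cnj (ch A)) y2"
    then obtain y1 y2 where y: "has_solution_with_modular_square Q (-2) ch y1"
      "has_solution_with_modular_square Q (-2) (\<lambda>A. cnj (ch A)) y2" by blast
    have 1: "(p\<^sup>2 = ch matT \<and> q = 0) \<or> ((cnj p)\<^sup>2 = ch matT \<and> s = 0)"
      by (rule modular_square_monodromy[OF X mS mT' y(1) ch(3)])
    have 2: "(p\<^sup>2 = cnj (ch matT) \<and> q = 0) \<or> ((cnj p)\<^sup>2 = cnj (ch matT) \<and> s = 0)"
      by (rule modular_square_monodromy[OF X mS mT' y(2)]) (simp_all add: ch(3))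
    \<comment> \<open>The two characters differ on \<open>T\<close>, so the two solutions cannot
      fall under the same alternative: one gives \<open>q = 0\<close>, the other
      \<open>s = 0\<close>.\<close>
    have "ch matT \<noteq> cnj (ch matT)" by (simp add: chT complex_eq_iff)
    hence "q = 0 \<and> s = 0" using 1 2 by auto
    hence "monodromy X matT (mat2 p (- cnj 0) 0 (cnj p))" using mT' by simp
    thus "\<exists>u. invariant_metric Q u" using metric_exists_if_unitary[OF X mS] by blast
  qed
qed

end

theorem theorem1p1:
  fixes Q :: "complex \<Rightarrow> complex" and r :: real
  assumes modular: "meromorphic_modular_form 4 (\<lambda>_. 1) Q"
    and fuchsian: "fuchsian_on_H Q" "fuchsian_at_cusp Q"
    and apparent: "\<And>p. p \<in> poles Q \<Longrightarrow> apparent_at Q p"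
    and kappa_half_nat: "\<And>p. p \<in> poles Q \<Longrightarrow> \<exists>n::nat. n \<ge> 1 \<and> kappa Q p = real n / 2"
    and kappa_gt_half: "\<And>p. p \<in> poles Q \<Longrightarrow> \<not> SL2Z_equivalent \<i> p \<Longrightarrow> \<not> SL2Z_equivalent rho p
           \<Longrightarrow> kappa Q p > 1/2"
    and cusp_value: "cusp_value Q \<in> \<real>" "Re (cusp_value Q) \<le> 0"
    and theta_i: "kappa Q \<i> \<notin> \<int>"
    and theta_rho: "2 * kappa Q rho / 3 \<notin> \<int>"
    and kappa_cusp: "2 * kappa_cusp Q \<notin> \<int>"
    and r: "0 < r" "r < 1/2" "kappa_cusp Q - r \<in> \<int> \<or> kappa_cusp Q + r \<in> \<int>"
  shows
    "(1/12 < r \<and> r < 5/12 \<longrightarrow>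
        (\<exists>u. invariant_metric Q u) \<and>
        (\<forall>u v. invariant_metric Q u \<and> invariant_metric Q v \<longrightarrow> (\<forall>z\<in>\<H> - poles Q. u z = v z))) \<and>
     ((\<exists>u. invariant_metric Q u) \<longrightarrow> 1/12 \<le> r \<and> r \<le> 5/12) \<and>
     (r = 1/12 \<or> r = 5/12 \<longrightarrow>
        (\<forall>ch. SL2Z_character ch \<and> ch matT = exp (2 * of_real pi * \<i> / 6) \<and> ch matS = -1 \<longrightarrow>
           ((\<exists>u. invariant_metric Q u) \<longleftrightarrow>
            (\<exists>y1 y2. has_solution_with_modular_square Q (-2) ch y1 \<and>
                     has_solution_with_modular_square Q (-2) (\<lambda>A. cnj (ch A)) y2))))"
proof -
  interpret main_setup Q r
    by unfold_locales
       (use modular fuchsian apparent kappa_half_nat cusp_value theta_i theta_rho kappa_cusp r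
        in \<open>auto simp: meromorphic_modular_form_def fuchsian_at_cusp_def\<close>)
  obtain X q s \<tau> where X: "\<And>z. z \<in> \<H> \<Longrightarrow> sq_at Q X z" and mS: "monodromy X matS (mat2 \<i> 0 0 (- \<i>))"
    and mT: "monodromy X matT (mat2 ((of_real \<tau> + \<i>) / 2) q s ((of_real \<tau> - \<i>) / 2))"
    and \<tau>: "\<tau>\<^sup>2 = 4 * (cos (2 * pi * r))\<^sup>2" and qs: "q * s = of_real ((\<tau>\<^sup>2 - 3) / 4)" by (rule normal_form) (rule that)
  have pc: "(of_real \<tau> - \<i>) / 2 = cnj ((of_real \<tau> + \<i>) / 2)" by simp
  note range = trace_square_range(1,2)[OF r(1,2), folded \<tau>]
  show ?thesis
  proof (intro conjI impI allI ballI)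
    assume "1/12 < r \<and> r < 5/12"
    hence "(3 - \<tau>\<^sup>2) / 4 > 0" using range(1) by simp
    moreover have "q * s = - of_real ((3 - \<tau>\<^sup>2) / 4)" unfolding qs by (simp flip: of_real_minus add: field_simps)
    ultimately show "\<exists>u. invariant_metric Q u"
      using metric_exists_if_negative[OF X mS mT[unfolded pc]] by blast
  next
    fix u v z
    assume "1/12 < r \<and> r < 5/12"
    hence "\<tau>\<^sup>2 < 3" using range(1) by simp
    hence "q * s \<noteq> 0" unfolding qs of_real_eq_0_iff by simp
    moreover assume "invariant_metric Q u \<and> invariant_metric Q v" and "z \<in> \<H> - poles Q"
    ultimately show "u z = v z" using metric_unique[OF X mS mT] by blast
  next
    assume "\<exists>u. invariant_metric Q u"
    then obtain u where "invariant_metric Q u" by blast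
    from metric_implies_nonpositive(1)[OF X mS mT qs this]
    show "1/12 \<le> r" "r \<le> 5/12" using range(2) by auto
  next
    fix ch assume "r = 1/12 \<or> r = 5/12" "SL2Z_character ch \<and> ch matT = exp (2 * of_real pi * \<i> / 6) \<and> ch matS = -1"
    thus "(\<exists>u. invariant_metric Q u) \<longleftrightarrow> (\<exists>y1 y2. has_solution_with_modular_square Q (-2) ch y1 \<and>
                     has_solution_with_modular_square Q (-2) (\<lambda>A. cnj (ch A)) y2)"
      using boundary_case by blast
  qed
qed

end
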